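(* Let $H_n=\mathbb C[x_1,\dots,x_n]/I$, where $I$ is the ideal generated by the symmetric polynomials without constant term, graded by $\deg x_i=2$. Let $\mathbb C$ denote the trivial one-dimensional graded $H_n$-module in degree $0$. (i) In the Grothendieck group of graded $H_n$-modules, $[H_n]=[\![n]\!]!\,[\mathbb C]$. (ii) Any projective resolution of the module $\mathbb C$ is infinite. The graded Poincaré polynomial (a power series) of the minimal projective resolution of $\mathbb C$ is of the form $$\frac{(1+q^2t)^{n-1}}{\prod_{j=2}^n(1-q^{2j}t^2)},$$ where $t$ encodes the homological grading and $q$ the internal algebra grading. (iii) The Ext-algebra $\operatorname{Ext}^*_{H_n}(\mathbb C,\mathbb C)$ has graded Euler characteristic $\dfrac{1}{[\![n]\!]!}$.
   Context: $[\![m]\!]=1+q^2+q^4+\cdots+q^{2(m-1)}$ and $[\![n]\!]!=[\![1]\!][\![2]\!]\cdots[\![n]\!]$. The Grothendieck group of graded modules is a $\mathbb Z[q,q^{-1}]$-module, where $q$ acts by the shift $\langle1\rangle$ of the internal grading up by $1$. If the minimal graded projective resolution has $m$-th term $\bigoplus_l H_n\langle l\rangle^{\oplus\beta_{m,l}}$, its graded Poincaré polynomial is $\sum_{m,l}\beta_{m,l}\,q^lt^m$. The graded Euler characteristic of $\operatorname{Ext}^*_{H_n}(\mathbb C,\mathbb C)$ is the formal power series $\sum_{m,l}(-1)^m q^l\dim\operatorname{Ext}^m(\mathbb C,\mathbb C\langle l\rangle)$, with Ext computed in graded $H_n$-modules.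
   Formalization: Here n is at least 1, and the claim that any projective resolution of C is infinite is stated only for n at least 2: for n = 1, H_1 = C is a field and C has the finite projective resolution 0 -> H_1 -> C -> 0. *)

theory Defs
  imports
    "HOL-Algebra.Algebra"
    "HOL-Computational_Algebra.Formal_Laurent_Series"
    "Jordan_Normal_Form.Missing_VectorSpace"
begin

section \<open>Graded rings and graded modules\<close>

record 'r gring = "'r ring" +
  rpart :: "int \<Rightarrow> 'r set"

record ('r, 'm) gmodule = "('r, 'm) module" +
  mpart :: "int \<Rightarrow> 'm set"

text \<open>Module records inherit ring fields \<open>mult\<close> and \<open>one\<close> from the library; they carry no
  meaning for modules and are left \<open>undefined\<close> below.\<close>

definition graded_module :: "'r gring \<Rightarrow> ('r, 'm) gmodule \<Rightarrow> bool" where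
  "graded_module R M \<longleftrightarrow>
     module R M \<and>
     (\<forall>i. subgroup (mpart M i) (add_monoid M)) \<and>
     (\<forall>i j. \<forall>r\<in>rpart R i. \<forall>x\<in>mpart M j. r \<odot>\<^bsub>M\<^esub> x \<in> mpart M (i + j)) \<and>
     (\<forall>x\<in>carrier M. \<exists>!c. (\<forall>i. c i \<in> mpart M i) \<and> finite {i. c i \<noteq> \<zero>\<^bsub>M\<^esub>} \<and>
        x = (\<Oplus>\<^bsub>M\<^esub>i\<in>{i. c i \<noteq> \<zero>\<^bsub>M\<^esub>}. c i))"

text \<open>The shift \<open>M\<langle>k\<rangle>\<close> moves the component of degree \<open>i\<close> to degree \<open>i + k\<close>.\<close>

definition gshift :: "int \<Rightarrow> ('r, 'm) gmodule \<Rightarrow> ('r, 'm) gmodule" where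
  "gshift k M = M\<lparr>mpart := \<lambda>i. mpart M (i - k)\<rparr>"

definition gr_hom :: "'r gring \<Rightarrow> ('r, 'm) gmodule \<Rightarrow> ('r, 'k) gmodule \<Rightarrow> ('m \<Rightarrow> 'k) set" where
  "gr_hom R M N = {f \<in> module_hom R M N. \<forall>i. f ` mpart M i \<subseteq> mpart N i}"

definition gr_isomorphic :: "'r gring \<Rightarrow> ('r, 'm) gmodule \<Rightarrow> ('r, 'k) gmodule \<Rightarrow> bool" where
  "gr_isomorphic R M N \<longleftrightarrow> (\<exists>f\<in>gr_hom R M N. bij_betw f (carrier M) (carrier N))"

definition mod_ker :: "('r, 'm, 'x) module_scheme \<Rightarrow> ('r, 'k, 'y) module_scheme \<Rightarrow> ('m \<Rightarrow> 'k) \<Rightarrow> 'm set"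
  where "mod_ker M N f = {x \<in> carrier M. f x = \<zero>\<^bsub>N\<^esub>}"

definition regular_gmodule :: "'r gring \<Rightarrow> ('r, 'r) gmodule" where
  "regular_gmodule R =
     \<lparr>carrier = carrier R, monoid.mult = undefined, monoid.one = undefined, ring.zero = \<zero>\<^bsub>R\<^esub>, ring.add = (\<oplus>\<^bsub>R\<^esub>),
      module.smult = (\<otimes>\<^bsub>R\<^esub>), mpart = rpart R\<rparr>"

text \<open>The direct sum of \<open>\<beta> l\<close> copies of \<open>R\<langle>l\<rangle>\<close> over all integers \<open>l\<close>; the coordinate \<open>(l, k)\<close>
  belongs to the \<open>k\<close>-th copy of \<open>R\<langle>l\<rangle>\<close>.\<close>

definition free_gmodule :: "'r gring \<Rightarrow> (int \<Rightarrow> nat) \<Rightarrow> ('r, int \<times> nat \<Rightarrow> 'r) gmodule" where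
  "free_gmodule R \<beta> =
     (let F = {f. finite {x. f x \<noteq> \<zero>\<^bsub>R\<^esub>} \<and>
                  (\<forall>l k. f (l, k) \<in> (if k < \<beta> l then carrier R else {\<zero>\<^bsub>R\<^esub>}))}
      in \<lparr>carrier = F, monoid.mult = undefined, monoid.one = undefined,
          ring.zero = (\<lambda>_. \<zero>\<^bsub>R\<^esub>), ring.add = (\<lambda>f g x. f x \<oplus>\<^bsub>R\<^esub> g x), module.smult = (\<lambda>r f x. r \<otimes>\<^bsub>R\<^esub> f x),
          mpart = (\<lambda>i. {f \<in> F. \<forall>l k. f (l, k) \<in> rpart R (i - l)})\<rparr>)"

section \<open>Projective resolutions\<close>

text \<open>The lifting property is tested on modules with elements in \<open>'p \<Rightarrow> 'r\<close>. This loses nothing: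
  that type contains both a copy of \<open>P\<close> and the free module on the elements of \<open>P\<close>, so
  the canonical surjection from that free module onto \<open>P\<close> is among the maps tested, and a
  splitting of it gives lifting against all modules.\<close>

definition projective_module :: "('r, 'z) ring_scheme \<Rightarrow> ('r, 'p, 'x) module_scheme \<Rightarrow> bool" where
  "projective_module R P \<longleftrightarrow>
     module R P \<and>
     (\<forall>(M :: ('r, 'p \<Rightarrow> 'r) module) (N :: ('r, 'p \<Rightarrow> 'r) module) g f.
        module R M \<and> module R N \<and> g \<in> module_hom R M N \<and> g ` carrier M = carrier N \<and>
        f \<in> module_hom R P N \<longrightarrow>
        (\<exists>h\<in>module_hom R P M. \<forall>x\<in>carrier P. g (h x) = f x))"

text \<open>An exact sequence \<open>\<dots> \<rightarrow> P 2 \<rightarrow> P 1 \<rightarrow> P 0 \<rightarrow> M \<rightarrow> 0\<close> with \<open>d m : P (m + 1) \<rightarrow> P m\<close> and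
  augmentation \<open>e : P 0 \<rightarrow> M\<close>. A finite resolution is one with \<open>P m = 0\<close> for large \<open>m\<close>.\<close>

definition projective_resolution ::
  "('r, 'z) ring_scheme \<Rightarrow> ('r, 'm, 'y) module_scheme \<Rightarrow>
   (nat \<Rightarrow> ('r, 'p, 'x) module_scheme) \<Rightarrow> (nat \<Rightarrow> 'p \<Rightarrow> 'p) \<Rightarrow> ('p \<Rightarrow> 'm) \<Rightarrow> bool" where
  "projective_resolution R M P d e \<longleftrightarrow>
     module R M \<and>
     (\<forall>m. projective_module R (P m)) \<and>
     (\<forall>m. d m \<in> module_hom R (P (Suc m)) (P m)) \<and>
     e \<in> module_hom R (P 0) M \<and>
     e ` carrier (P 0) = carrier M \<and>
     d 0 ` carrier (P (Suc 0)) = mod_ker (P 0) M e \<and>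
     (\<forall>m. d (Suc m) ` carrier (P (Suc (Suc m))) = mod_ker (P (Suc m)) (P m) (d m))"

definition graded_projective_resolution ::
  "'r gring \<Rightarrow> ('r, 'm) gmodule \<Rightarrow>
   (nat \<Rightarrow> ('r, 'p) gmodule) \<Rightarrow> (nat \<Rightarrow> 'p \<Rightarrow> 'p) \<Rightarrow> ('p \<Rightarrow> 'm) \<Rightarrow> bool" where
  "graded_projective_resolution R M P d e \<longleftrightarrow>
     projective_resolution R M P d e \<and>
     graded_module R M \<and>
     (\<forall>m. graded_module R (P m)) \<and>
     (\<forall>m. d m \<in> gr_hom R (P (Suc m)) (P m)) \<and>
     e \<in> gr_hom R (P 0) M"

definition graded_submodule :: "'r gring \<Rightarrow> ('r, 'm) gmodule \<Rightarrow> 'm set \<Rightarrow> bool" where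
  "graded_submodule R M L \<longleftrightarrow>
     LinearCombinations.submodule R L M \<and>
     graded_module R (M\<lparr>carrier := L, mpart := \<lambda>i. mpart M i \<inter> L\<rparr>)"

definition superfluous :: "'r gring \<Rightarrow> ('r, 'm) gmodule \<Rightarrow> 'm set \<Rightarrow> bool" where
  "superfluous R M K \<longleftrightarrow>
     (\<forall>L. graded_submodule R M L \<and> K <+>\<^bsub>M\<^esub> L = carrier M \<longrightarrow> L = carrier M)"

text \<open>Minimality: every \<open>P m\<close> is a projective cover of its image under \<open>e\<close> (if \<open>m = 0\<close>) or
  \<open>d (m - 1)\<close>. By exactness the kernel of that map is the image of \<open>d m\<close>.\<close>

definition minimal_graded_resolution ::
  "'r gring \<Rightarrow> ('r, 'm) gmodule \<Rightarrow>
   (nat \<Rightarrow> ('r, 'p) gmodule) \<Rightarrow> (nat \<Rightarrow> 'p \<Rightarrow> 'p) \<Rightarrow> ('p \<Rightarrow> 'm) \<Rightarrow> bool" where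
  "minimal_graded_resolution R M P d e \<longleftrightarrow>
     graded_projective_resolution R M P d e \<and>
     (\<forall>m. superfluous R (P m) (d m ` carrier (P (Suc m))))"

definition graded_betti_numbers ::
  "'r gring \<Rightarrow> (nat \<Rightarrow> ('r, 'p) gmodule) \<Rightarrow> (nat \<Rightarrow> int \<Rightarrow> nat) \<Rightarrow> bool" where
  "graded_betti_numbers R P \<beta> \<longleftrightarrow>
     (\<forall>m. finite {l. \<beta> m l \<noteq> 0} \<and> gr_isomorphic R (P m) (free_gmodule R (\<beta> m)))"

text \<open>Power series in \<open>t\<close> (\<open>fps_X\<close>) whose coefficients are Laurent series in \<open>q\<close> (\<open>fls_X\<close>).\<close>

definition poincare_series :: "(nat \<Rightarrow> int \<Rightarrow> nat) \<Rightarrow> rat fls fps" where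
  "poincare_series \<beta> = Abs_fps (\<lambda>m. \<Sum>l | \<beta> m l \<noteq> 0. of_nat (\<beta> m l) * fls_X_intpow l)"

section \<open>Graded Ext spaces\<close>

text \<open>For a map \<open>\<iota>\<close> embedding the complex numbers into the degree \<open>0\<close> part of \<open>R\<close>, the complex vector
  space of degree-preserving homomorphisms.\<close>

definition gr_hom_space ::
  "(complex \<Rightarrow> 'r) \<Rightarrow> 'r gring \<Rightarrow> ('r, 'm) gmodule \<Rightarrow> ('r, 'k) gmodule \<Rightarrow> (complex, 'm \<Rightarrow> 'k) module" where
  "gr_hom_space \<iota> R M N =
     \<lparr>carrier = gr_hom R M N \<inter> extensional (carrier M), monoid.mult = undefined, monoid.one = undefined,
      ring.zero = (\<lambda>x\<in>carrier M. \<zero>\<^bsub>N\<^esub>),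
      ring.add = (\<lambda>f g. \<lambda>x\<in>carrier M. f x \<oplus>\<^bsub>N\<^esub> g x),
      module.smult = (\<lambda>c f. \<lambda>x\<in>carrier M. \<iota> c \<odot>\<^bsub>N\<^esub> f x)\<rparr>"

definition quotient_module :: "('r, 'm) module \<Rightarrow> 'm set \<Rightarrow> ('r, 'm set) module" where
  "quotient_module V W =
     \<lparr>carrier = a_rcosets\<^bsub>V\<^esub> W, monoid.mult = undefined, monoid.one = undefined, ring.zero = W, ring.add = (<+>\<^bsub>V\<^esub>),
      module.smult = (\<lambda>r A. \<Union>x\<in>A. W +>\<^bsub>V\<^esub> (r \<odot>\<^bsub>V\<^esub> x))\<rparr>"

definition cocycles where
  "cocycles \<iota> R P d N m =
     {f \<in> carrier (gr_hom_space \<iota> R (P m) N). \<forall>x\<in>carrier (P (Suc m)). f (d m x) = \<zero>\<^bsub>N\<^esub>}"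

definition coboundaries where
  "coboundaries \<iota> R P d N m =
     (case m of
        0 \<Rightarrow> {\<zero>\<^bsub>gr_hom_space \<iota> R (P 0) N\<^esub>}
      | Suc k \<Rightarrow> (\<lambda>g. \<lambda>x\<in>carrier (P (Suc k)). g (d k x)) ` carrier (gr_hom_space \<iota> R (P k) N))"

text \<open>\<open>Ext\<^sup>m(M, N)\<close> in the category of graded modules, computed from a graded projective
  resolution \<open>(P, d)\<close> of \<open>M\<close> as the cohomology of \<open>Hom(P, N)\<close>.\<close>

definition Ext_space ::
  "(complex \<Rightarrow> 'r) \<Rightarrow> 'r gring \<Rightarrow> (nat \<Rightarrow> ('r, 'p) gmodule) \<Rightarrow> (nat \<Rightarrow> 'p \<Rightarrow> 'p) \<Rightarrow>
   ('r, 'k) gmodule \<Rightarrow> nat \<Rightarrow> (complex, ('p \<Rightarrow> 'k) set) module" where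
  "Ext_space \<iota> R P d N m =
     quotient_module
       ((gr_hom_space \<iota> R (P m) N)\<lparr>carrier := cocycles \<iota> R P d N m\<rparr>)
       (coboundaries \<iota> R P d N m)"

abbreviation complex_field :: "complex ring" where
  "complex_field \<equiv> \<lparr>carrier = UNIV, monoid.mult = (*), monoid.one = 1, ring.zero = 0, ring.add = (+)\<rparr>"

text \<open>The Euler characteristic of a bigraded space with dimensions \<open>D m l\<close>, supported in
  internal degrees \<open>l \<ge> 0\<close>.\<close>

definition euler_series :: "(nat \<Rightarrow> int \<Rightarrow> nat) \<Rightarrow> rat fps" where
  "euler_series D = Abs_fps (\<lambda>l. \<Sum>m | D m (int l) \<noteq> 0. (- 1) ^ m * of_nat (D m (int l)))"

section \<open>The Grothendieck group of graded modules\<close>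

text \<open>Finitely generated graded modules with elements in a fixed type \<open>'u\<close>. Isomorphic modules
  get the same class, via short exact sequences with zero third term. The type \<open>'u\<close> has to be large
  enough to contain a copy of every finitely generated graded module, as it is for \<open>'u = 'r\<close> when
  \<open>R\<close> is a finite-dimensional complex algebra.\<close>

definition fg_gmodules :: "'r gring \<Rightarrow> ('r, 'u) gmodule set" where
  "fg_gmodules R =
     {M. graded_module R M \<and>
         (\<exists>S. finite S \<and> S \<subseteq> carrier M \<and> module.span R M S = carrier M)}"

definition short_exact ::
  "'r gring \<Rightarrow> ('r, 'u) gmodule \<Rightarrow> ('r, 'u) gmodule \<Rightarrow> ('r, 'u) gmodule \<Rightarrow> bool" where
  "short_exact R A B C \<longleftrightarrow>
     (\<exists>f\<in>gr_hom R A B. \<exists>g\<in>gr_hom R B C.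
        inj_on f (carrier A) \<and> f ` carrier A = mod_ker B C g \<and> g ` carrier B = carrier C)"

definition K0_relations :: "'r gring \<Rightarrow> (('r, 'u) gmodule \<Rightarrow>\<^sub>0 int) set" where
  "K0_relations R =
     generate (free_Abelian_group (fg_gmodules R))
       {frag_of B - frag_of A - frag_of C | A B C.
          A \<in> fg_gmodules R \<and> B \<in> fg_gmodules R \<and> C \<in> fg_gmodules R \<and> short_exact R A B C}"

text \<open>Laurent polynomials in \<open>q\<close> are the group ring \<open>int \<Rightarrow>\<^sub>0 int\<close>, with \<open>q\<close> = \<open>single 1 1\<close>;
  \<open>q ^ k\<close> acts on the free group by \<open>M \<mapsto> M\<langle>k\<rangle>\<close>.\<close>

definition laurent_act ::
  "(int \<Rightarrow>\<^sub>0 int) \<Rightarrow> (('r, 'u) gmodule \<Rightarrow>\<^sub>0 int) \<Rightarrow> (('r, 'u) gmodule \<Rightarrow>\<^sub>0 int)" where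
  "laurent_act p x = frag_extend (\<lambda>k. frag_extend (\<lambda>M. frag_of (gshift k M)) x) p"

definition K0 :: "'r gring \<Rightarrow> (int \<Rightarrow>\<^sub>0 int, (('r, 'u) gmodule \<Rightarrow>\<^sub>0 int) set) module" where
  "K0 R =
     (let F = free_Abelian_group (fg_gmodules R); N = K0_relations R
      in \<lparr>carrier = carrier (F Mod N), monoid.mult = undefined, monoid.one = undefined,
          ring.zero = \<one>\<^bsub>F Mod N\<^esub>, ring.add = (\<otimes>\<^bsub>F Mod N\<^esub>),
          module.smult = (\<lambda>p A. \<Union>x\<in>A. N #>\<^bsub>F\<^esub> laurent_act p x)\<rparr>)"

definition K0_class :: "'r gring \<Rightarrow> ('r, 'u) gmodule \<Rightarrow> (('r, 'u) gmodule \<Rightarrow>\<^sub>0 int) set" where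
  "K0_class R M = K0_relations R #>\<^bsub>free_Abelian_group (fg_gmodules R)\<^esub> frag_of M"

section \<open>Quantum integers\<close>

definition qint :: "'a::comm_ring_1 \<Rightarrow> nat \<Rightarrow> 'a" where
  "qint q m = (\<Sum>i<m. q ^ (2 * i))"

definition qfact :: "'a::comm_ring_1 \<Rightarrow> nat \<Rightarrow> 'a" where
  "qfact q n = (\<Prod>k=1..n. qint q k)"

section \<open>The coinvariant algebra\<close>

text \<open>Polynomials are finitely supported functions from monomials (exponent functions)
  to coefficients, multiplied by convolution.\<close>

type_synonym cpoly = "(nat \<Rightarrow>\<^sub>0 nat) \<Rightarrow>\<^sub>0 complex"

definition cpoly_ring :: "nat \<Rightarrow> cpoly ring" where
  "cpoly_ring n =
     \<lparr>carrier = {p. \<forall>m\<in>Poly_Mapping.keys p. Poly_Mapping.keys m \<subseteq> {1..n}},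
      monoid.mult = (*), monoid.one = 1, ring.zero = 0, ring.add = (+)\<rparr>"

definition poly_part :: "nat \<Rightarrow> int \<Rightarrow> cpoly set" where
  "poly_part n d =
     {p \<in> carrier (cpoly_ring n). \<forall>m\<in>Poly_Mapping.keys p.
        int (2 * (\<Sum>i\<in>Poly_Mapping.keys m. Poly_Mapping.lookup m i)) = d}"

text \<open>\<open>map_key \<sigma> m\<close> is the exponent function \<open>m \<circ> \<sigma>\<close>.\<close>

definition symmetric_polys :: "nat \<Rightarrow> cpoly set" where
  "symmetric_polys n =
     {p \<in> carrier (cpoly_ring n). \<forall>\<sigma>. \<sigma> permutes {1..n} \<longrightarrow>
        (\<forall>m. Poly_Mapping.lookup p (Poly_Mapping.map_key \<sigma> m) = Poly_Mapping.lookup p m)}"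

definition coinv_ideal :: "nat \<Rightarrow> cpoly set" where
  "coinv_ideal n =
     genideal (cpoly_ring n) {p \<in> symmetric_polys n. Poly_Mapping.lookup p 0 = 0}"

definition coinv_algebra :: "nat \<Rightarrow> cpoly set gring" where
  "coinv_algebra n =
     ring.extend (cpoly_ring n Quot coinv_ideal n)
       (gring.fields (\<lambda>d. (\<lambda>p. coinv_ideal n +>\<^bsub>cpoly_ring n\<^esub> p) ` poly_part n d))"

definition coinv_scalar :: "nat \<Rightarrow> complex \<Rightarrow> cpoly set" where
  "coinv_scalar n c = coinv_ideal n +>\<^bsub>cpoly_ring n\<^esub> Poly_Mapping.single 0 c"

text \<open>The constant coefficient of any representative.\<close>

definition coinv_augmentation :: "cpoly set \<Rightarrow> complex" where
  "coinv_augmentation A = (THE c. \<forall>p\<in>A. Poly_Mapping.lookup p 0 = c)"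

text \<open>The trivial module, modelled on the scalars inside the algebra so that it has elements of
  the same type as the regular module. Every positive degree element acts by zero.\<close>

definition trivial_gmodule :: "nat \<Rightarrow> (cpoly set, cpoly set) gmodule" where
  "trivial_gmodule n =
     (let H = coinv_algebra n
      in \<lparr>carrier = range (coinv_scalar n), monoid.mult = undefined, monoid.one = undefined,
          ring.zero = \<zero>\<^bsub>H\<^esub>, ring.add = (\<oplus>\<^bsub>H\<^esub>),
          module.smult = (\<lambda>h x. coinv_scalar n (coinv_augmentation h) \<otimes>\<^bsub>H\<^esub> x),
          mpart = (\<lambda>i. if i = 0 then range (coinv_scalar n) else {\<zero>\<^bsub>H\<^esub>})\<rparr>)"

end

theory Submission
 imports Defs
begin

text \<open>With respect to the regular sequence of complete symmetric polynomials
 \<open>f\<^sub>i = h\<^bsub>n+1-i\<^esub>(x\<^sub>1, ..., x\<^sub>i)\<close>, which generates the coinvariant ideal and is monic in successive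
 variables, the algebra has the Artin monomials as a basis. Ordering them by degree filters the
 regular module by graded ideals with trivial quotients, which computes its class.

 Since \<open>f\<^sub>n = x\<^sub>1 + ... + x\<^sub>n\<close>, the last variable can be eliminated. What remains is a complete
 intersection with \<open>n - 1\<close> variables and \<open>n - 1\<close> relations without linear part, and the
 Koszul-Tate complex (one exterior generator for each variable, one divided power generator for
 each relation) resolves the trivial module. Its differential vanishes modulo the augmentation
 ideal, so it is minimal, its number of generators in each bidegree gives the graded Betti numbers
 and the dimensions of the Ext spaces, and no resolution is finite. Comparison with an
 arbitrary resolution is up to homotopy, which is unipotent by nilpotence of the augmentation
 ideal.\<close>

section \<open>Polynomials\<close>

text \<open>Each f_i is monic in x_i and free of later variables. Division with remainder by such
  polynomials gives normal forms, and cancelling their leading terms gives regularity and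
  uniqueness. The complex is not built as an algebra. Its elements are families of polynomial
  coefficients, and statements hold modulo the ideal of the relations treated so far. Over the
  polynomial ring itself D D is not 0 but a combination of the f_j, and the induction on the
  relations exploits this. The critical point is the passage from f_1, ..., f_j to one more
  relation: it creates new homology, spanned by a single class of degree one, which the next divided
  power variable has to kill. A constant \<open>c\<close> measures this class, and a comparison of
  constant terms excludes it in degree zero. After elimination of x_n there remain n - 1 exterior
  generators of internal degree 2 and relations of internal degrees 2n, ..., 4, whence the exponents
  of the Poincare series. At t = -1 the quotient of (1 - q^2)^(n-1) by the product of the 1 - q^(2j)
  is the inverse quantum factorial.\<close>

hide_const (open) Poly_Mapping.degree Poly_Mapping.range

abbreviation lkp :: "('a \<Rightarrow>\<^sub>0 'b::zero) => 'a => 'b" where "lkp \<equiv> Poly_Mapping.lookup"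
abbreviation kys :: "('a \<Rightarrow>\<^sub>0 'b::zero) => 'a set" where "kys \<equiv> Poly_Mapping.keys"
abbreviation sgl :: "'a => 'b::zero => 'a \<Rightarrow>\<^sub>0 'b" where "sgl \<equiv> Poly_Mapping.single"
abbreviation (input) "CA \<equiv> coinv_algebra"
abbreviation (input) "TM \<equiv> trivial_gmodule"
abbreviation (input) "aug \<equiv> coinv_augmentation"
abbreviation (input) "scl \<equiv> coinv_scalar"
abbreviation (input) "mkey \<equiv> Poly_Mapping.map_key"
abbreviation (input) "submod \<equiv> LinearCombinations.submodule"
abbreviation (input) "fmod n \<equiv> free_gmodule (coinv_algebra n)"
abbreviation (input) "rmod n \<equiv> regular_gmodule (coinv_algebra n)"
lemmas aug_def = coinv_augmentation_def
lemmas submod_def = LinearCombinations.submodule_def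

lemma poly_mapping_sum_single:
 fixes p :: "'a \<Rightarrow>\<^sub>0 'b::comm_monoid_add"
 shows "(\<Sum>m\<in>kys p. sgl m (lkp p m)) = p"
proof (rule poly_mapping_eqI)
 fix k
 have "lkp (\<Sum>m\<in>kys p. sgl m (lkp p m)) k = (\<Sum>m\<in>kys p. if m = k then lkp p m else 0)"
  by (auto simp: lookup_sum lookup_single when_def intro!: sum.cong)
 also have "... = lkp p k" by (simp add: sum.delta in_keys_iff)
 finally show "lkp (\<Sum>m\<in>kys p. sgl m (lkp p m)) k = lkp p k" .
qed

lemma keys_induct [consumes 1, case_names zero single add]:
 fixes p :: "'a \<Rightarrow>\<^sub>0 'b::comm_monoid_add"
 assumes "kys p \<subseteq> S" "P 0" "!!m c. m \<in> S ==> P (sgl m c)"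
  "!!p q. P p ==> P q ==> P (p + q)"
 shows "P p"
proof -
 have "P (\<Sum>m\<in>A. sgl m (lkp p m))" if "finite A" "A \<subseteq> S" for A
  using that by (induction A rule: finite_induct) (auto intro: assms)
 from this[of "kys p"] show ?thesis using assms(1) by (simp add: poly_mapping_sum_single)
qed

text \<open>The additive operator that drops the monomials failing \<open>Q\<close> and moves the
  others along \<open>t\<close>. Extraction of a coefficient in one variable (\<open>coef\<close>)
  and of a homogeneous component (\<open>gcomp\<close>) are both instances, so additivity and the
  product rules are proved once.\<close>

definition mono_ext :: "('a => bool) => ('a => 'a) => ('a \<Rightarrow>\<^sub>0 'b) => ('a \<Rightarrow>\<^sub>0 'b::comm_monoid_add)"
 where "mono_ext Q t p = (\<Sum>m\<in>kys p. if Q m then sgl (t m) (lkp p m) else 0)"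

lemma mono_ext_0 [simp]: "mono_ext Q t 0 = 0" by (simp add: mono_ext_def)

lemma mono_ext_single: "mono_ext Q t (sgl m c) = (if Q m then sgl (t m) c else 0)" by (simp add: mono_ext_def)

lemma mono_ext_add: "mono_ext Q t (p + q) = mono_ext Q t p + mono_ext Q t q" unfolding mono_ext_def
 by (rule setsum_keys_plus_distrib[where f = "\<lambda>m c. if Q m then sgl (t m) c else 0"])
  (auto simp: single_add)

lemma mono_ext_sum: "mono_ext Q t (\<Sum>i\<in>A. g i) = (\<Sum>i\<in>A. mono_ext Q t (g i))"
 by (induction A rule: infinite_finite_induct) (auto simp: mono_ext_add)

lemma mono_ext_minus: "mono_ext Q t (p - q) = mono_ext Q t p - mono_ext Q t (q :: 'a \<Rightarrow>\<^sub>0 'b::ab_group_add)"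
 using mono_ext_add[of Q t "p - q" q] by simp

lemma lookup_mono_ext_id: "lkp (mono_ext Q (\<lambda>m. m) p) m = (if Q m then lkp p m else 0)"
proof -
 have "lkp (mono_ext Q (\<lambda>m. m) p) m = (\<Sum>a\<in>kys p. if a = m then (if Q a then lkp p a else 0) else 0)"
  unfolding mono_ext_def lookup_sum by (rule sum.cong) (auto simp: lookup_single when_def)
 also have "... = (if Q m then lkp p m else 0)" by (auto simp: sum.delta in_keys_iff)
 finally show ?thesis .
qed

lemma keys_mono_ext: "kys (mono_ext Q t p) \<subseteq> t ` {m \<in> kys p. Q m}"
proof -
 have "kys (mono_ext Q t p) \<subseteq> (\<Union>m\<in>kys p. kys (if Q m then sgl (t m) (lkp p m) else 0))"
  unfolding mono_ext_def by (rule keys_sum)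
 also have "... \<subseteq> t ` {m \<in> kys p. Q m}" by (auto split: if_splits)
 finally show ?thesis .
qed

text \<open>By bilinearity both factors may be taken to be monomials. The two uses are a factor
  \<open>q\<close> free of the distinguished variable (then \<open>Q\<close> and \<open>t\<close>
  ignore it) and a homogeneous factor \<open>q\<close> (then \<open>Q\<close> changes by a degree
  shift).\<close>

lemma mono_ext_mult:
 fixes p q :: "'a::monoid_add \<Rightarrow>\<^sub>0 'b::semiring_0"
 assumes "!!a b. a \<in> kys q ==> Q (a + b) = Q' b"
  "!!a b. a \<in> kys q ==> Q' b ==> t (a + b) = a + t' b"
 shows "mono_ext Q t (q * p) = q * mono_ext Q' t' p"
proof (induction p rule: keys_induct[OF subset_UNIV, case_names zero single add])
 case (single m c)
 define S where "S = kys q"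
 have S: "!!a. a \<in> S ==> Q (a + m) = Q' m" "!!a. a \<in> S ==> Q' m ==> t (a + m) = a + t' m"
  unfolding S_def by (simp_all add: assms)
 have "kys q \<subseteq> S" by (simp add: S_def)
 then show ?case by (induction q rule: keys_induct)
   (simp_all add: mult_single mono_ext_single mono_ext_add distrib_right S)
qed (simp_all add: mono_ext_add distrib_left)

lemma mono_ext_mult_single:
 fixes p :: "'a::monoid_add \<Rightarrow>\<^sub>0 'b::semiring_1"
 assumes "!!b. Q (a + b) = Q' b" "!!b. Q' b ==> t (a + b) = t' b"
 shows "mono_ext Q t (sgl a 1 * p) = mono_ext Q' t' p"
 by (induction p rule: keys_induct[OF subset_UNIV])
  (auto simp: mult_single mono_ext_single mono_ext_add distrib_left assms)

section \<open>Polynomial rings in a set of variables, and their ideals\<close>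

definition polys :: "nat set => cpoly set" where
 "polys V = {p. \<forall>m\<in>kys p. kys m \<subseteq> V}"

lemma polys_0 [simp, intro]: "0 \<in> polys V" and polys_1 [simp, intro]: "1 \<in> polys V" by (auto simp: polys_def)

lemma polys_const [simp, intro]: "sgl 0 c \<in> polys V" by (auto simp: polys_def)

lemma polys_add [simp, intro]: "p \<in> polys V ==> q \<in> polys V ==> p + q \<in> polys V"
 unfolding polys_def using keys_add[of p q] by blast

lemma polys_uminus [simp, intro]: "p \<in> polys V ==> - p \<in> polys V" by (auto simp: polys_def in_keys_iff)

lemma polys_minus [simp, intro]: "p \<in> polys V ==> q \<in> polys V ==> p - q \<in> polys V"
 using polys_add[of p V "- q"] by simp

lemma keys_add_nat: "kys (a + b) = kys a \<union> kys (b :: 'a \<Rightarrow>\<^sub>0 nat)" by (auto simp: in_keys_iff lookup_add)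

lemma polys_mult [simp, intro]:
 assumes "p \<in> polys V" "q \<in> polys V"
 shows "p * q \<in> polys V"
 unfolding polys_def
proof safe
 fix m i assume "m \<in> kys (p * q)" and i: "i \<in> kys m"
 then obtain a b where "m = a + b" "a \<in> kys p" "b \<in> kys q" using keys_mult[of p q] by blast
 then show "i \<in> V" using assms i by (auto simp: polys_def keys_add_nat)
qed

lemma polys_sum [intro]: "(!!i. i \<in> A ==> g i \<in> polys V) ==> (\<Sum>i\<in>A. g i) \<in> polys V"
 by (induction A rule: infinite_finite_induct) auto

lemma polys_power [simp, intro]: "p \<in> polys V ==> p ^ k \<in> polys V" by (induction k) auto

lemma polys_mono: "V \<subseteq> W ==> p \<in> polys V ==> p \<in> polys W" by (auto simp: polys_def)

definition vx :: "nat => cpoly" where "vx i = sgl (sgl i 1) 1"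

lemma polys_vx [simp, intro]: "i \<in> V ==> vx i \<in> polys V" by (auto simp: polys_def vx_def)

lemma vx_power: "vx i ^ k = sgl (sgl i k) 1" by (induction k) (auto simp: vx_def mult_single single_add[symmetric])

text \<open>A submodule over the subring \<open>R\<close> of the full polynomial type;
  \<open>I\<close> may reach outside \<open>R\<close>. In this form an ideal over more variables is
  also one over fewer, which \<open>idl_mono\<close> uses.\<close>

definition ideal_of :: "cpoly set => cpoly set => bool" where
 "ideal_of R I \<longleftrightarrow> 0 \<in> I \<and> (\<forall>a\<in>I. \<forall>b\<in>I. a + b \<in> I) \<and> (\<forall>r\<in>R. \<forall>a\<in>I. r * a \<in> I)"

text \<open>The last part holds because nonzero constants are units. It permits division by the
  integers that appear in Newton's identities and in averaging over permutations.\<close>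

lemma
 assumes "ideal_of (polys V) I"
 shows ideal_of_0: "0 \<in> I"
  and ideal_of_add: "a \<in> I ==> b \<in> I ==> a + b \<in> I"
  and ideal_of_mult: "r \<in> polys V ==> a \<in> I ==> r * a \<in> I"
  and ideal_of_mult2: "r \<in> polys V ==> a \<in> I ==> a * r \<in> I"
  and ideal_of_uminus: "a \<in> I ==> - a \<in> I"
  and ideal_of_minus: "a \<in> I ==> b \<in> I ==> a - b \<in> I"
  and ideal_of_sum: "(!!i. i \<in> A ==> g i \<in> I) ==> (\<Sum>i\<in>A. g i) \<in> I"
  and ideal_of_scale: "c \<noteq> 0 ==> sgl 0 c * a \<in> I ==> a \<in> I"
proof -
 show "0 \<in> I" and add: "a \<in> I ==> b \<in> I ==> a + b \<in> I"
  and mult: "r \<in> polys V ==> a \<in> I ==> r * a \<in> I" for a b r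
  using assms by (auto simp: ideal_of_def)
 show "r \<in> polys V ==> a \<in> I ==> a * r \<in> I" using mult by (metis mult.commute)
 show neg: "a \<in> I ==> - a \<in> I" for a using mult[of "sgl 0 (- 1)" a] by (simp add: single_uminus)
 show "a \<in> I ==> b \<in> I ==> a - b \<in> I" using add[of a "- b"] neg by simp
 show "(!!i. i \<in> A ==> g i \<in> I) ==> (\<Sum>i\<in>A. g i) \<in> I"
  using \<open>0 \<in> I\<close> by (induction A rule: infinite_finite_induct) (auto intro: add)
 assume "c \<noteq> 0" "sgl 0 c * a \<in> I"
 then show "a \<in> I" using mult[of "sgl 0 (1/c)" "sgl 0 c * a"] by (simp add: mult.assoc[symmetric] mult_single)
qed

section \<open>Coefficients with respect to one variable\<close>

text \<open>The coefficient of x_j^k when a polynomial is read as a polynomial in x_j over the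
  remaining variables.\<close>

definition coef :: "nat => nat => cpoly => cpoly" where
 "coef j k = mono_ext (\<lambda>m. lkp m j = k) (\<lambda>m. m - sgl j k)"

lemma coef_0 [simp]: "coef j k 0 = 0"
 and coef_add: "coef j k (p + q) = coef j k p + coef j k q"
 and coef_minus: "coef j k (p - q) = coef j k p - coef j k q"
 and coef_sum: "coef j k (\<Sum>i\<in>A. g i) = (\<Sum>i\<in>A. coef j k (g i))"
 by (auto simp: coef_def mono_ext_add mono_ext_minus mono_ext_sum)

lemma coef_mult:
 assumes "q \<in> polys V" "j \<notin> V"
 shows "coef j k (q * p) = q * coef j k p"
 unfolding coef_def
proof (rule mono_ext_mult)
 fix a b :: "nat \<Rightarrow>\<^sub>0 nat" assume "a \<in> kys q"
 then have "kys a \<subseteq> V" using assms(1) by (auto simp: polys_def)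
 then have a: "lkp a j = 0" using assms(2) by (auto simp: in_keys_iff)
 show "(lkp (a + b) j = k) = (lkp b j = k)" by (simp add: lookup_add a)
 assume "lkp b j = k"
 then show "a + b - sgl j k = a + (b - sgl j k)"
  by (intro poly_mapping_eqI) (auto simp: lookup_add lookup_minus lookup_single when_def)
qed

lemma coef_vx_power: "coef j k (vx j ^ i * p) = (if i \<le> k then coef j (k - i) p else 0)"
proof (cases "i \<le> k")
 case True
 have "mono_ext (\<lambda>m. lkp m j = k) (\<lambda>m. m - sgl j k) (sgl (sgl j i) 1 * p) =
    mono_ext (\<lambda>m. lkp m j = k - i) (\<lambda>m. m - sgl j (k - i)) p"
 proof (rule mono_ext_mult_single)
  fix b :: "nat \<Rightarrow>\<^sub>0 nat"
  show "(lkp (sgl j i + b) j = k) = (lkp b j = k - i)" using True by (auto simp: lookup_add)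
  show "sgl j i + b - sgl j k = b - sgl j (k - i)" using True
   by (intro poly_mapping_eqI) (auto simp: lookup_add lookup_minus lookup_single when_def)
 qed
 then show ?thesis using True by (simp add: coef_def vx_power)
next
 case False
 have "mono_ext (\<lambda>m. lkp m j = k) (\<lambda>m. m - sgl j k) (sgl (sgl j i) 1 * p) =
    mono_ext (\<lambda>m. False) (\<lambda>m. m) p"
  using False by (intro mono_ext_mult_single) (auto simp: lookup_add)
 then show ?thesis using False by (simp add: coef_def vx_power) (simp add: mono_ext_def)
qed

lemma coef_polys: "p \<in> polys V ==> coef j k p \<in> polys (V - {j})"
 unfolding polys_def coef_def using keys_mono_ext[of "\<lambda>m. lkp m j = k" "\<lambda>m. m - sgl j k" p]
 by (fastforce simp: in_keys_iff lookup_minus lookup_single when_def split: if_splits)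

lemma coef_free:
 assumes "p \<in> polys V" "j \<notin> V"
 shows "coef j k p = (if k = 0 then p else 0)"
proof -
 have 1: "coef j k 1 = (if k = 0 then 1 else 0)"
  using mono_ext_single[of "\<lambda>m. lkp m j = k" "\<lambda>m. m - sgl j k" 0 "1::complex"]
  by (auto simp: coef_def)
 show ?thesis using coef_mult[OF assms, of k 1] 1 by auto
qed

lemma coef_support: "{k. coef j k p \<noteq> 0} \<subseteq> (\<lambda>m. lkp m j) ` kys p"
proof safe
 fix k assume "coef j k p \<noteq> 0"
 then have "kys (coef j k p) \<noteq> {}" by (metis keys_eq_empty)
 then show "k \<in> (\<lambda>m. lkp m j) ` kys p"
  using keys_mono_ext[of "\<lambda>m. lkp m j = k" "\<lambda>m. m - sgl j k" p] unfolding coef_def by blast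
qed

lemma coef_eventually_0: "finite {k. coef j k p \<noteq> 0}" by (rule finite_subset[OF coef_support]) simp

lemma coef_expand:
 assumes "finite K" "{k. coef j k p \<noteq> 0} \<subseteq> K"
 shows "p = (\<Sum>k\<in>K. coef j k p * vx j ^ k)"
proof -
 have "(\<Sum>k\<in>K. coef j k p * vx j ^ k) = (\<Sum>k | coef j k p \<noteq> 0. coef j k p * vx j ^ k)"
  using assms by (intro sum.mono_neutral_right) auto
 also have "... = (\<Sum>k\<in>(\<lambda>m. lkp m j) ` kys p. coef j k p * vx j ^ k)"
  by (intro sum.mono_neutral_left coef_support) auto
 also have "... = (\<Sum>k\<in>(\<lambda>m. lkp m j) ` kys p. \<Sum>m\<in>{m\<in>kys p. lkp m j = k}. sgl m (lkp p m))"
 proof (rule sum.cong)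
  fix k
  have "coef j k p * vx j ^ k = (\<Sum>m\<in>kys p. if lkp m j = k then sgl m (lkp p m) else 0)"
   unfolding coef_def mono_ext_def sum_distrib_right vx_power
  proof (rule sum.cong)
   fix m
   have "lkp m j = k ==> m - sgl j k + sgl j k = m"
    by (intro poly_mapping_eqI) (auto simp: lookup_add lookup_minus lookup_single when_def)
   then show "(if lkp m j = k then sgl (m - sgl j k) (lkp p m) else 0) * sgl (sgl j k) 1 =
    (if lkp m j = k then sgl m (lkp p m) else 0)" by (simp add: mult_single)
  qed simp
  then show "coef j k p * vx j ^ k = (\<Sum>m\<in>{m\<in>kys p. lkp m j = k}. sgl m (lkp p m))" by (simp add: sum.inter_filter)
 qed simp
 also have "... = (\<Sum>m\<in>kys p. sgl m (lkp p m))" by (rule sum.image_gen[symmetric]) simp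
 finally show ?thesis by (simp add: poly_mapping_sum_single)
qed

lemma coef_in_ideal_imp:
 assumes "ideal_of (polys V) I" "j \<in> V" "!!k. coef j k p \<in> I"
 shows "p \<in> I"
 by (subst coef_expand[OF coef_eventually_0 subset_refl, of p j])
  (auto intro!: ideal_of_sum[OF assms(1)] ideal_of_mult2[OF assms(1)] assms)

section \<open>Monic polynomials: cancellation, division and regular sequences\<close>

definition monic_in :: "nat => nat => nat set => cpoly => bool" where
 "monic_in j e V f \<longleftrightarrow> (\<exists>c. (\<forall>i. c i \<in> polys V) \<and> c e = 1 \<and> f = (\<Sum>i\<le>e. vx j ^ i * c i))"

lemma monic_in_polys:
 assumes "monic_in j e (V - {j}) f" "j \<in> V"
 shows "f \<in> polys V"
proof -
 obtain c where c: "!!i. c i \<in> polys (V - {j})" "f = (\<Sum>i\<le>e. vx j ^ i * c i)"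
  using assms(1) unfolding monic_in_def by blast
 have "c i \<in> polys V" for i using c(1) by (rule polys_mono[rotated]) auto
 then show ?thesis unfolding c(2) using assms(2) by (intro polys_sum) auto
qed

text \<open>The top coefficient of \<open>p\<close> outside \<open>I\<close> would show up as a coefficient of \<open>f p\<close>.\<close>

lemma monic_cancel:
 assumes I: "ideal_of (polys V) I" and j: "j \<in> V"
  and f: "monic_in j e (V - {j}) f"
  and fp: "!!k. k \<ge> e ==> coef j k (f * p) \<in> I"
 shows "p \<in> I"
proof (rule coef_in_ideal_imp[OF I j], rule ccontr)
 fix k0 assume "coef j k0 p \<notin> I"
 let ?B = "{k. coef j k p \<notin> I}"
 have "?B \<subseteq> {k. coef j k p \<noteq> 0}" using ideal_of_0[OF I] by auto
 then have fin: "finite ?B" using coef_eventually_0 finite_subset by blast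
 define k where "k = Max ?B"
 have kB: "k \<in> ?B" using fin \<open>coef j k0 p \<notin> I\<close> unfolding k_def by (intro Max_in) auto
 have top: "coef j l p \<in> I" if "l > k" for l using that fin Max_ge[OF fin, of l] unfolding k_def by fastforce
 obtain c where c: "!!i. c i \<in> polys (V - {j})" "c e = 1" "f = (\<Sum>i\<le>e. vx j ^ i * c i)"
  using f unfolding monic_in_def by blast
 have "coef j (k + e) (f * p) = (\<Sum>i\<le>e. c i * coef j (k + e - i) p)"
 proof -
  have "coef j (k + e) (vx j ^ i * c i * p) = c i * coef j (k + e - i) p" if "i \<le> e" for i
  proof -
   have "coef j (k + e) (vx j ^ i * c i * p) = coef j (k + e) (c i * (vx j ^ i * p))"
    by (simp add: mult.commute mult.left_commute mult.assoc)
   also have "... = c i * coef j (k + e - i) p" using that by (subst coef_mult[OF c(1)]) (auto simp: coef_vx_power)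
   finally show ?thesis .
  qed
  then show ?thesis by (simp add: c(3) sum_distrib_right coef_sum)
 qed
 \<comment> \<open>The leading coefficient 1 isolates \<open>coef j k p\<close>; every other summand
   contains a coefficient of index above \<open>k\<close>, which lies in \<open>I\<close> by
   maximality of \<open>k\<close>.\<close>
 also have "... = coef j k p + (\<Sum>i<e. c i * coef j (k + e - i) p)" by (simp add: lessThan_Suc_atMost[symmetric] c(2))
 finally have "coef j k p = coef j (k + e) (f * p) - (\<Sum>i<e. c i * coef j (k + e - i) p)" by simp
 also have "... \<in> I"
  by (intro ideal_of_minus[OF I] ideal_of_sum[OF I] ideal_of_mult[OF I] fp top polys_mono[OF _ c(1)]) auto
 finally show False using kB by simp
qed

text \<open>The ideal generated by \<open>f 1\<close>, ..., \<open>f k\<close> over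
  \<open>polys V\<close>, given by explicit cofactors: coefficient extraction and homogeneous
  components can then be applied to the cofactors one by one.\<close>

definition idl :: "nat set => (nat => cpoly) => nat => cpoly set" where
 "idl V f k = {\<Sum>i\<in>{1..k}. f i * q i | q. \<forall>i. q i \<in> polys V}"

lemma idl_ideal [intro]: "ideal_of (polys V) (idl V f k)" unfolding ideal_of_def
proof (intro conjI ballI)
 show "0 \<in> idl V f k" unfolding idl_def by (rule CollectI, rule exI[of _ "\<lambda>_. 0"]) auto
next
 fix a b assume "a \<in> idl V f k" "b \<in> idl V f k"
 then obtain q r where "a = (\<Sum>i\<in>{1..k}. f i * q i)" "b = (\<Sum>i\<in>{1..k}. f i * r i)"
  "\<forall>i. q i \<in> polys V" "\<forall>i. r i \<in> polys V" unfolding idl_def by auto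
 then show "a + b \<in> idl V f k" unfolding idl_def
  by (intro CollectI exI[of _ "\<lambda>i. q i + r i"]) (auto simp: sum.distrib distrib_left)
next
 fix a b assume r: "b \<in> polys V" and "a \<in> idl V f k"
 then obtain q where "a = (\<Sum>i\<in>{1..k}. f i * q i)" "\<forall>i. q i \<in> polys V" unfolding idl_def by auto
 then show "b * a \<in> idl V f k" unfolding idl_def using r
  by (intro CollectI exI[of _ "\<lambda>i. b * q i"]) (auto simp: sum_distrib_left ac_simps)
qed

lemmas idl_zero = ideal_of_0[OF idl_ideal] and idl_add = ideal_of_add[OF idl_ideal]
 and idl_mult = ideal_of_mult[OF idl_ideal] and idl_mult2 = ideal_of_mult2[OF idl_ideal]
 and idl_uminus = ideal_of_uminus[OF idl_ideal] and idl_minus = ideal_of_minus[OF idl_ideal]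
 and idl_sum = ideal_of_sum[OF idl_ideal]

lemma idl_gen: "i \<in> {1..k} ==> f i \<in> idl V f k" unfolding idl_def
 by (intro CollectI exI[of _ "\<lambda>j. if j = i then 1 else 0"]) (auto simp: if_distrib sum.delta cong: if_cong)

lemma idl_subset:
 assumes "ideal_of (polys V) I" "!!i. i \<in> {1..k} ==> f i \<in> I"
 shows "idl V f k \<subseteq> I"
 unfolding idl_def by (auto intro!: ideal_of_sum[OF assms(1)] ideal_of_mult2[OF assms(1)] assms(2))

lemma idl_mono: "k \<le> l ==> V \<subseteq> W ==> idl V f k \<subseteq> idl W f l"
proof -
 assume kl: "k \<le> l" and "V \<subseteq> W"
 then have "ideal_of (polys V) (idl W f l)"
  using idl_ideal[of W f l] unfolding ideal_of_def by (auto dest: polys_mono)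
 then show ?thesis using kl by (intro idl_subset idl_gen) auto
qed

lemma idl_polys:
 assumes "!!i. i \<in> {1..k} ==> f i \<in> polys V"
 shows "idl V f k \<subseteq> polys V"
 by (intro idl_subset assms) (auto simp: ideal_of_def)

lemma idl_Suc:
 assumes "p \<in> idl V f (Suc k)"
 obtains a q where "a \<in> idl V f k" "q \<in> polys V" "p = a + f (Suc k) * q"
proof -
 from assms obtain q where q: "p = (\<Sum>i\<in>{1..Suc k}. f i * q i)" "\<forall>i. q i \<in> polys V" unfolding idl_def by auto
 have "(\<Sum>i\<in>{1..k}. f i * q i) \<in> idl V f k" unfolding idl_def using q(2) by (intro CollectI exI[of _ q]) simp
 then show ?thesis by (rule that[of _ "q (Suc k)"]) (simp_all add: q)
qed

text \<open>Generators free of x_j behave as scalars for \<open>coef j l\<close>, which therefore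
  acts on the cofactors only.\<close>

lemma idl_coef:
 assumes f: "!!i. i \<in> {1..k} ==> f i \<in> polys W" "j \<notin> W" and p: "p \<in> idl V f k"
 shows "coef j l p \<in> idl (V - {j}) f k"
proof -
 from p obtain q where q: "p = (\<Sum>i\<in>{1..k}. f i * q i)" "\<forall>i. q i \<in> polys V" unfolding idl_def by auto
 have "coef j l p = (\<Sum>i\<in>{1..k}. f i * coef j l (q i))"
  unfolding q(1) coef_sum by (intro sum.cong refl coef_mult[OF f(1) f(2)])
 then show ?thesis unfolding idl_def using q(2)
  by (intro CollectI exI[of _ "\<lambda>i. coef j l (q i)"]) (simp add: coef_polys)
qed

text \<open>Write p = a + f q with f = \<open>f (Suc k)\<close>. From degree e on, the coefficients
  of f q are those of -a and so lie in the ideal of the first k generators; cancelling the monic f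
  puts q there as well. This is what makes remainders unique.\<close>

lemma idl_reduce:
 assumes f: "!!i. i \<in> {1..k} ==> f i \<in> polys W" "j \<notin> W" "j \<in> V"
  and monic: "monic_in j e (V - {j}) (f (Suc k))"
  and p: "p \<in> idl V f (Suc k)" and top: "!!l. l \<ge> e ==> coef j l p = 0"
 shows "p \<in> idl V f k"
proof -
 from p obtain a q where aq: "a \<in> idl V f k" "q \<in> polys V" "p = a + f (Suc k) * q" by (rule idl_Suc)
 have "coef j l (f (Suc k) * q) \<in> idl V f k" if "l \<ge> e" for l
 proof -
  have "coef j l (f (Suc k) * q) = - coef j l a"
   using top[OF that] aq(3) by (simp add: coef_add eq_neg_iff_add_eq_0 add.commute)
  moreover have "coef j l a \<in> idl V f k" using idl_coef[OF f(1,2) aq(1)] idl_mono[of k k "V - {j}" V f] by blast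
  ultimately show ?thesis using idl_uminus by auto
 qed
 then have "q \<in> idl V f k" using monic_cancel[OF idl_ideal f(3) monic] by blast
 then have "f (Suc k) * q \<in> idl V f k" by (rule idl_mult[OF monic_in_polys[OF monic f(3)]])
 then show ?thesis using aq idl_add by auto
qed

text \<open>A polynomial monic in a variable absent from \<open>f 1\<close>, ..., \<open>f k\<close>
  is a nonzerodivisor modulo them. All regularity used for the Koszul-Tate complex comes from here,
  for the relations and for the variables themselves.\<close>

lemma idl_regular:
 assumes f: "!!i. i \<in> {1..k} ==> f i \<in> polys W" "j \<notin> W" "j \<in> V"
  and monic: "monic_in j e (V - {j}) g" and gp: "g * p \<in> idl V f k"
 shows "p \<in> idl V f k"
proof (rule monic_cancel[OF idl_ideal f(3) monic])
 fix l show "coef j l (g * p) \<in> idl V f k" using idl_coef[OF f(1,2) gp] idl_mono[of k k "V - {j}" V f] by blast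
qed

text \<open>The polynomials that admit a division form an additive set \<open>Q\<close>, so it
  suffices to divide q x_j^i with q free of x_j, by strong induction on i.\<close>

lemma monic_division:
 assumes j: "j \<in> V" and monic: "monic_in j e (V - {j}) f" and p: "p \<in> polys V"
 shows "\<exists>r\<in>polys V. (\<forall>l\<ge>e. coef j l r = 0) \<and> (\<exists>q\<in>polys V. p - r = f * q)"
proof -
 define Q where "Q = {p \<in> polys V. \<exists>r\<in>polys V. (\<forall>l\<ge>e. coef j l r = 0) \<and> (\<exists>q\<in>polys V. p - r = f * q)}"
 have QI: "p \<in> Q" if "p \<in> polys V" "r \<in> polys V" "!!l. l \<ge> e ==> coef j l r = 0" "q \<in> polys V" "p - r = f * q" for p r q
  using that unfolding Q_def by blast
 have add: "p + p' \<in> Q" if "p \<in> Q" "p' \<in> Q" for p p'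
 proof -
  from that obtain r q r' q' where *: "r \<in> polys V" "\<forall>l\<ge>e. coef j l r = 0" "q \<in> polys V" "p - r = f * q"
   "r' \<in> polys V" "\<forall>l\<ge>e. coef j l r' = 0" "q' \<in> polys V" "p' - r' = f * q'" "p \<in> polys V" "p' \<in> polys V"
   unfolding Q_def by blast
  have "p + p' - (r + r') = f * (q + q')" using *(4,8) by (simp add: algebra_simps)
  then show ?thesis using * by (intro QI[of _ "r + r'" "q + q'"]) (auto simp: coef_add)
 qed
 have zero: "0 \<in> Q" unfolding Q_def by (auto intro!: bexI[of _ 0])
 have sumQ: "(\<Sum>i\<in>A. g i) \<in> Q" if "!!i. i \<in> A ==> g i \<in> Q" for A :: "nat set" and g
  using that zero add by (induction A rule: infinite_finite_induct) auto
 obtain c where c: "!!i. c i \<in> polys (V - {j})" "c e = 1" "f = (\<Sum>i\<le>e. vx j ^ i * c i)"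
  using monic unfolding monic_in_def by blast
 have sub: "polys (V - {j}) \<subseteq> polys V" using polys_mono by blast
 have main: "q * vx j ^ i \<in> Q" if "q \<in> polys (V - {j})" for q i using that
 proof (induction i arbitrary: q rule: less_induct)
  case (less i)
  have q: "q \<in> polys V" using less.prems sub by blast
  show ?case
  proof (cases "i < e")
   case True
   have "coef j l (q * vx j ^ i) = 0" if "l \<ge> e" for l using True that coef_vx_power[of j l i 1]
    by (simp add: coef_mult[OF less.prems] coef_free[OF polys_1[of "{}"]])
   then show ?thesis using q j by (intro QI[of _ "q * vx j ^ i" 0]) auto
  next
   case False
   \<comment> \<open>The leading term of this multiple of \<open>f\<close> is q x_j^i; all its other
     terms have exponent l + (i - e) < i and are covered by the induction hypothesis.\<close>
   have "f * (q * vx j ^ (i - e)) = (\<Sum>l<e. (q * c l) * vx j ^ (l + (i - e))) + q * vx j ^ i"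
   proof -
    have "f * (q * vx j ^ (i - e)) = (\<Sum>l<e. vx j ^ l * c l * (q * vx j ^ (i - e))) + vx j ^ e * (q * vx j ^ (i - e))"
     unfolding c(3) lessThan_Suc_atMost[symmetric] by (simp add: sum_distrib_right distrib_right c(2))
    moreover have "vx j ^ e * (q * vx j ^ (i - e)) = q * vx j ^ i"
     using False by (simp add: mult.left_commute power_add[symmetric])
    moreover have "vx j ^ l * c l * (q * vx j ^ (i - e)) = (q * c l) * vx j ^ (l + (i - e))" for l
     by (simp add: power_add ac_simps)
    ultimately show ?thesis by simp
   qed
   then have eq: "q * vx j ^ i = f * (q * vx j ^ (i - e)) + (\<Sum>l<e. (- (q * c l)) * vx j ^ (l + (i - e)))"
    by (simp add: sum_negf)
   have "f \<in> polys V" by (rule monic_in_polys[OF monic j])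
   then have "f * (q * vx j ^ (i - e)) \<in> Q" using q j by (intro QI[of _ 0 "q * vx j ^ (i - e)"]) auto
   moreover have "(\<Sum>l<e. (- (q * c l)) * vx j ^ (l + (i - e))) \<in> Q"
    using False less.prems c(1) by (intro sumQ less.IH) auto
   ultimately show ?thesis unfolding eq by (rule add)
  qed
 qed
 have "p \<in> Q" by (subst coef_expand[OF coef_eventually_0 subset_refl, of p j]) (auto intro!: sumQ main coef_polys p)
 then show ?thesis unfolding Q_def by blast
qed

section \<open>The coinvariant ideal\<close>

text \<open>Total degree with every variable counted once, hence half the internal degree.\<close>

definition mdeg :: "(nat \<Rightarrow>\<^sub>0 nat) => nat" where "mdeg m = (\<Sum>i\<in>kys m. lkp m i)"

lemma mdeg_superset: "finite S ==> kys m \<subseteq> S ==> mdeg m = (\<Sum>i\<in>S. lkp m i)"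
 unfolding mdeg_def by (rule sum.mono_neutral_left) (auto simp: in_keys_iff)

lemma mdeg_add: "mdeg (a + b) = mdeg a + mdeg b"
proof -
 let ?S = "kys a \<union> kys b"
 have "mdeg (a + b) = (\<Sum>i\<in>?S. lkp (a + b) i)" by (rule mdeg_superset) (auto simp: keys_add_nat)
 also have "... = (\<Sum>i\<in>?S. lkp a i) + (\<Sum>i\<in>?S. lkp b i)" by (simp add: lookup_add sum.distrib)
 also have "... = mdeg a + mdeg b" by (simp add: mdeg_superset[of ?S])
 finally show ?thesis .
qed

lemma mdeg_0 [simp]: "mdeg 0 = 0" and mdeg_single [simp]: "mdeg (sgl i k) = k" by (auto simp: mdeg_def)

lemma mdeg_eq_0_iff [simp]: "mdeg m = 0 \<longleftrightarrow> m = 0"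
proof
 assume "mdeg m = 0"
 then have "\<forall>i\<in>kys m. lkp m i = 0" by (simp add: mdeg_def)
 then have "kys m = {}" by (meson all_not_in_conv in_keys_iff)
 then show "m = 0" by simp
qed simp

definition homog :: "nat => cpoly => bool" where "homog d p \<longleftrightarrow> (\<forall>m\<in>kys p. mdeg m = d)"

lemma homog_0 [simp, intro]: "homog d 0" and homog_const [simp, intro]: "homog 0 (sgl 0 c)"
 and homog_1 [simp, intro]: "homog 0 1" and homog_vx [simp, intro]: "homog 1 (vx i)"
 by (auto simp: homog_def vx_def)

lemma homog_add [intro]: "homog d p ==> homog d q ==> homog d (p + q)"
 unfolding homog_def using keys_add[of p q] by blast

lemma homog_uminus [intro]: "homog d p ==> homog d (- p)" by (auto simp: homog_def in_keys_iff)

lemma homog_mult: 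
 assumes "homog d p" "homog e q" "c = d + e" shows "homog c (p * q)"
 unfolding homog_def
proof
 fix m assume "m \<in> kys (p * q)"
 then obtain a b where "m = a + b" "a \<in> kys p" "b \<in> kys q" using keys_mult[of p q] by blast
 then show "mdeg m = c" using assms by (auto simp: homog_def mdeg_add)
qed

lemma homog_sum [intro]: "(!!i. i \<in> A ==> homog d (g i)) ==> homog d (\<Sum>i\<in>A. g i)"
 by (induction A rule: infinite_finite_induct) auto

lemma homog_vx_power: "homog k (vx i ^ k)" by (auto simp: homog_def vx_power)

definition gcomp :: "nat => cpoly => cpoly" where "gcomp d = mono_ext (\<lambda>m. mdeg m = d) (\<lambda>m. m)"

lemma lookup_gcomp: "lkp (gcomp d p) m = (if mdeg m = d then lkp p m else 0)"
 by (simp add: gcomp_def lookup_mono_ext_id)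

lemma keys_gcomp: "kys (gcomp d p) = {m \<in> kys p. mdeg m = d}"
 by (auto simp: in_keys_iff lookup_gcomp split: if_splits)

lemma homog_gcomp [simp, intro]: "homog d (gcomp d p)" by (auto simp: homog_def keys_gcomp)

lemma gcomp_polys [simp, intro]: "p \<in> polys V ==> gcomp d p \<in> polys V" by (auto simp: polys_def keys_gcomp)

lemma gcomp_add: "gcomp d (p + q) = gcomp d p + gcomp d q"
 and gcomp_minus: "gcomp d (p - q) = gcomp d p - gcomp d q"
 and gcomp_sum: "gcomp d (\<Sum>i\<in>A. g i) = (\<Sum>i\<in>A. gcomp d (g i))"
 and gcomp_0 [simp]: "gcomp d 0 = 0"
 by (auto simp: gcomp_def mono_ext_add mono_ext_minus mono_ext_sum)

lemma gcomp_homog: "homog e p ==> gcomp d p = (if d = e then p else 0)"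
 by (rule poly_mapping_eqI) (auto simp: lookup_gcomp homog_def in_keys_iff)

lemma gcomp_expand:
 assumes "finite D" "mdeg ` kys p \<subseteq> D"
 shows "p = (\<Sum>d\<in>D. gcomp d p)"
proof (rule poly_mapping_eqI)
 fix m
 have "mdeg m \<notin> D ==> lkp p m = 0" using assms(2) by (metis image_subset_iff in_keys_iff)
 then show "lkp p m = lkp (\<Sum>d\<in>D. gcomp d p) m" using assms(1) by (auto simp: lookup_sum lookup_gcomp)
qed

lemma gcomp_mult:
 assumes "homog e q"
 shows "gcomp d (q * p) = (if e \<le> d then q * gcomp (d - e) p else 0)"
proof (cases "e \<le> d")
 case True
 then show ?thesis unfolding gcomp_def using assms by (auto intro!: mono_ext_mult simp: homog_def mdeg_add)
next
 case False
 have "mono_ext (\<lambda>m. mdeg m = d) (\<lambda>m. m) (q * p) = q * mono_ext (\<lambda>m. False) (\<lambda>m. m) p"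
  using assms False by (intro mono_ext_mult) (auto simp: homog_def mdeg_add)
 then show ?thesis using False by (simp add: gcomp_def) (simp add: mono_ext_def)
qed

text \<open>A homogeneous generator passes through \<open>gcomp\<close> and merely shifts the degree
  taken from its cofactor.\<close>

lemma idl_gcomp:
 assumes f: "!!i. i \<in> {1..k} ==> homog (e i) (f i)" and p: "p \<in> idl V f k"
 shows "gcomp d p \<in> idl V f k"
proof -
 from p obtain q where q: "p = (\<Sum>i\<in>{1..k}. f i * q i)" "\<forall>i. q i \<in> polys V" unfolding idl_def by auto
 have "gcomp d p = (\<Sum>i\<in>{1..k}. f i * (if e i \<le> d then gcomp (d - e i) (q i) else 0))"
  unfolding q(1) gcomp_sum by (intro sum.cong refl) (auto simp: gcomp_mult[OF f])
 then show ?thesis unfolding idl_def using q(2)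
  by (intro CollectI exI[of _ "\<lambda>i. if e i \<le> d then gcomp (d - e i) (q i) else 0"]) auto
qed

section \<open>Complete homogeneous polynomials and power sums\<close>

text \<open>\<open>hsym j k\<close> is the complete homogeneous symmetric polynomial of degree \<open>k\<close> in \<open>x\<^sub>1, ..., x\<^sub>j\<close>.\<close>

fun hsym :: "nat => nat => cpoly" where
 "hsym 0 k = (if k = 0 then 1 else 0)"
| "hsym (Suc j) k = (\<Sum>i\<le>k. vx (Suc j) ^ i * hsym j (k - i))"

declare hsym.simps(2) [simp del]

lemma hsym_0 [simp]: "hsym j 0 = 1" by (induction j) (simp_all add: hsym.simps(2))

text \<open>A monomial either avoids the last variable or is divisible by it.\<close>

lemma hsym_Suc_Suc: "hsym (Suc j) (Suc k) = hsym j (Suc k) + vx (Suc j) * hsym (Suc j) k"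
proof -
 have "hsym (Suc j) (Suc k) = (\<Sum>i\<le>Suc k. vx (Suc j) ^ i * hsym j (Suc k - i))" by (simp only: hsym.simps)
 also have "... = hsym j (Suc k) + (\<Sum>i\<le>k. vx (Suc j) ^ Suc i * hsym j (k - i))"
  unfolding sum.atMost_Suc_shift by simp
 also have "... = hsym j (Suc k) + vx (Suc j) * hsym (Suc j) k"
  by (simp add: sum_distrib_left mult.assoc hsym.simps(2))
 finally show ?thesis .
qed

lemma hsym_polys: "{1..j} \<subseteq> V ==> hsym j k \<in> polys V"
proof (induction j arbitrary: k)
 case (Suc j)
 have "Suc j \<in> V" "{1..j} \<subseteq> V" using Suc.prems by (auto simp: subset_iff)
 then have "vx (Suc j) \<in> polys V" and "hsym j i \<in> polys V" for i using Suc.IH by auto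
 then show ?case by (simp only: hsym.simps) (intro polys_sum polys_mult polys_power)
qed auto

lemma hsym_homog: "homog k (hsym j k)"
proof (induction j arbitrary: k)
 case (Suc j)
 show ?case by (simp only: hsym.simps) (intro homog_sum homog_mult[OF homog_vx_power Suc], simp)
qed auto

text \<open>The coefficient of the i-th power of the last variable is h_(k-i) in the earlier ones,
  and h_0 = 1.\<close>

lemma hsym_monic: "monic_in (Suc j) k {1..j} (hsym (Suc j) k)" unfolding monic_in_def
 by (intro exI[of _ "\<lambda>i. hsym j (k - i)"]) (simp add: hsym_polys hsym.simps(2))

text \<open>Monomials are sorted by the largest variable that divides them. This writes each
  relation as a combination of the variables and so supplies the coefficients \<open>g\<close> of
  the Koszul-Tate differential.\<close>

lemma hsym_expand: "hsym j (Suc k) = (\<Sum>i\<in>{1..j}. vx i * hsym i k)" by (induction j) (simp_all add: hsym_Suc_Suc)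

definition psum :: "nat => nat => cpoly" where "psum j k = (\<Sum>i\<in>{1..j}. vx i ^ k)"

text \<open>Logarithmic differentiation of the generating function \<open>\<Prod>\<^sub>i 1 / (1 - x\<^sub>i t)\<close>.\<close>

lemma newton_identity:
 "of_nat k * hsym j k = (\<Sum>i=0..k. (if i = 0 then 0 else psum j i) * hsym j (k - i))"
proof -
 define G where "G j = Abs_fps (hsym j)" for j
 define S where "S j = Abs_fps (\<lambda>k. if k = 0 then 0 else psum j k)" for j
 \<comment> \<open>Multiplication by u_j = 1 - x_j t strips the j-th factor from the generating
   function \<open>G\<close> and turns the new summand of \<open>S\<close> into x_j t.\<close>
 define u where "u j = 1 - fps_const (vx j) * fps_X" for j
 have uG: "u (Suc j) * G (Suc j) = G j" for j
 proof (rule fps_ext)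
  fix k show "(u (Suc j) * G (Suc j)) $ k = G j $ k"
   by (cases k) (simp_all add: u_def G_def algebra_simps hsym_Suc_Suc mult.assoc)
 qed
 have uS: "u (Suc j) * S (Suc j) = u (Suc j) * S j + fps_const (vx (Suc j)) * fps_X" for j
 proof -
  have "u (Suc j) * (S (Suc j) - S j) = fps_const (vx (Suc j)) * fps_X"
  proof (rule fps_ext)
   fix k show "(u (Suc j) * (S (Suc j) - S j)) $ k = (fps_const (vx (Suc j)) * fps_X) $ k"
    by (cases k; cases "k - 1") (simp_all add: u_def S_def psum_def algebra_simps mult.assoc)
  qed
  then show ?thesis by (simp add: algebra_simps)
 qed
 \<comment> \<open>The geometric series inverts \<open>u j\<close>, so the identity obtained after
   multiplication by \<open>u\<close> can be cancelled.\<close>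
 have unit: "Abs_fps (\<lambda>k. vx j ^ k) * u j = 1" for j
 proof (rule fps_ext)
  fix k show "(Abs_fps (\<lambda>k. vx j ^ k) * u j) $ k = 1 $ k"
   by (cases k) (simp_all add: u_def algebra_simps mult.assoc)
 qed
 have "fps_X * fps_deriv (G j) = S j * G j"
 proof (induction j)
  case 0
  have "G 0 = 1" by (rule fps_ext) (simp add: G_def)
  moreover have "S 0 = 0" by (rule fps_ext) (simp add: S_def psum_def)
  ultimately show ?case by simp
 next
  case (Suc j)
  let ?c = "fps_const (vx (Suc j))"
  have "fps_deriv (u (Suc j) * G (Suc j)) = u (Suc j) * fps_deriv (G (Suc j)) - ?c * G (Suc j)"
   by (simp add: u_def fps_deriv_mult algebra_simps)
  then have d: "u (Suc j) * fps_deriv (G (Suc j)) = fps_deriv (G j) + ?c * G (Suc j)" by (simp add: uG)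
  have "u (Suc j) * (fps_X * fps_deriv (G (Suc j))) = fps_X * (u (Suc j) * fps_deriv (G (Suc j)))"
   by (rule mult.left_commute)
  also have "... = fps_X * fps_deriv (G j) + ?c * fps_X * G (Suc j)"
   unfolding d distrib_left by (simp add: mult.assoc mult.left_commute)
  also have "... = S j * (u (Suc j) * G (Suc j)) + ?c * fps_X * G (Suc j)" by (simp add: Suc uG)
  also have "... = (u (Suc j) * S (Suc j)) * G (Suc j)" unfolding uS by (simp add: algebra_simps)
  finally have "Abs_fps (\<lambda>k. vx (Suc j) ^ k) * u (Suc j) * (fps_X * fps_deriv (G (Suc j)))
    = Abs_fps (\<lambda>k. vx (Suc j) ^ k) * u (Suc j) * (S (Suc j) * G (Suc j))" by (simp add: mult.assoc)
  then show ?case by (simp add: unit)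
 qed
 then have "(fps_X * fps_deriv (G j)) $ k = (S j * G j) $ k" by simp
 moreover have "(fps_X * fps_deriv (G j)) $ k = of_nat k * hsym j k" by (cases k) (simp_all add: G_def)
 ultimately show ?thesis by (simp add: fps_mult_nth S_def G_def)
qed

lemma of_nat_const: "(of_nat k :: cpoly) = sgl 0 (of_nat k)" by simp

text \<open>Newton's identity expresses k h_k through power sums, and k is invertible.\<close>

lemma hsym_in_ideal:
 assumes I: "ideal_of (polys {1..n}) I" and p: "!!i. i \<ge> 1 ==> psum n i \<in> I" and k: "k \<ge> 1"
 shows "hsym n k \<in> I"
proof -
 have "of_nat k * hsym n k \<in> I" unfolding newton_identity
 proof (rule ideal_of_sum[OF I])
  fix i
  have "(if i = 0 then 0 else psum n i) \<in> I" using p[of i] ideal_of_0[OF I] by simp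
  then show "(if i = 0 then 0 else psum n i) * hsym n (k - i) \<in> I" by (intro ideal_of_mult2[OF I] hsym_polys) simp
 qed
 then show ?thesis using k ideal_of_scale[OF I, of "of_nat k" "hsym n k"] unfolding of_nat_const by simp
qed

text \<open>The term i = k of Newton's identity is the power sum of degree k itself; the other terms
  contain power sums of smaller degree.\<close>

lemma psum_in_ideal:
 assumes I: "ideal_of (polys {1..n}) I" and h: "!!i. i \<ge> 1 ==> hsym n i \<in> I" and k: "k \<ge> 1"
 shows "psum n k \<in> I"
 using k
proof (induction k rule: less_induct)
 case (less k)
 let ?t = "\<lambda>i. (if i = 0 then 0 else psum n i) * hsym n (k - i)"
 have "of_nat k * hsym n k = (\<Sum>i\<le>k. ?t i)" by (simp only: newton_identity atLeast0AtMost)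
 also have "... = (\<Sum>i<k. ?t i) + ?t k" by (simp only: lessThan_Suc_atMost[symmetric] sum.lessThan_Suc)
 also have "?t k = psum n k" using less.prems by simp
 finally have "of_nat k * hsym n k = (\<Sum>i<k. ?t i) + psum n k" .
 then have "psum n k = of_nat k * hsym n k - (\<Sum>i<k. (if i = 0 then 0 else psum n i) * hsym n (k - i))" by simp
 also have "... \<in> I"
 proof (intro ideal_of_minus[OF I] ideal_of_sum[OF I])
  show "of_nat k * hsym n k \<in> I" using h[of k] less.prems
   unfolding of_nat_const by (intro ideal_of_mult[OF I polys_const]) simp
  fix i assume "i \<in> {..<k}"
  then have "(if i = 0 then 0 else psum n i) \<in> I" using less.IH[of i] ideal_of_0[OF I] by simp
  then show "?t i \<in> I" by (intro ideal_of_mult2[OF I] hsym_polys) simp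
 qed
 finally show ?case .
qed

definition frel :: "nat => nat => cpoly" where "frel n i = hsym i (n + 1 - i)"

text \<open>Dropping the last variable through h_k(x_1..x_i) = h_k(x_1..x_(i+1)) - x_(i+1)
  h_(k-1)(x_1..x_(i+1)) costs one degree. After j variables are dropped all degrees above j remain
  in the ideal, and \<open>frel\<close> sits at the lowest of them.\<close>

lemma frel_in_ideal:
 assumes I: "ideal_of (polys {1..n}) I" and h: "!!k. k \<ge> 1 ==> hsym n k \<in> I"
  and "i \<le> n"
 shows "frel n i \<in> I"
proof -
 have "\<forall>k\<ge>n + 1 - (n - j). hsym (n - j) k \<in> I" if "j \<le> n" for j using that
 proof (induction j)
  case 0
  then show ?case using h by auto
 next
  case (Suc j)
  show ?case
  proof (intro allI impI)
   fix k assume k: "k \<ge> n + 1 - (n - Suc j)"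
   with Suc.prems obtain k' where k': "k = Suc k'" by (cases k) auto
   have S: "Suc (n - Suc j) = n - j" using Suc.prems by simp
   have "hsym (n - Suc j) k = hsym (n - j) k - vx (n - j) * hsym (n - j) k'"
    using hsym_Suc_Suc[of "n - Suc j" k'] unfolding S k' by simp
   also have "... \<in> I" using Suc k k' by (intro ideal_of_minus[OF I] ideal_of_mult[OF I]) auto
   finally show "hsym (n - Suc j) k \<in> I" .
  qed
 qed
 from this[of "n - i"] assms(3) show ?thesis by (simp add: frel_def)
qed

text \<open>The reverse walk: variables are added one at a time. With j variables the lowest
  admissible degree n + 1 - j is that of \<open>frel n j\<close>, and the higher degrees follow from
  the recurrence.\<close>

lemma hsym_in_idl:
 assumes "k \<ge> 1" shows "hsym n k \<in> idl {1..n} (frel n) n"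
proof -
 have "\<forall>k\<ge>n + 1 - j. hsym j k \<in> idl {1..n} (frel n) n" if "j \<le> n" for j using that
 proof (induction j)
  case 0
  then show ?case by (auto intro!: idl_zero)
 next
  case (Suc j)
  show ?case
  proof (intro allI impI)
   fix k assume k: "k \<ge> n + 1 - Suc j"
   then show "hsym (Suc j) k \<in> idl {1..n} (frel n) n"
   proof (induction k rule: dec_induct)
    case base
    have "frel n (Suc j) \<in> idl {1..n} (frel n) n" using Suc.prems by (intro idl_gen) auto
    then show ?case unfolding frel_def[of n "Suc j"] .
   next
    case (step k)
    then show ?case unfolding hsym_Suc_Suc using Suc by (intro idl_add idl_mult) auto
   qed
  qed
 qed
 from this[of n] assms show ?thesis by simp
qed

section \<open>Symmetrised monomials\<close>

text \<open>The sum runs over permutations rather than over the orbit, so monomials with a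
  stabiliser occur with multiplicity. Products with power sums then need no case distinction, and in
  characteristic 0 the multiplicities are invertible.\<close>

definition orb :: "nat => (nat \<Rightarrow>\<^sub>0 nat) => cpoly" where
 "orb n m = (\<Sum>\<sigma> | \<sigma> permutes {1..n}. sgl (mkey \<sigma> m) 1)"

lemma lookup_map_key: "\<sigma> permutes S ==> lkp (mkey \<sigma> m) k = lkp m (\<sigma> k)" by (simp add: Poly_Mapping.map_key.rep_eq permutes_inj)

lemma orb_permute:
 assumes t: "t permutes {1..n}"
 shows "orb n (mkey t m) = orb n m"
proof -
 have "orb n m = (\<Sum>\<sigma> | \<sigma> permutes {1..n}. sgl (mkey (t \<circ> \<sigma>) m) 1)"
  unfolding orb_def by (rule setum_permutations_compose_left[OF t])
 also have "... = orb n (mkey t m)" unfolding orb_def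
 proof (intro sum.cong refl)
  fix \<sigma> assume s: "\<sigma> \<in> {\<sigma>. \<sigma> permutes {1..n}}"
  then have "t \<circ> \<sigma> permutes {1..n}" using permutes_compose[OF _ t] by blast
  then have "mkey (t \<circ> \<sigma>) m = mkey \<sigma> (mkey t m)" using s t by (intro poly_mapping_eqI) (simp add: lookup_map_key)
  then show "sgl (mkey (t \<circ> \<sigma>) m) (1::complex) = sgl (mkey \<sigma> (mkey t m)) 1" by simp
 qed
 finally show ?thesis by simp
qed

text \<open>For each permutation the power sum is reindexed by that permutation, so that its i-th
  summand becomes the image of the exponent added at \<sigma> i.\<close>

lemma orb_mult_psum:
 "orb n m * psum n b = (\<Sum>i\<in>{1..n}. orb n (m + sgl i b))"
proof -
 have "(\<Sum>i\<in>{1..n}. orb n (m + sgl i b)) =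
   (\<Sum>\<sigma> | \<sigma> permutes {1..n}. \<Sum>i\<in>{1..n}. sgl (mkey \<sigma> (m + sgl i b)) 1)"
  unfolding orb_def by (rule sum.swap)
 also have "... = (\<Sum>\<sigma> | \<sigma> permutes {1..n}. sgl (mkey \<sigma> m) 1 * psum n b)"
 proof (rule sum.cong[OF refl])
  fix \<sigma> assume "\<sigma> \<in> {\<sigma>. \<sigma> permutes {1..n}}"
  then have s: "\<sigma> permutes {1..n}" by simp
  have "(\<Sum>i\<in>{1..n}. sgl (mkey \<sigma> (m + sgl i b)) 1) =
    (\<Sum>i\<in>{1..n}. sgl (mkey \<sigma> (m + sgl (\<sigma> i) b)) (1::complex))"
   by (rule sum.permute[OF s, unfolded o_def])
  also have "... = (\<Sum>i\<in>{1..n}. sgl (mkey \<sigma> m) 1 * vx i ^ b)"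
  proof (rule sum.cong[OF refl])
   fix i
   have "mkey \<sigma> (m + sgl (\<sigma> i) b) = mkey \<sigma> m + sgl i b" using permutes_inj[OF s]
    by (intro poly_mapping_eqI) (auto simp: lookup_map_key[OF s] lookup_add lookup_single when_def inj_eq)
   then show "sgl (mkey \<sigma> (m + sgl (\<sigma> i) b)) (1::complex) = sgl (mkey \<sigma> m) 1 * vx i ^ b"
    by (simp add: vx_power mult_single)
  qed
  finally show "(\<Sum>i\<in>{1..n}. sgl (mkey \<sigma> (m + sgl i b)) 1) = sgl (mkey \<sigma> m) (1::complex) * psum n b"
   by (simp add: psum_def sum_distrib_left)
 qed
 finally show ?thesis by (simp add: orb_def sum_distrib_right)
qed

text \<open>Splitting off the power \<open>x\<^sub>i\<^sup>b\<close> of one variable, \<open>R(m') p\<^sub>b\<close> is a multiple of \<open>R(m)\<close> plus orbit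
 sums with fewer variables.\<close>

lemma orb_in_ideal:
 assumes I: "ideal_of (polys {1..n}) I" and p: "!!i. i \<ge> 1 ==> psum n i \<in> I"
 shows "m \<noteq> 0 ==> kys m \<subseteq> {1..n} ==> orb n m \<in> I"
proof (induction "card (kys m)" arbitrary: m rule: less_induct)
 case less
 then obtain i0 where i0: "i0 \<in> kys m" by (metis all_not_in_conv keys_eq_empty)
 define b where "b = lkp m i0"
 define m' where "m' = m - sgl i0 b"
 have b: "b \<ge> 1" using i0 by (simp add: b_def in_keys_iff Suc_le_eq)
 have m: "m = m' + sgl i0 b" unfolding m'_def b_def
  by (intro poly_mapping_eqI) (auto simp: lookup_add lookup_minus lookup_single when_def)
 have k': "kys m' = kys m - {i0}" unfolding m'_def b_def
  by (auto simp: in_keys_iff lookup_minus lookup_single when_def split: if_splits)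
 have sub: "kys m' \<subseteq> {1..n}" and i0n: "i0 \<in> {1..n}" using less.prems k' i0 by auto
 \<comment> \<open>For a position outside the support of \<open>m'\<close> the two exponent
   functions differ by the transposition of \<open>i\<close> and \<open>i0\<close>.\<close>
 have same: "orb n (m' + sgl i b) = orb n m" if i: "i \<in> {1..n} - kys m'" for i
 proof -
  let ?t = "Transposition.transpose i i0"
  have t: "?t permutes {1..n}" using i i0n by (intro permutes_swap_id) auto
  have "i \<notin> kys m'" "i0 \<notin> kys m'" using i k' by blast+
  then have z: "lkp m' i = 0" "lkp m' i0 = 0" by (simp_all add: in_keys_iff)
  have "mkey ?t m = m' + sgl i b"
  proof (rule poly_mapping_eqI)
   fix l
   consider "l = i" | "l = i0" "i \<noteq> i0" | "l \<noteq> i" "l \<noteq> i0" by blast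
   then show "lkp (mkey ?t m) l = lkp (m' + sgl i b) l" unfolding lookup_map_key[OF t] m lookup_add
    by cases (simp_all add: z lookup_single when_def)
  qed
  then show ?thesis using orb_permute[OF t, of m] by simp
 qed
 \<comment> \<open>Adding \<open>b\<close> at a position already in use keeps the support
   \<open>kys m'\<close>, which is smaller than that of \<open>m\<close> by the element
   \<open>i0\<close>.\<close>
 have fewer: "orb n (m' + sgl i b) \<in> I" if i: "i \<in> kys m'" for i
 proof (rule less.hyps)
  have "kys (m' + sgl i b) = kys m'" using i b by (auto simp: keys_add_nat)
  moreover have "kys m' \<subset> kys m" using i0 k' by blast
  ultimately show "card (kys (m' + sgl i b)) < card (kys m)" by (simp add: psubset_card_mono)
  show "m' + sgl i b \<noteq> 0" using \<open>kys (m' + sgl i b) = kys m'\<close> i by (metis empty_iff keys_zero)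
  show "kys (m' + sgl i b) \<subseteq> {1..n}" using \<open>kys (m' + sgl i b) = kys m'\<close> sub by simp
 qed
 have "orb n m' * psum n b = (\<Sum>i\<in>{1..n} - kys m'. orb n (m' + sgl i b)) + (\<Sum>i\<in>kys m'. orb n (m' + sgl i b))"
  unfolding orb_mult_psum by (rule sum.subset_diff) (use sub in auto)
 also have "(\<Sum>i\<in>{1..n} - kys m'. orb n (m' + sgl i b)) = of_nat (card ({1..n} - kys m')) * orb n m"
  by (simp add: same)
 finally have "of_nat (card ({1..n} - kys m')) * orb n m = orb n m' * psum n b - (\<Sum>i\<in>kys m'. orb n (m' + sgl i b))"
  by simp
 also have "... \<in> I"
 proof (intro ideal_of_minus[OF I] ideal_of_mult[OF I] ideal_of_sum[OF I] p b fewer)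
  show "orb n m' \<in> polys {1..n}" unfolding orb_def
  proof (rule polys_sum)
   fix \<sigma> assume "\<sigma> \<in> {\<sigma>. \<sigma> permutes {1..n}}"
   then have s: "\<sigma> permutes {1..n}" by simp
   show "sgl (mkey \<sigma> m') 1 \<in> polys {1..n}"
    using sub permutes_in_image[OF s] unfolding polys_def in_keys_iff subset_iff
    by (auto simp del: One_nat_def simp: lookup_map_key[OF s] in_keys_iff)
  qed
 qed
 finally have *: "of_nat (card ({1..n} - kys m')) * orb n m \<in> I" .
 \<comment> \<open>The position \<open>i0\<close> itself is free in \<open>m'\<close>, so the
   multiplicity of \<open>orb n m\<close> is positive.\<close>
 have "card ({1..n} - kys m') \<noteq> 0" using i0n k' by auto
 then have "of_nat (card ({1..n} - kys m')) \<noteq> (0::complex)" by (simp only: of_nat_eq_0_iff not_False_eq_True)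
 then show ?case using * unfolding of_nat_const by (rule ideal_of_scale[OF I])
qed

lemma cpoly_carrier: "carrier (cpoly_ring n) = polys {1..n}" by (simp add: cpoly_ring_def polys_def)

text \<open>A symmetric p equals each of its permuted forms; summing them over all permutations
  writes n! p as a combination of the symmetrised monomials, with the coefficients of p.\<close>

lemma symmetric_in_ideal:
 assumes I: "ideal_of (polys {1..n}) I" and ps: "!!i. i \<ge> 1 ==> psum n i \<in> I"
  and p: "p \<in> symmetric_polys n" and p0: "lkp p 0 = 0"
 shows "p \<in> I"
proof -
 let ?P = "{\<sigma>. \<sigma> permutes {1..n}}"
 have sym: "lkp p (mkey \<sigma> m) = lkp p m" if "\<sigma> permutes {1..n}" for \<sigma> m
  using p that by (auto simp: symmetric_polys_def)
 have one: "(\<Sum>m\<in>kys p. sgl (mkey \<sigma> m) (lkp p m)) = p" if s: "\<sigma> permutes {1..n}" for \<sigma>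
 proof -
  have inv: "mkey \<sigma> (mkey (inv_into UNIV \<sigma>) m) = m"
   "mkey (inv_into UNIV \<sigma>) (mkey \<sigma> m) = m" for m :: "nat \<Rightarrow>\<^sub>0 nat"
   using s by (auto intro!: poly_mapping_eqI simp: lookup_map_key[OF s] lookup_map_key[OF permutes_inv[OF s]] permutes_inverses)
  have "bij_betw (mkey \<sigma>) (kys p) (kys p)" by (rule bij_betw_byWitness[where f' = "mkey (inv_into UNIV \<sigma>)"])
    (auto simp: inv in_keys_iff sym[OF s] sym[OF permutes_inv[OF s]])
  then have "(\<Sum>m\<in>kys p. sgl (mkey \<sigma> m) (lkp p (mkey \<sigma> m))) = (\<Sum>m\<in>kys p. sgl m (lkp p m))"
   by (rule sum.reindex_bij_betw)
  then show ?thesis by (simp add: sym[OF s] poly_mapping_sum_single)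
 qed
 have "of_nat (card ?P) * p = (\<Sum>\<sigma>\<in>?P. \<Sum>m\<in>kys p. sgl (mkey \<sigma> m) (lkp p m))" using one by simp
 also have "... = (\<Sum>m\<in>kys p. sgl 0 (lkp p m) * orb n m)"
  by (subst sum.swap) (simp add: orb_def sum_distrib_left mult_single)
 also have "... \<in> I"
 proof (intro ideal_of_sum[OF I] ideal_of_mult[OF I] orb_in_ideal[OF I ps])
  fix m assume m: "m \<in> kys p"
  then show "m \<noteq> 0" using p0 by (auto simp: in_keys_iff)
  show "kys m \<subseteq> {1..n}" using p m by (auto simp: symmetric_polys_def cpoly_carrier polys_def)
 qed auto
 finally have *: "of_nat (card ?P) * p \<in> I" .
 have "of_nat (card ?P) \<noteq> (0::complex)" by (simp add: card_permutations)
 then show ?thesis using * unfolding of_nat_const by (rule ideal_of_scale[OF I])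
qed

lemma psum_symmetric: "psum n k \<in> symmetric_polys n" unfolding symmetric_polys_def
proof safe
 show "psum n k \<in> carrier (cpoly_ring n)" unfolding cpoly_carrier psum_def by (intro polys_sum) auto
 fix \<sigma> m assume s: "\<sigma> permutes {1..n}"
 have eq: "(sgl i k = mkey \<sigma> m) = (sgl (\<sigma> i) k = m)" for i
 proof -
  have "mkey \<sigma> (sgl (\<sigma> i) k) = sgl i k" using permutes_inj[OF s]
   by (intro poly_mapping_eqI) (auto simp: lookup_map_key[OF s] lookup_single when_def inj_eq)
  moreover have "mkey \<sigma> a = mkey \<sigma> c ==> a = c" for a c :: "nat \<Rightarrow>\<^sub>0 nat"
   by (rule poly_mapping_eqI) (metis lookup_map_key[OF s] permutes_inverses(1)[OF s])
  ultimately show ?thesis by metis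
 qed
 have "lkp (psum n k) (mkey \<sigma> m) = (\<Sum>i\<in>{1..n}. lkp (vx (\<sigma> i) ^ k) m)"
  unfolding psum_def lookup_sum vx_power lookup_single by (simp add: eq)
 also have "... = lkp (psum n k) m"
  unfolding psum_def lookup_sum by (rule sum.permute[OF s, symmetric, unfolded o_def])
 finally show "lkp (psum n k) (mkey \<sigma> m) = lkp (psum n k) m" .
qed

lemma cring_cpoly_ring: "cring (cpoly_ring n)"
proof (rule cringI)
 show "abelian_group (cpoly_ring n)"
 proof (rule abelian_groupI)
  fix x assume "x \<in> carrier (cpoly_ring n)"
  then show "\<exists>y\<in>carrier (cpoly_ring n). y \<oplus>\<^bsub>cpoly_ring n\<^esub> x = \<zero>\<^bsub>cpoly_ring n\<^esub>"
   unfolding cpoly_carrier by (intro bexI[of _ "- x"]) (auto simp: cpoly_ring_def)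
 qed (unfold cpoly_carrier, auto simp: cpoly_ring_def)
 show "Group.comm_monoid (cpoly_ring n)" by (rule comm_monoidI; unfold cpoly_carrier) (auto simp: cpoly_ring_def)
qed (auto simp: cpoly_ring_def distrib_right)

text \<open>Symmetric polynomials without constant term reduce to power sums, these to the h_k, and
  these to the \<open>frel n i\<close>. Conversely the \<open>frel n i\<close> come from the h_k,
  these from the power sums, which belong to the given generators.\<close>

lemma coinv_ideal_eq: "coinv_ideal n = idl {1..n} (frel n) n"
proof
 interpret R: cring "cpoly_ring n" by (rule cring_cpoly_ring)
 let ?S = "{p \<in> symmetric_polys n. lkp p 0 = 0}"
 have S: "?S \<subseteq> carrier (cpoly_ring n)" by (auto simp: symmetric_polys_def)
 have idl_poly: "idl {1..n} (frel n) n \<subseteq> polys {1..n}" by (intro idl_polys) (auto simp: frel_def intro!: hsym_polys)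
 have "ideal (idl {1..n} (frel n) n) (cpoly_ring n)"
 proof (rule idealI)
  show "ring (cpoly_ring n)" by unfold_locales
  show "subgroup (idl {1..n} (frel n) n) (add_monoid (cpoly_ring n))"
  proof (rule subgroup.intro)
   fix x assume x: "x \<in> idl {1..n} (frel n) n"
   then have "x \<in> carrier (cpoly_ring n)" using idl_poly by (auto simp: cpoly_carrier)
   then have "\<ominus>\<^bsub>cpoly_ring n\<^esub> x = - x"
    by (intro R.minus_equality) (auto simp: cpoly_carrier, auto simp: cpoly_ring_def)
   then show "inv\<^bsub>add_monoid (cpoly_ring n)\<^esub> x \<in> idl {1..n} (frel n) n"
    using idl_uminus[OF x] by (simp add: a_inv_def)
  qed (use idl_poly in \<open>auto simp: cpoly_carrier, auto simp: cpoly_ring_def intro: idl_zero idl_add\<close>)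
 qed (auto simp: cpoly_carrier, auto simp: cpoly_ring_def intro: idl_mult idl_mult2)
 then show "coinv_ideal n \<subseteq> idl {1..n} (frel n) n" unfolding coinv_ideal_def
 proof (rule R.genideal_minimal)
  show "?S \<subseteq> idl {1..n} (frel n) n"
   using symmetric_in_ideal[OF idl_ideal psum_in_ideal[OF idl_ideal hsym_in_idl]] by blast
 qed
 have ci: "ideal (coinv_ideal n) (cpoly_ring n)" unfolding coinv_ideal_def by (rule R.genideal_ideal[OF S])
 interpret I: ideal "coinv_ideal n" "cpoly_ring n" by (rule ci)
 have I: "ideal_of (polys {1..n}) (coinv_ideal n)" unfolding ideal_of_def
  using I.I_l_closed additive_subgroup.zero_closed[OF ideal.axioms(1)[OF ci]]
   additive_subgroup.a_closed[OF ideal.axioms(1)[OF ci]]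
  unfolding cpoly_carrier by (simp add: cpoly_ring_def)
 have "psum n i \<in> coinv_ideal n" if "i \<ge> 1" for i
 proof -
  have "sgl j i \<noteq> 0" for j :: nat using that by (metis lookup_single_eq lookup_zero not_one_le_zero)
  then have "lkp (psum n i) 0 = 0" unfolding psum_def lookup_sum vx_power by (simp add: lookup_single_not_eq)
  then show ?thesis using R.genideal_self[OF S] psum_symmetric[of n i] unfolding coinv_ideal_def by blast
 qed
 then show "idl {1..n} (frel n) n \<subseteq> coinv_ideal n"
  by (intro idl_subset I frel_in_ideal[OF I] hsym_in_ideal[OF I]) auto
qed

lemma monic_in_mono: "monic_in j e V f ==> V \<subseteq> W ==> monic_in j e W f"
 unfolding monic_in_def using polys_mono by blast

lemma frel_polys: "{1..i} \<subseteq> V ==> frel n i \<in> polys V" by (simp add: frel_def hsym_polys)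

lemma frel_homog: "homog (n + 1 - i) (frel n i)" unfolding frel_def by (rule hsym_homog)

lemma frel_monic: "Suc k \<in> V ==> {1..k} \<subseteq> V ==> monic_in (Suc k) (n - k) (V - {Suc k}) (frel n (Suc k))"
 using hsym_monic[of k "n - k"] by (auto simp: frel_def intro: monic_in_mono)

section \<open>Artin monomials and elimination of the last variable\<close>

definition artin :: "nat => nat => (nat \<Rightarrow>\<^sub>0 nat) set" where
 "artin n k = {m. kys m \<subseteq> {1..k} \<and> (\<forall>i\<in>{1..k}. lkp m i < n + 1 - i)}"

lemma atMost_Suc_diff: "{1..Suc k} - {Suc k} = {1..k}" by auto

text \<open>Divide by \<open>frel n (Suc k)\<close> in its top variable, then reduce every
  coefficient of the remainder by induction; the coefficients involve the first k variables
  only.\<close>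

lemma artin_exists:
 "k \<le> n ==> p \<in> polys {1..k} ==> \<exists>r. kys r \<subseteq> artin n k \<and> p - r \<in> idl {1..k} (frel n) k"
proof (induction k arbitrary: p)
 case 0
 have "kys p \<subseteq> artin n 0"
 proof
  fix m assume "m \<in> kys p"
  then have "kys m \<subseteq> {}" using 0 by (auto simp: polys_def)
  then show "m \<in> artin n 0" by (auto simp: artin_def)
 qed
 then show ?case by (intro exI[of _ p]) (auto intro: idl_zero)
next
 case (Suc k)
 let ?V = "{1..Suc k}" and ?f = "frel n (Suc k)"
 have "monic_in (Suc k) (n - k) (?V - {Suc k}) ?f" by (intro frel_monic) auto
 from monic_division[OF _ this Suc.prems(2)]
 obtain r q where r: "r \<in> polys ?V" "!!l. l \<ge> n - k ==> coef (Suc k) l r = 0" and q: "q \<in> polys ?V" "p - r = ?f * q"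
  by auto
 have "\<exists>s. kys s \<subseteq> artin n k \<and> coef (Suc k) l r - s \<in> idl {1..k} (frel n) k" for l
  using Suc.IH[of "coef (Suc k) l r"] Suc.prems(1) coef_polys[OF r(1), of "Suc k" l] unfolding atMost_Suc_diff by simp
 then obtain s where s: "!!l. kys (s l) \<subseteq> artin n k" "!!l. coef (Suc k) l r - s l \<in> idl {1..k} (frel n) k" by metis
 define t where "t = (\<Sum>l<n - k. s l * vx (Suc k) ^ l)"
 have "kys t \<subseteq> (\<Union>l\<in>{..<n - k}. kys (s l * vx (Suc k) ^ l))" unfolding t_def by (rule keys_sum)
 also have "... \<subseteq> artin n (Suc k)"
 proof (rule UN_least)
  fix l assume l: "l \<in> {..<n - k}"
  show "kys (s l * vx (Suc k) ^ l) \<subseteq> artin n (Suc k)"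
  proof
   fix m assume "m \<in> kys (s l * vx (Suc k) ^ l)"
   then obtain a where a: "a \<in> kys (s l)" "m = a + sgl (Suc k) l"
    using keys_mult[of "s l" "vx (Suc k) ^ l"] unfolding vx_power by auto
   then have "a \<in> artin n k" using s(1) by blast
   then have "kys a \<subseteq> {1..k}" "!!i. i \<in> {1..k} ==> lkp a i < n + 1 - i" by (auto simp: artin_def)
   moreover have "lkp a (Suc k) = 0" using calculation(1) by (metis atLeastAtMost_iff in_keys_iff not_less_eq_eq order_refl subsetD)
   ultimately show "m \<in> artin n (Suc k)" using l unfolding a(2) artin_def
    by (auto simp: keys_add_nat lookup_add lookup_single when_def le_Suc_eq split: if_splits)
  qed
 qed
 finally have "kys t \<subseteq> artin n (Suc k)" .
 moreover have "p - t \<in> idl ?V (frel n) (Suc k)"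
 proof -
  have "r = (\<Sum>l<n - k. coef (Suc k) l r * vx (Suc k) ^ l)"
   using r(2) by (intro coef_expand) (auto simp: not_less[symmetric])
  then have "r - t = (\<Sum>l<n - k. (coef (Suc k) l r - s l) * vx (Suc k) ^ l)"
   by (simp add: t_def sum_subtractf left_diff_distrib)
  also have "... \<in> idl ?V (frel n) (Suc k)" using s(2) idl_mono[of k "Suc k" "{1..k}" ?V "frel n"]
   by (intro idl_sum idl_mult2) auto
  finally have "r - t \<in> idl ?V (frel n) (Suc k)" .
  moreover have "?f * q \<in> idl ?V (frel n) (Suc k)" using q by (intro idl_mult2 idl_gen) auto
  ultimately have "?f * q + (r - t) \<in> idl ?V (frel n) (Suc k)" by (rule idl_add[rotated])
  then show ?thesis unfolding q(2)[symmetric] by simp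
 qed
 ultimately show ?case by blast
qed

text \<open>The exponent bound for the top variable lets \<open>idl_reduce\<close> discard
  \<open>frel n (Suc k)\<close>. The remaining relations are free of that variable, so each
  coefficient lies in the smaller ideal and vanishes by induction.\<close>

lemma artin_unique:
 "k \<le> n ==> kys r \<subseteq> artin n k ==> r \<in> idl {1..k} (frel n) k ==> r = 0"
proof (induction k arbitrary: r)
 case 0
 then show ?case by (auto simp: idl_def)
next
 case (Suc k)
 let ?V = "{1..Suc k}"
 have supp: "kys (coef (Suc k) l r) \<subseteq> {m \<in> artin n k. l < n - k}" for l
 proof
  fix m assume "m \<in> kys (coef (Suc k) l r)"
  then obtain a where a: "a \<in> kys r" "lkp a (Suc k) = l" "m = a - sgl (Suc k) l"
   using keys_mono_ext[of "\<lambda>m. lkp m (Suc k) = l" "\<lambda>m. m - sgl (Suc k) l" r] unfolding coef_def by blast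
  have am: "a \<in> artin n (Suc k)" using a(1) Suc.prems(2) by blast
  then have "\<forall>i\<in>{1..Suc k}. lkp a i < n + 1 - i" by (simp add: artin_def)
  then have "lkp a (Suc k) < n + 1 - Suc k" by (rule bspec) simp
  then have "l < n - k" using a(2) by simp
  moreover have lm: "lkp m i = (if i = Suc k then 0 else lkp a i)" for i
   using a by (auto simp: lookup_minus lookup_single when_def)
  have "kys m \<subseteq> {1..k}"
  proof
   fix i assume "i \<in> kys m"
   then have "i \<noteq> Suc k" "i \<in> kys a" by (auto simp: in_keys_iff lm split: if_splits)
   then show "i \<in> {1..k}" using am by (auto simp: artin_def le_Suc_eq subset_iff)
  qed
  moreover have "lkp m i < n + 1 - i" if "i \<in> {1..k}" for i using am that unfolding artin_def by (auto simp: lm)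
  ultimately show "m \<in> {m \<in> artin n k. l < n - k}" by (auto simp: artin_def)
 qed
 have "r \<in> idl ?V (frel n) k"
 proof (rule idl_reduce[OF _ _ _ frel_monic Suc.prems(3)])
  show "frel n i \<in> polys {1..k}" if "i \<in> {1..k}" for i using that by (intro frel_polys) auto
  show "coef (Suc k) l r = 0" if "l \<ge> n - k" for l using supp[of l] that by (auto simp flip: keys_eq_empty)
 qed auto
 then have "coef (Suc k) l r \<in> idl {1..k} (frel n) k" for l
  using idl_coef[of k "frel n" "{1..k}" "Suc k" r ?V l] frel_polys[of _ "{1..k}" n]
  unfolding atMost_Suc_diff by auto
 then have "coef (Suc k) l r = 0" for l using Suc.IH[of "coef (Suc k) l r"] supp[of l] Suc.prems(1) by auto
 then show ?case using coef_expand[of "{}" "Suc k" r] by simp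
qed

text \<open>\<open>frel n n\<close> is linear and monic in x_n, so the remainder of the division by
  it does not contain x_n.\<close>

lemma eliminate_last:
 assumes n: "n \<ge> 1" and p: "p \<in> polys {1..n}"
 shows "\<exists>q\<in>polys {1..n-1}. p - q \<in> idl {1..n} (frel n) n"
proof -
 obtain N where N: "n = Suc N" using n by (cases n) auto
 have nV: "n \<in> {1..n}" using n by simp
 have "monic_in (Suc N) (n - N) ({1..n} - {Suc N}) (frel n (Suc N))" by (rule frel_monic) (simp_all add: N)
 then have m: "monic_in n 1 ({1..n} - {n}) (frel n n)" using N by simp
 obtain r q where r: "r \<in> polys {1..n}" "!!l. l \<ge> 1 ==> coef n l r = 0" and q: "q \<in> polys {1..n}" "p - r = frel n n * q"
  using monic_division[OF nV m p] by blast
 have "{l. coef n l r \<noteq> 0} \<subseteq> {0}"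
 proof (rule subsetI, rule ccontr)
  fix l assume l: "l \<in> {l. coef n l r \<noteq> 0}" "l \<notin> {0}"
  then have "l \<ge> 1" by simp
  with r(2) l(1) show False by blast
 qed
 then have "r = (\<Sum>l\<in>{0}. coef n l r * vx n ^ l)" by (rule coef_expand[of "{0}" n r, rotated]) simp
 also have "... = coef n 0 r" by simp
 finally have r0: "coef n 0 r = r" by (rule sym)
 have "coef n 0 r \<in> polys ({1..n} - {n})" by (rule coef_polys[OF r(1)])
 moreover have "{1..n} - {n} = {1..n-1}" by auto
 ultimately have "r \<in> polys {1..n-1}" unfolding r0 by (simp only:)
 moreover have "p - r \<in> idl {1..n} (frel n) n" unfolding q(2) by (rule idl_mult2[OF q(1) idl_gen[OF nV]])
 ultimately show ?thesis by blast
qed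

lemma eliminate_last_homog:
 assumes n: "n \<ge> 1" and p: "p \<in> polys {1..n}" "homog d p"
 shows "\<exists>q\<in>polys {1..n-1}. homog d q \<and> p - q \<in> idl {1..n} (frel n) n"
proof -
 obtain q where q: "q \<in> polys {1..n-1}" "p - q \<in> idl {1..n} (frel n) n" using eliminate_last[OF n p(1)] by blast
 have "gcomp d (p - q) \<in> idl {1..n} (frel n) n" using idl_gcomp[OF frel_homog q(2)] .
 then show ?thesis using q(1) p(2) by (intro bexI[of _ "gcomp d q"]) (auto simp: gcomp_minus gcomp_homog)
qed

text \<open>Elimination creates no further relations: a polynomial free of x_n has degree below 1 in
  x_n, so \<open>idl_reduce\<close> removes \<open>frel n n\<close>, and taking the 0-th coefficient
  removes x_n from the cofactors.\<close>

lemma eliminate_last_kernel: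
 assumes n: "n \<ge> 1" and p: "p \<in> polys {1..n-1}" "p \<in> idl {1..n} (frel n) n"
 shows "p \<in> idl {1..n-1} (frel n) (n-1)"
proof -
 obtain N where N: "n = Suc N" using n by (cases n) auto
 have nN: "n \<notin> {1..n-1}" using n by auto
 have fr: "frel n i \<in> polys {1..N}" if "i \<in> {1..N}" for i using that by (intro frel_polys) auto
 have "p \<in> idl {1..n} (frel n) N"
 proof (rule idl_reduce[of N "frel n" "{1..N}" n _ 1])
  have "monic_in (Suc N) (n - N) ({1..n} - {Suc N}) (frel n (Suc N))" by (rule frel_monic) (simp_all add: N)
  then show "monic_in n 1 ({1..n} - {n}) (frel n (Suc N))" using N by simp
  show "coef n l p = 0" if "1 \<le> l" for l using coef_free[OF p(1) nN] that by simp
  show "n \<notin> {1..N}" "n \<in> {1..n}" using N by simp_all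
  show "p \<in> idl {1..n} (frel n) (Suc N)" using p(2) N by simp
 qed (rule fr)
 moreover have "n \<notin> {1..N}" using N by simp
 ultimately have "coef n 0 p \<in> idl ({1..n} - {n}) (frel n) N"
  using idl_coef[of N "frel n" "{1..N}" n p "{1..n}" 0] fr by blast
 moreover have "{1..n} - {n} = {1..N}" using N by auto
 ultimately show ?thesis using coef_free[OF p(1) nN, of 0] N by simp
qed

lemma frel_pos_degree: "i \<in> {1..n} ==> lkp (frel n i * q) 0 = 0"
proof -
 assume i: "i \<in> {1..n}"
 have "0 \<notin> kys (frel n i * q)"
 proof
  assume "0 \<in> kys (frel n i * q)"
  then obtain a b where "0 = a + b" "a \<in> kys (frel n i)" using keys_mult[of "frel n i" q] by blast
  moreover have "mdeg a = n + 1 - i" using frel_homog[of n i] calculation(2) by (auto simp: homog_def)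
  ultimately have "n + 1 - i = 0" using mdeg_add[of a b] by simp
  then show False using i by auto
 qed
 then show ?thesis by (simp add: in_keys_iff)
qed

lemma idl_const_0: "k \<le> n ==> p \<in> idl V (frel n) k ==> lkp p 0 = 0"
 unfolding idl_def by (auto simp: lookup_sum frel_pos_degree intro!: sum.neutral)

section \<open>The coinvariant algebra\<close>

abbreviation pn :: "nat => cpoly set" where "pn n \<equiv> polys {1..n}"

definition cl :: "nat => cpoly => cpoly set" where "cl n p = coinv_ideal n +>\<^bsub>cpoly_ring n\<^esub> p"

lemma cl_eq: "cl n p = (\<lambda>i. i + p) ` coinv_ideal n" by (auto simp: cl_def a_r_coset_def r_coset_def cpoly_ring_def)

lemma ideal_coinv: "ideal (coinv_ideal n) (cpoly_ring n)"
proof -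
 interpret R: cring "cpoly_ring n" by (rule cring_cpoly_ring)
 show ?thesis unfolding coinv_ideal_def by (rule R.genideal_ideal) (auto simp: symmetric_polys_def)
qed

lemma ideal_of_coinv: "ideal_of (pn n) (coinv_ideal n)" unfolding coinv_ideal_eq by (rule idl_ideal)

lemma cl_eq_iff: "cl n p = cl n q \<longleftrightarrow> p - q \<in> coinv_ideal n"
proof
 assume "cl n p = cl n q"
 then have "0 + p \<in> (\<lambda>i. i + q) ` coinv_ideal n" unfolding cl_eq using ideal_of_0[OF ideal_of_coinv] by blast
 then show "p - q \<in> coinv_ideal n" by auto
next
 assume pq: "p - q \<in> coinv_ideal n"
 have sub: "cl n p \<subseteq> cl n q" if "p - q \<in> coinv_ideal n" for p q
 proof
  fix x assume "x \<in> cl n p"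
  then obtain i where i: "i \<in> coinv_ideal n" "x = i + p" by (auto simp: cl_eq)
  then have "x = (i + (p - q)) + q" "i + (p - q) \<in> coinv_ideal n" using ideal_of_add[OF ideal_of_coinv] that by auto
  then show "x \<in> cl n q" unfolding cl_eq by blast
 qed
 have "q - p \<in> coinv_ideal n" using ideal_of_uminus[OF ideal_of_coinv pq] by simp
 then show "cl n p = cl n q" using sub pq by blast
qed

lemma
 shows H_carrier: "carrier (CA n) = cl n ` pn n"
  and H_zero: "\<zero>\<^bsub>CA n\<^esub> = cl n 0"
  and H_one: "\<one>\<^bsub>CA n\<^esub> = cl n 1"
  and H_add: "p \<in> pn n ==> q \<in> pn n ==> cl n p \<oplus>\<^bsub>CA n\<^esub> cl n q = cl n (p + q)"
  and H_mult: "p \<in> pn n ==> q \<in> pn n ==> cl n p \<otimes>\<^bsub>CA n\<^esub> cl n q = cl n (p * q)"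
  and H_rpart: "rpart (CA n) d = cl n ` poly_part n d"
proof -
 interpret I: ideal "coinv_ideal n" "cpoly_ring n" by (rule ideal_coinv)
 note d = coinv_algebra_def FactRing_def ring.defs gring.defs
 show "carrier (CA n) = cl n ` pn n" by (auto simp: d A_RCOSETS_def' cl_def cpoly_carrier)
 show "\<zero>\<^bsub>CA n\<^esub> = cl n 0" by (simp add: d cl_eq)
 show "\<one>\<^bsub>CA n\<^esub> = cl n 1" by (simp add: d cl_def) (simp add: cpoly_ring_def)
 show "rpart (CA n) d = cl n ` poly_part n d" by (simp add: d cl_def)
 assume pq: "p \<in> pn n" "q \<in> pn n"
 show "cl n p \<oplus>\<^bsub>CA n\<^esub> cl n q = cl n (p + q)"
  using I.a_rcos_sum[of p q] pq by (simp add: d cl_def cpoly_carrier) (simp add: cpoly_ring_def)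
 show "cl n p \<otimes>\<^bsub>CA n\<^esub> cl n q = cl n (p * q)"
  using I.rcoset_mult_add[of p q] pq by (simp add: d cl_def cpoly_carrier) (simp add: cpoly_ring_def)
qed

lemma H_cring: "cring (CA n)"
proof (rule cringI)
 show "abelian_group (CA n)"
 proof (rule abelian_groupI)
  fix x assume "x \<in> carrier (CA n)"
  then obtain p where p: "p \<in> pn n" "x = cl n p" by (auto simp: H_carrier)
  then show "\<exists>y\<in>carrier (CA n). y \<oplus>\<^bsub>CA n\<^esub> x = \<zero>\<^bsub>CA n\<^esub>"
   by (intro bexI[of _ "cl n (- p)"]) (auto simp: H_carrier H_add H_zero)
 qed (auto simp: H_carrier H_zero H_add ac_simps)
 show "Group.comm_monoid (CA n)" by (rule comm_monoidI) (auto simp: H_carrier H_one H_mult ac_simps)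
qed (auto simp: H_carrier H_mult H_add distrib_right)

lemma poly_part_eq: "poly_part n d = {p \<in> pn n. \<forall>m\<in>kys p. int (2 * mdeg m) = d}"
 by (simp add: poly_part_def cpoly_carrier mdeg_def)

lemma coinv_scalar_cl: "scl n c = cl n (sgl 0 c)" by (simp add: coinv_scalar_def cl_def)

text \<open>The ideal contains no constant terms, so all representatives share the constant
  coefficient.\<close>

lemma aug_cl: "aug (cl n p) = lkp p 0"
proof -
 have "lkp i 0 = 0" if "i \<in> coinv_ideal n" for i using that idl_const_0[of n n] unfolding coinv_ideal_eq by blast
 then have 1: "lkp q 0 = lkp p 0" if "q \<in> cl n p" for q using that unfolding cl_eq by (auto simp: lookup_add)
 have 2: "p \<in> cl n p" unfolding cl_eq using ideal_of_0[OF ideal_of_coinv] by (rule image_eqI[rotated]) simp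
 show ?thesis unfolding aug_def
 proof (rule the_equality)
  show "\<forall>q\<in>cl n p. lkp q 0 = lkp p 0" using 1 by blast
  show "c = lkp p 0" if "\<forall>q\<in>cl n p. lkp q 0 = c" for c using bspec[OF that 2] by (rule sym)
 qed
qed

text \<open>The presentation by n - 1 variables and n - 1 relations on which the Koszul-Tate complex
  is built.\<close>

lemma cl_small:
 assumes "n \<ge> 1"
 shows H_carrier_small: "carrier (CA n) = cl n ` pn (n-1)"
  and cl_zero_small: "p \<in> pn (n-1) ==> cl n p = cl n 0 \<longleftrightarrow> p \<in> idl {1..n-1} (frel n) (n-1)"
proof -
 have sub: "pn (n-1) \<subseteq> pn n" using polys_mono[of "{1..n-1}" "{1..n}"] by auto
 have "cl n p \<in> cl n ` pn (n-1)" if p: "p \<in> pn n" for p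
 proof -
  obtain q where q: "q \<in> pn (n-1)" "p - q \<in> idl {1..n} (frel n) n" using eliminate_last[OF assms p] by blast
  then have "cl n p = cl n q" by (simp only: cl_eq_iff coinv_ideal_eq)
  then show ?thesis using q(1) by (rule image_eqI)
 qed
 then show "carrier (CA n) = cl n ` pn (n-1)" using sub unfolding H_carrier by blast
 assume p: "p \<in> pn (n-1)"
 have "idl {1..n-1} (frel n) (n-1) \<subseteq> idl {1..n} (frel n) n" by (rule idl_mono) auto
 then show "cl n p = cl n 0 \<longleftrightarrow> p \<in> idl {1..n-1} (frel n) (n-1)"
  using eliminate_last_kernel[OF assms p] unfolding cl_eq_iff coinv_ideal_eq diff_zero by blast
qed

lemma H_rpart_small:
 assumes "n \<ge> 1"
 shows "rpart (CA n) (2 * int d) = cl n ` {p \<in> pn (n-1). homog d p}"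
  and "(!!d. i \<noteq> 2 * int d) ==> rpart (CA n) i = {cl n 0}"
proof -
 have sub: "pn (n-1) \<subseteq> pn n" using polys_mono[of "{1..n-1}" "{1..n}"] by auto
 have "cl n p \<in> cl n ` {p \<in> pn (n-1). homog d p}" if p: "p \<in> pn n" "homog d p" for p
 proof -
  obtain q where q: "q \<in> pn (n-1)" "homog d q" "p - q \<in> idl {1..n} (frel n) n"
   using eliminate_last_homog[OF assms p] by blast
  then have "cl n p = cl n q" by (simp only: cl_eq_iff coinv_ideal_eq)
  then show ?thesis using q by blast
 qed
 then show "rpart (CA n) (2 * int d) = cl n ` {p \<in> pn (n-1). homog d p}"
 proof -
  have "poly_part n (2 * int d) = {p \<in> pn n. homog d p}" by (auto simp: poly_part_eq homog_def)
  moreover assume "!!p. p \<in> pn n ==> homog d p ==> cl n p \<in> cl n ` {p \<in> pn (n-1). homog d p}"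
  ultimately show ?thesis using sub unfolding H_rpart by blast
 qed
 assume i: "!!d. i \<noteq> 2 * int d"
 have "poly_part n i = {0}"
 proof -
  have "p = 0" if "p \<in> poly_part n i" for p
  proof -
   have "kys p = {}"
   proof (rule ccontr)
    assume "kys p \<noteq> {}"
    then obtain m where "m \<in> kys p" by blast
    then have "i = 2 * int (mdeg m)" using that by (auto simp: poly_part_eq)
    then show False using i by blast
   qed
   then show ?thesis by simp
  qed
  then show ?thesis by (auto simp: poly_part_eq)
 qed
 then show "rpart (CA n) i = {cl n 0}" by (simp add: H_rpart)
qed

text \<open>The classes of polynomials without monomials of degree below \<open>s\<close>, i.e. the \<open>s\<close>-th power of
 the augmentation ideal.\<close>

definition Hge :: "nat => nat => cpoly set set" where
 "Hge n s = cl n ` {p \<in> pn n. \<forall>m\<in>kys p. s \<le> mdeg m}"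

lemma Hge_0: "Hge n 0 = carrier (CA n)" by (simp add: Hge_def H_carrier)

lemma Hge_sub: "Hge n s \<subseteq> carrier (CA n)" by (auto simp: Hge_def H_carrier)

lemma Hge_zero: "\<zero>\<^bsub>CA n\<^esub> \<in> Hge n s" unfolding Hge_def H_zero by (intro imageI) auto

lemma Hge_add: "x \<in> Hge n s ==> y \<in> Hge n s ==> x \<oplus>\<^bsub>CA n\<^esub> y \<in> Hge n s"
proof -
 assume "x \<in> Hge n s" "y \<in> Hge n s"
 then obtain p q where pq: "x = cl n p" "y = cl n q" "p \<in> pn n" "q \<in> pn n"
  "\<forall>m\<in>kys p. s \<le> mdeg m" "\<forall>m\<in>kys q. s \<le> mdeg m" by (auto simp: Hge_def)
 then have "\<forall>m\<in>kys (p + q). s \<le> mdeg m" using keys_add[of p q] by blast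
 then show ?thesis unfolding Hge_def using pq by (auto simp: H_add)
qed

lemma Hge_mult: "x \<in> Hge n s ==> y \<in> Hge n t ==> x \<otimes>\<^bsub>CA n\<^esub> y \<in> Hge n (s + t)"
proof -
 assume "x \<in> Hge n s" "y \<in> Hge n t"
 then obtain p q where pq: "x = cl n p" "y = cl n q" "p \<in> pn n" "q \<in> pn n"
  "\<forall>m\<in>kys p. s \<le> mdeg m" "\<forall>m\<in>kys q. t \<le> mdeg m" by (auto simp: Hge_def)
 then have "\<forall>m\<in>kys (p * q). s + t \<le> mdeg m" using keys_mult[of p q] by (force simp: mdeg_add add_mono)
 then show ?thesis unfolding Hge_def using pq by (auto simp: H_mult)
qed

lemma Hge_1: "x \<in> carrier (CA n) ==> x \<in> Hge n 1 \<longleftrightarrow> aug x = 0"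
proof -
 have key: "lkp p 0 = 0 \<longleftrightarrow> (\<forall>m\<in>kys p. 1 \<le> mdeg m)" for p :: cpoly
 proof -
  have "(\<forall>m\<in>kys p. 1 \<le> mdeg m) \<longleftrightarrow> 0 \<notin> kys p" by (auto simp: Suc_le_eq gr0_conv_Suc) (metis mdeg_eq_0_iff not0_implies_Suc)
  then show ?thesis by (simp add: in_keys_iff)
 qed
 assume "x \<in> carrier (CA n)"
 then obtain p where p: "p \<in> pn n" "x = cl n p" by (auto simp: H_carrier)
 show ?thesis unfolding p(2) aug_cl key
 proof
  assume "cl n p \<in> Hge n 1"
  then obtain q where q: "cl n p = cl n q" "\<forall>m\<in>kys q. 1 \<le> mdeg m" by (auto simp: Hge_def)
  then have "lkp p 0 = lkp q 0" by (metis aug_cl)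
  then show "\<forall>m\<in>kys p. 1 \<le> mdeg m" using q(2) key by metis
 qed (use p in \<open>auto simp: Hge_def\<close>)
qed

lemma finite_artin: "finite (artin n n)"
proof (rule finite_imageD)
 show "inj_on (lkp :: (nat \<Rightarrow>\<^sub>0 nat) => _) (artin n n)" by (auto intro!: inj_onI poly_mapping_eqI)
 have "lkp ` artin n n \<subseteq> {f. \<forall>x. (x \<in> {1..n} --> f x \<in> {..n}) \<and> (x \<notin> {1..n} --> f x = 0)}"
 proof clarify
  fix m x assume m: "m \<in> artin n n"
  have "x \<in> {1..n} ==> lkp m x < n + 1 - x" "kys m \<subseteq> {1..n}" using m unfolding artin_def by blast+
  moreover have "x \<notin> {1..n} ==> lkp m x = 0" using calculation(2) by (meson in_keys_iff subsetD)
  ultimately show "(x \<in> {1..n} --> lkp m x \<in> {..n}) \<and> (x \<notin> {1..n} --> lkp m x = 0)" by auto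
 qed
 then show "finite (lkp ` artin n n)" by (rule finite_subset) (intro finite_set_of_finite_funs, auto)
qed

text \<open>Let \<open>D\<close> exceed the degrees of all Artin monomials. Components of the normal
  form vanish from degree \<open>D\<close> on, those of \<open>p\<close> below \<open>D\<close>, and
  the ideal is homogeneous; so every component of \<open>p\<close> lies in it.\<close>

lemma Hge_top: "\<exists>D. Hge n D = {\<zero>\<^bsub>CA n\<^esub>}"
proof -
 define D where "D = Suc (Max (insert 0 (mdeg ` artin n n)))"
 have D: "mdeg m < D" if "m \<in> artin n n" for m
  unfolding D_def less_Suc_eq_le using finite_artin that by (intro Max_ge) auto
 have "cl n p = cl n 0" if p: "p \<in> pn n" "\<forall>m\<in>kys p. D \<le> mdeg m" for p
 proof -
  obtain r where r: "kys r \<subseteq> artin n n" "p - r \<in> idl {1..n} (frel n) n"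
   using artin_exists[OF order_refl p(1)] by blast
  have hom: "gcomp d p \<in> idl {1..n} (frel n) n" for d
  proof (cases "d < D")
   case True
   have "lkp p m = 0" if "mdeg m = d" for m using p(2) True that by (metis in_keys_iff not_le)
   then have "gcomp d p = 0" by (intro poly_mapping_eqI) (simp add: lookup_gcomp)
   then show ?thesis by (simp add: idl_zero)
  next
   case False
   have "lkp r m = 0" if "mdeg m = d" for m using r(1) False D that by (metis in_keys_iff subsetD)
   then have "gcomp d r = 0" by (intro poly_mapping_eqI) (simp add: lookup_gcomp)
   then show ?thesis using idl_gcomp[OF frel_homog r(2), of d] by (simp add: gcomp_minus)
  qed
  have "(\<Sum>d\<in>mdeg ` kys p. gcomp d p) \<in> idl {1..n} (frel n) n" by (intro idl_sum hom)
  moreover have "(\<Sum>d\<in>mdeg ` kys p. gcomp d p) = p" by (rule gcomp_expand[symmetric]) auto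
  ultimately show ?thesis by (simp only: cl_eq_iff coinv_ideal_eq diff_zero)
 qed
 then have "Hge n D \<subseteq> {\<zero>\<^bsub>CA n\<^esub>}" unfolding Hge_def H_zero by blast
 then show ?thesis using Hge_zero by blast
qed

section \<open>Homological algebra of graded modules\<close>

text \<open>Each axiom is verified after applying the injection; additive inverses are supplied by
  the scalar -1.\<close>

lemma module_transport:
 fixes R (structure)
 assumes M: "module R M" and inj: "inj_on \<Theta> (carrier N)" and car: "\<Theta> ` carrier N \<subseteq> carrier M"
  and zero: "\<zero>\<^bsub>N\<^esub> \<in> carrier N" "\<Theta> \<zero>\<^bsub>N\<^esub> = \<zero>\<^bsub>M\<^esub>"
  and add: "!!x y. x \<in> carrier N ==> y \<in> carrier N ==> x \<oplus>\<^bsub>N\<^esub> y \<in> carrier N \<and> \<Theta> (x \<oplus>\<^bsub>N\<^esub> y) = \<Theta> x \<oplus>\<^bsub>M\<^esub> \<Theta> y"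
  and smult: "!!r x. r \<in> carrier R ==> x \<in> carrier N ==> r \<odot>\<^bsub>N\<^esub> x \<in> carrier N \<and> \<Theta> (r \<odot>\<^bsub>N\<^esub> x) = r \<odot>\<^bsub>M\<^esub> \<Theta> x"
 shows "module R N"
proof -
 interpret M: module R M by (rule M)
 have T: "\<Theta> x \<in> carrier M" if "x \<in> carrier N" for x using car that by blast
 have eq: "x = y" if "x \<in> carrier N" "y \<in> carrier N" "\<Theta> x = \<Theta> y" for x y using inj that by (auto dest: inj_onD)
 have a: "x \<oplus>\<^bsub>N\<^esub> y \<in> carrier N" "\<Theta> (x \<oplus>\<^bsub>N\<^esub> y) = \<Theta> x \<oplus>\<^bsub>M\<^esub> \<Theta> y"
  if "x \<in> carrier N" "y \<in> carrier N" for x y using add that by auto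
 have s: "r \<odot>\<^bsub>N\<^esub> x \<in> carrier N" "\<Theta> (r \<odot>\<^bsub>N\<^esub> x) = r \<odot>\<^bsub>M\<^esub> \<Theta> x"
  if "r \<in> carrier R" "x \<in> carrier N" for r x using smult that by auto
 show ?thesis
 proof (rule module_criteria; (intro allI ballI impI)?; (elim conjE)?)
  show "cring R" by (rule M.is_cring)
  fix v assume v: "v \<in> carrier N"
  show "\<exists>w\<in>carrier N. v \<oplus>\<^bsub>N\<^esub> w = \<zero>\<^bsub>N\<^esub>"
  proof (rule bexI[of _ "(\<ominus> \<one>) \<odot>\<^bsub>N\<^esub> v"])
   show "v \<oplus>\<^bsub>N\<^esub> (\<ominus> \<one>) \<odot>\<^bsub>N\<^esub> v = \<zero>\<^bsub>N\<^esub>" by (rule eq) (auto simp: v a s zero T M.smult_l_minus M.r_neg)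
  qed (auto simp: v s)
 qed (auto simp: zero a s T M.a_ac M.smult_l_distr M.smult_r_distr M.smult_assoc1 intro!: eq)
qed

text \<open>The grading of the ring is expressed through its regular module, so the tools for graded
  modules also decompose scalars.\<close>

definition gring_ok :: "'r gring => bool" where
 "gring_ok R \<longleftrightarrow> cring R \<and> graded_module R (regular_gmodule R)"

lemma hom_zero:
 assumes "module R M" "module R N" "f \<in> module_hom R M N"
 shows "f \<zero>\<^bsub>M\<^esub> = \<zero>\<^bsub>N\<^esub>"
proof -
 interpret mod_hom R M N f by (intro mod_hom.intro mod_hom_axioms.intro assms)
 show ?thesis by simp
qed

lemma hom_finsum:
 assumes M: "module R M" and N: "module R N" and f: "f \<in> module_hom R M N"
 shows "finite A ==> g \<in> A \<rightarrow> carrier M ==> f (\<Oplus>\<^bsub>M\<^esub>a\<in>A. g a) = (\<Oplus>\<^bsub>N\<^esub>a\<in>A. f (g a))"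
proof -
 interpret M: module R M by (rule M)
 interpret N: module R N by (rule N)
 note fc = module_hom_closed[OF f]
 show "finite A ==> g \<in> A \<rightarrow> carrier M ==> f (\<Oplus>\<^bsub>M\<^esub>a\<in>A. g a) = (\<Oplus>\<^bsub>N\<^esub>a\<in>A. f (g a))"
 proof (induction A rule: finite_induct)
  case empty
  then show ?case by (simp add: hom_zero[OF M N f])
 next
  case (insert x A)
  have "f (\<Oplus>\<^bsub>M\<^esub>a\<in>insert x A. g a) = f (g x \<oplus>\<^bsub>M\<^esub> (\<Oplus>\<^bsub>M\<^esub>a\<in>A. g a))" using insert by (subst M.finsum_insert) auto
  also have "... = f (g x) \<oplus>\<^bsub>N\<^esub> f (\<Oplus>\<^bsub>M\<^esub>a\<in>A. g a)"
   using insert.prems by (intro module_hom_add[OF f] M.finsum_closed) auto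
  also have "... = (\<Oplus>\<^bsub>N\<^esub>a\<in>insert x A. f (g a))" using insert fc by (subst N.finsum_insert) auto
  finally show ?case .
 qed
qed

lemma graded_moduleD:
 assumes "graded_module R M"
 shows "module R M" "mpart M i \<subseteq> carrier M" "\<zero>\<^bsub>M\<^esub> \<in> mpart M i"
  "x \<in> mpart M i ==> y \<in> mpart M i ==> x \<oplus>\<^bsub>M\<^esub> y \<in> mpart M i"
  "r \<in> rpart R j ==> x \<in> mpart M i ==> r \<odot>\<^bsub>M\<^esub> x \<in> mpart M (j + i)"
proof -
 show "module R M" using assms by (simp add: graded_module_def)
 have "subgroup (mpart M i) (add_monoid M)" using assms by (simp add: graded_module_def)
 then show "mpart M i \<subseteq> carrier M" "\<zero>\<^bsub>M\<^esub> \<in> mpart M i"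
  "x \<in> mpart M i ==> y \<in> mpart M i ==> x \<oplus>\<^bsub>M\<^esub> y \<in> mpart M i"
  using subgroup.subset subgroup.one_closed subgroup.m_closed by fastforce+
 show "r \<in> rpart R j ==> x \<in> mpart M i ==> r \<odot>\<^bsub>M\<^esub> x \<in> mpart M (j + i)" using assms by (simp add: graded_module_def)
qed

section \<open>Homogeneous components in graded modules\<close>

definition gdec :: "('r, 'm) gmodule => 'm => int => 'm" where
 "gdec M x = (THE c. (\<forall>i. c i \<in> mpart M i) \<and> finite {i. c i \<noteq> \<zero>\<^bsub>M\<^esub>} \<and>
   x = (\<Oplus>\<^bsub>M\<^esub>i\<in>{i. c i \<noteq> \<zero>\<^bsub>M\<^esub>}. c i))"

lemma gdec:
 assumes "graded_module R M" "x \<in> carrier M"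
 shows "gdec M x i \<in> mpart M i" "finite {i. gdec M x i \<noteq> \<zero>\<^bsub>M\<^esub>}"
  "x = (\<Oplus>\<^bsub>M\<^esub>i\<in>{i. gdec M x i \<noteq> \<zero>\<^bsub>M\<^esub>}. gdec M x i)" "gdec M x i \<in> carrier M"
proof -
 let ?P = "\<lambda>c. (\<forall>i. c i \<in> mpart M i) \<and> finite {i. c i \<noteq> \<zero>\<^bsub>M\<^esub>} \<and> x = (\<Oplus>\<^bsub>M\<^esub>i\<in>{i. c i \<noteq> \<zero>\<^bsub>M\<^esub>}. c i)"
 have "\<exists>!c. ?P c" using assms by (simp add: graded_module_def)
 then have "?P (gdec M x)" unfolding gdec_def by (rule theI')
 then show 1: "gdec M x i \<in> mpart M i" "finite {i. gdec M x i \<noteq> \<zero>\<^bsub>M\<^esub>}"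
  "x = (\<Oplus>\<^bsub>M\<^esub>i\<in>{i. gdec M x i \<noteq> \<zero>\<^bsub>M\<^esub>}. gdec M x i)" by blast+
 then show "gdec M x i \<in> carrier M" using graded_moduleD(2)[OF assms(1)] by blast
qed

lemma gdec_unique:
 assumes M: "graded_module R M" and c: "!!i. c i \<in> mpart M i" and S: "finite S" "!!i. i \<notin> S ==> c i = \<zero>\<^bsub>M\<^esub>"
  and x: "x = (\<Oplus>\<^bsub>M\<^esub>i\<in>S. c i)"
 shows "gdec M x = c"
proof -
 interpret M: module R M by (rule graded_moduleD(1)[OF M])
 let ?P = "\<lambda>c. (\<forall>i. c i \<in> mpart M i) \<and> finite {i. c i \<noteq> \<zero>\<^bsub>M\<^esub>} \<and> x = (\<Oplus>\<^bsub>M\<^esub>i\<in>{i. c i \<noteq> \<zero>\<^bsub>M\<^esub>}. c i)"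
 have cc: "c i \<in> carrier M" for i using c graded_moduleD(2)[OF M] by blast
 have sub: "{i. c i \<noteq> \<zero>\<^bsub>M\<^esub>} \<subseteq> S" using S(2) by blast
 have "(\<Oplus>\<^bsub>M\<^esub>i\<in>{i. c i \<noteq> \<zero>\<^bsub>M\<^esub>}. c i) = (\<Oplus>\<^bsub>M\<^esub>i\<in>S. c i)"
  using S(1) sub cc by (intro M.add.finprod_mono_neutral_cong_left) auto
 then have "?P c" using c finite_subset[OF sub S(1)] x by simp
 moreover have "x \<in> carrier M" unfolding x using cc by (intro M.finsum_closed) auto
 then have "\<exists>!c. ?P c" using M by (simp add: graded_module_def)
 ultimately show ?thesis unfolding gdec_def by (intro the1_equality) auto
qed

lemma gdec_homog:
 assumes M: "graded_module R M" and x: "x \<in> mpart M i"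
 shows "gdec M x j = (if j = i then x else \<zero>\<^bsub>M\<^esub>)"
proof -
 interpret M: module R M by (rule graded_moduleD(1)[OF M])
 have "gdec M x = (\<lambda>j. if j = i then x else \<zero>\<^bsub>M\<^esub>)"
 proof (rule gdec_unique[OF M, where S = "{i}"])
  have "x \<in> carrier M" using x graded_moduleD(2)[OF M] by blast
  then show "x = (\<Oplus>\<^bsub>M\<^esub>j\<in>{i}. if j = i then x else \<zero>\<^bsub>M\<^esub>)"
   using M.finsum_insert[of "{}" i "\<lambda>j. if j = i then x else \<zero>\<^bsub>M\<^esub>"] by simp
 qed (use x graded_moduleD(3)[OF M] in auto)
 then show ?thesis by simp
qed

lemma graded_induct [consumes 2, case_names homog add]:
 assumes M: "graded_module R M" and x: "x \<in> carrier M"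
  and Q: "!!i y. y \<in> mpart M i ==> Q y"
  "!!y z. y \<in> carrier M ==> z \<in> carrier M ==> Q y ==> Q z ==> Q (y \<oplus>\<^bsub>M\<^esub> z)"
 shows "Q x"
proof -
 interpret M: module R M by (rule graded_moduleD(1)[OF M])
 have "Q (\<Oplus>\<^bsub>M\<^esub>i\<in>A. gdec M x i)" if "finite A" for A using that
 proof (induction A rule: finite_induct)
  case empty
  then show ?case using Q(1) graded_moduleD(3)[OF M] by simp
 next
  case (insert a A)
  have "Q (gdec M x a \<oplus>\<^bsub>M\<^esub> (\<Oplus>\<^bsub>M\<^esub>i\<in>A. gdec M x i))"
   using insert gdec[OF M x] Q(1) by (intro Q(2)) (auto intro!: M.finsum_closed)
  then show ?case using insert gdec[OF M x] by (subst M.finsum_insert) auto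
 qed
 from this[OF gdec(2)[OF M x]] show ?thesis using gdec(3)[OF M x] by simp
qed

lemma gdec_add:
 assumes M: "graded_module R M" and x: "x \<in> carrier M" and y: "y \<in> carrier M"
 shows "gdec M (x \<oplus>\<^bsub>M\<^esub> y) i = gdec M x i \<oplus>\<^bsub>M\<^esub> gdec M y i"
proof -
 interpret M: module R M by (rule graded_moduleD(1)[OF M])
 let ?S = "{i. gdec M x i \<noteq> \<zero>\<^bsub>M\<^esub>} \<union> {i. gdec M y i \<noteq> \<zero>\<^bsub>M\<^esub>}"
 have S: "finite ?S" using gdec(2)[OF M x] gdec(2)[OF M y] by simp
 have e: "z = (\<Oplus>\<^bsub>M\<^esub>i\<in>?S. gdec M z i)" if "z \<in> carrier M" "{i. gdec M z i \<noteq> \<zero>\<^bsub>M\<^esub>} \<subseteq> ?S" for z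
 proof (rule trans[OF gdec(3)[OF M that(1)]])
  show "(\<Oplus>\<^bsub>M\<^esub>i\<in>{i. gdec M z i \<noteq> \<zero>\<^bsub>M\<^esub>}. gdec M z i) = (\<Oplus>\<^bsub>M\<^esub>i\<in>?S. gdec M z i)"
   using S that(2) gdec(4)[OF M that(1)] by (intro M.add.finprod_mono_neutral_cong_left) auto
 qed
 have "gdec M (x \<oplus>\<^bsub>M\<^esub> y) = (\<lambda>i. gdec M x i \<oplus>\<^bsub>M\<^esub> gdec M y i)"
 proof (rule gdec_unique[OF M _ S])
  have "x \<oplus>\<^bsub>M\<^esub> y = (\<Oplus>\<^bsub>M\<^esub>i\<in>?S. gdec M x i) \<oplus>\<^bsub>M\<^esub> (\<Oplus>\<^bsub>M\<^esub>i\<in>?S. gdec M y i)" by (rule arg_cong2[OF e[OF x] e[OF y]]) auto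
  also have "... = (\<Oplus>\<^bsub>M\<^esub>i\<in>?S. gdec M x i \<oplus>\<^bsub>M\<^esub> gdec M y i)"
   using gdec(4)[OF M x] gdec(4)[OF M y] by (intro M.finsum_addf[symmetric]) auto
  finally show "x \<oplus>\<^bsub>M\<^esub> y = (\<Oplus>\<^bsub>M\<^esub>i\<in>?S. gdec M x i \<oplus>\<^bsub>M\<^esub> gdec M y i)" .
 qed (use gdec(1)[OF M x] gdec(1)[OF M y] graded_moduleD(4)[OF M] in auto)
 then show ?thesis by simp
qed

lemma gr_homD:
 assumes "f \<in> gr_hom R M N"
 shows "f \<in> module_hom R M N" "x \<in> mpart M i ==> f x \<in> mpart N i"
 using assms unfolding gr_hom_def by blast+

lemma gdec_hom:
 assumes M: "graded_module R M" and N: "graded_module R N" and f: "f \<in> gr_hom R M N" and x: "x \<in> carrier M"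
 shows "gdec N (f x) i = f (gdec M x i)"
 using M x
proof (induction x rule: graded_induct)
 case (homog j y)
 then show ?case using hom_zero[OF graded_moduleD(1)[OF M] graded_moduleD(1)[OF N] gr_homD(1)[OF f]]
  by (simp add: gdec_homog[OF M] gdec_homog[OF N gr_homD(2)[OF f]])
next
 case (add y z)
 have "f y \<in> carrier N" "f z \<in> carrier N" using module_hom_closed[OF gr_homD(1)[OF f]] add by auto
 then show ?case using add gdec(4)[OF M add(1)] gdec(4)[OF M add(2)]
  by (simp add: module_hom_add[OF gr_homD(1)[OF f]] gdec_add[OF M] gdec_add[OF N])
qed

lemma rpart_carrier: "gring_ok R ==> rpart R i \<subseteq> carrier R"
 using graded_moduleD(2)[of R "regular_gmodule R" i] by (auto simp: gring_ok_def regular_gmodule_def)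

lemma gdec_smult:
 assumes R: "gring_ok R" and M: "graded_module R M" and r: "r \<in> rpart R k" and x: "x \<in> carrier M"
 shows "gdec M (r \<odot>\<^bsub>M\<^esub> x) i = r \<odot>\<^bsub>M\<^esub> gdec M x (i - k)"
 using M x
proof (induction x rule: graded_induct)
 interpret M: module R M by (rule graded_moduleD(1)[OF M])
 have r': "r \<in> carrier R" using r rpart_carrier[OF R] by blast
 case (homog j y)
 then show ?case using r' by (auto simp: gdec_homog[OF M] gdec_homog[OF M graded_moduleD(5)[OF M r]])
next
 interpret M: module R M by (rule graded_moduleD(1)[OF M])
 have r': "r \<in> carrier R" using r rpart_carrier[OF R] by blast
 case (add y z)
 then show ?case using r' gdec(4)[OF M add(1)] gdec(4)[OF M add(2)] by (simp add: M.smult_r_distr gdec_add[OF M])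
qed

text \<open>Homogeneous scalars suffice because both arguments decompose into homogeneous parts.\<close>

lemma gr_homI:
 assumes R: "gring_ok R" and M: "graded_module R M" and N: "graded_module R N"
  and part: "!!i x. x \<in> mpart M i ==> f x \<in> mpart N i"
  and add: "!!x y. x \<in> carrier M ==> y \<in> carrier M ==> f x \<in> carrier N \<and> f (x \<oplus>\<^bsub>M\<^esub> y) = f x \<oplus>\<^bsub>N\<^esub> f y"
  and smult: "!!i j r x. r \<in> rpart R i ==> x \<in> mpart M j ==> f (r \<odot>\<^bsub>M\<^esub> x) = r \<odot>\<^bsub>N\<^esub> f x"
 shows "f \<in> gr_hom R M N"
proof -
 interpret M: module R M by (rule graded_moduleD(1)[OF M])
 interpret N: module R N by (rule graded_moduleD(1)[OF N])
 have RR: "graded_module R (regular_gmodule R)" using R by (simp add: gring_ok_def)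
 have fc: "f x \<in> carrier N" if "x \<in> carrier M" for x using add[OF that that] by blast
 have *: "f (r \<odot>\<^bsub>M\<^esub> x) = r \<odot>\<^bsub>N\<^esub> f x" if r: "r \<in> rpart R i" and x: "x \<in> carrier M" for i r x using M x
 proof (induction x rule: graded_induct)
  case (homog j y)
  then show ?case using smult r by blast
 next
  case (add y z)
  have "r \<in> carrier R" using r rpart_carrier[OF R] by blast
  then show ?case using add assms(5) fc by (simp add: M.smult_r_distr N.smult_r_distr)
 qed
 have "f (r \<odot>\<^bsub>M\<^esub> x) = r \<odot>\<^bsub>N\<^esub> f x" if r: "r \<in> carrier R" and x: "x \<in> carrier M" for r x
 proof -
  have "r \<in> carrier (regular_gmodule R)" using r by (simp add: regular_gmodule_def)
  with RR show ?thesis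
  proof (induction r rule: graded_induct)
   case (homog j y)
   then show ?case using * x by (simp add: regular_gmodule_def)
  next
   case (add y z)
   then have "y \<in> carrier R" "z \<in> carrier R" by (auto simp: regular_gmodule_def)
   then show ?case using add x assms(5) fc by (simp add: M.smult_l_distr N.smult_l_distr regular_gmodule_def)
  qed
 qed
 then show ?thesis using part add by (auto simp: gr_hom_def module_hom_def)
qed

text \<open>The flag selects graded or plain homomorphisms. Infinitude concerns arbitrary
  resolutions, the Betti numbers and Ext graded ones; with the flag, lifting, comparison and
  homotopy serve both.\<close>

definition homs :: "bool => 'r gring => ('r, 'm) gmodule => ('r, 'k) gmodule => ('m => 'k) set" where
 "homs b R M N = (if b then gr_hom R M N else module_hom R M N)"

definition gmod :: "bool => 'r gring => ('r, 'm) gmodule => bool" where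
 "gmod b R M \<longleftrightarrow> module R M \<and> (b --> graded_module R M)"

lemma homs_hom: "f \<in> homs b R M N ==> f \<in> module_hom R M N" by (auto simp: homs_def gr_hom_def split: if_splits)

lemma homs_closed: "f \<in> homs b R M N ==> x \<in> carrier M ==> f x \<in> carrier N"
 using module_hom_closed[OF homs_hom] by blast

lemma homs_add: "f \<in> homs b R M N ==> x \<in> carrier M ==> y \<in> carrier M ==> f (x \<oplus>\<^bsub>M\<^esub> y) = f x \<oplus>\<^bsub>N\<^esub> f y"
 by (rule module_hom_add[OF homs_hom])

lemma homs_zero: "gmod b R M ==> gmod b R N ==> f \<in> homs b R M N ==> f \<zero>\<^bsub>M\<^esub> = \<zero>\<^bsub>N\<^esub>"
 using hom_zero[OF _ _ homs_hom] by (auto simp: gmod_def)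

lemma homs_comp: "f \<in> homs b R L M ==> g \<in> homs b R M N ==> (\<lambda>x. g (f x)) \<in> homs b R L N"
 unfolding homs_def gr_hom_def module_hom_def by (auto simp: image_subset_iff Pi_iff split: if_splits)

lemma homs_id: "(\<lambda>x. x) \<in> homs b R M M" unfolding homs_def gr_hom_def module_hom_def by auto

lemma homs_minus:
 assumes M: "gmod b R M" and N: "gmod b R N" and f: "f \<in> homs b R M N" and g: "g \<in> homs b R M N"
 shows "(\<lambda>x. f x \<ominus>\<^bsub>N\<^esub> g x) \<in> homs b R M N"
proof -
 interpret N: module R N using N by (simp add: gmod_def)
 have fc: "f x \<in> carrier N" and gc: "g x \<in> carrier N" if "x \<in> carrier M" for x
  using homs_closed[OF f that] homs_closed[OF g that] .
 note fh = homs_hom[OF f] and gh = homs_hom[OF g]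
 have mh: "(\<lambda>x. f x \<ominus>\<^bsub>N\<^esub> g x) \<in> module_hom R M N" unfolding module_hom_def
  by (auto simp: fc gc module_hom_add[OF fh] module_hom_add[OF gh] module_hom_smult[OF fh] module_hom_smult[OF gh]
    a_minus_def N.minus_add N.a_ac N.smult_r_distr N.smult_r_minus)
 moreover have "f x \<ominus>\<^bsub>N\<^esub> g x \<in> mpart N i" if b and x: "x \<in> mpart M i" for i x
 proof -
  have "subgroup (mpart N i) (add_monoid N)" using N \<open>b\<close> by (simp add: gmod_def graded_module_def)
  moreover have "f x \<in> mpart N i" "g x \<in> mpart N i" using gr_homD(2)[OF _ x] f g \<open>b\<close> by (auto simp: homs_def)
  ultimately show ?thesis unfolding a_minus_def a_inv_def
   using subgroup.m_closed[of "mpart N i" "add_monoid N"] subgroup.m_inv_closed[of "mpart N i" "add_monoid N"] by auto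
 qed
 ultimately show ?thesis by (auto simp: homs_def gr_hom_def)
qed

section \<open>Dual bases and projectivity\<close>

definition functionals :: "('r, 'z) ring_scheme => ('r, 'p, 'x) module_scheme => 'b set => ('b => 'p => 'r) => bool" where
 "functionals R P B \<phi> \<longleftrightarrow>
   (\<forall>b\<in>B. \<forall>x\<in>carrier P. \<phi> b x \<in> carrier R \<and> (\<forall>y\<in>carrier P. \<phi> b (x \<oplus>\<^bsub>P\<^esub> y) = \<phi> b x \<oplus>\<^bsub>R\<^esub> \<phi> b y) \<and>
    (\<forall>r\<in>carrier R. \<phi> b (r \<odot>\<^bsub>P\<^esub> x) = r \<otimes>\<^bsub>R\<^esub> \<phi> b x)) \<and>
   (\<forall>x\<in>carrier P. finite {b\<in>B. \<phi> b x \<noteq> \<zero>\<^bsub>R\<^esub>})"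

text \<open>The dual basis criterion for projectivity. It speaks of \<open>P\<close> alone and so
  yields lifting against modules with elements of any type, whereas \<open>projective_module\<close>
  tests one fixed type.\<close>

definition dual_basis :: "('r, 'z) ring_scheme => ('r, 'p, 'x) module_scheme => 'b set => ('b => 'p) => ('b => 'p => 'r) => bool" where
 "dual_basis R P B v \<phi> \<longleftrightarrow> functionals R P B \<phi> \<and> v ` B \<subseteq> carrier P \<and>
   (\<forall>x\<in>carrier P. x = (\<Oplus>\<^bsub>P\<^esub>b\<in>{b\<in>B. \<phi> b x \<noteq> \<zero>\<^bsub>R\<^esub>}. \<phi> b x \<odot>\<^bsub>P\<^esub> v b))"

lemma functionals_hom:
 assumes P: "module R P" and M: "module R M" and \<phi>: "functionals R P B \<phi>" and \<mu>: "\<mu> ` B \<subseteq> carrier M"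
 shows "(\<lambda>x. \<Oplus>\<^bsub>M\<^esub>b\<in>{b\<in>B. \<phi> b x \<noteq> \<zero>\<^bsub>R\<^esub>}. \<phi> b x \<odot>\<^bsub>M\<^esub> \<mu> b) \<in> module_hom R P M"
proof -
 interpret P: module R P by (rule P)
 interpret M: module R M by (rule M)
 let ?s = "\<lambda>x. {b\<in>B. \<phi> b x \<noteq> \<zero>\<^bsub>R\<^esub>}"
 let ?h = "\<lambda>x. \<Oplus>\<^bsub>M\<^esub>b\<in>?s x. \<phi> b x \<odot>\<^bsub>M\<^esub> \<mu> b"
 have fin: "finite (?s x)" if "x \<in> carrier P" for x using \<phi> that by (simp add: functionals_def)
 have c: "\<phi> b x \<in> carrier R" "\<mu> b \<in> carrier M" if "b \<in> B" "x \<in> carrier P" for b x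
  using \<phi> \<mu> that by (auto simp: functionals_def)
 have a: "\<phi> b (x \<oplus>\<^bsub>P\<^esub> y) = \<phi> b x \<oplus>\<^bsub>R\<^esub> \<phi> b y" if "b \<in> B" "x \<in> carrier P" "y \<in> carrier P" for b x y
  using \<phi> that by (simp add: functionals_def)
 have s: "\<phi> b (r \<odot>\<^bsub>P\<^esub> x) = r \<otimes>\<^bsub>R\<^esub> \<phi> b x" if "b \<in> B" "x \<in> carrier P" "r \<in> carrier R" for b x r
  using \<phi> that by (simp add: functionals_def)
 have S: "?h x = (\<Oplus>\<^bsub>M\<^esub>b\<in>S. \<phi> b x \<odot>\<^bsub>M\<^esub> \<mu> b)" if "x \<in> carrier P" "finite S" "?s x \<subseteq> S" "S \<subseteq> B" for x S
  using that c by (intro M.add.finprod_mono_neutral_cong_left) auto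
 show ?thesis unfolding module_hom_def
 proof (intro CollectI conjI allI impI; (elim conjE)?)
  show "?h \<in> carrier P \<rightarrow> carrier M" using c by (intro Pi_I M.finsum_closed) auto
 next
  fix x y assume xy: "x \<in> carrier P" "y \<in> carrier P"
  let ?S = "?s x \<union> ?s y"
  have fS: "finite ?S" using fin xy by simp
  have "?h (x \<oplus>\<^bsub>P\<^esub> y) = (\<Oplus>\<^bsub>M\<^esub>b\<in>?S. \<phi> b (x \<oplus>\<^bsub>P\<^esub> y) \<odot>\<^bsub>M\<^esub> \<mu> b)" using xy fS a by (intro S) auto
  also have "... = (\<Oplus>\<^bsub>M\<^esub>b\<in>?S. \<phi> b x \<odot>\<^bsub>M\<^esub> \<mu> b \<oplus>\<^bsub>M\<^esub> \<phi> b y \<odot>\<^bsub>M\<^esub> \<mu> b)"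
   using xy a c by (intro M.add.finprod_cong') (auto simp: M.smult_l_distr)
  also have "... = (\<Oplus>\<^bsub>M\<^esub>b\<in>?S. \<phi> b x \<odot>\<^bsub>M\<^esub> \<mu> b) \<oplus>\<^bsub>M\<^esub> (\<Oplus>\<^bsub>M\<^esub>b\<in>?S. \<phi> b y \<odot>\<^bsub>M\<^esub> \<mu> b)"
   using xy c by (intro M.finsum_addf) auto
  also have "... = ?h x \<oplus>\<^bsub>M\<^esub> ?h y" using S[OF xy(1) fS] S[OF xy(2) fS] by auto
  finally show "?h (x \<oplus>\<^bsub>P\<^esub> y) = ?h x \<oplus>\<^bsub>M\<^esub> ?h y" .
 next
  fix r x assume rx: "r \<in> carrier R" "x \<in> carrier P"
  have "?h (r \<odot>\<^bsub>P\<^esub> x) = (\<Oplus>\<^bsub>M\<^esub>b\<in>?s x. \<phi> b (r \<odot>\<^bsub>P\<^esub> x) \<odot>\<^bsub>M\<^esub> \<mu> b)" using rx fin s by (intro S) auto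
  also have "... = (\<Oplus>\<^bsub>M\<^esub>b\<in>?s x. r \<odot>\<^bsub>M\<^esub> (\<phi> b x \<odot>\<^bsub>M\<^esub> \<mu> b))"
   using rx s c by (intro M.add.finprod_cong') (auto simp: M.smult_assoc1)
  also have "... = r \<odot>\<^bsub>M\<^esub> ?h x" using rx c fin by (intro M.finsum_smult_ldistr[symmetric]) auto
  finally show "?h (r \<odot>\<^bsub>P\<^esub> x) = r \<odot>\<^bsub>M\<^esub> ?h x" .
 qed
qed

text \<open>Choose preimages \<mu>_b of f(v_b) and send x to the sum of the \<phi>_b(x) \<mu>_b. The
  inclusion of images is the form in which exactness of a resolution is applied later.\<close>

lemma dual_basis_lift:
 assumes P: "module R P" and M: "module R M" and N: "module R N" and db: "dual_basis R P B v \<phi>"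
  and g: "g \<in> module_hom R M N" and f: "f \<in> module_hom R P N" and im: "f ` carrier P \<subseteq> g ` carrier M"
 shows "\<exists>h\<in>module_hom R P M. \<forall>x\<in>carrier P. g (h x) = f x"
proof -
 interpret P: module R P by (rule P)
 interpret M: module R M by (rule M)
 interpret N: module R N by (rule N)
 have fn: "functionals R P B \<phi>" and v: "v ` B \<subseteq> carrier P" using db by (auto simp: dual_basis_def)
 have "\<forall>b\<in>B. \<exists>m\<in>carrier M. g m = f (v b)" using v im by fastforce
 then obtain \<mu> where \<mu>: "!!b. b \<in> B ==> \<mu> b \<in> carrier M" "!!b. b \<in> B ==> g (\<mu> b) = f (v b)" by metis
 let ?s = "\<lambda>x. {b\<in>B. \<phi> b x \<noteq> \<zero>\<^bsub>R\<^esub>}"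
 let ?h = "\<lambda>x. \<Oplus>\<^bsub>M\<^esub>b\<in>?s x. \<phi> b x \<odot>\<^bsub>M\<^esub> \<mu> b"
 have h: "?h \<in> module_hom R P M" using \<mu>(1) by (intro functionals_hom[OF P M fn]) auto
 have "g (?h x) = f x" if x: "x \<in> carrier P" for x
 proof -
  have fin: "finite (?s x)" and c: "!!b. b \<in> B ==> \<phi> b x \<in> carrier R" using fn x by (auto simp: functionals_def)
  have "g (?h x) = (\<Oplus>\<^bsub>N\<^esub>b\<in>?s x. g (\<phi> b x \<odot>\<^bsub>M\<^esub> \<mu> b))" using c \<mu>(1) by (intro hom_finsum[OF M N g fin]) auto
  also have "... = (\<Oplus>\<^bsub>N\<^esub>b\<in>?s x. f (\<phi> b x \<odot>\<^bsub>P\<^esub> v b))"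
  proof (intro N.add.finprod_cong' refl)
   have vc: "v b \<in> carrier P" if "b \<in> B" for b using v that by blast
   show "(\<lambda>b. f (\<phi> b x \<odot>\<^bsub>P\<^esub> v b)) \<in> ?s x \<rightarrow> carrier N"
    by (intro Pi_I funcset_mem[OF module_hom_closed[OF f]] P.smult_closed c vc) simp_all
   fix b assume "b \<in> ?s x"
   then show "g (\<phi> b x \<odot>\<^bsub>M\<^esub> \<mu> b) = f (\<phi> b x \<odot>\<^bsub>P\<^esub> v b)"
    using c \<mu> vc by (simp add: module_hom_smult[OF g] module_hom_smult[OF f])
  qed
  also have "... = f (\<Oplus>\<^bsub>P\<^esub>b\<in>?s x. \<phi> b x \<odot>\<^bsub>P\<^esub> v b)" using c v by (intro hom_finsum[OF P N f fin, symmetric]) auto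
  also have "(\<Oplus>\<^bsub>P\<^esub>b\<in>?s x. \<phi> b x \<odot>\<^bsub>P\<^esub> v b) = x"
  proof (rule sym)
   show "x = (\<Oplus>\<^bsub>P\<^esub>b\<in>?s x. \<phi> b x \<odot>\<^bsub>P\<^esub> v b)" using db x unfolding dual_basis_def by blast
  qed
  finally show ?thesis .
 qed
 then show ?thesis by (intro bexI[OF _ h] ballI)
qed

text \<open>Used for the free module on the elements of a projective module, for the module
  underlying \<open>free_gmodule\<close>, and for coordinate spaces over the complex
  numbers.\<close>

definition free_mod :: "('r, 'z) ring_scheme => 'b set => ('r, 'b => 'r) module" where
 "free_mod R B =
   \<lparr>carrier = {a. finite {x. a x \<noteq> \<zero>\<^bsub>R\<^esub>} \<and> (\<forall>x. a x \<in> (if x \<in> B then carrier R else {\<zero>\<^bsub>R\<^esub>}))},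
   monoid.mult = undefined, monoid.one = undefined, ring.zero = (\<lambda>_. \<zero>\<^bsub>R\<^esub>),
   ring.add = (\<lambda>f g x. f x \<oplus>\<^bsub>R\<^esub> g x), module.smult = (\<lambda>r f x. r \<otimes>\<^bsub>R\<^esub> f x)\<rparr>"

lemma (in cring) free_mod_carrier:
 "a \<in> carrier (free_mod R B) \<longleftrightarrow> finite {x. a x \<noteq> \<zero>} \<and> (\<forall>x. a x \<in> carrier R) \<and> (\<forall>x. x \<notin> B --> a x = \<zero>)"
 by (auto simp: free_mod_def split: if_splits) (metis zero_closed)

lemma (in cring) free_mod_simps:
 "\<zero>\<^bsub>free_mod R B\<^esub> = (\<lambda>_. \<zero>)" "a \<oplus>\<^bsub>free_mod R B\<^esub> b = (\<lambda>x. a x \<oplus> b x)" "r \<odot>\<^bsub>free_mod R B\<^esub> a = (\<lambda>x. r \<otimes> a x)"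
 by (auto simp: free_mod_def)

lemma (in cring) free_mod_module: "module R (free_mod R B)"
proof (rule module_criteria; (intro allI ballI impI)?; (elim conjE)?)
 show "cring R" by (rule is_cring)
 fix v w assume v: "v \<in> carrier (free_mod R B)" and w: "w \<in> carrier (free_mod R B)"
 have "finite {x. v x \<oplus> w x \<noteq> \<zero>}"
  by (rule finite_subset[of _ "{x. v x \<noteq> \<zero>} \<union> {x. w x \<noteq> \<zero>}"]) (use v w in \<open>auto simp: free_mod_carrier\<close>)
 then show "v \<oplus>\<^bsub>free_mod R B\<^esub> w \<in> carrier (free_mod R B)" using v w by (simp add: free_mod_carrier free_mod_simps)
next
 fix v assume v: "v \<in> carrier (free_mod R B)"
 have "finite {x. \<ominus> v x \<noteq> \<zero>}" by (rule finite_subset[of _ "{x. v x \<noteq> \<zero>}"]) (use v in \<open>auto simp: free_mod_carrier\<close>)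
 then show "\<exists>w\<in>carrier (free_mod R B). v \<oplus>\<^bsub>free_mod R B\<^esub> w = \<zero>\<^bsub>free_mod R B\<^esub>"
  using v by (intro bexI[of _ "\<lambda>x. \<ominus> v x"]) (auto simp: free_mod_carrier free_mod_simps r_neg)
next
 fix r v assume r: "r \<in> carrier R" and v: "v \<in> carrier (free_mod R B)"
 have "finite {x. r \<otimes> v x \<noteq> \<zero>}"
  by (rule finite_subset[of _ "{x. v x \<noteq> \<zero>}"]) (use r v in \<open>auto simp: free_mod_carrier\<close>)
 then show "r \<odot>\<^bsub>free_mod R B\<^esub> v \<in> carrier (free_mod R B)" using r v by (simp add: free_mod_carrier free_mod_simps)
qed (auto simp: free_mod_carrier free_mod_simps a_ac m_assoc l_distr r_distr)

definition unit_vec :: "('r, 'z) ring_scheme => 'b => 'b => 'r" where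
 "unit_vec R b = (\<lambda>x. if x = b then \<one>\<^bsub>R\<^esub> else \<zero>\<^bsub>R\<^esub>)"

lemma (in cring) unit_vec_carrier: "b \<in> B ==> unit_vec R b \<in> carrier (free_mod R B)"
 by (auto simp: free_mod_carrier unit_vec_def)

lemma (in cring) free_mod_functionals: "functionals R (free_mod R B) B (\<lambda>b a. a b)"
 by (auto simp: functionals_def free_mod_carrier free_mod_simps intro: rev_finite_subset)

lemma (in cring) free_mod_finsum:
 assumes "finite A" "!!b. b \<in> A ==> F b \<in> carrier (free_mod R B)"
 shows "(\<Oplus>\<^bsub>free_mod R B\<^esub>b\<in>A. F b) x = (\<Oplus>b\<in>A. F b x)"
proof -
 interpret F: module R "free_mod R B" by (rule free_mod_module)
 show ?thesis using assms
 proof (induction A rule: finite_induct)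
  case (insert a A)
  have "(\<Oplus>\<^bsub>free_mod R B\<^esub>b\<in>insert a A. F b) = F a \<oplus>\<^bsub>free_mod R B\<^esub> (\<Oplus>\<^bsub>free_mod R B\<^esub>b\<in>A. F b)"
   using insert by (intro F.finsum_insert) auto
  then show ?case using insert by (subst finsum_insert) (auto simp: free_mod_simps free_mod_carrier)
 qed (auto simp: free_mod_simps)
qed

lemma (in cring) free_mod_dual_basis: "dual_basis R (free_mod R B) B (unit_vec R) (\<lambda>b a. a b)"
 unfolding dual_basis_def
proof (intro conjI ballI free_mod_functionals)
 interpret F: module R "free_mod R B" by (rule free_mod_module)
 show "unit_vec R ` B \<subseteq> carrier (free_mod R B)" by (intro image_subsetI unit_vec_carrier)
 fix a assume a: "a \<in> carrier (free_mod R B)"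
 let ?s = "{b\<in>B. a b \<noteq> \<zero>}"
 have fin: "finite ?s" using a by (auto simp: free_mod_carrier intro: rev_finite_subset)
 show "a = (\<Oplus>\<^bsub>free_mod R B\<^esub>b\<in>?s. a b \<odot>\<^bsub>free_mod R B\<^esub> unit_vec R b)"
 proof
  fix x
  have "(\<Oplus>\<^bsub>free_mod R B\<^esub>b\<in>?s. a b \<odot>\<^bsub>free_mod R B\<^esub> unit_vec R b) x = (\<Oplus>b\<in>?s. (a b \<odot>\<^bsub>free_mod R B\<^esub> unit_vec R b) x)"
   using a fin by (intro free_mod_finsum F.smult_closed unit_vec_carrier) (auto simp: free_mod_carrier)
  also have "... = (\<Oplus>b\<in>?s. if x = b then a b else \<zero>)"
   using a by (intro add.finprod_cong') (auto simp: free_mod_simps unit_vec_def free_mod_carrier)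
  also have "... = a x"
  proof (cases "x \<in> ?s")
   case True
   then show ?thesis using fin a by (intro add.finprod_singleton) (auto simp: free_mod_carrier)
  next
   case False
   then have "a x = \<zero>" using a by (auto simp: free_mod_carrier)
   moreover have "(\<Oplus>b\<in>?s. if x = b then a b else \<zero>) = (\<Oplus>b\<in>?s. \<zero>)" using False by (intro add.finprod_cong') auto
   ultimately show ?thesis by simp
  qed
  finally show "a x = (\<Oplus>\<^bsub>free_mod R B\<^esub>b\<in>?s. a b \<odot>\<^bsub>free_mod R B\<^esub> unit_vec R b) x" by simp
 qed
qed

lemma projective_moduleI:
 assumes "module R P" "dual_basis R P B v \<phi>"
 shows "projective_module R P"
 unfolding projective_module_def
proof (intro conjI allI impI; (elim conjE)?)
 fix M N g f assume *: "module R M" "module R N" "g \<in> module_hom R M N" "g ` carrier M = carrier N" "f \<in> module_hom R P N"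
 show "\<exists>h\<in>module_hom R P M. \<forall>x\<in>carrier P. g (h x) = f x"
  using dual_basis_lift[OF assms(1) *(1,2) assms(2) *(3,5)] module_hom_closed[OF *(5)] *(4) by blast
qed (rule assms)

text \<open>Split the canonical surjection onto \<open>P\<close> from the free module on the elements of \<open>P\<close>.\<close>

lemma projective_dual_basis:
 assumes P: "projective_module R (P :: ('r, 'p, 'x) module_scheme)" and nontriv: "\<one>\<^bsub>R\<^esub> \<noteq> \<zero>\<^bsub>R\<^esub>"
 shows "\<exists>\<phi>. dual_basis R P (carrier P) (\<lambda>b. b) \<phi>"
proof -
 have mP: "module R P" using P by (simp add: projective_module_def)
 interpret P: module R P by (rule mP)
 let ?B = "carrier P"
 let ?F = "free_mod R ?B"
 have mF: "module R ?F" by (rule P.R.free_mod_module)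
 define \<pi> where "\<pi> = (\<lambda>a. \<Oplus>\<^bsub>P\<^esub>b\<in>{b\<in>?B. a b \<noteq> \<zero>\<^bsub>R\<^esub>}. a b \<odot>\<^bsub>P\<^esub> b)"
 have \<pi>: "\<pi> \<in> module_hom R ?F P" unfolding \<pi>_def by (rule functionals_hom[OF mF mP P.R.free_mod_functionals]) auto
 \<comment> \<open>Indicator functions embed the elements of \<open>P\<close> into the function type
   over which \<open>projective_module\<close> quantifies; \<open>N\<close> is the copy of
   \<open>P\<close> there. Injectivity needs 1 \<noteq> 0.\<close>
 define j where "j x = (\<lambda>y. if y = x then \<one>\<^bsub>R\<^esub> else \<zero>\<^bsub>R\<^esub>)" for x :: 'p
 define i where "i = inv_into UNIV j"
 have "inj j"
 proof (rule injI)
  fix x y assume "j x = j y"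
  then have "j x x = j y x" by simp
  then show "x = y" using nontriv by (auto simp: j_def split: if_splits)
 qed
 then have ij [simp]: "i (j x) = x" for x by (simp add: i_def)
 define N :: "('r, 'p => 'r) module" where
  "N = \<lparr>carrier = j ` carrier P, monoid.mult = undefined, monoid.one = undefined, ring.zero = j \<zero>\<^bsub>P\<^esub>,
     ring.add = (\<lambda>a b. j (i a \<oplus>\<^bsub>P\<^esub> i b)), module.smult = (\<lambda>r a. j (r \<odot>\<^bsub>P\<^esub> i a))\<rparr>"
 have mN: "module R N" by (rule module_transport[OF mP, of i]) (auto simp: N_def inj_on_def)
 have g: "(\<lambda>a. j (\<pi> a)) \<in> module_hom R ?F N" using \<pi> by (auto simp: module_hom_def N_def)
 have f: "j \<in> module_hom R P N" by (auto simp: module_hom_def N_def)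
 have "\<pi> (unit_vec R b) = b" if "b \<in> ?B" for b
 proof -
  have "{c\<in>?B. unit_vec R b c \<noteq> \<zero>\<^bsub>R\<^esub>} = {b}" using that nontriv by (auto simp: unit_vec_def)
  then show ?thesis using that unfolding \<pi>_def by (simp add: unit_vec_def)
 qed
 then have "?B \<subseteq> \<pi> ` carrier ?F" using P.R.unit_vec_carrier[of _ ?B] by force
 moreover have "\<pi> ` carrier ?F \<subseteq> ?B" using module_hom_closed[OF \<pi>] by blast
 ultimately have "\<pi> ` carrier ?F = ?B" by blast
 then have "(\<lambda>a. j (\<pi> a)) ` carrier ?F = carrier N" by (simp add: N_def image_image[symmetric])
 then obtain h where h: "h \<in> module_hom R P ?F" "!!x. x \<in> carrier P ==> j (\<pi> (h x)) = j x"
  using P mF mN g f unfolding projective_module_def by blast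
 have \<pi>h: "\<pi> (h x) = x" if "x \<in> carrier P" for x using h(2)[OF that] ij by metis
 have hc: "h x \<in> carrier ?F" if "x \<in> carrier P" for x using module_hom_closed[OF h(1)] that by blast
 have "dual_basis R P (carrier P) (\<lambda>b. b) (\<lambda>b x. h x b)" unfolding dual_basis_def functionals_def
 proof (intro conjI ballI)
  fix b x assume "b \<in> ?B" "x \<in> ?B"
  then show "h x b \<in> carrier R" using hc P.R.free_mod_carrier by blast
 next
  fix b x y assume "b \<in> ?B" "x \<in> ?B" "y \<in> ?B"
  then show "h (x \<oplus>\<^bsub>P\<^esub> y) b = h x b \<oplus>\<^bsub>R\<^esub> h y b" by (simp add: module_hom_add[OF h(1)] P.R.free_mod_simps)
 next
  fix b x r assume "b \<in> ?B" "x \<in> ?B" "r \<in> carrier R"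
  then show "h (r \<odot>\<^bsub>P\<^esub> x) b = r \<otimes>\<^bsub>R\<^esub> h x b" by (simp add: module_hom_smult[OF h(1)] P.R.free_mod_simps)
 next
  fix x assume x: "x \<in> ?B"
  then show "finite {b \<in> ?B. h x b \<noteq> \<zero>\<^bsub>R\<^esub>}"
   using hc[OF x] P.R.free_mod_carrier[of "h x" ?B] by (auto intro: rev_finite_subset)
  show "x = (\<Oplus>\<^bsub>P\<^esub>b\<in>{b \<in> ?B. h x b \<noteq> \<zero>\<^bsub>R\<^esub>}. h x b \<odot>\<^bsub>P\<^esub> b)" using \<pi>h[OF x] by (simp add: \<pi>_def)
 qed auto
 then show ?thesis by blast
qed

text \<open>In the graded case an arbitrary lift h is replaced by its part of degree 0, which sends
  x to the sum over i of the i-th component of h(x_i). Since f and g preserve degrees, this is still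
  a lift.\<close>

lemma projective_lift:
 assumes R: "b ==> gring_ok R" and nontriv: "\<one>\<^bsub>R\<^esub> \<noteq> \<zero>\<^bsub>R\<^esub>"
  and P: "gmod b R P" "projective_module R P" and M: "gmod b R M" and N: "gmod b R N"
  and g: "g \<in> homs b R M N" and f: "f \<in> homs b R P N" and im: "f ` carrier P \<subseteq> g ` carrier M"
 shows "\<exists>h\<in>homs b R P M. \<forall>x\<in>carrier P. g (h x) = f x"
proof -
 have mods: "module R P" "module R M" "module R N" using P M N by (auto simp: gmod_def)
 interpret P: module R P by (rule mods)
 interpret M: module R M by (rule mods)
 interpret N: module R N by (rule mods)
 obtain \<phi> where "dual_basis R P (carrier P) (\<lambda>b. b) \<phi>" using projective_dual_basis[OF P(2) nontriv] by blast
 from dual_basis_lift[OF mods this homs_hom[OF g] homs_hom[OF f] im]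
 obtain h where h: "h \<in> module_hom R P M" "!!x. x \<in> carrier P ==> g (h x) = f x" by blast
 show ?thesis
 proof (cases b)
  case False
  then show ?thesis using h by (auto simp: homs_def)
 next
  case True
  have gP: "graded_module R P" and gM: "graded_module R M" and gN: "graded_module R N" and Rok: "gring_ok R"
   and gg: "g \<in> gr_hom R M N" and gf: "f \<in> gr_hom R P N"
   using P M N R g f True by (auto simp: gmod_def homs_def)
  have hc: "h x \<in> carrier M" if "x \<in> carrier P" for x using module_hom_closed[OF h(1)] that by blast
  have h0: "h \<zero>\<^bsub>P\<^esub> = \<zero>\<^bsub>M\<^esub>" by (rule hom_zero[OF mods(1,2) h(1)])
  have M0: "gdec M \<zero>\<^bsub>M\<^esub> i = \<zero>\<^bsub>M\<^esub>" for i using gdec_homog[OF gM graded_moduleD(3)[OF gM, of i]] by simp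
  define k where "k = (\<lambda>x. \<Oplus>\<^bsub>M\<^esub>i\<in>{i. gdec P x i \<noteq> \<zero>\<^bsub>P\<^esub>}. gdec M (h (gdec P x i)) i)"
  have kc: "gdec M (h (gdec P x i)) i \<in> carrier M" if "x \<in> carrier P" for x i
   using gdec(4)[OF gM hc[OF gdec(4)[OF gP that]]] .
  have kS: "k x = (\<Oplus>\<^bsub>M\<^esub>i\<in>S. gdec M (h (gdec P x i)) i)"
   if "x \<in> carrier P" "finite S" "{i. gdec P x i \<noteq> \<zero>\<^bsub>P\<^esub>} \<subseteq> S" for x S
   unfolding k_def using that kc by (intro M.add.finprod_mono_neutral_cong_left) (auto simp: h0 M0)
  have kh: "k x = gdec M (h x) i" if x: "x \<in> mpart P i" for x i
  proof -
   have xc: "x \<in> carrier P" using x graded_moduleD(2)[OF gP] by blast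
   have "k x = (\<Oplus>\<^bsub>M\<^esub>j\<in>{i}. gdec M (h (gdec P x j)) j)"
    using xc by (intro kS) (auto simp: gdec_homog[OF gP x] split: if_splits)
   also have "... = gdec M (h x) i" using gdec(4)[OF gM hc[OF xc]] by (simp add: gdec_homog[OF gP x])
   finally show ?thesis .
  qed
  have kadd: "k x \<in> carrier M \<and> k (x \<oplus>\<^bsub>P\<^esub> y) = k x \<oplus>\<^bsub>M\<^esub> k y" if xy: "x \<in> carrier P" "y \<in> carrier P" for x y
  proof
   show "k x \<in> carrier M" unfolding k_def using kc xy by (intro M.finsum_closed) auto
   let ?S = "{i. gdec P x i \<noteq> \<zero>\<^bsub>P\<^esub>} \<union> {i. gdec P y i \<noteq> \<zero>\<^bsub>P\<^esub>}"
   have S: "finite ?S" using gdec(2)[OF gP] xy by auto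
   have "k (x \<oplus>\<^bsub>P\<^esub> y) = (\<Oplus>\<^bsub>M\<^esub>i\<in>?S. gdec M (h (gdec P (x \<oplus>\<^bsub>P\<^esub> y) i)) i)"
    using xy S by (intro kS) (auto simp: gdec_add[OF gP])
   also have "... = (\<Oplus>\<^bsub>M\<^esub>i\<in>?S. gdec M (h (gdec P x i)) i \<oplus>\<^bsub>M\<^esub> gdec M (h (gdec P y i)) i)"
    using xy kc gdec(4)[OF gP] hc
    by (intro M.add.finprod_cong') (auto simp: gdec_add[OF gP] gdec_add[OF gM] module_hom_add[OF h(1)])
   also have "... = (\<Oplus>\<^bsub>M\<^esub>i\<in>?S. gdec M (h (gdec P x i)) i) \<oplus>\<^bsub>M\<^esub> (\<Oplus>\<^bsub>M\<^esub>i\<in>?S. gdec M (h (gdec P y i)) i)"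
    using kc xy by (intro M.finsum_addf) auto
   also have "... = k x \<oplus>\<^bsub>M\<^esub> k y" using kS[OF xy(1) S] kS[OF xy(2) S] by auto
   finally show "k (x \<oplus>\<^bsub>P\<^esub> y) = k x \<oplus>\<^bsub>M\<^esub> k y" .
  qed
  have "k \<in> gr_hom R P M"
  proof (rule gr_homI[OF Rok gP gM _ kadd])
   show "k x \<in> mpart M i" if "x \<in> mpart P i" for i x
   proof -
    have "x \<in> carrier P" using that graded_moduleD(2)[OF gP] by blast
    then show ?thesis unfolding kh[OF that] by (rule gdec(1)[OF gM hc])
   qed
   fix i j r x assume rx: "r \<in> rpart R i" "x \<in> mpart P j"
   have xc: "x \<in> carrier P" and rc: "r \<in> carrier R" using rx graded_moduleD(2)[OF gP] rpart_carrier[OF Rok] by blast+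
   have "k (r \<odot>\<^bsub>P\<^esub> x) = gdec M (h (r \<odot>\<^bsub>P\<^esub> x)) (i + j)" by (rule kh[OF graded_moduleD(5)[OF gP rx]])
   also have "... = r \<odot>\<^bsub>M\<^esub> gdec M (h x) j"
    using gdec_smult[OF Rok gM rx(1) hc[OF xc], of "i + j"] by (simp add: module_hom_smult[OF h(1) rc xc])
   finally show "k (r \<odot>\<^bsub>P\<^esub> x) = r \<odot>\<^bsub>M\<^esub> k x" by (simp add: kh[OF rx(2)])
  qed
  moreover have "g (k x) = f x" if x: "x \<in> carrier P" for x using gP x
  proof (induction x rule: graded_induct)
   case (homog i y)
   then have yc: "y \<in> carrier P" using graded_moduleD(2)[OF gP] by blast
   have "g (k y) = gdec N (g (h y)) i" unfolding kh[OF homog] by (rule gdec_hom[OF gM gN gg hc[OF yc], symmetric])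
   also have "... = f y" unfolding h(2)[OF yc] using gdec_homog[OF gN gr_homD(2)[OF gf homog]] by simp
   finally show ?case .
  next
   case (add y z)
   then show ?case using kadd
    by (simp add: module_hom_add[OF gr_homD(1)[OF gg]] module_hom_add[OF gr_homD(1)[OF gf]])
  qed
  ultimately show ?thesis using True by (auto simp: homs_def)
 qed
qed

section \<open>Comparison maps and homotopies\<close>

definition res :: "bool => 'r gring => ('r, 'm) gmodule => (nat => ('r, 'p) gmodule) => (nat => 'p => 'p) => ('p => 'm) => bool" where
 "res b R M P d e \<longleftrightarrow> projective_resolution R M P d e \<and> (b --> graded_projective_resolution R M P d e)"

lemma resD:
 assumes "res b R M P d e"
 shows "gmod b R M" "gmod b R (P m)" "projective_module R (P m)" "d m \<in> homs b R (P (Suc m)) (P m)"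
  "e \<in> homs b R (P 0) M" "e ` carrier (P 0) = carrier M"
  "d 0 ` carrier (P (Suc 0)) = {x \<in> carrier (P 0). e x = \<zero>\<^bsub>M\<^esub>}"
  "d (Suc m) ` carrier (P (Suc (Suc m))) = {x \<in> carrier (P (Suc m)). d m x = \<zero>\<^bsub>P m\<^esub>}"
  "x \<in> carrier (P (Suc 0)) ==> e (d 0 x) = \<zero>\<^bsub>M\<^esub>"
  "x \<in> carrier (P (Suc (Suc m))) ==> d m (d (Suc m) x) = \<zero>\<^bsub>P m\<^esub>"
proof -
 have "projective_resolution R M P d e" "b --> graded_projective_resolution R M P d e" using assms by (auto simp: res_def)
 then show "gmod b R M" "gmod b R (P m)" "projective_module R (P m)" "d m \<in> homs b R (P (Suc m)) (P m)"
  "e \<in> homs b R (P 0) M" "e ` carrier (P 0) = carrier M"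
  and 1: "d 0 ` carrier (P (Suc 0)) = {x \<in> carrier (P 0). e x = \<zero>\<^bsub>M\<^esub>}"
  and 2: "d (Suc m) ` carrier (P (Suc (Suc m))) = {x \<in> carrier (P (Suc m)). d m x = \<zero>\<^bsub>P m\<^esub>}"
  unfolding projective_resolution_def graded_projective_resolution_def mod_ker_def gmod_def homs_def projective_module_def
  by auto
 show "x \<in> carrier (P (Suc 0)) ==> e (d 0 x) = \<zero>\<^bsub>M\<^esub>" using 1 by blast
 show "x \<in> carrier (P (Suc (Suc m))) ==> d m (d (Suc m) x) = \<zero>\<^bsub>P m\<^esub>" using 2 by blast
qed

text \<open>The maps are chosen one after the other. The invariant carried along, that f_m d_m lands
  in the image of the target differential, is exactly what the next lifting requires.\<close>

lemma comparison:
 assumes R: "b ==> gring_ok R" and nontriv: "\<one>\<^bsub>R\<^esub> \<noteq> \<zero>\<^bsub>R\<^esub>"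
  and P: "res b R C P d e" and Q: "res b R C Q d' e'"
 shows "\<exists>f. (\<forall>m. f m \<in> homs b R (P m) (Q m)) \<and> (\<forall>x\<in>carrier (P 0). e' (f 0 x) = e x) \<and>
  (\<forall>m. \<forall>x\<in>carrier (P (Suc m)). d' m (f (Suc m) x) = f m (d m x))"
proof -
 let ?Q = "\<lambda>m u. u \<in> homs b R (P m) (Q m) \<and> (m = 0 --> (\<forall>x\<in>carrier (P 0). e' (u x) = e x)) \<and>
   (\<forall>x\<in>carrier (P (Suc m)). u (d m x) \<in> d' m ` carrier (Q (Suc m)))"
 have "\<exists>f. \<forall>m. ?Q m (f m) \<and> (\<forall>x\<in>carrier (P (Suc m)). d' m (f (Suc m) x) = f m (d m x))"
 proof (rule dependent_nat_choice)
  obtain u where u: "u \<in> homs b R (P 0) (Q 0)" "!!x. x \<in> carrier (P 0) ==> e' (u x) = e x"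
   using projective_lift[OF R nontriv resD(2,3)[OF P] resD(2)[OF Q] resD(1)[OF Q] resD(5)[OF Q] resD(5)[OF P]]
    resD(6)[OF P] resD(6)[OF Q] by blast
  have "u (d 0 x) \<in> d' 0 ` carrier (Q (Suc 0))" if x: "x \<in> carrier (P (Suc 0))" for x
   unfolding resD(7)[OF Q] using homs_closed[OF resD(4)[OF P] x] homs_closed[OF u(1)] u(2) resD(9)[OF P x] by auto
  then show "\<exists>u. ?Q 0 u" using u by blast
 next
  fix u m assume u: "?Q m u"
  have ud: "(\<lambda>x. u (d m x)) \<in> homs b R (P (Suc m)) (Q m)" using homs_comp[OF resD(4)[OF P]] u by blast
  obtain w where w: "w \<in> homs b R (P (Suc m)) (Q (Suc m))" "!!x. x \<in> carrier (P (Suc m)) ==> d' m (w x) = u (d m x)"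
   using projective_lift[OF R nontriv resD(2,3)[OF P] resD(2)[OF Q] resD(2)[OF Q] resD(4)[OF Q] ud] u by blast
  have "w (d (Suc m) x) \<in> d' (Suc m) ` carrier (Q (Suc (Suc m)))" if x: "x \<in> carrier (P (Suc (Suc m)))" for x
  proof -
   have dx: "d (Suc m) x \<in> carrier (P (Suc m))" by (rule homs_closed[OF resD(4)[OF P] x])
   have "u \<zero>\<^bsub>P m\<^esub> = \<zero>\<^bsub>Q m\<^esub>" using u by (intro homs_zero[OF resD(2)[OF P] resD(2)[OF Q]]) auto
   then show ?thesis unfolding resD(8)[OF Q] using homs_closed[OF w(1) dx] w(2)[OF dx] resD(10)[OF P x] by simp
  qed
  then show "\<exists>w. ?Q (Suc m) w \<and> (\<forall>x\<in>carrier (P (Suc m)). d' m (w x) = u (d m x))"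
   using w by (intro exI[of _ w]) simp
 qed
 then obtain f where "\<forall>m. ?Q m (f m) \<and> (\<forall>x\<in>carrier (P (Suc m)). d' m (f (Suc m) x) = f m (d m x))" by (rule exE)
 then show ?thesis by (intro exI[of _ f]) simp
qed

text \<open>The invariant of the recursive choice is d' h_m d = \<phi>_m d.\<close>

lemma homotopy:
 assumes R: "b ==> gring_ok R" and nontriv: "\<one>\<^bsub>R\<^esub> \<noteq> \<zero>\<^bsub>R\<^esub>"
  and P: "res b R C P d e" and Q: "res b R C Q d' e'"
  and \<phi>: "!!m. \<phi> m \<in> homs b R (P m) (Q m)" "!!x. x \<in> carrier (P 0) ==> e' (\<phi> 0 x) = \<zero>\<^bsub>C\<^esub>"
  "!!m x. x \<in> carrier (P (Suc m)) ==> d' m (\<phi> (Suc m) x) = \<phi> m (d m x)"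
 shows "\<exists>h. (\<forall>m. h m \<in> homs b R (P m) (Q (Suc m))) \<and> (\<forall>x\<in>carrier (P 0). \<phi> 0 x = d' 0 (h 0 x)) \<and>
  (\<forall>m. \<forall>x\<in>carrier (P (Suc m)). \<phi> (Suc m) x = d' (Suc m) (h (Suc m) x) \<oplus>\<^bsub>Q (Suc m)\<^esub> h m (d m x))"
proof -
 let ?Q = "\<lambda>m u. u \<in> homs b R (P m) (Q (Suc m)) \<and> (m = 0 --> (\<forall>x\<in>carrier (P 0). \<phi> 0 x = d' 0 (u x))) \<and>
   (\<forall>x\<in>carrier (P (Suc m)). d' m (u (d m x)) = \<phi> m (d m x))"
 have "\<exists>h. \<forall>m. ?Q m (h m) \<and> (\<forall>x\<in>carrier (P (Suc m)). \<phi> (Suc m) x = d' (Suc m) (h (Suc m) x) \<oplus>\<^bsub>Q (Suc m)\<^esub> h m (d m x))"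
 proof (rule dependent_nat_choice)
  have im: "\<phi> 0 ` carrier (P 0) \<subseteq> d' 0 ` carrier (Q (Suc 0))"
   unfolding resD(7)[OF Q] using homs_closed[OF \<phi>(1)] \<phi>(2) by blast
  obtain u where u: "u \<in> homs b R (P 0) (Q (Suc 0))" "!!x. x \<in> carrier (P 0) ==> d' 0 (u x) = \<phi> 0 x"
   using projective_lift[OF R nontriv resD(2,3)[OF P] resD(2)[OF Q] resD(2)[OF Q] resD(4)[OF Q] \<phi>(1) im] by blast
  then show "\<exists>u. ?Q 0 u" using homs_closed[OF resD(4)[OF P]] by fastforce
 next
  fix u m assume u: "?Q m u"
  interpret Q0: module R "Q m" using resD(2)[OF Q] by (simp add: gmod_def)
  interpret Q: module R "Q (Suc m)" using resD(2)[OF Q] by (simp add: gmod_def)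
  have ud: "(\<lambda>x. u (d m x)) \<in> homs b R (P (Suc m)) (Q (Suc m))" using homs_comp[OF resD(4)[OF P]] u by blast
  \<comment> \<open>By the invariant d' annihilates \<phi>_(m+1) - h_m d_m, so this difference lifts
    through the next differential.\<close>
  let ?w = "\<lambda>x. \<phi> (Suc m) x \<ominus>\<^bsub>Q (Suc m)\<^esub> u (d m x)"
  have w: "?w \<in> homs b R (P (Suc m)) (Q (Suc m))" by (rule homs_minus[OF resD(2)[OF P] resD(2)[OF Q] \<phi>(1) ud])
  have wc: "?w x \<oplus>\<^bsub>Q (Suc m)\<^esub> u (d m x) = \<phi> (Suc m) x" if x: "x \<in> carrier (P (Suc m))" for x
   using homs_closed[OF \<phi>(1) x] homs_closed[OF ud x]
   by (simp add: a_minus_def Q.a_assoc Q.l_neg)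
  have im: "?w ` carrier (P (Suc m)) \<subseteq> d' (Suc m) ` carrier (Q (Suc (Suc m)))"
  proof (rule image_subsetI)
   fix x assume x: "x \<in> carrier (P (Suc m))"
   have c: "?w x \<in> carrier (Q (Suc m))" "u (d m x) \<in> carrier (Q (Suc m))"
    using homs_closed[OF w x] homs_closed[OF ud x] .
   have "d' m (?w x) \<oplus>\<^bsub>Q m\<^esub> d' m (u (d m x)) = d' m (\<phi> (Suc m) x)"
    using homs_add[OF resD(4)[OF Q] c] wc[OF x] by simp
   also have "... = d' m (u (d m x))" using u x \<phi>(3)[OF x] by simp
   finally have "d' m (?w x) = \<zero>\<^bsub>Q m\<^esub>"
    using homs_closed[OF resD(4)[OF Q] c(1)] homs_closed[OF resD(4)[OF Q] c(2)] by (metis Q0.add.r_cancel_one)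
   then show "?w x \<in> d' (Suc m) ` carrier (Q (Suc (Suc m)))" unfolding resD(8)[OF Q] using c by simp
  qed
  obtain k where k: "k \<in> homs b R (P (Suc m)) (Q (Suc (Suc m)))" "!!x. x \<in> carrier (P (Suc m)) ==> d' (Suc m) (k x) = ?w x"
   using projective_lift[OF R nontriv resD(2,3)[OF P] resD(2)[OF Q] resD(2)[OF Q] resD(4)[OF Q] w im] by blast
  have eq: "\<phi> (Suc m) x = d' (Suc m) (k x) \<oplus>\<^bsub>Q (Suc m)\<^esub> u (d m x)" if "x \<in> carrier (P (Suc m))" for x
   using wc[OF that] k(2)[OF that] by simp
  have "d' (Suc m) (k (d (Suc m) x)) = \<phi> (Suc m) (d (Suc m) x)" if x: "x \<in> carrier (P (Suc (Suc m)))" for x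
  proof -
   have dx: "d (Suc m) x \<in> carrier (P (Suc m))" by (rule homs_closed[OF resD(4)[OF P] x])
   have "u (d m (d (Suc m) x)) = \<zero>\<^bsub>Q (Suc m)\<^esub>"
    unfolding resD(10)[OF P x] using u by (intro homs_zero[OF resD(2)[OF P] resD(2)[OF Q]]) auto
   then show ?thesis using eq[OF dx] homs_closed[OF resD(4)[OF Q] homs_closed[OF k(1) dx]] by simp
  qed
  then show "\<exists>k. ?Q (Suc m) k \<and> (\<forall>x\<in>carrier (P (Suc m)). \<phi> (Suc m) x = d' (Suc m) (k x) \<oplus>\<^bsub>Q (Suc m)\<^esub> u (d m x))"
   using k(1) eq by (intro exI[of _ k]) simp
 qed
 then obtain h where "\<forall>m. ?Q m (h m) \<and> (\<forall>x\<in>carrier (P (Suc m)). \<phi> (Suc m) x = d' (Suc m) (h (Suc m) x) \<oplus>\<^bsub>Q (Suc m)\<^esub> h m (d m x))"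
  by (rule exE)
 then show ?thesis by (intro exI[of _ h]) simp
qed

section \<open>The Koszul-Tate complex\<close>

text \<open>Elements of the complex are families \<open>a I u\<close>, the coefficient of
 \<open>T\<^sub>I U\<^sup>(\<^sup>u\<^sup>)\<close>; \<open>io i\<close> is contraction with \<open>T\<^sub>i\<close>, \<open>ep i\<close> is multiplication by
 \<open>T\<^sub>i\<close> from the left.\<close>

type_synonym family = "nat set => (nat => nat) => cpoly"

text \<open>The sign of moving T_i from the left past the larger factors of T_I, where T_I is a
  product in decreasing order. A new largest index then costs no sign (\<open>sg_top\<close>), which
  suits induction on the number of variables.\<close>

definition sg :: "nat => nat set => cpoly" where "sg i I = (-1) ^ card {k\<in>I. i < k}"

definition io :: "nat => family => family" where
 "io i a = (\<lambda>I u. if i \<in> I then 0 else sg i I * a (insert i I) u)"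

definition ep :: "nat => family => family" where
 "ep i a = (\<lambda>I u. if i \<in> I then sg i I * a (I - {i}) u else 0)"

lemma sg_insert:
 assumes "finite I" "k \<notin> I"
 shows "sg i (insert k I) = (if i < k then - sg i I else sg i I)"
proof (cases "i < k")
 case True
 then have "{l\<in>insert k I. i < l} = insert k {l\<in>I. i < l}" by auto
 then show ?thesis using assms True by (simp add: sg_def)
next
 case False
 then have "{l\<in>insert k I. i < l} = {l\<in>I. i < l}" by auto
 then show ?thesis using False by (simp add: sg_def)
qed

lemma sg_insert_same: "sg i (insert i I) = sg i I"
proof -
 have "{l\<in>insert i I. i < l} = {l\<in>I. i < l}" by auto
 then show ?thesis by (simp add: sg_def)
qed

lemma sg_sq: "sg i I * sg i I = 1" unfolding sg_def by (simp add: power_mult_distrib[symmetric])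

lemma sg_polys [simp, intro]: "sg i I \<in> polys V" unfolding sg_def by (intro polys_power polys_uminus) auto

lemma sg_top: "(!!k. k \<in> I ==> k \<le> i) ==> sg i I = 1"
proof -
 assume "!!k. k \<in> I ==> k \<le> i"
 then have "{k\<in>I. i < k} = {}" by (auto simp: not_less[symmetric])
 then show ?thesis unfolding sg_def by (simp only: card.empty power_0)
qed

lemma io_io:
 assumes "finite I"
 shows "io i (io k a) I u + io k (io i a) I u = 0"
proof (cases "i = k \<or> i \<in> I \<or> k \<in> I")
 case False
 then show ?thesis using assms by (auto simp: io_def sg_insert insert_commute)
qed (auto simp: io_def)

text \<open>Together with \<open>io_io\<close> and \<open>ep_ep\<close> these are the canonical
  anticommutation relations of contraction and exterior multiplication.\<close>

lemma io_ep:
 assumes I: "finite I"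
 shows "io i (ep k a) I u + ep k (io i a) I u = (if i = k then a I u else 0)"
proof (cases "i = k")
 case True
 show ?thesis
 proof (cases "i \<in> I")
  case True
  then have "insert i (I - {i}) = I" "sg i (I - {i}) = sg i I" using sg_insert_same[of i "I - {i}"] by (auto simp: insert_absorb)
  then show ?thesis using \<open>i = k\<close> True by (simp add: io_def ep_def mult.assoc[symmetric] sg_sq)
 next
  case False
  then show ?thesis using \<open>i = k\<close> by (simp add: io_def ep_def mult.assoc[symmetric] sg_insert_same sg_sq)
 qed
next
 case False
 show ?thesis
 proof (cases "k \<in> I \<and> i \<notin> I")
  case True
  define J where "J = I - {k}"
  have J: "I = insert k J" "k \<notin> J" "i \<notin> J" "finite J" using True I by (auto simp: J_def)
  have eqs: "insert i (insert k J) - {k} = insert i J" "insert k J - {k} = J" using J False by auto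
  show ?thesis using J False unfolding J(1) io_def ep_def by (simp add: eqs sg_insert sg_insert_same)
 next
  case False
  then show ?thesis using \<open>i \<noteq> k\<close> by (auto simp: io_def ep_def)
 qed
qed

lemma ep_ep:
 assumes I: "finite I"
 shows "ep i (ep k a) I u + ep k (ep i a) I u = 0"
proof (cases "i \<noteq> k \<and> i \<in> I \<and> k \<in> I")
 case True
 define J where "J = I - {i} - {k}"
 have J: "I = insert i (insert k J)" "k \<notin> J" "i \<notin> J" "finite J" "i \<noteq> k" using True I by (auto simp: J_def)
 have eqs: "insert i (insert k J) - {i} = insert k J" "insert i (insert k J) - {k} = insert i J"
  "insert k J - {k} = J" "insert i J - {i} = J" using J by auto
 have s: "sg i (insert i (insert k J)) = sg i (insert k J)" "sg k (insert i (insert k J)) = sg k (insert i J)"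
  by (rule sg_insert_same, simp only: insert_commute[of i k J] sg_insert_same)
 show ?thesis using J unfolding J(1) ep_def by (simp add: eqs s sg_insert)
qed (auto simp: ep_def)

lemma monic_in_vx: "monic_in j 1 V (vx j)" unfolding monic_in_def
 by (rule exI[of _ "\<lambda>k. if k = 1 then 1 else 0"]) (simp add: if_distrib cong: if_cong)

section \<open>The differential and exactness of the Koszul part\<close>

text \<open>A regular sequence of relations, each written through the variables. The coefficients
  \<open>g\<close> define the elements z_j, the sum of the g_ij T_i, with boundary f_j; the divided
  power variable U_j is mapped to z_j.\<close>

locale koszul_tate =
 fixes N :: nat and f :: "nat => cpoly" and g :: "nat => nat => cpoly"
 assumes g_polys: "!!i j. g i j \<in> polys {1..N}"
  and f_eq: "!!j. j \<in> {1..N} ==> f j = (\<Sum>i\<in>{1..N}. vx i * g i j)"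
  and reg: "!!j p. j < N ==> f (Suc j) * p \<in> idl {1..N} f j ==> p \<in> idl {1..N} f j"
  and const0: "!!j p. j \<le> N ==> p \<in> idl {1..N} f j ==> lkp p 0 = 0"
begin

abbreviation (input) "V \<equiv> {1..N}"

text \<open>The operator sum over j of g_ij d/dU_j. With divided powers U^(k) goes to U^(k-1)
  without a numerical factor, so the coefficient at \<open>u\<close> is read off at \<open>u\<close>
  raised by one in place j.\<close>

definition G :: "nat => family => family" where
 "G i a = (\<lambda>I u. \<Sum>j\<in>V. g i j * a I (u(j := Suc (u j))))"

definition D :: "family => family" where
 "D a = (\<lambda>I u. \<Sum>i\<in>V. vx i * io i a I u + ep i (G i a) I u)"

lemma D_add: "D (\<lambda>I u. a I u + b I u) I u = D a I u + D b I u" unfolding D_def G_def io_def ep_def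
 by (simp add: sum.distrib[symmetric] algebra_simps sum_distrib_left if_distrib cong: if_cong)

lemma D_scale: "D (\<lambda>I u. r * a I u) I u = r * D a I u" unfolding D_def G_def io_def ep_def
 by (simp add: sum_distrib_left algebra_simps if_distrib cong: if_cong)

lemma D_minus: "D (\<lambda>I u. a I u - b I u) I u = D a I u - D b I u"
 using D_add[of a "\<lambda>I u. (-1) * b I u" I u] D_scale[of "-1" b I u] by simp

text \<open>Multiplication by T_k is a homotopy for multiplication by x_k.\<close>

lemma D_ep:
 assumes I: "finite I" and k: "k \<in> V"
 shows "D (ep k a) I u + ep k (D a) I u = vx k * a I u"
proof -
 have Gep: "G i (ep k a) = ep k (G i a)" for i
  unfolding G_def ep_def by (auto simp: fun_eq_iff sum_distrib_left algebra_simps)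
 have epD: "ep k (D a) I u = (\<Sum>i\<in>V. vx i * ep k (io i a) I u + ep k (ep i (G i a)) I u)"
  unfolding D_def by (simp add: ep_def sum_distrib_left algebra_simps sum.distrib)
 have "D (ep k a) I u + ep k (D a) I u =
  (\<Sum>i\<in>V. vx i * (io i (ep k a) I u + ep k (io i a) I u) + (ep i (ep k (G i a)) I u + ep k (ep i (G i a)) I u))"
  unfolding epD unfolding D_def Gep sum.distrib[symmetric] by (simp add: algebra_simps)
 also have "... = (\<Sum>i\<in>V. if i = k then vx k * a I u else 0)"
  by (intro sum.cong refl) (simp add: io_ep[OF I] ep_ep[OF I])
 also have "... = vx k * a I u" using k by simp
 finally show ?thesis .
qed

text \<open>D D is the sum of the f_j d/dU_j. The summands \<open>T i\<close> of D anticommute for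
  different indices; only their squares x_i G_i contribute, and x_i g_ij sums to f_j.\<close>

lemma D_D:
 assumes I: "finite I"
 shows "D (D a) I u = (\<Sum>j\<in>V. f j * a I (u(j := Suc (u j))))"
proof -
 define T where "T i a = (\<lambda>I u. vx i * io i a I u + ep i (G i a) I u)" for i and a :: family
 have DT: "D a = (\<lambda>I u. \<Sum>i\<in>V. T i a I u)" for a by (simp add: D_def T_def)
 have lin: "T i (\<lambda>I u. \<Sum>k\<in>A. b k I u) I u = (\<Sum>k\<in>A. T i (b k) I u)" for i u I A and b :: "nat => family"
 proof -
  have "G i (\<lambda>I u. \<Sum>k\<in>A. b k I u) I u = (\<Sum>k\<in>A. G i (b k) I u)" for I u
   unfolding G_def sum_distrib_left by (rule sum.swap)
  then show ?thesis unfolding T_def io_def ep_def by (simp add: sum_distrib_left sum.distrib)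
 qed
 have TT: "T i (T k a) I u = vx i * vx k * io i (io k a) I u + vx i * io i (ep k (G k a)) I u
   + vx k * ep i (io k (G i a)) I u + ep i (ep k (G i (G k a))) I u" for i k
 proof -
  have io_lin: "io i (\<lambda>I u. r * b I u + c I u) I u = r * io i b I u + io i c I u" for r b c
   by (simp add: io_def algebra_simps)
  have ep_lin: "ep i (\<lambda>I u. r * b I u + c I u) I u = r * ep i b I u + ep i c I u" for r b c
   by (simp add: ep_def algebra_simps)
  have GT: "G i (T k a) = (\<lambda>I u. vx k * io k (G i a) I u + ep k (G i (G k a)) I u)"
   unfolding T_def G_def io_def ep_def
   by (intro ext) (simp add: sum.distrib sum_distrib_left algebra_simps)
  have Tk: "T k a = (\<lambda>I u. vx k * io k a I u + ep k (G k a) I u)" by (rule T_def)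
  have "T i (T k a) I u = vx i * io i (T k a) I u + ep i (G i (T k a)) I u" by (simp only: T_def[of i "T k a"])
  also have "io i (T k a) I u = vx k * io i (io k a) I u + io i (ep k (G k a)) I u" by (simp only: Tk io_lin)
  also have "ep i (G i (T k a)) I u = vx k * ep i (io k (G i a)) I u + ep i (ep k (G i (G k a))) I u"
   by (simp only: GT ep_lin)
  finally show ?thesis by (simp add: algebra_simps)
 qed
 have GG: "G i (G k a) = G k (G i a)" for i k
 proof (intro ext)
  fix I u
  have "G i (G k a) I u = (\<Sum>j\<in>V. \<Sum>l\<in>V. g i j * (g k l * a I (u(j := Suc (u j), l := Suc ((u(j := Suc (u j))) l)))))"
   by (simp add: G_def sum_distrib_left)
  also have "... = (\<Sum>l\<in>V. \<Sum>j\<in>V. g i j * (g k l * a I (u(j := Suc (u j), l := Suc ((u(j := Suc (u j))) l)))))"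
   by (rule sum.swap)
  also have "... = (\<Sum>l\<in>V. \<Sum>j\<in>V. g k l * (g i j * a I (u(l := Suc (u l), j := Suc ((u(l := Suc (u l))) j)))))"
  proof (intro sum.cong refl)
   fix l j
   have "u(j := Suc (u j), l := Suc ((u(j := Suc (u j))) l)) = u(l := Suc (u l), j := Suc ((u(l := Suc (u l))) j))"
    by (auto simp: fun_eq_iff)
   then show "g i j * (g k l * a I (u(j := Suc (u j), l := Suc ((u(j := Suc (u j))) l)))) =
    g k l * (g i j * a I (u(l := Suc (u l), j := Suc ((u(l := Suc (u l))) j))))" by (simp add: algebra_simps)
  qed
  also have "... = G k (G i a) I u" by (simp add: G_def sum_distrib_left)
  finally show "G i (G k a) I u = G k (G i a) I u" .
 qed
 have anti: "T i (T k a) I u + T k (T i a) I u = (if i = k then 2 * (vx i * G i a I u) else 0)" for i k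
 proof -
  have "T i (T k a) I u + T k (T i a) I u =
   vx i * vx k * (io i (io k a) I u + io k (io i a) I u)
   + vx i * (io i (ep k (G k a)) I u + ep k (io i (G k a)) I u)
   + vx k * (io k (ep i (G i a)) I u + ep i (io k (G i a)) I u)
   + (ep i (ep k (G i (G k a))) I u + ep k (ep i (G i (G k a))) I u)"
   unfolding TT GG[of k i] by (simp add: algebra_simps)
  also have "... = (if i = k then 2 * (vx i * G i a I u) else 0)"
   unfolding io_io[OF I] ep_ep[OF I] io_ep[OF I] by auto
  finally show ?thesis .
 qed
 have DD: "D (D a) I u = (\<Sum>i\<in>V. \<Sum>k\<in>V. T i (T k a) I u)"
 proof -
  have "D (D a) I u = (\<Sum>i\<in>V. T i (D a) I u)" by (rule fun_cong[OF fun_cong[OF DT]])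
  also have "... = (\<Sum>i\<in>V. \<Sum>k\<in>V. T i (T k a) I u)" by (intro sum.cong refl) (simp only: DT[of a] lin)
  finally show ?thesis .
 qed
 \<comment> \<open>Adding the double sum to its transpose turns each pair into an anticommutator;
   the factor 2 is cancelled afterwards.\<close>
 have "2 * D (D a) I u = (\<Sum>i\<in>V. \<Sum>k\<in>V. T i (T k a) I u + T k (T i a) I u)"
  unfolding DD sum.distrib mult_2 by (subst (2) sum.swap) simp
 also have "... = 2 * (\<Sum>i\<in>V. vx i * G i a I u)" unfolding anti sum_distrib_left by (simp add: sum.delta)
 finally have "D (D a) I u = (\<Sum>i\<in>V. vx i * G i a I u)" by simp
 also have "... = (\<Sum>j\<in>V. \<Sum>i\<in>V. vx i * g i j * a I (u(j := Suc (u j))))"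
  unfolding G_def sum_distrib_left mult.assoc by (rule sum.swap)
 also have "... = (\<Sum>j\<in>V. f j * a I (u(j := Suc (u j))))" by (intro sum.cong refl) (simp add: f_eq sum_distrib_right)
 finally show ?thesis .
qed

text \<open>Basis elements of homological degree m: each T_i counts 1, each U_k counts 2. The bounds
  i and j are separate because exactness is proved by adjoining exterior variables with j = 0 and
  then divided power variables with i = N.\<close>

definition idx :: "nat => nat => nat => (nat set \<times> (nat => nat)) set" where
 "idx i j m = {(I, u). I \<subseteq> {1..i} \<and> (\<forall>k. k \<notin> {1..j} --> u k = 0) \<and> card I + 2 * (\<Sum>k\<in>{1..j}. u k) = m}"

lemma idx_iff: "(I, u) \<in> idx i j m \<longleftrightarrow>
  I \<subseteq> {1..i} \<and> (\<forall>k. k \<notin> {1..j} --> u k = 0) \<and> card I + 2 * (\<Sum>k\<in>{1..j}. u k) = m"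
 by (simp add: idx_def)

definition fam :: "nat => nat => nat => family set" where
 "fam i j m = {a. (\<forall>I u. a I u \<in> polys V) \<and> (\<forall>I u. (I, u) \<notin> idx i j m --> a I u = 0)}"

lemma fam_polys: "a \<in> fam i j m ==> a I u \<in> polys V"
 and fam_0: "a \<in> fam i j m ==> (I, u) \<notin> idx i j m ==> a I u = 0"
 by (auto simp: fam_def)

lemma fam_add: "a \<in> fam i j m ==> b \<in> fam i j m ==> (\<lambda>I u. a I u + b I u) \<in> fam i j m"
 and fam_minus: "a \<in> fam i j m ==> b \<in> fam i j m ==> (\<lambda>I u. a I u - b I u) \<in> fam i j m"
 and fam_scale: "r \<in> polys V ==> a \<in> fam i j m ==> (\<lambda>I u. r * a I u) \<in> fam i j m"
 and fam_zero: "(\<lambda>I u. 0) \<in> fam i j m"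
 by (auto simp: fam_def)

lemma idx_sum_mono:
 assumes "\<forall>k. k \<notin> {1..j} --> u k = 0" "j \<le> (j'::nat)"
 shows "(\<Sum>k\<in>{1..j'}. u k) = (\<Sum>k\<in>{1..j}. u k :: nat)"
 using assms by (intro sum.mono_neutral_right) auto

lemma idx_mono: "i \<le> i' ==> j \<le> j' ==> idx i j m \<subseteq> idx i' j' m"
proof
 fix x assume ij: "i \<le> i'" "j \<le> j'" and "x \<in> idx i j m"
 then obtain I u where x: "x = (I, u)" "I \<subseteq> {1..i}" "\<forall>k. k \<notin> {1..j} --> u k = 0" "card I + 2 * (\<Sum>k\<in>{1..j}. u k) = m"
  by (auto simp: idx_def)
 then show "x \<in> idx i' j' m" using ij idx_sum_mono[OF x(3) ij(2)] by (auto simp: idx_def)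
qed

lemma fam_mono: "i \<le> i' ==> j \<le> j' ==> a \<in> fam i j m ==> a \<in> fam i' j' m"
 unfolding fam_def using idx_mono[of i i' j j' m] by blast

lemma idx_finite_set: "(I, u) \<in> idx i j m ==> finite I" by (auto simp: idx_def intro: finite_subset)

lemma fam_infinite: "a \<in> fam i j m ==> infinite I ==> a I u = 0" using fam_0 idx_finite_set by blast

lemma D_infinite:
 assumes "!!I u. infinite I ==> a I u = 0" "infinite I"
 shows "D a I u = 0"
 using assms unfolding D_def G_def io_def ep_def by (intro sum.neutral) auto

lemma D_polys:
 assumes "!!I u. a I u \<in> polys V"
 shows "D a I u \<in> polys V"
proof -
 have G: "G i a I u \<in> polys V" for i I u unfolding G_def by (intro polys_sum polys_mult g_polys assms)
 have "vx i * io i a I u + ep i (G i a) I u \<in> polys V" if i: "i \<in> V" for i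
 proof (cases "i \<in> I")
  case True
  then have "vx i * io i a I u + ep i (G i a) I u = sg i I * G i a (I - {i}) u" by (simp add: io_def ep_def)
  also have "... \<in> polys V" by (rule polys_mult[OF sg_polys G])
  finally show ?thesis .
 next
  case False
  then have "vx i * io i a I u + ep i (G i a) I u = vx i * (sg i I * a (insert i I) u)" by (simp add: io_def ep_def)
  also have "... \<in> polys V" by (rule polys_mult[OF polys_vx[OF i] polys_mult[OF sg_polys assms]])
  finally show ?thesis .
 qed
 then show ?thesis unfolding D_def by (rule polys_sum)
qed

lemma fam_ep:
 assumes a: "a \<in> fam i j m" and i: "i < i'" 
 shows "ep i' a \<in> fam i' j (Suc m)"
 unfolding fam_def
proof (intro CollectI conjI allI impI)
 show "ep i' a I u \<in> polys V" for I u using fam_polys[OF a] by (auto simp: ep_def)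
 fix I u assume n: "(I, u) \<notin> idx i' j (Suc m)"
 show "ep i' a I u = 0"
 proof (cases "i' \<in> I \<and> (I - {i'}, u) \<in> idx i j m")
  case True
  then have x: "i' \<in> I" "I - {i'} \<subseteq> {1..i}" "\<forall>k. k \<notin> {1..j} --> u k = 0"
   "card (I - {i'}) + 2 * (\<Sum>k\<in>{1..j}. u k) = m" unfolding idx_iff by blast+
  have "finite (I - {i'})" using finite_subset[OF x(2)] by simp
  then have "card I = Suc (card (I - {i'}))" using x(1) by (intro card.remove) simp_all
  moreover have "I \<subseteq> {1..i'}" using x(2) i by fastforce
  ultimately have "(I, u) \<in> idx i' j (Suc m)" using x by (simp add: idx_def)
  then show ?thesis using n by blast
 next
  case False
  then show ?thesis using fam_0[OF a] by (auto simp: ep_def)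
 qed
qed

text \<open>The image of U_j may involve every T_i, so the truncated family is a subcomplex when it
  has no U or all T.\<close>

lemma fam_D:
 assumes a: "a \<in> fam i j (Suc m)" and ij: "i \<le> N" "j \<le> N" "j = 0 \<or> i = N"
 shows "D a \<in> fam i j m"
 unfolding fam_def
proof (intro CollectI conjI allI impI)
 show "D a I u \<in> polys V" for I u using fam_polys[OF a] by (rule D_polys)
 fix I u assume n: "(I, u) \<notin> idx i j m"
 have 1: "io k a I u = 0" for k
 proof (cases "k \<notin> I \<and> (insert k I, u) \<in> idx i j (Suc m)")
  case True
  then have "finite I" using idx_finite_set[of "insert k I" u i j "Suc m"] by simp
  then have "(I, u) \<in> idx i j m" using True by (auto simp: idx_def)
  then show ?thesis using n by blast
 next
  case False
  then show ?thesis using fam_0[OF a] by (auto simp: io_def)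
 qed
 have 2: "ep k (G k a) I u = 0" if k: "k \<in> V" for k
 proof -
  have "a (I - {k}) (u(l := Suc (u l))) = 0" if kI: "k \<in> I" and l: "l \<in> V" for l
  proof (cases "(I - {k}, u(l := Suc (u l))) \<in> idx i j (Suc m)")
   case True
   then have sub: "I - {k} \<subseteq> {1..i}" and z: "\<forall>x. x \<notin> {1..j} --> (u(l := Suc (u l))) x = 0"
    and c: "card (I - {k}) + 2 * (\<Sum>x\<in>{1..j}. (u(l := Suc (u l))) x) = Suc m" by (auto simp: idx_def)
   have lj: "l \<in> {1..j}"
   proof (rule ccontr)
    assume "l \<notin> {1..j}"
    then have "(u(l := Suc (u l))) l = 0" using z by blast
    then show False by simp
   qed
   then have iN: "i = N" using ij(3) by auto
   have zu: "\<forall>x. x \<notin> {1..j} --> u x = 0"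
   proof (intro allI impI)
    fix x assume x: "x \<notin> {1..j}"
    then have "(u(l := Suc (u l))) x = 0" "x \<noteq> l" using z lj by blast+
    then show "u x = 0" by simp
   qed
   have "(\<Sum>x\<in>{1..j}. (u(l := Suc (u l))) x) = Suc (u l) + (\<Sum>x\<in>{1..j} - {l}. (u(l := Suc (u l))) x)"
    using lj by (subst sum.remove[of _ l]) auto
   also have "... = Suc (\<Sum>x\<in>{1..j}. u x)" using lj by (subst (2) sum.remove[of _ l]) (auto intro!: sum.cong)
   finally have s: "(\<Sum>x\<in>{1..j}. (u(l := Suc (u l))) x) = Suc (\<Sum>x\<in>{1..j}. u x)" .
   have fin: "finite I" using finite_subset[OF sub] by simp
   have "I \<subseteq> {1..i}" using sub k kI iN by blast
   moreover have "card I + 2 * (\<Sum>x\<in>{1..j}. u x) = m" using c s card.remove[OF fin kI] by linarith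
   ultimately have "(I, u) \<in> idx i j m" using zu by (simp add: idx_def)
   then show ?thesis using n by blast
  qed (rule fam_0[OF a])
  then show ?thesis by (auto simp: ep_def G_def)
 qed
 show "D a I u = 0" unfolding D_def using 1 2 by (intro sum.neutral) simp
qed

text \<open>The scalar \<open>q\<close> as an element of degree 0; by \<open>fam_0_dl\<close> all
  elements of degree 0 arise so.\<close>

definition dl :: "cpoly => family" where
 "dl q = (\<lambda>I u. if I = {} \<and> u = (\<lambda>_. 0) then q else 0)"

lemma idx_0: "idx i j 0 = {({}, \<lambda>_. 0)}"
proof -
 have "I = {} \<and> u = (\<lambda>_. 0)" if "(I, u) \<in> idx i j 0" for I u
 proof -
  have "card I = 0" "(\<Sum>k\<in>{1..j}. u k) = 0" "\<forall>k. k \<notin> {1..j} --> u k = 0" using that by (auto simp: idx_def)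
  then have "I = {}" "\<forall>k. u k = 0" using idx_finite_set[OF that] by (auto simp del: One_nat_def)
  then show ?thesis by auto
 qed
 then show ?thesis by (auto simp: idx_def)
qed

lemma fam_dl: "q \<in> polys V ==> dl q \<in> fam i j 0" by (auto simp: fam_def idx_0 dl_def)

lemma fam_0_dl: "a \<in> fam i j 0 ==> a = dl (a {} (\<lambda>_. 0))" unfolding fam_def idx_0 dl_def by (intro ext) auto

lemma D_dl: "D (dl q) I u = 0"
proof -
 have 1: "dl q I (u(j := Suc (u j))) = 0" for I j
 proof -
  have "u(j := Suc (u j)) \<noteq> (\<lambda>_. 0)" by (metis fun_upd_same nat.distinct(1))
  then show ?thesis by (simp add: dl_def)
 qed
 have 2: "dl q (insert i I) u = 0" for i by (simp add: dl_def)
 show ?thesis unfolding D_def G_def io_def ep_def by (intro sum.neutral ballI) (simp add: 1 2)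
qed

lemma D_deg1:
 assumes a: "a \<in> fam i j 1" and i: "i \<le> N"
 shows "D a {} (\<lambda>_. 0) \<in> idl V vx i"
proof -
 have "D a {} (\<lambda>_. 0) = (\<Sum>k\<in>V. vx k * a {k} (\<lambda>_. 0))" unfolding D_def io_def ep_def by (simp add: sg_def)
 also have "... = (\<Sum>k\<in>{1..i}. vx k * a {k} (\<lambda>_. 0))"
 proof (rule sum.mono_neutral_right)
  show "\<forall>k\<in>V - {1..i}. vx k * a {k} (\<lambda>_. 0) = 0"
  proof
   fix k assume "k \<in> V - {1..i}"
   then have "({k}, \<lambda>_. 0) \<notin> idx i j 1" by (auto simp: idx_def)
   then show "vx k * a {k} (\<lambda>_. 0) = 0" using fam_0[OF a] by simp
  qed
 qed (use i in auto)
 also have "... \<in> idl V vx i" unfolding idl_def using fam_polys[OF a]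
  by (intro CollectI exI[of _ "\<lambda>k. a {k} (\<lambda>_. 0)"]) simp
 finally show ?thesis .
qed

text \<open>Let t = i + 1 and a = a0 + T_t b be a cycle. Then D b = 0 and D a0 = -x_t b. If b = D c,
  then a0 + x_t c is a cycle free of T_t, hence some D e, and a = D(e - T_t c). The second conjunct
  describes degree 0, where not every element is a boundary.\<close>

lemma koszul_exact:
 "i \<le> N ==>
  (\<forall>m a. m \<ge> 1 --> a \<in> fam i 0 m --> D a = (\<lambda>I u. 0) --> (\<exists>b\<in>fam i 0 (Suc m). D b = a)) \<and>
  (\<forall>p\<in>idl V vx i. \<exists>b\<in>fam i 0 1. D b = dl p)"
proof (induction i)
 case 0
 have "a = (\<lambda>I u. 0)" if "a \<in> fam 0 0 m" "m \<ge> 1" for a m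
 proof (intro ext)
  fix I u
  have "(I, u) \<notin> idx 0 0 m" using that(2) by (auto simp: idx_def)
  then show "a I u = 0" using that(1) fam_0 by blast
 qed
 moreover have D0: "D (\<lambda>I u. 0) = (\<lambda>I u. 0)" using D_scale[of 0 "\<lambda>I u. 0"] by (intro ext) simp
 ultimately have "\<exists>b\<in>fam 0 0 (Suc m). D b = a" if "a \<in> fam 0 0 m" "m \<ge> 1" for a m
  using that by (intro bexI[of _ "\<lambda>I u. 0"] fam_zero) simp
 moreover have "dl 0 = (\<lambda>I u. 0)" by (auto simp: dl_def fun_eq_iff)
 then have "\<exists>b\<in>fam 0 0 1. D b = dl p" if "p \<in> idl V vx 0" for p
  using that by (intro bexI[of _ "\<lambda>I u. 0"] fam_zero) (simp add: idl_def D0)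
 ultimately show ?case by (intro conjI allI impI ballI)
next
 case (Suc i)
 let ?t = "Suc i"
 have tV: "?t \<in> V" and iN: "i \<le> N" using Suc.prems by auto
 have ex: "!!m a. m \<ge> 1 ==> a \<in> fam i 0 m ==> D a = (\<lambda>I u. 0) ==> \<exists>b\<in>fam i 0 (Suc m). D b = a"
  and ex0: "!!p. p \<in> idl V vx i ==> \<exists>b\<in>fam i 0 1. D b = dl p" using Suc.IH[OF iN] by simp_all
 have mono: "a \<in> fam ?t 0 m" if "a \<in> fam i 0 m" for a m using fam_mono[OF _ _ that, of ?t 0] by simp
 have ep: "ep ?t a \<in> fam ?t 0 (Suc m)" if "a \<in> fam i 0 m" for a m using fam_ep[OF that] by simp
 have top: "a I u = 0" if "a \<in> fam i 0 m" "?t \<in> I" for a m I u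
 proof -
  have "(I, u) \<notin> idx i 0 m" using that(2) unfolding idx_def by auto
  then show ?thesis by (rule fam_0[OF that(1)])
 qed
 have Dep: "D (ep ?t c) I u = vx ?t * c I u - ep ?t (D c) I u" if "c \<in> fam i 0 m" for c m I u
 proof (cases "finite I")
  case True
  then show ?thesis using D_ep[OF True tV, of c u] by (simp add: algebra_simps)
 next
  case False
  then show ?thesis using fam_infinite[OF that] D_infinite[of "ep ?t c"] D_infinite[of c]
   by (auto simp: ep_def fam_infinite[OF that])
 qed
 have two: "\<exists>b\<in>fam ?t 0 (Suc m). D b = a" if m: "m \<ge> 1" and a: "a \<in> fam ?t 0 m" and Da: "D a = (\<lambda>I u. 0)" for m a
 proof -
  obtain m' where m': "m = Suc m'" using m by (cases m) auto
  \<comment> \<open>Since t is the largest index, the signs in T_t b are 1, and the coefficients of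
    \<open>b\<close> and \<open>a0\<close> are read off directly.\<close>
  define b where "b = (\<lambda>I u. if ?t \<in> I then 0 else a (insert ?t I) u)"
  define a0 where "a0 = (\<lambda>I u. if ?t \<in> I then 0 else a I u)"
  have b: "b \<in> fam i 0 m'" unfolding fam_def
  proof (intro CollectI conjI allI impI)
   show "b I u \<in> polys V" for I u using fam_polys[OF a] by (auto simp: b_def)
   fix I u assume n: "(I, u) \<notin> idx i 0 m'"
   show "b I u = 0"
   proof (cases "?t \<notin> I \<and> (insert ?t I, u) \<in> idx ?t 0 m")
    case True
    then have "finite I" using idx_finite_set[of "insert ?t I" u ?t 0 m] by simp
    then have "(I, u) \<in> idx i 0 m'" using True m' by (auto simp: idx_def le_Suc_eq)
    then show ?thesis using n by blast
   qed (use fam_0[OF a] in \<open>auto simp: b_def\<close>)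
  qed
  have a0: "a0 \<in> fam i 0 m" unfolding fam_def
  proof (intro CollectI conjI allI impI)
   show "a0 I u \<in> polys V" for I u using fam_polys[OF a] by (auto simp: a0_def)
   fix I u assume n: "(I, u) \<notin> idx i 0 m"
   show "a0 I u = 0"
   proof (cases "?t \<notin> I \<and> (I, u) \<in> idx ?t 0 m")
    case True
    then have "(I, u) \<in> idx i 0 m" by (auto simp: idx_def le_Suc_eq)
    then show ?thesis using n by blast
   qed (use fam_0[OF a] in \<open>auto simp: a0_def\<close>)
  qed
  have sg1: "sg ?t I = 1" if "(I, u) \<in> idx ?t 0 m" for I u using that by (intro sg_top) (auto simp: idx_def)
  have dec: "a = (\<lambda>I u. a0 I u + ep ?t b I u)"
  proof (intro ext)
   fix I u
   show "a I u = a0 I u + ep ?t b I u"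
   proof (cases "(I, u) \<in> idx ?t 0 m")
    case True
    then show ?thesis using sg1[OF True] by (auto simp: a0_def ep_def b_def insert_absorb)
   next
    case False
    then have "a I u = 0" using fam_0[OF a] by blast
    then show ?thesis by (auto simp: a0_def ep_def b_def insert_absorb)
   qed
  qed
  have eq: "D a0 I u + (vx ?t * b I u - ep ?t (D b) I u) = 0" for I u
  proof -
   have "D a I u = D a0 I u + D (ep ?t b) I u" by (subst dec) (rule D_add)
   then show ?thesis using Da Dep[OF b] by simp
  qed
  have Da0: "D a0 \<in> fam i 0 m'" using fam_D[OF a0[unfolded m'] iN] by simp
  have cyc: "D a0 I u = - vx ?t * b I u" for I u
  proof (cases "?t \<in> I")
   case True
   then show ?thesis using top[OF Da0 True] top[OF b True] by simp
  next
   case False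
   then show ?thesis using eq[of I u] by (simp add: ep_def eq_neg_iff_add_eq_0)
  qed
  have Db: "D b = (\<lambda>I u. 0)"
  proof (intro ext)
   fix I u
   show "D b I u = 0"
   proof (cases "?t \<in> I \<or> infinite I")
    case True
    then show ?thesis
    proof
     assume t: "?t \<in> I"
     show ?thesis
     proof (cases m')
      case 0
      then have "b = dl (b {} (\<lambda>_. 0))" using b by (intro fam_0_dl[of b i 0]) simp
      then have "D b I u = D (dl (b {} (\<lambda>_. 0))) I u" by (rule arg_cong)
      then show ?thesis by (simp only: D_dl)
     next
      case (Suc k)
      then show ?thesis using top[OF fam_D[OF b[unfolded Suc] iN] t] by simp
     qed
    next
     assume "infinite I"
     then show ?thesis by (intro D_infinite fam_infinite[OF b])
    qed
   next
    case False
    then have "ep ?t (D b) (insert ?t I) u = sg ?t (insert ?t I) * D b I u" by (auto simp: ep_def)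
    moreover have "ep ?t (D b) (insert ?t I) u = 0" using eq[of "insert ?t I" u] cyc[of "insert ?t I" u] by simp
    moreover have "sg ?t (insert ?t I) * (sg ?t (insert ?t I) * D b I u) = D b I u"
     by (simp add: mult.assoc[symmetric] sg_sq)
    ultimately show ?thesis by (metis mult_zero_right)
   qed
  qed
  have "\<exists>c\<in>fam i 0 (Suc m'). D c = b"
  \<comment> \<open>In degree 0 exactness says nothing about \<open>b\<close>. Instead x_t b = -D a0
    lies in the ideal of x_1, ..., x_i, modulo which x_t is regular, so \<open>b\<close> lies there
    and is a boundary.\<close>
  proof (cases "m' \<ge> 1")
   case True
   then show ?thesis using ex[OF True b Db] by simp
  next
   case False
   then have m0: "m' = 0" by simp
   have "vx ?t * b {} (\<lambda>_. 0) = - D a0 {} (\<lambda>_. 0)" unfolding cyc by simp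
   also have "... \<in> idl V vx i" using D_deg1[OF _ iN, of a0 0] a0 m' m0 by (intro idl_uminus) simp
   finally have "vx ?t * b {} (\<lambda>_. 0) \<in> idl V vx i" .
   then have "b {} (\<lambda>_. 0) \<in> idl V vx i"
    by (rule idl_regular[where W = "{1..i}" and j = ?t, OF _ _ tV monic_in_vx, rotated 2]) auto
   then obtain c where "c \<in> fam i 0 1" "D c = dl (b {} (\<lambda>_. 0))" using ex0 by blast
   moreover have "b = dl (b {} (\<lambda>_. 0))" using b m0 by (intro fam_0_dl[of b i 0]) simp
   ultimately show ?thesis using m0 by (intro bexI[of _ c]) simp_all
  qed
  then obtain c where c: "c \<in> fam i 0 m" "D c = b" using m' by auto
  have "(\<lambda>I u. a0 I u + vx ?t * c I u) \<in> fam i 0 m" using a0 c tV by (intro fam_add fam_scale) auto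
  moreover have "D (\<lambda>I u. a0 I u + vx ?t * c I u) = (\<lambda>I u. 0)" by (intro ext) (simp add: D_add D_scale cyc c(2))
  ultimately obtain e where e: "e \<in> fam i 0 (Suc m)" "D e = (\<lambda>I u. a0 I u + vx ?t * c I u)" using ex[OF m] by blast
  show ?thesis
  proof (rule bexI[of _ "\<lambda>I u. e I u - ep ?t c I u"])
   show "(\<lambda>I u. e I u - ep ?t c I u) \<in> fam ?t 0 (Suc m)" by (intro fam_minus mono e ep c)
   show "D (\<lambda>I u. e I u - ep ?t c I u) = a" by (subst dec, intro ext) (simp add: D_minus e(2) Dep[OF c(1)] c(2))
  qed
 qed
 have "\<exists>b\<in>fam ?t 0 1. D b = dl p" if p: "p \<in> idl V vx ?t" for p
 proof -
  obtain a q where aq: "a \<in> idl V vx i" "q \<in> polys V" "p = a + vx ?t * q" by (rule idl_Suc[OF p])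
  obtain e where e: "e \<in> fam i 0 1" "D e = dl a" using ex0[OF aq(1)] by blast
  have q: "dl q \<in> fam i 0 0" by (rule fam_dl[OF aq(2)])
  have Dq: "D (dl q) = (\<lambda>I u. 0)" by (intro ext) (rule D_dl)
  show ?thesis
  proof (rule bexI[of _ "\<lambda>I u. e I u + ep ?t (dl q) I u"])
   show "(\<lambda>I u. e I u + ep ?t (dl q) I u) \<in> fam ?t 0 1" using fam_add[OF mono[OF e(1)]] ep[OF q] by simp
   show "D (\<lambda>I u. e I u + ep ?t (dl q) I u) = dl p"
    by (intro ext) (simp add: D_add e(2) Dep[OF q] Dq aq(3), simp add: dl_def ep_def)
  qed
 qed
 with two show ?case by (intro conjI allI impI ballI)
qed

end

lemma const0_in_vx_ideal:
 assumes "p \<in> polys {1..N}" "lkp p 0 = 0"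
 shows "p \<in> idl {1..N} vx N"
proof -
 have "sgl m (lkp p m) \<in> idl {1..N} vx N" if m: "m \<in> kys p" for m
 proof -
  have "m \<noteq> 0" using m assms(2) by (auto simp: in_keys_iff)
  then obtain i where i: "i \<in> kys m" by (metis all_not_in_conv keys_eq_empty)
  have mV: "kys m \<subseteq> {1..N}" using m assms(1) by (auto simp: polys_def)
  have eq: "sgl i 1 + (m - sgl i 1) = m" using i
   by (intro poly_mapping_eqI) (auto simp: lookup_add lookup_minus lookup_single when_def in_keys_iff)
  have "sgl m (lkp p m) = vx i * sgl (m - sgl i 1) (lkp p m)" by (simp only: vx_def mult_single mult_1_left eq)
  also have "... \<in> idl {1..N} vx N"
  proof (rule idl_mult2[OF _ idl_gen])
   have "kys (m - sgl i 1) \<subseteq> kys m" by (auto simp: in_keys_iff lookup_minus)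
   then show "sgl (m - sgl i 1) (lkp p m) \<in> polys {1..N}" using mV by (auto simp: polys_def)
  qed (use i mV in auto)
  finally show ?thesis .
 qed
 then have "(\<Sum>m\<in>kys p. sgl m (lkp p m)) \<in> idl {1..N} vx N" by (rule idl_sum)
 then show ?thesis by (simp only: poly_mapping_sum_single)
qed

lemma idl_vx_const0: "p \<in> idl V vx k ==> lkp p 0 = 0"
proof -
 have "lkp (vx i * q) 0 = 0" for i q
 proof -
  have "0 \<notin> kys (vx i * q)"
  proof
   assume "0 \<in> kys (vx i * q)"
   then obtain a b where "0 = a + b" "a \<in> kys (vx i)" using keys_mult[of "vx i" q] by blast
   moreover have "mdeg a = 1" using homog_vx[of i] calculation(2) by (simp add: homog_def)
   ultimately show False using mdeg_add[of a b] by simp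
  qed
  then show ?thesis by (simp add: in_keys_iff)
 qed
 then show "p \<in> idl V vx k ==> lkp p 0 = 0" unfolding idl_def by (auto simp: lookup_sum)
qed

section \<open>Adjoining divided power variables\<close>

context koszul_tate
begin

text \<open>Multiplication by z_t, the sum of the g_it T_i; modulo f_t this element is the cycle
  that U_t is meant to kill.\<close>

definition Z :: "nat => family => family" where
 "Z t a = (\<lambda>I u. \<Sum>i\<in>V. g i t * ep i a I u)"

text \<open>Multiplication by the divided power \<open>U_t^(K)\<close> of an element free of
  U_t.\<close>

definition mu :: "nat => nat => family => family" where
 "mu t K a = (\<lambda>I u. if u t = K then a I (u(t := 0)) else 0)"

text \<open>The coefficient of \<open>U_t^(K)\<close>, again regarded as an element free of
  U_t.\<close>

definition cmp :: "nat => nat => family => family" where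
 "cmp t K a = (\<lambda>I u. if u t = 0 then a I (u(t := K)) else 0)"

lemma D_zero: "D (\<lambda>I u. 0) I u = 0" using D_scale[of 0 "\<lambda>I u. 0" I u] by simp

lemma D_sum: "finite A ==> D (\<lambda>I u. \<Sum>i\<in>A. b i I u) I u = (\<Sum>i\<in>A. D (b i) I u)"
proof (induction A rule: finite_induct)
 case empty
 then show ?case by (simp add: D_zero)
next
 case (insert x A)
 then show ?case by (simp add: D_add)
qed

text \<open>By linearity from \<open>D_ep\<close>: multiplication by z_t is a homotopy for
  multiplication by f_t.\<close>

lemma D_Z:
 assumes t: "t \<in> V" and I: "finite I"
 shows "D (Z t a) I u + Z t (D a) I u = f t * a I u"
proof -
 have "D (Z t a) I u = (\<Sum>i\<in>V. g i t * D (ep i a) I u)" unfolding Z_def by (subst D_sum) (simp_all add: D_scale)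
 then have "D (Z t a) I u + Z t (D a) I u = (\<Sum>i\<in>V. g i t * (D (ep i a) I u + ep i (D a) I u))"
  unfolding Z_def by (simp add: sum.distrib distrib_left)
 also have "... = (\<Sum>i\<in>V. (vx i * g i t) * a I u)"
 proof (intro sum.cong refl)
  fix i assume i: "i \<in> V"
  show "g i t * (D (ep i a) I u + ep i (D a) I u) = (vx i * g i t) * a I u"
   unfolding D_ep[OF I i] by (simp add: algebra_simps)
 qed
 also have "... = f t * a I u" unfolding f_eq[OF t] by (simp add: sum_distrib_right)
 finally show ?thesis .
qed

lemma Z_diff: "Z t (\<lambda>I u. a I u - b I u) I u = Z t a I u - Z t b I u" unfolding Z_def ep_def
 by (simp add: sum_subtractf[symmetric] algebra_simps if_distrib cong: if_cong)

lemma Z_scale: "Z t (\<lambda>I u. r * a I u) I u = r * Z t a I u"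
 unfolding Z_def ep_def by (simp add: sum_distrib_left algebra_simps if_distrib cong: if_cong)

lemma Z_zero: "Z t (\<lambda>I u. 0) I u = 0" using Z_scale[of t 0 "\<lambda>I u. 0" I u] by simp

lemma Z_infinite:
 assumes "!!I u. infinite I ==> a I u = 0" "infinite I"
 shows "Z t a I u = 0"
 using assms unfolding Z_def ep_def by (intro sum.neutral) auto

lemma D_Z_dl:
 assumes t: "t \<in> V"
 shows "D (Z t (dl q)) I u = f t * dl q I u"
proof (cases "finite I")
 case True
 have "D (dl q) = (\<lambda>I u. 0)" by (intro ext) (rule D_dl)
 then show ?thesis using D_Z[OF t True, of "dl q" u] by (simp add: Z_zero)
next
 case False
 have dl: "infinite I ==> dl q I u = 0" for I u by (auto simp: dl_def)
 have "D (Z t (dl q)) I u = 0" using False by (intro D_infinite Z_infinite dl)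
 then show ?thesis using dl[OF False] by simp
qed

lemma G_mu:
 assumes t: "t \<in> V" and a: "!!I u. u t \<noteq> 0 ==> a I u = 0"
 shows "G i (mu t K a) I u = mu t K (G i a) I u + (if K = 0 then 0 else g i t * mu t (K - 1) a I u)"
proof -
 have split: "(\<Sum>l\<in>V. F l) = F t + (\<Sum>l\<in>V - {t}. F l)" for F :: "nat => cpoly" using t by (intro sum.remove) auto
 have off: "mu t K a I (u(l := Suc (u l))) = (if u t = K then a I ((u(t := 0))(l := Suc ((u(t := 0)) l))) else 0)"
  if "l \<in> V - {t}" for l using that by (simp add: mu_def fun_upd_twist)
 have z: "a I ((u(t := 0))(t := Suc ((u(t := 0)) t))) = 0" by (rule a) simp
 have on: "mu t K a I (u(t := Suc (u t))) = (if K = 0 then 0 else mu t (K - 1) a I u)"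
  by (cases K) (auto simp: mu_def)
 have "(\<Sum>l\<in>V - {t}. g i l * mu t K a I (u(l := Suc (u l)))) = mu t K (G i a) I u"
 proof (cases "u t = K")
  case True
  have "(\<Sum>l\<in>V - {t}. g i l * mu t K a I (u(l := Suc (u l)))) =
    (\<Sum>l\<in>V - {t}. g i l * a I ((u(t := 0))(l := Suc ((u(t := 0)) l))))"
   using True by (intro sum.cong refl) (simp only: off simp_thms if_True)
  also have "... = G i a I (u(t := 0))"
   unfolding G_def split[of "\<lambda>l. g i l * a I ((u(t := 0))(l := Suc ((u(t := 0)) l)))"] z by simp
  also have "... = mu t K (G i a) I u" using True by (simp add: mu_def)
  finally show ?thesis .
 next
  case False
  then show ?thesis using off by (simp add: mu_def[of t K "G i a"])
 qed
 then show ?thesis unfolding G_def[of i "mu t K a"] split[of "\<lambda>l. g i l * mu t K a I (u(l := Suc (u l)))"] on by simp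
qed

text \<open>The Leibniz rule together with D \<open>U^(K)\<close> = z
  \<open>U^(K-1)\<close>.\<close>

lemma D_mu:
 assumes t: "t \<in> V" and a: "!!I u. u t \<noteq> 0 ==> a I u = 0"
 shows "D (mu t K a) I u = mu t K (D a) I u + (if K = 0 then 0 else mu t (K - 1) (Z t a) I u)"
proof -
 have i: "io i (mu t K a) I u = mu t K (io i a) I u" for i by (simp add: io_def mu_def)
 have e: "ep i (G i (mu t K a)) I u = mu t K (ep i (G i a)) I u + (if K = 0 then 0 else g i t * mu t (K - 1) (ep i a) I u)" for i
 proof (cases "i \<in> I")
  case True
  then have E: "ep i F I u' = sg i I * F (I - {i}) u'" for F u' by (simp add: ep_def)
  have mE: "mu t k (ep i F) I u = sg i I * mu t k F (I - {i}) u" for k F by (simp add: mu_def E)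
  have m: "G i (mu t K a) J u = mu t K (G i a) J u + (if K = 0 then 0 else g i t * mu t (K - 1) a J u)" for J
   by (rule G_mu[OF t]) (rule a)
  show ?thesis unfolding mE unfolding E m by (simp add: algebra_simps)
 next
  case False
  then have "ep i F I u' = 0" "mu t k (ep i F) I u = 0" for F u' k by (simp_all add: ep_def mu_def)
  then show ?thesis by simp
 qed
 have "D (mu t K a) I u = (\<Sum>i\<in>V. (vx i * mu t K (io i a) I u + mu t K (ep i (G i a)) I u) +
    (if K = 0 then 0 else g i t * mu t (K - 1) (ep i a) I u))"
  unfolding D_def i e by (simp add: add.assoc)
 also have "... = (\<Sum>i\<in>V. vx i * mu t K (io i a) I u + mu t K (ep i (G i a)) I u) +
    (\<Sum>i\<in>V. if K = 0 then 0 else g i t * mu t (K - 1) (ep i a) I u)" by (rule sum.distrib)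
 also have "(\<Sum>i\<in>V. vx i * mu t K (io i a) I u + mu t K (ep i (G i a)) I u) = mu t K (D a) I u"
  by (cases "u t = K") (simp_all add: mu_def D_def)
 also have "(\<Sum>i\<in>V. if K = 0 then 0 else g i t * mu t (K - 1) (ep i a) I u) = (if K = 0 then 0 else mu t (K - 1) (Z t a) I u)"
  by (cases "K = 0"; cases "u t = K - 1") (simp_all add: mu_def Z_def)
 finally show ?thesis .
qed

lemma cmp_G:
 assumes t: "t \<in> V"
 shows "cmp t K (G i a) I u = G i (cmp t K a) I u + g i t * cmp t (Suc K) a I u"
proof (cases "u t = 0")
 case True
 have split: "(\<Sum>l\<in>V. F l) = F t + (\<Sum>l\<in>V - {t}. F l)" for F :: "nat => cpoly" using t by (intro sum.remove) auto
 have off: "cmp t K a I (u(l := Suc (u l))) = a I ((u(t := K))(l := Suc ((u(t := K)) l)))" if "l \<in> V - {t}" for l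
  using that True by (simp add: cmp_def fun_upd_twist)
 have on: "cmp t K a I (u(t := Suc (u t))) = 0" by (simp add: cmp_def)
 have "G i (cmp t K a) I u = (\<Sum>l\<in>V - {t}. g i l * a I ((u(t := K))(l := Suc ((u(t := K)) l))))"
  unfolding G_def split[of "\<lambda>l. g i l * cmp t K a I (u(l := Suc (u l)))"] on using off by simp
 moreover have "cmp t K (G i a) I u = g i t * a I (u(t := Suc K)) + (\<Sum>l\<in>V - {t}. g i l * a I ((u(t := K))(l := Suc ((u(t := K)) l))))"
  using True unfolding cmp_def G_def split[of "\<lambda>l. g i l * a I ((u(t := K))(l := Suc ((u(t := K)) l)))"] by simp
 ultimately show ?thesis using True by (simp add: cmp_def)
next
 case False
 then have "cmp t K a I (u(l := Suc (u l))) = 0" for l by (simp add: cmp_def)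
 then show ?thesis using False unfolding G_def by (simp add: cmp_def)
qed

text \<open>The coefficient of \<open>U^(K)\<close> in D a receives D a_K and, from the next power,
  z a_(K+1).\<close>

lemma cmp_D:
 assumes t: "t \<in> V"
 shows "cmp t K (D a) I u = D (cmp t K a) I u + Z t (cmp t (Suc K) a) I u"
proof -
 have i: "cmp t K (io i a) I u = io i (cmp t K a) I u" for i by (simp add: io_def cmp_def)
 have e: "cmp t K (ep i (G i a)) I u = ep i (G i (cmp t K a)) I u + g i t * ep i (cmp t (Suc K) a) I u" for i
 proof -
  have "cmp t K (ep i (G i a)) I u = ep i (cmp t K (G i a)) I u" by (simp add: ep_def cmp_def)
  also have "... = ep i (G i (cmp t K a)) I u + g i t * ep i (cmp t (Suc K) a) I u"
   unfolding ep_def cmp_G[OF t] by (simp add: algebra_simps)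
  finally show ?thesis .
 qed
 have "cmp t K (D a) I u = (\<Sum>i\<in>V. vx i * cmp t K (io i a) I u + cmp t K (ep i (G i a)) I u)"
  by (cases "u t = 0") (simp_all add: cmp_def D_def)
 also have "... = (\<Sum>i\<in>V. (vx i * io i (cmp t K a) I u + ep i (G i (cmp t K a)) I u) + g i t * ep i (cmp t (Suc K) a) I u)"
  unfolding i e by (simp add: add.assoc)
 also have "... = D (cmp t K a) I u + Z t (cmp t (Suc K) a) I u" unfolding sum.distrib D_def Z_def ..
 finally show ?thesis .
qed

lemma ideal_D:
 assumes J: "ideal_of (polys V) J" and a: "!!I u. a I u \<in> J"
 shows "D a I u \<in> J"
proof -
 have G: "G i a I u \<in> J" for i I u unfolding G_def by (rule ideal_of_sum[OF J], rule ideal_of_mult[OF J g_polys a])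
 have "vx i * io i a I u + ep i (G i a) I u \<in> J" if i: "i \<in> V" for i
 proof (cases "i \<in> I")
  case True
  then have "vx i * io i a I u + ep i (G i a) I u = sg i I * G i a (I - {i}) u" by (simp add: io_def ep_def)
  also have "... \<in> J" by (rule ideal_of_mult[OF J sg_polys G])
  finally show ?thesis .
 next
  case False
  then have "vx i * io i a I u + ep i (G i a) I u = vx i * (sg i I * a (insert i I) u)" by (simp add: io_def ep_def)
  also have "... \<in> J" by (rule ideal_of_mult[OF J polys_vx[OF i] ideal_of_mult[OF J sg_polys a]])
  finally show ?thesis .
 qed
 then show ?thesis unfolding D_def by (rule ideal_of_sum[OF J])
qed

lemma fam_ep_same:
 assumes a: "a \<in> fam i j m" and i: "i' \<in> {1..i}"
 shows "ep i' a \<in> fam i j (Suc m)"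
 unfolding fam_def
proof (intro CollectI conjI allI impI)
 show "ep i' a I u \<in> polys V" for I u using fam_polys[OF a] by (auto simp: ep_def)
 fix I u assume n: "(I, u) \<notin> idx i j (Suc m)"
 show "ep i' a I u = 0"
 proof (cases "i' \<in> I \<and> (I - {i'}, u) \<in> idx i j m")
  case True
  then have x: "i' \<in> I" "I - {i'} \<subseteq> {1..i}" "\<forall>k. k \<notin> {1..j} --> u k = 0"
   "card (I - {i'}) + 2 * (\<Sum>k\<in>{1..j}. u k) = m" unfolding idx_iff by blast+
  have "finite (I - {i'})" using finite_subset[OF x(2)] by simp
  then have "card I = Suc (card (I - {i'}))" using x(1) by (intro card.remove) simp_all
  moreover have "I \<subseteq> {1..i}" using x(2) i by blast
  ultimately have "(I, u) \<in> idx i j (Suc m)" using x by (simp add: idx_def)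
  then show ?thesis using n by blast
 next
  case False
  then show ?thesis using fam_0[OF a] by (auto simp: ep_def)
 qed
qed

lemma fam_Z: "a \<in> fam N j m ==> Z t a \<in> fam N j (Suc m)"
proof -
 assume a: "a \<in> fam N j m"
 have e: "ep i a \<in> fam N j (Suc m)" if "i \<in> V" for i by (rule fam_ep_same[OF a that])
 show ?thesis unfolding fam_def
 proof (intro CollectI conjI allI impI)
  show "Z t a I u \<in> polys V" for I u unfolding Z_def by (intro polys_sum polys_mult g_polys fam_polys[OF e])
  show "Z t a I u = 0" if "(I, u) \<notin> idx N j (Suc m)" for I u
   unfolding Z_def using fam_0[OF e that] by (intro sum.neutral) simp
 qed
qed

lemma sum_upd: "(\<Sum>k\<in>{1..Suc j}. (u(Suc j := K)) k) = (\<Sum>k\<in>{1..j}. u k) + (K::nat)"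
proof -
 have "(\<Sum>k\<in>{1..Suc j}. (u(Suc j := K)) k) = (\<Sum>k\<in>{1..j}. (u(Suc j := K)) k) + K" by simp
 also have "(\<Sum>k\<in>{1..j}. (u(Suc j := K)) k) = (\<Sum>k\<in>{1..j}. u k)" by (intro sum.cong) auto
 finally show ?thesis .
qed

lemma idx_upd:
 "(I, u(Suc j := K)) \<in> idx i (Suc j) m \<longleftrightarrow> 2 * K \<le> m \<and> (I, u(Suc j := 0)) \<in> idx i j (m - 2 * K)"
proof -
 have "(\<forall>k. k \<notin> {1..Suc j} --> (u(Suc j := K)) k = 0) \<longleftrightarrow> (\<forall>k. k \<notin> {1..j} --> (u(Suc j := 0)) k = 0)"
  by (auto simp: le_Suc_eq)
 moreover have "(\<Sum>k\<in>{1..j}. (u(Suc j := 0)) k) = (\<Sum>k\<in>{1..j}. u k)" by (intro sum.cong) auto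
 ultimately show ?thesis unfolding idx_iff sum_upd by auto
qed

lemma fam_mu:
 assumes a: "a \<in> fam i j m"
 shows "mu (Suc j) K a \<in> fam i (Suc j) (m + 2 * K)"
 unfolding fam_def
proof (intro CollectI conjI allI impI)
 show "mu (Suc j) K a I u \<in> polys V" for I u using fam_polys[OF a] by (simp add: mu_def)
 fix I u assume n: "(I, u) \<notin> idx i (Suc j) (m + 2 * K)"
 show "mu (Suc j) K a I u = 0"
 proof (cases "u (Suc j) = K")
  case True
  then have "(I, u(Suc j := 0)) \<notin> idx i j m" using n idx_upd[of I u j K i "m + 2 * K"] by (simp add: fun_upd_idem)
  then show ?thesis using fam_0[OF a] by (simp add: mu_def)
 qed (simp add: mu_def)
qed

lemma fam_cmp:
 assumes a: "a \<in> fam i (Suc j) m" and K: "2 * K \<le> m"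
 shows "cmp (Suc j) K a \<in> fam i j (m - 2 * K)"
 unfolding fam_def
proof (intro CollectI conjI allI impI)
 show "cmp (Suc j) K a I u \<in> polys V" for I u using fam_polys[OF a] by (simp add: cmp_def)
 fix I u assume n: "(I, u) \<notin> idx i j (m - 2 * K)"
 show "cmp (Suc j) K a I u = 0"
 proof (cases "u (Suc j) = 0")
  case True
  then have "(I, u(Suc j := K)) \<notin> idx i (Suc j) m" using n idx_upd[of I u j K i m] by (simp add: fun_upd_idem)
  then show ?thesis using fam_0[OF a] by (simp add: cmp_def)
 qed (simp add: cmp_def)
qed

text \<open>Only U_1, ..., U_j occur, so only the first j summands of D D survive.\<close>

lemma D_D_idl:
 assumes a: "a \<in> fam i j m" and j: "j \<le> N"
 shows "D (D a) I u \<in> idl V f j"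
proof (cases "finite I")
 case True
 have "f l * a I (u(l := Suc (u l))) \<in> idl V f j" if l: "l \<in> V" for l
 proof (cases "l \<le> j")
  case True
  then show ?thesis using l by (intro idl_mult2[OF fam_polys[OF a]] idl_gen) simp
 next
  case False
  have "(I, u(l := Suc (u l))) \<notin> idx i j m"
  proof
   assume "(I, u(l := Suc (u l))) \<in> idx i j m"
   then have "(u(l := Suc (u l))) l = 0" using False unfolding idx_iff by fastforce
   then show False by simp
  qed
  then show ?thesis using fam_0[OF a] by (simp add: idl_zero)
 qed
 then show ?thesis unfolding D_D[OF True] by (rule idl_sum)
next
 case False
 have "D (D a) I u = 0" using False by (intro D_infinite fam_infinite[OF a])
 then show ?thesis by (simp add: idl_zero)
qed

lemma tate_exact_0:
 assumes a: "a \<in> fam N j 0" and c: "lkp (a {} (\<lambda>_. 0)) 0 = 0"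
 shows "\<exists>b\<in>fam N j 1. \<forall>I u. a I u = D b I u"
proof -
 have "a {} (\<lambda>_. 0) \<in> idl V vx N" by (rule const0_in_vx_ideal[OF fam_polys[OF a] c])
 then obtain b where b: "b \<in> fam N 0 1" "D b = dl (a {} (\<lambda>_. 0))" using koszul_exact[OF order_refl] by blast
 have "b \<in> fam N j 1" by (rule fam_mono[OF order_refl _ b(1)]) simp
 moreover have "D b = a" unfolding b(2) by (rule fam_0_dl[OF a, symmetric])
 ultimately show ?thesis by auto
qed

text \<open>Coefficientwise division by the new relation modulo the earlier ones; quotients outside
  the index set are set to 0 so that the result is again a member of \<open>fam\<close>.\<close>

lemma idl_division:
 assumes a: "a \<in> fam i j m" and I: "!!I u. a I u \<in> idl V f (Suc k)"
 shows "\<exists>y\<in>fam i j m. \<forall>I u. a I u - f (Suc k) * y I u \<in> idl V f k"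
proof -
 have "\<exists>y. y \<in> polys V \<and> a I u - f (Suc k) * y \<in> idl V f k" for I u
 proof -
  obtain p q where "p \<in> idl V f k" "q \<in> polys V" "a I u = p + f (Suc k) * q" by (rule idl_Suc[OF I])
  then show ?thesis by (intro exI[of _ q]) simp
 qed
 then obtain y where y: "!!I u. y I u \<in> polys V" "!!I u. a I u - f (Suc k) * y I u \<in> idl V f k" by metis
 let ?y = "\<lambda>I u. if (I, u) \<in> idx i j m then y I u else 0"
 have "?y \<in> fam i j m" using y(1) by (simp add: fam_def)
 moreover have "a I u - f (Suc k) * ?y I u \<in> idl V f k" for I u using y(2) fam_0[OF a] by (simp add: idl_zero)
 ultimately show ?thesis by (intro bexI[of _ ?y]) simp_all
qed

text \<open>Let J be the ideal of f_1, ..., f_j and J' that of one more relation F. By regularity of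
  F the complex without the new variable U has modulo J' only one extra homology class, that of z.
  In \<open>step\<close> the coefficient of the highest power of U in a cycle is shown to be a
  boundary plus c z; in \<open>main\<close> the powers of U are removed from the top, where c z is
  cancelled by c times the boundary of the next power of U.\<close>

theorem tate_exact:
 "j \<le> N ==> m \<ge> 1 ==> a \<in> fam N j m ==> (!!I u. D a I u \<in> idl V f j) ==>
  \<exists>b\<in>fam N j (Suc m). \<forall>I u. a I u - D b I u \<in> idl V f j"
proof (induction j arbitrary: m a)
 case 0
 have "D a = (\<lambda>I u. 0)" using 0(4) by (intro ext) (simp add: idl_def)
 then obtain b where "b \<in> fam N 0 (Suc m)" "D b = a" using koszul_exact[OF order_refl] 0 by blast
 then show ?case by (intro bexI[of _ b]) (simp_all add: idl_zero)
next
 case (Suc j)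
 let ?t = "Suc j"
 let ?J = "idl V f j" and ?J' = "idl V f (Suc j)" and ?F = "f (Suc j)"
 have jN: "j \<le> N" "j < N" and tV: "?t \<in> V" using Suc.prems(1) by auto
 have sub: "p \<in> ?J ==> p \<in> ?J'" for p using idl_mono[of j "Suc j" V V f] by auto
 have F: "?F * p \<in> ?J'" if "p \<in> polys V" for p using tV by (intro idl_mult2[OF that] idl_gen) simp
 have Fp: "?F \<in> polys V" unfolding f_eq[OF tV] by (intro polys_sum polys_mult polys_vx g_polys)
 have c1: "dl 1 \<in> fam N j 0" by (rule fam_dl) simp
 have supp: "b I u = 0" if "b \<in> fam N j k" "u ?t \<noteq> 0" for b k I u
 proof -
  have "(I, u) \<notin> idx N j k"
  proof
   assume "(I, u) \<in> idx N j k"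
   then have "\<forall>k. k \<notin> {1..j} --> u k = 0" unfolding idx_iff by blast
   from spec[OF this, of ?t] show False using that(2) by simp
  qed
  then show ?thesis by (rule fam_0[OF that(1)])
 qed
 have inf: "D b I u = 0" if "b \<in> fam N j k" "infinite I" for b k I u
  using that(2) by (intro D_infinite fam_infinite[OF that(1)])
 have DZ: "D (Z ?t b) I u = ?F * b I u - Z ?t (D b) I u" if b: "b \<in> fam N j k" for b k I u
 proof (cases "finite I")
  case True
  then show ?thesis using D_Z[OF tV True, of b u] by (simp add: algebra_simps)
 next
  case False
  then have "D (Z ?t b) I u = 0" "Z ?t (D b) I u = 0" "b I u = 0"
   using inf[OF fam_Z[OF b]] fam_infinite[OF b] Z_infinite[of "D b", OF inf[OF b]] by auto
  then show ?thesis by simp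
 qed
 have step: "\<exists>b c. b \<in> fam N j (Suc r) \<and> (c \<noteq> 0 --> r = 1) \<and>
   (\<forall>I u. cmp ?t K a I u - D b I u - sgl 0 c * Z ?t (dl 1) I u \<in> ?J')"
  if a: "a \<in> fam N ?t m" and m: "m \<ge> 1" and Da: "!!I u. D a I u \<in> ?J'" and top: "!!I u. u ?t > K ==> a I u = 0"
   and K: "2 * K \<le> m" and r: "r = m - 2 * K" for a m K r
 proof -
  let ?A = "cmp ?t K a"
  have A: "?A \<in> fam N j r" using fam_cmp[OF a K] r by simp
  have cz: "cmp ?t (Suc K) a = (\<lambda>I u. 0)" using top by (auto simp: cmp_def fun_eq_iff)
  have cD: "cmp ?t k (D a) I u \<in> ?J'" for k I u using Da by (simp add: cmp_def idl_zero)
  have DA: "D ?A I u \<in> ?J'" for I u using cD[of K I u] unfolding cmp_D[OF tV] cz Z_zero by simp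
  show ?thesis
  proof (cases r)
   case (Suc r')
   have "D ?A \<in> fam N j r'" using fam_D[OF A[unfolded Suc]] jN by simp
   then obtain y where y: "y \<in> fam N j r'" "!!I u. D ?A I u - ?F * y I u \<in> ?J" using idl_division DA by blast
   \<comment> \<open>D applied to D A - F y stays in J, and D D A lies in J; so F D y is in J, and F
     is regular modulo J.\<close>
   have Dy: "D y I u \<in> ?J" for I u
   proof -
    have "D (\<lambda>I u. D ?A I u - ?F * y I u) I u \<in> ?J" by (rule ideal_D[OF idl_ideal y(2)])
    then have "D (D ?A) I u - ?F * D y I u \<in> ?J" by (simp add: D_minus D_scale)
    then have "D (D ?A) I u - (D (D ?A) I u - ?F * D y I u) \<in> ?J" by (rule idl_minus[OF D_D_idl[OF A jN(1)]])
    then have "?F * D y I u \<in> ?J" by simp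
    then show ?thesis by (rule reg[OF jN(2)])
   qed
   \<comment> \<open>Modulo J the cycle \<open>y\<close> is a boundary if its degree is positive; in
     degree 0 a constant c is left over, and only then has A degree 1.\<close>
   have "\<exists>w c. w \<in> fam N j r \<and> (c \<noteq> 0 --> r = 1) \<and> (\<forall>I u. y I u - D w I u - sgl 0 c * dl 1 I u \<in> ?J)"
   proof (cases "r' \<ge> 1")
    case True
    obtain w where "w \<in> fam N j (Suc r')" "\<forall>I u. y I u - D w I u \<in> ?J"
     using Suc.IH[OF jN(1) True y(1) Dy] by blast
    then show ?thesis using Suc by (intro exI[of _ w] exI[of _ 0]) simp
   next
    case False
    then have r0: "r' = 0" by simp
    define c where "c = lkp (y {} (\<lambda>_. 0)) 0"
    have "(\<lambda>I u. y I u - sgl 0 c * dl 1 I u) \<in> fam N j 0"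
     using y(1) r0 by (intro fam_minus fam_scale c1 polys_const) simp
    moreover have "lkp (y {} (\<lambda>_. 0) - sgl 0 c * dl 1 {} (\<lambda>_. 0)) 0 = 0" by (simp add: dl_def lookup_minus c_def)
    ultimately obtain w where w: "w \<in> fam N j 1" "\<forall>I u. y I u - sgl 0 c * dl 1 I u = D w I u"
     using tate_exact_0[of "\<lambda>I u. y I u - sgl 0 c * dl 1 I u" j] by blast
    have "y I u - D w I u - sgl 0 c * dl 1 I u = 0" for I u using w(2)[rule_format, of I u, symmetric] by simp
    then show ?thesis using w(1) Suc r0 by (intro exI[of _ w] exI[of _ c]) (simp add: idl_zero)
   qed
   then obtain w c where w: "w \<in> fam N j r" "c \<noteq> 0 --> r = 1" "!!I u. y I u - D w I u - sgl 0 c * dl 1 I u \<in> ?J"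
    by blast
   let ?zc = "\<lambda>I u. sgl 0 c * Z ?t (dl 1) I u"
   have zc: "?zc \<in> fam N j r"
   proof (cases "c = 0")
    case True
    then show ?thesis using fam_zero by simp
   next
    case False
    then have r1: "r = Suc 0" using w(2) by simp
    show ?thesis unfolding r1 by (intro fam_scale fam_Z c1) simp
   qed
   \<comment> \<open>The correction by F w and c z turns a cycle modulo J' into one modulo J, where
     the induction hypothesis applies. Modulo J' the term F w disappears.\<close>
   let ?e = "\<lambda>I u. ?A I u - ?F * w I u - ?zc I u"
   have e: "?e \<in> fam N j r" by (rule fam_minus[OF fam_minus[OF A fam_scale[OF Fp w(1)]] zc])
   have "D ?e I u \<in> ?J" for I u
   proof -
    have "D ?e I u = D ?A I u - ?F * D w I u - sgl 0 c * (?F * dl 1 I u)"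
     by (simp only: D_minus D_scale D_Z_dl[OF tV])
    also have "... = (D ?A I u - ?F * y I u) + ?F * (y I u - D w I u - sgl 0 c * dl 1 I u)"
     by (simp add: algebra_simps)
    also have "... \<in> ?J" by (rule idl_add[OF y(2) idl_mult[OF Fp w(3)]])
    finally show ?thesis .
   qed
   then obtain b where b: "b \<in> fam N j (Suc r)" "!!I u. ?e I u - D b I u \<in> ?J"
    using Suc.IH[OF jN(1) _ e] Suc by auto
   have "?A I u - D b I u - ?zc I u \<in> ?J'" for I u
   proof -
    have "(?e I u - D b I u) + ?F * w I u \<in> ?J'" by (rule idl_add[OF sub[OF b(2)] F[OF fam_polys[OF w(1)]]])
    moreover have "(?e I u - D b I u) + ?F * w I u = ?A I u - D b I u - ?zc I u" by simp
    ultimately show ?thesis by simp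
   qed
   then show ?thesis using b(1) w(2) by blast
  next
   case 0
   define c where "c = lkp (?A {} (\<lambda>_. 0)) 0"
   have A0: "?A \<in> fam N j 0" using A 0 by simp
   have "(\<lambda>I u. ?A I u - sgl 0 c * dl 1 I u) \<in> fam N j 0" by (intro fam_minus fam_scale c1 A0 polys_const)
   moreover have "lkp (?A {} (\<lambda>_. 0) - sgl 0 c * dl 1 {} (\<lambda>_. 0)) 0 = 0" by (simp add: dl_def lookup_minus c_def)
   ultimately obtain b where b: "b \<in> fam N j 1" "!!I u. ?A I u - sgl 0 c * dl 1 I u = D b I u"
    using tate_exact_0[of "\<lambda>I u. ?A I u - sgl 0 c * dl 1 I u" j] by blast
   \<comment> \<open>A has degree 0 here, so c must be shown to vanish. As m is at least 1, so is K,
     and the cycle condition at the power K - 1 says that D a1 + z A lies in J', with a1 of degree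
     2.\<close>
   obtain K' where K': "K = Suc K'" using 0 r K m by (cases K) auto
   let ?a1 = "cmp ?t K' a"
   have a1: "?a1 \<in> fam N j 2" 
   proof -
    have "2 * K' \<le> m" "m - 2 * K' = 2" using 0 r K K' by simp_all
    then show ?thesis using fam_cmp[OF a, of K'] by simp
   qed
   \<comment> \<open>With A = c + D b and D(z b) = F b - z D b the condition becomes D E + c z in
     J'. Division by F and another application of D give c - D y in J.\<close>
   define E where "E = (\<lambda>I u. ?a1 I u - Z ?t b I u)"
   have E: "E \<in> fam N j 2" unfolding E_def using fam_Z[OF b(1), of ?t] by (intro fam_minus a1) (simp add: numeral_2_eq_2)
   let ?W = "\<lambda>I u. D E I u + sgl 0 c * Z ?t (dl 1) I u"
   have DE: "D E \<in> fam N j 1" using fam_D[of E N j 1] E jN by (simp add: numeral_2_eq_2)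
   have W: "?W \<in> fam N j 1" using fam_Z[OF c1, of ?t] by (intro fam_add DE fam_scale) simp_all
   have "?W I u \<in> ?J'" for I u
   proof -
    have ZA: "Z ?t ?A I u = Z ?t (D b) I u + sgl 0 c * Z ?t (dl 1) I u"
    proof -
     have "D b = (\<lambda>I u. ?A I u - sgl 0 c * dl 1 I u)" using b(2) by (intro ext) simp
     then have "Z ?t (D b) I u = Z ?t ?A I u - sgl 0 c * Z ?t (dl 1) I u" by (simp only: Z_diff Z_scale)
     then show ?thesis by simp
    qed
    have "cmp ?t K' (D a) I u - ?F * b I u \<in> ?J'" by (rule idl_minus[OF cD F[OF fam_polys[OF b(1)]]])
    moreover have "cmp ?t K' (D a) I u - ?F * b I u = ?W I u"
     unfolding E_def cmp_D[OF tV] D_minus DZ[OF b(1)] K'[symmetric] ZA by simp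
    ultimately show ?thesis by simp
   qed
   then obtain y where y: "y \<in> fam N j 1" "!!I u. ?W I u - ?F * y I u \<in> ?J" using idl_division[OF W] by blast
   have "sgl 0 c * dl 1 I u - D y I u \<in> ?J" for I u
   proof -
    have "D (\<lambda>I u. ?W I u - ?F * y I u) I u \<in> ?J" by (rule ideal_D[OF idl_ideal y(2)])
    then have "(D (D E) I u + sgl 0 c * (?F * dl 1 I u)) - ?F * D y I u \<in> ?J"
     by (simp only: D_minus D_add D_scale D_Z_dl[OF tV])
    then have "((D (D E) I u + sgl 0 c * (?F * dl 1 I u)) - ?F * D y I u) - D (D E) I u \<in> ?J"
     by (rule idl_minus[OF _ D_D_idl[OF E jN(1)]])
    moreover have "((D (D E) I u + sgl 0 c * (?F * dl 1 I u)) - ?F * D y I u) - D (D E) I u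
     = ?F * (sgl 0 c * dl 1 I u - D y I u)" by (simp add: algebra_simps)
    ultimately have "?F * (sgl 0 c * dl 1 I u - D y I u) \<in> ?J" by simp
    then show ?thesis by (rule reg[OF jN(2)])
   qed
   \<comment> \<open>Neither elements of J nor boundaries of degree-one elements have a constant
     term.\<close>
   then have "lkp (sgl 0 c * dl 1 {} (\<lambda>_. 0) - D y {} (\<lambda>_. 0)) 0 = 0" by (rule const0[OF jN(1)])
   moreover have "lkp (D y {} (\<lambda>_. 0)) 0 = 0" by (rule idl_vx_const0[OF D_deg1[OF y(1) order_refl]])
   ultimately have "c = 0" by (simp add: dl_def lookup_minus)
   then have "?A I u - D b I u - sgl 0 0 * Z ?t (dl 1) I u \<in> ?J'" for I u
    using b(2)[of I u, symmetric] by (simp add: idl_zero)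
   then show ?thesis using b(1) 0 by (intro exI[of _ b] exI[of _ 0]) simp
  qed
 qed
 \<comment> \<open>Induction on a strict bound K for the powers of U that occur; the top coefficient
   belongs to the power K - 1.\<close>
 have main: "\<exists>b\<in>fam N ?t (Suc m). \<forall>I u. a I u - D b I u \<in> ?J'"
  if m: "m \<ge> 1" and "a \<in> fam N ?t m" "!!I u. D a I u \<in> ?J'" "!!I u. u ?t \<ge> K ==> a I u = 0" for a m K
  using that(2-)
 proof (induction K arbitrary: a)
  case 0
  then show ?case by (intro bexI[of _ "\<lambda>I u. 0"] fam_zero) (simp add: D_zero idl_zero)
 next
  case (Suc K)
  show ?case
  proof (cases "2 * K \<le> m")
   case False
   have "a I u = 0" if "u ?t \<ge> K" for I u
   proof -
    have "(I, u(?t := u ?t)) \<notin> idx N ?t m" unfolding idx_upd using False that by simp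
    then show ?thesis using fam_0[OF Suc.prems(1)] by simp
   qed
   then show ?thesis using Suc.IH[OF Suc.prems(1,2)] by blast
  next
   case True
   define r where "r = m - 2 * K"
   obtain b c where b: "b \<in> fam N j (Suc r)" and c: "c \<noteq> 0 --> r = 1"
    and bc: "!!I u. cmp ?t K a I u - D b I u - sgl 0 c * Z ?t (dl 1) I u \<in> ?J'"
    using step[OF Suc.prems(1) m Suc.prems(2) _ True r_def] Suc.prems(3) by (metis Suc_leI)
   \<comment> \<open>The boundary of b \<open>U^(K)\<close> + c \<open>U^(K+1)\<close> has (D b + c
     z) \<open>U^(K)\<close> as its term of highest power, because z \<open>U^(K)\<close> is the
     boundary of \<open>U^(K+1)\<close>.\<close>
   let ?B = "\<lambda>I u. mu ?t K b I u + sgl 0 c * mu ?t (Suc K) (dl 1) I u"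
   have B: "?B \<in> fam N ?t (Suc m)"
   proof (rule fam_add)
    show "mu ?t K b \<in> fam N ?t (Suc m)" using fam_mu[OF b, of K] True by (simp add: r_def)
    show "(\<lambda>I u. sgl 0 c * mu ?t (Suc K) (dl 1) I u) \<in> fam N ?t (Suc m)"
    proof (cases "c = 0")
     case True
     then show ?thesis using fam_zero by simp
    next
     case False
     then have "Suc m = 0 + 2 * Suc K" using c True by (simp add: r_def)
     then show ?thesis using fam_mu[OF c1, of "Suc K"] by (intro fam_scale) (simp_all only: polys_const)
    qed
   qed
   have dl0: "dl q I u = 0" if "u ?t \<noteq> 0" for q I u using that by (auto simp: dl_def)
   have DB: "D ?B I u = (if u ?t = K then D b I (u(?t := 0)) + sgl 0 c * Z ?t (dl 1) I (u(?t := 0)) else 0)" if u: "u ?t \<ge> K" for I u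
   proof -
    have 1: "D (mu ?t K b) I u = mu ?t K (D b) I u"
    proof -
     have "D (mu ?t K b) I u = mu ?t K (D b) I u + (if K = 0 then 0 else mu ?t (K - 1) (Z ?t b) I u)"
      by (rule D_mu[OF tV]) (rule supp[OF b])
     then show ?thesis using u by (cases K) (simp_all add: mu_def)
    qed
    have 2: "D (mu ?t (Suc K) (dl 1)) I u = mu ?t K (Z ?t (dl 1)) I u"
    proof -
     have "D (mu ?t (Suc K) (dl 1)) I u = mu ?t (Suc K) (D (dl 1)) I u + (if Suc K = 0 then 0 else mu ?t (Suc K - 1) (Z ?t (dl 1)) I u)"
      by (rule D_mu[OF tV]) (rule dl0)
     then show ?thesis by (simp add: mu_def D_dl)
    qed
    show ?thesis unfolding D_add D_scale 1 2 by (simp add: mu_def)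
   qed
   let ?a2 = "\<lambda>I u. a I u - D ?B I u"
   have a2: "?a2 I u \<in> ?J'" if u: "u ?t \<ge> K" for I u
   proof (cases "u ?t = K")
    case True
    then have "cmp ?t K a I (u(?t := 0)) = a I u" by (simp add: cmp_def fun_upd_idem)
    then show ?thesis unfolding DB[where u=u and I=I, OF u] using bc[of I "u(?t := 0)"] True by (simp add: algebra_simps)
   next
    case False
    then have "a I u = 0" using u by (intro Suc.prems(3)) simp
    then show ?thesis unfolding DB[where u=u and I=I, OF u] using False by (simp add: idl_zero)
   qed
   \<comment> \<open>After the subtraction the coefficients from power K on lie in J' but need not
     be 0. Replacing them by 0 changes the family only by J' and makes the induction hypothesis
     applicable.\<close>
   let ?a3 = "\<lambda>I u. if u ?t \<ge> K then 0 else ?a2 I u"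
   have a2f: "?a2 \<in> fam N ?t m" using fam_D[OF B] Suc.prems(1) \<open>Suc j \<le> N\<close> by (intro fam_minus) simp_all
   have a3: "?a3 \<in> fam N ?t m" using a2f by (simp add: fam_def)
   have dif: "?a2 I u - ?a3 I u \<in> ?J'" for I u using a2[of u I] by (simp add: idl_zero)
   have Da2: "D ?a2 I u \<in> ?J'" for I u
    unfolding D_minus by (rule idl_minus[OF Suc.prems(2) D_D_idl[OF B \<open>Suc j \<le> N\<close>]])
   have Da3: "D ?a3 I u \<in> ?J'" for I u
   proof -
    have "D (\<lambda>I u. ?a2 I u - ?a3 I u) I u \<in> ?J'" by (rule ideal_D[OF idl_ideal dif])
    then have "D ?a2 I u - D ?a3 I u \<in> ?J'" by (simp only: D_minus)
    then have "D ?a2 I u - (D ?a2 I u - D ?a3 I u) \<in> ?J'" by (rule idl_minus[OF Da2])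
    then show ?thesis by simp
   qed
   obtain b3 where b3: "b3 \<in> fam N ?t (Suc m)" "!!I u. ?a3 I u - D b3 I u \<in> ?J'" using Suc.IH[OF a3 Da3] by auto
   have "a I u - D (\<lambda>I u. ?B I u + b3 I u) I u \<in> ?J'" for I u
   proof -
    have "(?a2 I u - ?a3 I u) + (?a3 I u - D b3 I u) \<in> ?J'" by (rule idl_add[OF dif b3(2)])
    moreover have "(?a2 I u - ?a3 I u) + (?a3 I u - D b3 I u) = a I u - (D ?B I u + D b3 I u)" by simp
    moreover have "D (\<lambda>I u. ?B I u + b3 I u) I u = D ?B I u + D b3 I u" by (rule D_add)
    ultimately show ?thesis by simp
   qed
   then show ?thesis using fam_add[OF B b3(1)] by blast
  qed
 qed
 show ?case
 proof (rule main[OF Suc.prems(2,3,4)])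
  fix I and u :: "nat => nat" assume "Suc m \<le> u ?t"
  then have "(I, u(?t := u ?t)) \<notin> idx N ?t m" unfolding idx_upd by simp
  then show "a I u = 0" using fam_0[OF Suc.prems(3)] by simp
 qed
qed

end

section \<open>Counting\<close>

text \<open>Basis elements T_I \<open>U^(u)\<close> of a weighted degree d. Weights 1 and 2 give the
  homological degree, for the Poincare series; weights 2 and 2(n + 1 - k) give the internal degree,
  for the Euler characteristic.\<close>

definition fib :: "nat => (nat => nat) => nat => nat => nat => (nat set \<times> (nat => nat)) set" where
 "fib \<alpha> \<gamma> i j d = {(I, u). I \<subseteq> {1..i} \<and> (\<forall>k. k \<notin> {1..j} --> u k = 0) \<and> \<alpha> * card I + (\<Sum>k\<in>{1..j}. \<gamma> k * u k) = d}"

definition wt :: "'a::comm_ring_1 => (nat => 'a) => nat => nat set \<times> (nat => nat) => 'a" where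
 "wt A C j x = A ^ card (fst x) * (\<Prod>k\<in>{1..j}. C k ^ snd x k)"

text \<open>\<open>fps_X\<close> records the weighted degree, while \<open>A\<close> and
  \<open>C k\<close> record the second grading: powers of q for the Poincare series, -1 and 1 as
  signs for the Euler characteristic.\<close>

definition gen_series :: "nat => (nat => nat) => 'a::comm_ring_1 => (nat => 'a) => nat => nat => 'a fps" where
 "gen_series \<alpha> \<gamma> A C i j = Abs_fps (\<lambda>d. \<Sum>x\<in>fib \<alpha> \<gamma> i j d. wt A C j x)"

lemma finite_fib:
 assumes "!!k. k \<in> {1..j} ==> \<gamma> k \<ge> 1"
 shows "finite (fib \<alpha> \<gamma> i j d)"
proof -
 let ?U = "{u. \<forall>x. (x \<in> {1..j} --> u x \<in> {..d}) \<and> (x \<notin> {1..j} --> u x = (0::nat))}"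
 have "fib \<alpha> \<gamma> i j d \<subseteq> Pow {1..i} \<times> ?U"
 proof (rule subrelI)
  fix I u assume "(I, u) \<in> fib \<alpha> \<gamma> i j d"
  then have x: "I \<subseteq> {1..i}" "\<forall>k. k \<notin> {1..j} --> u k = 0" "\<alpha> * card I + (\<Sum>k\<in>{1..j}. \<gamma> k * u k) = d"
   unfolding fib_def by blast+
  have "u k \<le> d" if k: "k \<in> {1..j}" for k
  proof -
   have "u k \<le> \<gamma> k * u k" using assms[OF k] by simp
   also have "... \<le> (\<Sum>k\<in>{1..j}. \<gamma> k * u k)" using k by (intro member_le_sum) auto
   finally show ?thesis using x(3) by simp
  qed
  then show "(I, u) \<in> Pow {1..i} \<times> ?U" using x by simp
 qed
 moreover have "finite (Pow {1..i} \<times> ?U)" by (intro finite_cartesian_product finite_set_of_finite_funs) simp_all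
 ultimately show ?thesis by (rule finite_subset)
qed

text \<open>The new exterior index is either absent or present, the latter contributing A
  X^\<alpha>.\<close>

lemma gen_series_T:
 assumes \<gamma>: "!!k. k \<in> {1..j} ==> \<gamma> k \<ge> 1"
 shows "gen_series \<alpha> \<gamma> A C (Suc i) j = (1 + fps_const A * fps_X ^ \<alpha>) * gen_series \<alpha> \<gamma> A C i j"
proof (rule fps_ext)
 fix d
 let ?h = "\<lambda>(I, u). (insert (Suc i) I, u :: nat => nat)"
 let ?S = "if \<alpha> \<le> d then fib \<alpha> \<gamma> i j (d - \<alpha>) else {}"
 have new: "Suc i \<notin> I" "finite I" if "(I, u) \<in> fib \<alpha> \<gamma> i j d'" for I u d'
  using that finite_subset[of I "{1..i}"] by (auto simp: fib_def)
 have nS: "Suc i \<notin> I" "finite I" if "(I, u) \<in> ?S" for I u using that new[of I u] by (auto split: if_splits)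
 have eq: "fib \<alpha> \<gamma> (Suc i) j d = fib \<alpha> \<gamma> i j d \<union> ?h ` ?S"
 proof (intro equalityI subsetI)
  fix x assume "x \<in> fib \<alpha> \<gamma> (Suc i) j d"
  then obtain I u where x: "x = (I, u)" "I \<subseteq> {1..Suc i}" "\<forall>k. k \<notin> {1..j} --> u k = 0"
   "\<alpha> * card I + (\<Sum>k\<in>{1..j}. \<gamma> k * u k) = d" unfolding fib_def by blast
  show "x \<in> fib \<alpha> \<gamma> i j d \<union> ?h ` ?S"
  proof (cases "Suc i \<in> I")
   case True
   have fin: "finite I" using finite_subset[OF x(2)] by simp
   have cd: "card I = Suc (card (I - {Suc i}))" by (rule card.remove[OF fin True])
   then have ad: "\<alpha> \<le> d" using x(4) by simp
   have "I - {Suc i} \<subseteq> {1..i}" using x(2) by (auto simp: le_Suc_eq)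
   then have "(I - {Suc i}, u) \<in> fib \<alpha> \<gamma> i j (d - \<alpha>)" unfolding fib_def using x(3,4) cd by simp
   moreover have "x = ?h (I - {Suc i}, u)" using True x(1) by (simp add: insert_absorb)
   ultimately show ?thesis using ad by (intro UnI2 image_eqI[where x = "(I - {Suc i}, u)"]) simp_all
  next
   case False
   then have "I \<subseteq> {1..i}" using x(2) by (auto simp: le_Suc_eq)
   then show ?thesis using x by (simp add: fib_def)
  qed
 next
  fix x assume "x \<in> fib \<alpha> \<gamma> i j d \<union> ?h ` ?S"
  then show "x \<in> fib \<alpha> \<gamma> (Suc i) j d"
  proof
   assume "x \<in> fib \<alpha> \<gamma> i j d"
   then show ?thesis by (auto simp: fib_def)
  next
   assume "x \<in> ?h ` ?S"
   then obtain I u where x: "x = (insert (Suc i) I, u)" "(I, u) \<in> fib \<alpha> \<gamma> i j (d - \<alpha>)" "\<alpha> \<le> d"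
    by (auto split: if_splits)
   then show ?thesis using new[OF x(2)] by (auto simp: fib_def)
  qed
 qed
 have disj: "fib \<alpha> \<gamma> i j d \<inter> ?h ` ?S = {}" using new by (fastforce split: if_splits)
 have inj: "inj_on ?h ?S"
 proof (rule inj_onI)
  fix x y assume xy: "x \<in> ?S" "y \<in> ?S" "?h x = ?h y"
  obtain I u where x: "x = (I, u)" by (cases x)
  obtain I' u' where y: "y = (I', u')" by (cases y)
  have "u = u'" "insert (Suc i) I = insert (Suc i) I'" using xy(3) unfolding x y by simp_all
  then show "x = y" using nS[OF xy(1)[unfolded x]] nS[OF xy(2)[unfolded y]] unfolding x y by (simp add: insert_ident)
 qed
 have fin: "finite ?S" using finite_fib[OF \<gamma>] by simp
 have "(\<Sum>x\<in>fib \<alpha> \<gamma> (Suc i) j d. wt A C j x) = (\<Sum>x\<in>fib \<alpha> \<gamma> i j d. wt A C j x) + (\<Sum>x\<in>?h ` ?S. wt A C j x)"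
  unfolding eq using fin disj by (intro sum.union_disjoint finite_fib[OF \<gamma>]) auto
 also have "(\<Sum>x\<in>?h ` ?S. wt A C j x) = (\<Sum>x\<in>?S. wt A C j (?h x))" by (rule sum.reindex[OF inj, unfolded o_def])
 also have "... = (\<Sum>x\<in>?S. A * wt A C j x)"
 proof (rule sum.cong[OF refl], clarify)
  fix I u assume "(I, u) \<in> ?S"
  then have "Suc i \<notin> I" "finite I" by (rule nS)+
  then show "wt A C j (insert (Suc i) I, u) = A * wt A C j (I, u)" by (simp add: wt_def mult.assoc)
 qed
 finally show "gen_series \<alpha> \<gamma> A C (Suc i) j $ d = ((1 + fps_const A * fps_X ^ \<alpha>) * gen_series \<alpha> \<gamma> A C i j) $ d"
  by (simp add: gen_series_def distrib_right mult.assoc fps_X_power_mult_nth sum_distrib_left not_le)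
qed

text \<open>The new exponent is either 0 or can be lowered by one, which gives a geometric series in
  C X^\<gamma>.\<close>

lemma gen_series_U:
 assumes \<gamma>: "!!k. k \<in> {1..Suc j} ==> \<gamma> k \<ge> 1"
 shows "(1 - fps_const (C (Suc j)) * fps_X ^ \<gamma> (Suc j)) * gen_series \<alpha> \<gamma> A C i (Suc j) = gen_series \<alpha> \<gamma> A C i j"
proof -
 let ?t = "Suc j"
 have "gen_series \<alpha> \<gamma> A C i ?t = gen_series \<alpha> \<gamma> A C i j + fps_const (C ?t) * fps_X ^ \<gamma> ?t * gen_series \<alpha> \<gamma> A C i ?t"
 proof (rule fps_ext)
  fix d
  let ?h = "\<lambda>(I, u). (I :: nat set, u(?t := Suc (u ?t)))"
  let ?S = "if \<gamma> ?t \<le> d then fib \<alpha> \<gamma> i ?t (d - \<gamma> ?t) else {}"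
  have su: "(\<Sum>k\<in>{1..j}. \<gamma> k * (u(?t := v)) k) = (\<Sum>k\<in>{1..j}. \<gamma> k * u k)" for u :: "nat => nat" and v
   by (intro sum.cong) auto
  have eq: "fib \<alpha> \<gamma> i ?t d = fib \<alpha> \<gamma> i j d \<union> ?h ` ?S"
  proof (intro equalityI subsetI)
   fix x assume "x \<in> fib \<alpha> \<gamma> i ?t d"
   then obtain I u where x: "x = (I, u)" "I \<subseteq> {1..i}" "\<forall>k. k \<notin> {1..?t} --> u k = 0"
    "\<alpha> * card I + (\<Sum>k\<in>{1..?t}. \<gamma> k * u k) = d" unfolding fib_def by blast
   show "x \<in> fib \<alpha> \<gamma> i j d \<union> ?h ` ?S"
   proof (cases "u ?t")
    case 0
    then have "\<forall>k. k \<notin> {1..j} --> u k = 0" using x(3) by (metis atLeastAtMost_iff le_Suc_eq)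
    then show ?thesis using x 0 by (simp add: fib_def)
   next
    case (Suc v)
    let ?u = "u(?t := v)"
    have up: "?u(?t := Suc (?u ?t)) = u" using Suc by (auto simp: fun_eq_iff)
    have d: "d = \<alpha> * card I + (\<Sum>k\<in>{1..j}. \<gamma> k * u k) + \<gamma> ?t * v + \<gamma> ?t" using x(4) Suc by simp
    have z: "\<forall>k. k \<notin> {1..?t} --> ?u k = 0" using x(3) by auto
    have "(I, ?u) \<in> fib \<alpha> \<gamma> i ?t (d - \<gamma> ?t)" unfolding fib_def using x(2) z d
     by (simp add: su del: fun_upd_apply) simp
    moreover have "x = ?h (I, ?u)" using x(1) up by simp
    ultimately show ?thesis using d by (intro UnI2 image_eqI[where x = "(I, ?u)"]) simp_all
   qed
  next
   fix x assume "x \<in> fib \<alpha> \<gamma> i j d \<union> ?h ` ?S"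
   then show "x \<in> fib \<alpha> \<gamma> i ?t d"
   proof
    assume "x \<in> fib \<alpha> \<gamma> i j d"
    then show ?thesis by (auto simp: fib_def)
   next
    assume "x \<in> ?h ` ?S"
    then obtain I u where x: "x = (I, u(?t := Suc (u ?t)))" "(I, u) \<in> fib \<alpha> \<gamma> i ?t (d - \<gamma> ?t)" "\<gamma> ?t \<le> d"
     by (auto split: if_splits)
    then have y: "I \<subseteq> {1..i}" "\<forall>k. k \<notin> {1..?t} --> u k = 0" "\<alpha> * card I + (\<Sum>k\<in>{1..?t}. \<gamma> k * u k) = d - \<gamma> ?t"
     unfolding fib_def by blast+
    have "(\<Sum>k\<in>{1..?t}. \<gamma> k * (u(?t := Suc (u ?t))) k) = (\<Sum>k\<in>{1..j}. \<gamma> k * (u(?t := Suc (u ?t))) k) + \<gamma> ?t * Suc (u ?t)" by simp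
    also have "... = (\<Sum>k\<in>{1..?t}. \<gamma> k * u k) + \<gamma> ?t" unfolding su by simp
    finally have "\<alpha> * card I + (\<Sum>k\<in>{1..?t}. \<gamma> k * (u(?t := Suc (u ?t))) k) = d" using y(3) x(3) by linarith
    moreover have "\<forall>k. k \<notin> {1..?t} --> (u(?t := Suc (u ?t))) k = 0" using y(2) by auto
    ultimately show ?thesis unfolding x(1) fib_def using y(1) by blast
   qed
  qed
  have disj: "fib \<alpha> \<gamma> i j d \<inter> ?h ` ?S = {}"
  proof -
   have "snd x ?t = 0" if "x \<in> fib \<alpha> \<gamma> i j d" for x using that by (auto simp: fib_def)
   moreover have "snd x ?t \<noteq> 0" if "x \<in> ?h ` ?S" for x using that by auto
   ultimately show ?thesis by blast
  qed
  have inj: "inj_on ?h ?S"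
  proof (rule inj_onI)
   fix x y assume xy: "?h x = ?h y"
   obtain I u where x: "x = (I, u)" by (cases x)
   obtain I' u' where y: "y = (I', u')" by (cases y)
   have I: "I = I'" and e: "u(?t := Suc (u ?t)) = u'(?t := Suc (u' ?t))" using xy unfolding x y by simp_all
   have "u = u'"
   proof
    fix k show "u k = u' k" using fun_cong[OF e, of k] by (cases "k = ?t") auto
   qed
   then show "x = y" unfolding x y I by simp
  qed
  have fin: "finite ?S" using finite_fib[OF \<gamma>] by simp
  have finj: "finite (fib \<alpha> \<gamma> i j d)" using \<gamma> by (intro finite_fib) auto
  have "(\<Sum>x\<in>fib \<alpha> \<gamma> i ?t d. wt A C ?t x) = (\<Sum>x\<in>fib \<alpha> \<gamma> i j d. wt A C ?t x) + (\<Sum>x\<in>?h ` ?S. wt A C ?t x)"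
   unfolding eq using fin finj disj by (intro sum.union_disjoint) auto
  also have "(\<Sum>x\<in>?h ` ?S. wt A C ?t x) = (\<Sum>x\<in>?S. wt A C ?t (?h x))" by (rule sum.reindex[OF inj, unfolded o_def])
  also have "... = (\<Sum>x\<in>?S. C ?t * wt A C ?t x)"
  proof (rule sum.cong[OF refl], clarify)
   fix I and u :: "nat => nat"
   have "(\<Prod>k\<in>{1..j}. C k ^ (u(?t := Suc (u ?t))) k) = (\<Prod>k\<in>{1..j}. C k ^ u k)" by (intro prod.cong) auto
   then show "wt A C ?t (I, u(?t := Suc (u ?t))) = C ?t * wt A C ?t (I, u)"
    by (simp add: wt_def algebra_simps del: fun_upd_apply) (simp add: algebra_simps)
  qed
  also have "(\<Sum>x\<in>fib \<alpha> \<gamma> i j d. wt A C ?t x) = (\<Sum>x\<in>fib \<alpha> \<gamma> i j d. wt A C j x)"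
   by (intro sum.cong refl) (auto simp: wt_def fib_def)
  finally show "gen_series \<alpha> \<gamma> A C i ?t $ d = (gen_series \<alpha> \<gamma> A C i j + fps_const (C ?t) * fps_X ^ \<gamma> ?t * gen_series \<alpha> \<gamma> A C i ?t) $ d"
   by (simp add: gen_series_def mult.assoc fps_X_power_mult_nth sum_distrib_left not_le)
 qed
 then show ?thesis by (simp add: algebra_simps)
qed

lemma gen_series_eq:
 assumes \<gamma>: "!!k. k \<in> {1..j} ==> \<gamma> k \<ge> 1" and \<alpha>: "\<alpha> \<ge> 1"
 shows "gen_series \<alpha> \<gamma> A C i j * (\<Prod>k\<in>{1..j}. 1 - fps_const (C k) * fps_X ^ \<gamma> k) = (1 + fps_const A * fps_X ^ \<alpha>) ^ i"
 using \<gamma>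
proof (induction j)
 case 0
 have "gen_series \<alpha> \<gamma> A C i 0 = (1 + fps_const A * fps_X ^ \<alpha>) ^ i"
 proof (induction i)
  case 0
  have "fib \<alpha> \<gamma> 0 0 d = (if d = 0 then {({}, \<lambda>_. 0)} else {})" for d by (auto simp: fib_def fun_eq_iff)
  then show ?case by (intro fps_ext) (simp add: gen_series_def wt_def)
 next
  case (Suc i)
  then show ?case using gen_series_T[of 0 \<gamma> \<alpha> A C i] by simp
 qed
 then show ?case by simp
next
 case (Suc j)
 have "gen_series \<alpha> \<gamma> A C i (Suc j) * (\<Prod>k\<in>{1..Suc j}. 1 - fps_const (C k) * fps_X ^ \<gamma> k)
   = ((1 - fps_const (C (Suc j)) * fps_X ^ \<gamma> (Suc j)) * gen_series \<alpha> \<gamma> A C i (Suc j)) * (\<Prod>k\<in>{1..j}. 1 - fps_const (C k) * fps_X ^ \<gamma> k)"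
  by (simp add: ac_simps)
 also have "... = gen_series \<alpha> \<gamma> A C i j * (\<Prod>k\<in>{1..j}. 1 - fps_const (C k) * fps_X ^ \<gamma> k)"
  using Suc.prems by (subst gen_series_U) auto
 also have "... = (1 + fps_const A * fps_X ^ \<alpha>) ^ i" using Suc by simp
 finally show ?case .
qed

section \<open>Graded modules over the coinvariant algebra\<close>

declare split_paired_All [simp del] split_paired_Ex [simp del]

text \<open>Additive projections decide uniqueness: p_i applied to any homogeneous decomposition
  returns its i-th summand.\<close>

lemma graded_moduleI:
 assumes M: "module R M"
  and sub: "!!i. mpart M i \<subseteq> carrier M" and zero: "!!i. \<zero>\<^bsub>M\<^esub> \<in> mpart M i"
  and add: "!!i x y. x \<in> mpart M i ==> y \<in> mpart M i ==> x \<oplus>\<^bsub>M\<^esub> y \<in> mpart M i"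
  and neg: "!!i x. x \<in> mpart M i ==> \<ominus>\<^bsub>M\<^esub> x \<in> mpart M i"
  and smult: "!!i j r x. r \<in> rpart R i ==> x \<in> mpart M j ==> r \<odot>\<^bsub>M\<^esub> x \<in> mpart M (i + j)"
  and p: "!!i x. x \<in> carrier M ==> p i x \<in> mpart M i"
  and p_add: "!!i x y. x \<in> carrier M ==> y \<in> carrier M ==> p i (x \<oplus>\<^bsub>M\<^esub> y) = p i x \<oplus>\<^bsub>M\<^esub> p i y"
  and p_hom: "!!i j x. x \<in> mpart M j ==> p i x = (if i = j then x else \<zero>\<^bsub>M\<^esub>)"
  and p_sum: "!!x. x \<in> carrier M ==> \<exists>S. finite S \<and> (\<forall>i. i \<notin> S --> p i x = \<zero>\<^bsub>M\<^esub>) \<and> (\<Oplus>\<^bsub>M\<^esub>i\<in>S. p i x) = x"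
 shows "graded_module R M"
 unfolding graded_module_def
proof (intro conjI allI ballI M)
 interpret M: module R M by (rule M)
 show "subgroup (mpart M i) (add_monoid M)" for i
  by (rule subgroup.intro) (use sub zero add neg in \<open>auto simp: a_inv_def\<close>)
 show "r \<odot>\<^bsub>M\<^esub> x \<in> mpart M (i + j)" if "r \<in> rpart R i" "x \<in> mpart M j" for i j r x using smult that .
 fix x assume x: "x \<in> carrier M"
 have pc: "p i x \<in> carrier M" for i using p[OF x] sub by blast
 obtain S where S: "finite S" "!!i. i \<notin> S ==> p i x = \<zero>\<^bsub>M\<^esub>" "(\<Oplus>\<^bsub>M\<^esub>i\<in>S. p i x) = x" using p_sum[OF x] by blast
 let ?P = "\<lambda>c. (\<forall>i. c i \<in> mpart M i) \<and> finite {i. c i \<noteq> \<zero>\<^bsub>M\<^esub>} \<and> x = (\<Oplus>\<^bsub>M\<^esub>i\<in>{i. c i \<noteq> \<zero>\<^bsub>M\<^esub>}. c i)"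
 show "\<exists>!c. ?P c"
 proof (rule ex1I[of _ "\<lambda>i. p i x"])
  have subS: "{i. p i x \<noteq> \<zero>\<^bsub>M\<^esub>} \<subseteq> S" using S(2) by blast
  have "(\<Oplus>\<^bsub>M\<^esub>i\<in>{i. p i x \<noteq> \<zero>\<^bsub>M\<^esub>}. p i x) = (\<Oplus>\<^bsub>M\<^esub>i\<in>S. p i x)"
   using S(1) subS pc by (intro M.add.finprod_mono_neutral_cong_left) auto
  then show "?P (\<lambda>i. p i x)" using S(3) p[OF x] finite_subset[OF subS S(1)] by simp
 next
  fix c assume c: "?P c"
  have cc: "c i \<in> carrier M" for i using c sub by blast
  have p0: "p i \<zero>\<^bsub>M\<^esub> = \<zero>\<^bsub>M\<^esub>" for i using p_hom[OF zero[of i], of i] by simp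
  have "p i (\<Oplus>\<^bsub>M\<^esub>j\<in>A. c j) = (if i \<in> A then c i else \<zero>\<^bsub>M\<^esub>)" if "finite A" for A i using that
  proof (induction A rule: finite_induct)
   case (insert a A)
   have "p i (\<Oplus>\<^bsub>M\<^esub>j\<in>insert a A. c j) = p i (c a \<oplus>\<^bsub>M\<^esub> (\<Oplus>\<^bsub>M\<^esub>j\<in>A. c j))"
    using insert cc by (subst M.finsum_insert) auto
   also have "... = p i (c a) \<oplus>\<^bsub>M\<^esub> p i (\<Oplus>\<^bsub>M\<^esub>j\<in>A. c j)" using cc by (intro p_add M.finsum_closed) auto
   also have "p i (c a) = (if i = a then c a else \<zero>\<^bsub>M\<^esub>)" using c by (intro p_hom) simp
   finally show ?case using insert cc by auto
  qed (simp add: p0)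
  then have "p i (\<Oplus>\<^bsub>M\<^esub>j\<in>{i. c i \<noteq> \<zero>\<^bsub>M\<^esub>}. c j) = c i" for i using c by auto
  then show "c = (\<lambda>i. p i x)" using c by auto
 qed
qed

lemma gdec_superset:
 assumes M: "graded_module R M" and z: "z \<in> carrier M" and S: "finite S" "{i. gdec M z i \<noteq> \<zero>\<^bsub>M\<^esub>} \<subseteq> S"
 shows "(\<Oplus>\<^bsub>M\<^esub>i\<in>S. gdec M z i) = z"
proof -
 interpret M: module R M by (rule graded_moduleD(1)[OF M])
 have "(\<Oplus>\<^bsub>M\<^esub>i\<in>{i. gdec M z i \<noteq> \<zero>\<^bsub>M\<^esub>}. gdec M z i) = (\<Oplus>\<^bsub>M\<^esub>i\<in>S. gdec M z i)"
  using S gdec(4)[OF M z] by (intro M.add.finprod_mono_neutral_cong_left) auto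
 then show ?thesis using gdec(3)[OF M z] by (rule trans[OF sym sym])
qed

lemma rmod_simps:
 "carrier (regular_gmodule R) = carrier R" "\<zero>\<^bsub>regular_gmodule R\<^esub> = \<zero>\<^bsub>R\<^esub>"
 "x \<oplus>\<^bsub>regular_gmodule R\<^esub> y = x \<oplus>\<^bsub>R\<^esub> y" "x \<odot>\<^bsub>regular_gmodule R\<^esub> y = x \<otimes>\<^bsub>R\<^esub> y" "mpart (regular_gmodule R) = rpart R"
 by (simp_all add: regular_gmodule_def)

lemma regular_module: "cring R ==> module R (regular_gmodule R)"
proof -
 assume "cring R"
 then interpret cring R .
 show ?thesis
  by (rule module_criteria) (auto simp: rmod_simps a_ac m_assoc l_distr r_distr is_cring intro!: bexI[of _ "\<ominus>\<^bsub>R\<^esub> _"] r_neg)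
qed

lemma graded_neg:
 assumes "graded_module R M" "x \<in> mpart M i"
 shows "\<ominus>\<^bsub>M\<^esub> x \<in> mpart M i"
proof -
 have "subgroup (mpart M i) (add_monoid M)" using assms(1) by (simp add: graded_module_def)
 from subgroup.m_inv_closed[OF this assms(2)] show ?thesis by (simp add: a_inv_def)
qed

lemma gshift_simps:
 "carrier (gshift k M) = carrier M" "\<zero>\<^bsub>gshift k M\<^esub> = \<zero>\<^bsub>M\<^esub>"
 "x \<oplus>\<^bsub>gshift k M\<^esub> y = x \<oplus>\<^bsub>M\<^esub> y" "r \<odot>\<^bsub>gshift k M\<^esub> y = r \<odot>\<^bsub>M\<^esub> y" "mpart (gshift k M) i = mpart M (i - k)"
 "\<ominus>\<^bsub>gshift k M\<^esub> x = \<ominus>\<^bsub>M\<^esub> x" "finsum (gshift k M) = finsum M"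
 by (simp_all add: gshift_def a_inv_def finsum_def fun_eq_iff)

lemma gshift_module: "module R M ==> module R (gshift k M)"
proof -
 assume M: "module R M"
 interpret module R M by (rule M)
 show ?thesis by (rule module_transport[OF M, of "\<lambda>x. x"]) (auto simp: gshift_simps)
qed

lemma graded_gshift:
 assumes M: "graded_module R M"
 shows "graded_module R (gshift k M)"
proof (rule graded_moduleI[where p = "\<lambda>i x. gdec M x (i - k)"])
 interpret module R M by (rule graded_moduleD(1)[OF M])
 show "module R (gshift k M)" by (rule gshift_module[OF graded_moduleD(1)[OF M]])
 fix i j r x assume "r \<in> rpart R i" "x \<in> mpart (gshift k M) j"
 then show "r \<odot>\<^bsub>gshift k M\<^esub> x \<in> mpart (gshift k M) (i + j)"
  using graded_moduleD(5)[OF M, of r i x "j - k"] by (simp add: gshift_simps add_diff_eq)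
next
 fix x assume "x \<in> carrier (gshift k M)"
 then have x: "x \<in> carrier M" by (simp add: gshift_simps)
 interpret module R M by (rule graded_moduleD(1)[OF M])
 let ?s = "{i. gdec M x i \<noteq> \<zero>\<^bsub>M\<^esub>}"
 let ?S = "(\<lambda>i. i + k) ` ?s"
 have "(\<Oplus>\<^bsub>M\<^esub>i\<in>?S. gdec M x (i - k)) = (\<Oplus>\<^bsub>M\<^esub>i\<in>?s. gdec M x i)"
  using gdec(4)[OF M x] by (subst M.finsum_reindex) (auto simp: inj_on_def)
 also have "... = x" by (rule gdec(3)[OF M x, symmetric])
 finally have "(\<Oplus>\<^bsub>M\<^esub>i\<in>?S. gdec M x (i - k)) = x" .
 moreover have "gdec M x (i - k) = \<zero>\<^bsub>M\<^esub>" if "i \<notin> ?S" for i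
 proof (rule ccontr)
  assume "gdec M x (i - k) \<noteq> \<zero>\<^bsub>M\<^esub>"
  then have "(i - k) + k \<in> ?S" by blast
  then show False using that by simp
 qed
 ultimately show "\<exists>S. finite S \<and> (\<forall>i. i \<notin> S --> gdec M x (i - k) = \<zero>\<^bsub>gshift k M\<^esub>) \<and>
   (\<Oplus>\<^bsub>gshift k M\<^esub>i\<in>S. gdec M x (i - k)) = x"
  using gdec(2)[OF M x] unfolding gshift_simps by (intro exI[of _ ?S]) simp
qed (use graded_moduleD[OF M] graded_neg[OF M] gdec[OF M] gdec_add[OF M] gdec_homog[OF M] in \<open>auto simp: gshift_simps\<close>)

definition gsub :: "('r, 'm) gmodule => 'm set => ('r, 'm) gmodule" where
 "gsub M L = M\<lparr>carrier := L, mpart := \<lambda>i. mpart M i \<inter> L\<rparr>"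

lemma gsub_simps:
 "carrier (gsub M L) = L" "\<zero>\<^bsub>gsub M L\<^esub> = \<zero>\<^bsub>M\<^esub>"
 "x \<oplus>\<^bsub>gsub M L\<^esub> y = x \<oplus>\<^bsub>M\<^esub> y" "r \<odot>\<^bsub>gsub M L\<^esub> y = r \<odot>\<^bsub>M\<^esub> y" "mpart (gsub M L) i = mpart M i \<inter> L"
 by (simp_all add: gsub_def)

lemma graded_gsub:
 assumes R: "gring_ok R" and M: "graded_module R M" and L: "submod R L M"
  and comp: "!!x i. x \<in> L ==> gdec M x i \<in> L"
 shows "graded_module R (gsub M L)"
proof -
 interpret M: module R M by (rule graded_moduleD(1)[OF M])
 have Lc: "x \<in> carrier M" if "x \<in> L" for x using L that by (auto simp: submod_def)
 have La: "x \<oplus>\<^bsub>M\<^esub> y \<in> L" if "x \<in> L" "y \<in> L" for x y using L that by (auto simp: submod_def)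
 have L0: "\<zero>\<^bsub>M\<^esub> \<in> L" using L by (auto simp: submod_def)
 have Ls: "r \<odot>\<^bsub>M\<^esub> x \<in> L" if "r \<in> carrier R" "x \<in> L" for r x using L that by (auto simp: submod_def)
 have mL: "module R (gsub M L)"
  by (rule module_transport[OF graded_moduleD(1)[OF M], of "\<lambda>x. x"]) (auto simp: gsub_simps Lc La L0 Ls)
 interpret L: module R "gsub M L" by (rule mL)
 have neg: "\<ominus>\<^bsub>gsub M L\<^esub> x = \<ominus>\<^bsub>M\<^esub> x" "\<ominus>\<^bsub>M\<^esub> x \<in> L" if x: "x \<in> L" for x
 proof -
  have "(\<ominus>\<^bsub>R\<^esub> \<one>\<^bsub>R\<^esub>) \<odot>\<^bsub>M\<^esub> x = \<ominus>\<^bsub>M\<^esub> x" using Lc[OF x] by (simp add: M.smult_l_minus)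
  then show nL: "\<ominus>\<^bsub>M\<^esub> x \<in> L" using Ls[of "\<ominus>\<^bsub>R\<^esub> \<one>\<^bsub>R\<^esub>" x] x by simp
  show "\<ominus>\<^bsub>gsub M L\<^esub> x = \<ominus>\<^bsub>M\<^esub> x" using x nL Lc[OF x] by (intro L.minus_equality) (auto simp: gsub_simps M.l_neg)
 qed
 have hom: "(\<lambda>x. x) \<in> module_hom R (gsub M L) M" by (auto simp: module_hom_def gsub_simps Lc)
 have fs: "finsum (gsub M L) g A = finsum M g A" if "finite A" "!!i. i \<in> A ==> g i \<in> L" for g :: "int => 'b" and A
  using hom_finsum[OF mL graded_moduleD(1)[OF M] hom that(1), of g] that(2) by (auto simp: gsub_simps)
 show ?thesis
 proof (rule graded_moduleI[where p = "\<lambda>i x. gdec M x i", OF mL])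
  fix i j r x assume rx: "r \<in> rpart R i" "x \<in> mpart (gsub M L) j"
  then have x: "x \<in> L" "x \<in> mpart M j" by (auto simp: gsub_simps)
  have "r \<odot>\<^bsub>M\<^esub> x \<in> mpart M (i + j)" by (rule graded_moduleD(5)[OF M rx(1) x(2)])
  moreover have "r \<odot>\<^bsub>M\<^esub> x \<in> L" using Ls x(1) rx(1) rpart_carrier[OF R] by blast
  ultimately show "r \<odot>\<^bsub>gsub M L\<^esub> x \<in> mpart (gsub M L) (i + j)" by (simp add: gsub_simps)
 next
  fix x assume x: "x \<in> carrier (gsub M L)"
  then have xL: "x \<in> L" by (simp add: gsub_simps)
  let ?S = "{i. gdec M x i \<noteq> \<zero>\<^bsub>M\<^esub>}"
  have "finsum (gsub M L) (\<lambda>i. gdec M x i) ?S = x"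
   using fs[OF gdec(2)[OF M Lc[OF xL]] comp[OF xL]] gdec(3)[OF M Lc[OF xL]] by (rule trans[OF _ sym])
  then show "\<exists>S. finite S \<and> (\<forall>i. i \<notin> S --> gdec M x i = \<zero>\<^bsub>gsub M L\<^esub>) \<and> (\<Oplus>\<^bsub>gsub M L\<^esub>i\<in>S. gdec M x i) = x"
   using gdec(2)[OF M Lc[OF xL]] by (intro exI[of _ ?S]) (simp add: gsub_simps)
 qed (use L0 La graded_moduleD[OF M] graded_neg[OF M] neg gdec[OF M] gdec_add[OF M] gdec_homog[OF M] comp Lc in \<open>auto simp: gsub_simps\<close>)
qed

section \<open>Graded free modules\<close>

text \<open>The index set of the free generators, l being the internal degree; through it
  \<open>free_gmodule\<close> becomes an instance of \<open>free_mod\<close>.\<close>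

definition bs :: "(int => nat) => (int \<times> nat) set" where "bs \<beta> = {(l, k). k < \<beta> l}"

lemma finite_bs: "finite {l. \<beta> l \<noteq> 0} ==> finite (bs \<beta>)"
proof -
 assume "finite {l. \<beta> l \<noteq> 0}"
 moreover have "bs \<beta> \<subseteq> (SIGMA l:{l. \<beta> l \<noteq> 0}. {..<\<beta> l})" by (auto simp: bs_def)
 ultimately show ?thesis using finite_subset by blast
qed

lemma fmod_simps:
 "carrier (free_gmodule R \<beta>) = carrier (free_mod R (bs \<beta>))"
 "\<zero>\<^bsub>free_gmodule R \<beta>\<^esub> = (\<lambda>_. \<zero>\<^bsub>R\<^esub>)" "f \<oplus>\<^bsub>free_gmodule R \<beta>\<^esub> g = (\<lambda>x. f x \<oplus>\<^bsub>R\<^esub> g x)"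
 "r \<odot>\<^bsub>free_gmodule R \<beta>\<^esub> f = (\<lambda>x. r \<otimes>\<^bsub>R\<^esub> f x)"
 "mpart (free_gmodule R \<beta>) i = {f \<in> carrier (free_mod R (bs \<beta>)). \<forall>x. f x \<in> rpart R (i - fst x)}"
 by (auto simp: free_gmodule_def free_mod_def bs_def Let_def split_paired_All split_paired_Ex split: if_splits)

lemma fmod_module:
 fixes R :: "'r gring"
 assumes "cring R"
 shows "module R (free_gmodule R \<beta>)"
proof -
 interpret cring R by fact
 interpret F: module R "free_mod R (bs \<beta>)" by (rule free_mod_module)
 show ?thesis by (rule module_transport[OF free_mod_module, of "\<lambda>x. x" _ "bs \<beta>"])
   (use F.zero_closed F.a_closed F.smult_closed in \<open>auto simp: fmod_simps free_mod_simps\<close>)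
qed

lemma free_gmodule_projective:
 fixes R :: "'r gring"
 assumes R: "cring R"
 shows "projective_module R (free_gmodule R \<beta>)"
proof -
 interpret cring R by fact
 have h: "module_hom R (free_gmodule R \<beta>) M = module_hom R (free_mod R (bs \<beta>)) M" for M :: "('r, 'k) module"
  by (simp add: module_hom_def fmod_simps free_mod_simps)
 have "projective_module R (free_mod R (bs \<beta>))" by (rule projective_moduleI[OF free_mod_module free_mod_dual_basis])
 then show ?thesis using fmod_module[OF R, of \<beta>] unfolding projective_module_def h fmod_simps(1) by blast
qed

lemma coordinate_hom:
 fixes R :: "'r gring"
 assumes "cring R"
 shows "(\<lambda>f. f x) \<in> module_hom R (free_gmodule R \<beta>) (regular_gmodule R)"
proof -
 interpret cring R by fact
 show ?thesis by (auto simp: module_hom_def fmod_simps rmod_simps free_mod_carrier)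
qed

text \<open>The projection to degree i takes the component of degree i - l in each coordinate (l,
  k). Finitely many generators ensure that finitely many degrees suffice for all
  coordinates.\<close>

lemma free_gmodule_graded:
 fixes R :: "'r gring" (structure)
 assumes R: "gring_ok R" and fin: "finite (bs \<beta>)"
 shows "graded_module R (free_gmodule R \<beta>)"
proof -
 interpret cring R using R by (simp add: gring_ok_def)
 let ?F = "free_gmodule R \<beta>" and ?R = "regular_gmodule R"
 have RR: "graded_module R ?R" using R by (simp add: gring_ok_def)
 have mF: "module R ?F" by (rule fmod_module[OF is_cring])
 interpret F: module R ?F by (rule mF)
 interpret RM: module R ?R by (rule graded_moduleD(1)[OF RR])
 have g0: "gdec ?R \<zero> i = \<zero>" for i
  using gdec_homog[OF RR graded_moduleD(3)[OF RR, of i], of i] by (simp add: rmod_simps)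
 have rc: "rpart R i \<subseteq> carrier R" for i by (rule rpart_carrier[OF R])
 let ?p = "\<lambda>i f x. gdec ?R (f x) (i - fst x)"
 have pc: "?p i f \<in> carrier ?F" "!!x. ?p i f x \<in> rpart R (i - fst x)" if f: "f \<in> carrier ?F" for i f
 proof -
  have fx: "f x \<in> carrier ?R" "x \<notin> bs \<beta> ==> f x = \<zero>" for x
   using f by (auto simp: fmod_simps free_mod_carrier rmod_simps)
  show r: "?p i f x \<in> rpart R (i - fst x)" for x using gdec(1)[OF RR fx(1)] by (simp add: rmod_simps)
  have "{x. ?p i f x \<noteq> \<zero>} \<subseteq> bs \<beta>" using fx(2) g0 by fastforce
  then have "finite {x. ?p i f x \<noteq> \<zero>}" using fin finite_subset by blast
  moreover have "?p i f x \<in> carrier R" for x using r rc by blast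
  ultimately show "?p i f \<in> carrier ?F" using fx(2) g0 by (simp add: fmod_simps free_mod_carrier)
 qed
 show ?thesis
 proof (rule graded_moduleI[where p = ?p, OF mF])
  show "mpart ?F i \<subseteq> carrier ?F" for i by (auto simp: fmod_simps)
  show "\<zero>\<^bsub>?F\<^esub> \<in> mpart ?F i" for i using F.zero_closed graded_moduleD(3)[OF RR] by (simp add: fmod_simps rmod_simps)
  fix i f g assume f: "f \<in> mpart ?F i" and g: "g \<in> mpart ?F i"
  then have "f \<oplus>\<^bsub>?F\<^esub> g \<in> carrier ?F" by (intro F.a_closed) (auto simp: fmod_simps)
  then show "f \<oplus>\<^bsub>?F\<^esub> g \<in> mpart ?F i" using f g graded_moduleD(4)[OF RR] by (simp add: fmod_simps rmod_simps)
 next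
  fix i f assume f: "f \<in> mpart ?F i"
  then have fc: "f \<in> carrier ?F" by (auto simp: fmod_simps)
  have fx: "f x \<in> carrier R" for x using fc by (auto simp: fmod_simps free_mod_carrier)
  have "\<ominus>\<^bsub>?F\<^esub> f = (\<lambda>x. \<ominus>\<^bsub>?R\<^esub> f x)"
  proof -
   have "(\<ominus> \<one>) \<odot>\<^bsub>?F\<^esub> f = \<ominus>\<^bsub>?F\<^esub> f" using fc by (simp add: F.smult_l_minus)
   moreover have "(\<ominus> \<one>) \<odot>\<^bsub>?R\<^esub> f x = \<ominus>\<^bsub>?R\<^esub> f x" for x
    using RM.smult_l_minus[OF one_closed, of "f x"] RM.smult_one[of "f x"] fx[of x] unfolding rmod_simps(1) by simp
   ultimately show ?thesis by (simp add: fmod_simps rmod_simps(4))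
  qed
  moreover have "\<ominus>\<^bsub>?F\<^esub> f \<in> carrier ?F" using fc by (rule F.a_inv_closed)
  ultimately show "\<ominus>\<^bsub>?F\<^esub> f \<in> mpart ?F i" using f graded_neg[OF RR] by (simp add: fmod_simps rmod_simps(5))
 next
  fix i j r f assume r: "r \<in> rpart R i" and f: "f \<in> mpart ?F j"
  have "r \<odot>\<^bsub>?F\<^esub> f \<in> carrier ?F" using f r rc by (intro F.smult_closed) (auto simp: fmod_simps)
  moreover have "r \<otimes> f x \<in> rpart R (i + j - fst x)" for x
   using graded_moduleD(5)[OF RR r, of "f x" "j - fst x"] f by (simp add: fmod_simps rmod_simps add_diff_eq)
  ultimately show "r \<odot>\<^bsub>?F\<^esub> f \<in> mpart ?F (i + j)" by (simp add: fmod_simps)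
 next
  fix i f assume "f \<in> carrier ?F"
  then show "?p i f \<in> mpart ?F i" using pc by (simp add: fmod_simps)
 next
  fix i f g assume f: "f \<in> carrier ?F" and g: "g \<in> carrier ?F"
  have "gdec ?R (f x \<oplus> g x) l = gdec ?R (f x) l \<oplus> gdec ?R (g x) l" for x l
   using gdec_add[OF RR, of "f x" "g x" l] f g by (simp add: fmod_simps free_mod_carrier rmod_simps)
  then show "?p i (f \<oplus>\<^bsub>?F\<^esub> g) = ?p i f \<oplus>\<^bsub>?F\<^esub> ?p i g" by (simp add: fmod_simps)
 next
  fix i j f assume "f \<in> mpart ?F j"
  then have "f x \<in> mpart ?R (j - fst x)" for x by (simp add: fmod_simps rmod_simps)
  then have "gdec ?R (f x) (i - fst x) = (if i = j then f x else \<zero>)" for x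
   using gdec_homog[OF RR, of "f x" "j - fst x" "i - fst x"] by (auto simp: rmod_simps)
  then show "?p i f = (if i = j then f else \<zero>\<^bsub>?F\<^esub>)" by (auto simp: fmod_simps)
 next
  fix f assume f: "f \<in> carrier ?F"
  have fx: "f x \<in> carrier ?R" "x \<notin> bs \<beta> ==> f x = \<zero>" for x
   using f by (auto simp: fmod_simps free_mod_carrier rmod_simps)
  let ?s = "\<lambda>x. {i. gdec ?R (f x) i \<noteq> \<zero>}"
  have fs: "finite (?s x)" for x using gdec(2)[OF RR fx(1)] by (simp add: rmod_simps)
  let ?S = "\<Union>x\<in>bs \<beta>. (\<lambda>i. i + fst x) ` ?s x"
  have S: "finite ?S" using fin fs by blast
  have out: "gdec ?R (f x) (i - fst x) = \<zero>" if "i \<notin> ?S" for i x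
  proof (rule ccontr)
   assume n: "gdec ?R (f x) (i - fst x) \<noteq> \<zero>"
   then have "x \<in> bs \<beta>" using fx(2) g0 by metis
   moreover have "i = (i - fst x) + fst x" by simp
   ultimately have "i \<in> ?S" using n by blast
   then show False using that by blast
  qed
  have "(\<Oplus>\<^bsub>?F\<^esub>i\<in>?S. ?p i f) = f"
  proof
   fix x
   have "(\<Oplus>\<^bsub>?F\<^esub>i\<in>?S. ?p i f) x = (\<Oplus>\<^bsub>?R\<^esub>i\<in>?S. ?p i f x)"
    using hom_finsum[OF mF graded_moduleD(1)[OF RR] coordinate_hom[OF is_cring] S, of "\<lambda>i. ?p i f" x] pc[OF f] by blast
   also have "... = (\<Oplus>\<^bsub>?R\<^esub>i\<in>(\<lambda>i. i - fst x) ` ?S. gdec ?R (f x) i)"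
    using gdec(4)[OF RR fx(1)] by (subst RM.M.finsum_reindex) (auto simp: inj_on_def)
   also have "... = f x"
   proof (rule gdec_superset[OF RR fx(1)])
    show "finite ((\<lambda>i. i - fst x) ` ?S)" using S by simp
    show "{i. gdec ?R (f x) i \<noteq> \<zero>\<^bsub>?R\<^esub>} \<subseteq> (\<lambda>i. i - fst x) ` ?S"
    proof
     fix i assume i: "i \<in> {i. gdec ?R (f x) i \<noteq> \<zero>\<^bsub>?R\<^esub>}"
     have "i + fst x \<in> ?S"
     proof (rule ccontr)
      assume "i + fst x \<notin> ?S"
      then show False using out[of "i + fst x" x] i by (simp add: rmod_simps)
     qed
     then show "i \<in> (\<lambda>i. i - fst x) ` ?S" by (rule image_eqI[rotated]) simp
    qed
   qed
   finally show "(\<Oplus>\<^bsub>?F\<^esub>i\<in>?S. ?p i f) x = f x" .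
  qed
  then show "\<exists>S. finite S \<and> (\<forall>i. i \<notin> S --> ?p i f = \<zero>\<^bsub>?F\<^esub>) \<and> (\<Oplus>\<^bsub>?F\<^esub>i\<in>S. ?p i f) = f"
   using S out by (intro exI[of _ ?S]) (simp add: fmod_simps)
 qed
qed

section \<open>The gradings of the coinvariant algebra and of the trivial module\<close>

lemma lookup_mult_0: "lkp (p * q) 0 = lkp p 0 * lkp (q :: cpoly) 0"
proof -
 have z: "lkp (a * b) 0 = 0" if "lkp a 0 = 0" for a b :: cpoly
 proof -
  have "0 \<notin> kys (a * b)"
  proof
   assume "0 \<in> kys (a * b)"
   then obtain x y where xy: "0 = x + y" "x \<in> kys a" using keys_mult[of a b] by blast
   then have "mdeg x = 0" using mdeg_add[of x y] by simp
   then show False using xy(2) that by (simp add: in_keys_iff)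
  qed
  then show ?thesis by (simp add: in_keys_iff)
 qed
 have s: "lkp (sgl 0 c * q) 0 = c * lkp q 0" for c :: complex by (induction q rule: keys_induct[OF subset_UNIV])
   (auto simp: mult_single lookup_single when_def distrib_left lookup_add)
 have "p * q = (p - sgl 0 (lkp p 0)) * q + sgl 0 (lkp p 0) * q" by (simp add: algebra_simps)
 then have "lkp (p * q) 0 = lkp ((p - sgl 0 (lkp p 0)) * q) 0 + lkp (sgl 0 (lkp p 0) * q) 0"
  by (simp only: lookup_add)
 then show ?thesis using z[of "p - sgl 0 (lkp p 0)" q] s by (simp add: lookup_minus)
qed

lemma H_nontrivial: "\<one>\<^bsub>CA n\<^esub> \<noteq> \<zero>\<^bsub>CA n\<^esub>" using aug_cl[of n 1] aug_cl[of n 0] by (auto simp: H_one H_zero)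

lemma cl_sum:
 assumes "finite A" "!!i. i \<in> A ==> g i \<in> pn n"
 shows "(\<Oplus>\<^bsub>rmod n\<^esub>i\<in>A. cl n (g i)) = cl n (\<Sum>i\<in>A. g i)"
proof -
 interpret M: module "CA n" "rmod n" by (rule regular_module[OF H_cring])
 show ?thesis using assms
 proof (induction A rule: finite_induct)
  case empty
  then show ?case by (simp add: rmod_simps H_zero)
 next
  case (insert a A)
  have s: "sum g A \<in> pn n" "g a \<in> pn n" using insert by (auto intro: polys_sum)
  have "(\<Oplus>\<^bsub>rmod n\<^esub>i\<in>insert a A. cl n (g i)) =
    cl n (g a) \<oplus>\<^bsub>rmod n\<^esub> (\<Oplus>\<^bsub>rmod n\<^esub>i\<in>A. cl n (g i))"
   using insert by (intro M.M.finsum_insert) (auto simp: rmod_simps H_carrier)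
  then show ?case using insert s by (simp add: rmod_simps H_add)
 qed
qed

lemma cl_gcomp: "p \<in> pn n ==> q \<in> pn n ==> cl n p = cl n q ==> cl n (gcomp d p) = cl n (gcomp d q)"
 unfolding cl_eq_iff coinv_ideal_eq gcomp_minus[symmetric] by (rule idl_gcomp[OF frel_homog])

text \<open>The projections are induced by homogeneous components of representatives, which is well
  defined because the coinvariant ideal is homogeneous.\<close>

lemma H_gring_ok: "gring_ok (CA n)" unfolding gring_ok_def
proof (intro conjI H_cring)
 let ?H = "CA n" and ?M = "rmod n"
 have mM: "module ?H ?M" by (rule regular_module[OF H_cring])
 interpret H: cring ?H by (rule H_cring)
 interpret M: module ?H ?M by (rule mM)
 have part: "x \<in> mpart ?M i \<longleftrightarrow> (\<exists>p. p \<in> pn n \<and> (\<forall>m\<in>kys p. 2 * int (mdeg m) = i) \<and> x = cl n p)" for x i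
  by (auto simp: rmod_simps H_rpart poly_part_eq)
 define rp where "rp x = (SOME p. p \<in> pn n \<and> cl n p = x)" for x
 have rp: "rp x \<in> pn n" "cl n (rp x) = x" if "x \<in> carrier ?M" for x
 proof -
  have "\<exists>p. p \<in> pn n \<and> cl n p = x" using that by (auto simp: rmod_simps H_carrier)
  then have "rp x \<in> pn n \<and> cl n (rp x) = x" unfolding rp_def by (rule someI_ex)
  then show "rp x \<in> pn n" "cl n (rp x) = x" by auto
 qed
 \<comment> \<open>Internal degrees are even and nonnegative; for every other integer the component
   is 0.\<close>
 define sel where "sel i p = (if i \<in> range (\<lambda>d. 2 * int d) then gcomp (nat (i div 2)) p else 0)" for i p
 define p where "p i x = cl n (sel i (rp x))" for i x
 have sel: "sel i q \<in> pn n" if "q \<in> pn n" for i q using that by (simp add: sel_def)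
 have sel_add: "sel i (a + b) = sel i a + sel i b" for i a b by (simp add: sel_def gcomp_add)
 have p_cl: "p i (cl n q) = cl n (sel i q)" if q: "q \<in> pn n" for i q
 proof -
  have "cl n q \<in> carrier ?M" using q by (auto simp: rmod_simps H_carrier)
  from rp[OF this] show ?thesis unfolding p_def sel_def using cl_gcomp[OF _ q] by simp
 qed
 have car: "x \<in> carrier ?M \<longleftrightarrow> (\<exists>q\<in>pn n. x = cl n q)" for x by (auto simp: rmod_simps H_carrier)
 show "graded_module ?H ?M"
 proof (rule graded_moduleI[where p = p, OF mM])
  show "mpart ?M i \<subseteq> carrier ?M" for i using part car by blast
  show "\<zero>\<^bsub>?M\<^esub> \<in> mpart ?M i" for i unfolding part by (intro exI[of _ 0]) (simp add: rmod_simps H_zero)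
  fix i x y assume "x \<in> mpart ?M i" "y \<in> mpart ?M i"
  then obtain q r where qr: "q \<in> pn n" "\<forall>m\<in>kys q. 2 * int (mdeg m) = i" "x = cl n q"
   "r \<in> pn n" "\<forall>m\<in>kys r. 2 * int (mdeg m) = i" "y = cl n r" unfolding part by blast
  have "\<forall>m\<in>kys (q + r). 2 * int (mdeg m) = i" using qr keys_add[of q r] by blast
  then show "x \<oplus>\<^bsub>?M\<^esub> y \<in> mpart ?M i" unfolding part using qr
   by (intro exI[of _ "q + r"]) (simp add: rmod_simps H_add)
 next
  fix i x assume "x \<in> mpart ?M i"
  then obtain q where q: "q \<in> pn n" "\<forall>m\<in>kys q. 2 * int (mdeg m) = i" "x = cl n q" unfolding part by blast
  have "\<ominus>\<^bsub>?M\<^esub> x = cl n (- q)" using q by (intro M.M.minus_equality) (auto simp: rmod_simps H_carrier H_add H_zero)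
  then show "\<ominus>\<^bsub>?M\<^esub> x \<in> mpart ?M i" unfolding part using q by (intro exI[of _ "- q"]) (auto simp: in_keys_iff)
 next
  fix i j r x assume "r \<in> rpart ?H i" "x \<in> mpart ?M j"
  then obtain q s where qs: "s \<in> pn n" "\<forall>m\<in>kys s. 2 * int (mdeg m) = i" "r = cl n s"
   "q \<in> pn n" "\<forall>m\<in>kys q. 2 * int (mdeg m) = j" "x = cl n q" unfolding part[unfolded rmod_simps] rmod_simps by blast
  have "\<forall>m\<in>kys (s * q). 2 * int (mdeg m) = i + j"
  proof
   fix m assume "m \<in> kys (s * q)"
   then obtain a b where "m = a + b" "a \<in> kys s" "b \<in> kys q" using keys_mult[of s q] by blast
   then show "2 * int (mdeg m) = i + j" using qs(2,5) by (simp add: mdeg_add)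
  qed
  then show "r \<odot>\<^bsub>?M\<^esub> x \<in> mpart ?M (i + j)" unfolding part using qs
   by (intro exI[of _ "s * q"]) (simp add: rmod_simps H_mult)
 next
  fix i x assume "x \<in> carrier ?M"
  then obtain q where q: "q \<in> pn n" "x = cl n q" unfolding car by blast
  have "\<forall>m\<in>kys (sel i q). 2 * int (mdeg m) = i" by (auto simp: sel_def keys_gcomp)
  then show "p i x \<in> mpart ?M i" unfolding q(2) p_cl[OF q(1)] part using sel[OF q(1)] by blast
 next
  fix i x y assume "x \<in> carrier ?M" "y \<in> carrier ?M"
  then obtain q r where qr: "q \<in> pn n" "x = cl n q" "r \<in> pn n" "y = cl n r" unfolding car by blast
  then show "p i (x \<oplus>\<^bsub>?M\<^esub> y) = p i x \<oplus>\<^bsub>?M\<^esub> p i y"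
   using sel[OF qr(1), of i] sel[OF qr(3), of i] by (simp add: rmod_simps H_add p_cl sel_add)
 next
  fix i j x assume "x \<in> mpart ?M j"
  then obtain q where q: "q \<in> pn n" "\<forall>m\<in>kys q. 2 * int (mdeg m) = j" "x = cl n q" unfolding part by blast
  have "sel i q = (if i = j then q else 0)"
  proof (rule poly_mapping_eqI)
   fix m
   show "lkp (sel i q) m = lkp (if i = j then q else 0) m"
   proof (cases "m \<in> kys q")
    case True
    then have "2 * int (mdeg m) = j" using q(2) by blast
    then show ?thesis by (auto simp: sel_def lookup_gcomp)
   next
    case False
    then show ?thesis by (simp add: sel_def lookup_gcomp in_keys_iff)
   qed
  qed
  then show "p i x = (if i = j then x else \<zero>\<^bsub>?M\<^esub>)" unfolding q(3) p_cl[OF q(1)] by (simp add: rmod_simps H_zero)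
 next
  fix x assume "x \<in> carrier ?M"
  then obtain q where q: "q \<in> pn n" "x = cl n q" unfolding car by blast
  let ?S = "(\<lambda>d. 2 * int d) ` mdeg ` kys q"
  have "(\<Oplus>\<^bsub>?M\<^esub>i\<in>?S. p i x) = cl n (\<Sum>i\<in>?S. sel i q)" unfolding q(2) p_cl[OF q(1)] by (intro cl_sum sel q(1)) simp
  also have "(\<Sum>i\<in>?S. sel i q) = (\<Sum>d\<in>mdeg ` kys q. sel (2 * int d) q)"
   by (rule sum.reindex[unfolded o_def]) (auto simp: inj_on_def)
  also have "... = (\<Sum>d\<in>mdeg ` kys q. gcomp d q)" by (simp add: sel_def)
  also have "... = q" by (rule gcomp_expand[symmetric]) auto
  finally have "(\<Oplus>\<^bsub>?M\<^esub>i\<in>?S. p i x) = x" using q(2) by simp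
  moreover have "p i x = \<zero>\<^bsub>?M\<^esub>" if "i \<notin> ?S" for i
  proof -
   have "sel i q = 0"
   proof (rule poly_mapping_eqI)
    fix m
    show "lkp (sel i q) m = lkp 0 m" using that by (auto simp: sel_def lookup_gcomp in_keys_iff image_iff)
   qed
   then show ?thesis unfolding q(2) p_cl[OF q(1)] by (simp add: rmod_simps H_zero)
  qed
  ultimately show "\<exists>S. finite S \<and> (\<forall>i. i \<notin> S --> p i x = \<zero>\<^bsub>?M\<^esub>) \<and> (\<Oplus>\<^bsub>?M\<^esub>i\<in>S. p i x) = x"
   by (intro exI[of _ ?S]) simp
 qed
qed

lemma trivial_simps:
 "carrier (TM n) = range (scl n)" "\<zero>\<^bsub>TM n\<^esub> = scl n 0"
 "scl n a \<oplus>\<^bsub>TM n\<^esub> scl n b = scl n (a + b)"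
 "h \<odot>\<^bsub>TM n\<^esub> scl n b = scl n (aug h * b)"
 "mpart (TM n) i = (if i = 0 then range (scl n) else {scl n 0})"
 by (simp_all add: trivial_gmodule_def Let_def coinv_scalar_cl H_zero H_add H_mult mult_single single_add)

lemma aug_scalar [simp]: "aug (scl n c) = c" by (simp add: coinv_scalar_cl aug_cl)

lemma coinv_scalar_inj: "scl n a = scl n b \<longleftrightarrow> a = b" by (metis aug_scalar)

lemma augmentation_add: "x \<in> carrier (CA n) ==> y \<in> carrier (CA n) ==>
  aug (x \<oplus>\<^bsub>CA n\<^esub> y) = aug x + aug y"
 and augmentation_mult: "x \<in> carrier (CA n) ==> y \<in> carrier (CA n) ==>
  aug (x \<otimes>\<^bsub>CA n\<^esub> y) = aug x * aug y"
 and augmentation_one: "aug \<one>\<^bsub>CA n\<^esub> = 1"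
 and augmentation_zero: "aug \<zero>\<^bsub>CA n\<^esub> = 0"
 by (auto simp: H_carrier H_add H_mult H_one H_zero aug_cl lookup_add lookup_mult_0)

lemma augmentation_rpart:
 assumes "x \<in> rpart (CA n) i" "i \<noteq> 0"
 shows "aug x = 0"
proof -
 obtain p where p: "p \<in> poly_part n i" "x = cl n p" using assms(1) by (auto simp: H_rpart)
 have "0 \<notin> kys p" using p(1) assms(2) by (auto simp: poly_part_eq)
 then show ?thesis by (simp add: p(2) aug_cl in_keys_iff)
qed

lemma trivial_module: "module (CA n) (TM n)"
proof (rule module_criteria; (intro allI ballI impI)?; (elim conjE)?)
 show "cring (CA n)" by (rule H_cring)
 fix v assume "v \<in> carrier (TM n)"
 then obtain a where "v = scl n a" by (auto simp: trivial_simps)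
 then show "\<exists>w\<in>carrier (TM n). v \<oplus>\<^bsub>TM n\<^esub> w = \<zero>\<^bsub>TM n\<^esub>" by (intro bexI[of _ "scl n (- a)"]) (auto simp: trivial_simps)
qed (auto simp: trivial_simps augmentation_add augmentation_mult augmentation_one algebra_simps)

lemma trivial_graded: "graded_module (CA n) (TM n)"
proof (rule graded_moduleI[where p = "\<lambda>i x. if i = 0 then x else scl n 0", OF trivial_module])
 let ?C = "TM n"
 interpret C: module "CA n" ?C by (rule trivial_module)
 show "\<ominus>\<^bsub>?C\<^esub> x \<in> mpart ?C i" if "x \<in> mpart ?C i" for i x
 proof -
  have "\<ominus>\<^bsub>?C\<^esub> \<zero>\<^bsub>?C\<^esub> = \<zero>\<^bsub>?C\<^esub>" by simp
  then show ?thesis using that C.M.a_inv_closed[of x] by (auto simp: trivial_simps split: if_splits)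
 qed
 show "r \<odot>\<^bsub>?C\<^esub> x \<in> mpart ?C (i + j)" if r: "r \<in> rpart (CA n) i" and x: "x \<in> mpart ?C j" for i j r x
 proof -
  obtain a where a: "x = scl n a" "j \<noteq> 0 ==> a = 0" using x by (auto simp: trivial_simps split: if_splits)
  have "aug r * a = 0 \<or> i + j = 0" using augmentation_rpart[OF r] a(2) by (cases "i = 0") auto
  then show ?thesis unfolding a(1) trivial_simps by auto
 qed
 show "\<exists>S. finite S \<and> (\<forall>i::int. i \<notin> S --> (if i = 0 then x else scl n 0) = \<zero>\<^bsub>?C\<^esub>) \<and>
   (\<Oplus>\<^bsub>?C\<^esub>i\<in>S. if i = 0 then x else scl n 0) = x" if "x \<in> carrier ?C" for x
 proof (intro exI[of _ "{0::int}"] conjI)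
  show "(\<Oplus>\<^bsub>?C\<^esub>i\<in>{0::int}. if i = 0 then x else scl n 0) = x"
   using that C.M.finsum_insert[of "{}" "0::int" "\<lambda>i. if i = 0 then x else scl n 0"] by simp
 qed (auto simp: trivial_simps)
qed (auto simp: trivial_simps split: if_splits)

lemma free_gmodule_dual_basis:
 fixes R :: "'r gring" (structure)
 assumes "cring R"
 shows "dual_basis R (free_gmodule R \<beta>) (bs \<beta>) (unit_vec R) (\<lambda>b a. a b)"
proof -
 interpret cring R by fact
 let ?F = "free_gmodule R \<beta>" and ?M = "free_mod R (bs \<beta>)"
 interpret M: module R ?M by (rule free_mod_module)
 have db: "dual_basis R ?M (bs \<beta>) (unit_vec R) (\<lambda>b a. a b)" by (rule free_mod_dual_basis)
 have id: "(\<lambda>x. x) \<in> module_hom R ?M ?F" by (auto simp: module_hom_def fmod_simps free_mod_simps)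
 have uc: "unit_vec R b \<in> carrier ?M" if "b \<in> bs \<beta>" for b using that by (rule unit_vec_carrier)
 have "x = (\<Oplus>\<^bsub>?F\<^esub>b\<in>{b \<in> bs \<beta>. x b \<noteq> \<zero>}. x b \<odot>\<^bsub>?F\<^esub> unit_vec R b)" if x: "x \<in> carrier ?M" for x
 proof -
  let ?s = "{b \<in> bs \<beta>. x b \<noteq> \<zero>}"
  have "finite ?s" using x by (auto simp: free_mod_carrier intro: rev_finite_subset)
  moreover have "(\<lambda>b. x b \<odot>\<^bsub>?M\<^esub> unit_vec R b) \<in> ?s \<rightarrow> carrier ?M" using x uc by (auto simp: free_mod_carrier)
  ultimately have "(\<Oplus>\<^bsub>?M\<^esub>b\<in>?s. x b \<odot>\<^bsub>?M\<^esub> unit_vec R b) = (\<Oplus>\<^bsub>?F\<^esub>b\<in>?s. x b \<odot>\<^bsub>?M\<^esub> unit_vec R b)"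
   by (rule hom_finsum[OF free_mod_module fmod_module[OF is_cring] id])
  moreover have "x = (\<Oplus>\<^bsub>?M\<^esub>b\<in>?s. x b \<odot>\<^bsub>?M\<^esub> unit_vec R b)" using db x unfolding dual_basis_def by blast
  ultimately show ?thesis by (simp add: free_mod_simps fmod_simps)
 qed
 then show ?thesis using free_mod_functionals[of "bs \<beta>"] uc
  unfolding dual_basis_def functionals_def fmod_simps(1-4) free_mod_simps by blast
qed

lemma submodule_finsum:
 assumes M: "module R M" and L: "submod R L M"
 shows "finite A ==> (!!a. a \<in> A ==> g a \<in> L) ==> (\<Oplus>\<^bsub>M\<^esub>a\<in>A. g a) \<in> L"
proof (induction A rule: finite_induct)
 interpret M: module R M by (rule M)
 case empty
 then show ?case using L by (auto simp: submod_def)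
next
 interpret M: module R M by (rule M)
 case (insert a A)
 have "L \<subseteq> carrier M" using L by (auto simp: submod_def)
 then have "(\<Oplus>\<^bsub>M\<^esub>a\<in>insert a A. g a) = g a \<oplus>\<^bsub>M\<^esub> (\<Oplus>\<^bsub>M\<^esub>a\<in>A. g a)" using insert by (intro M.M.finsum_insert) auto
 then show ?case using L insert by (auto simp: submod_def)
qed

lemma fmod_in_submod:
 assumes R: "cring R" and L: "submod R L (free_gmodule R \<beta>)"
  and x: "x \<in> carrier (free_gmodule R \<beta>)"
  and b: "!!b. b \<in> bs \<beta> ==> x b \<odot>\<^bsub>free_gmodule R \<beta>\<^esub> unit_vec R b \<in> L"
 shows "x \<in> L"
proof -
 interpret cring R by (rule R)
 have db: "dual_basis R (free_gmodule R \<beta>) (bs \<beta>) (unit_vec R) (\<lambda>b a. a b)" by (rule free_gmodule_dual_basis[OF R])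
 have "finite {b \<in> bs \<beta>. x b \<noteq> \<zero>\<^bsub>R\<^esub>}" using db x unfolding dual_basis_def functionals_def by blast
 then have "(\<Oplus>\<^bsub>free_gmodule R \<beta>\<^esub>b\<in>{b \<in> bs \<beta>. x b \<noteq> \<zero>\<^bsub>R\<^esub>}. x b \<odot>\<^bsub>free_gmodule R \<beta>\<^esub> unit_vec R b) \<in> L"
  by (rule submodule_finsum[OF fmod_module[OF R] L]) (use b in blast)
 moreover have "x = (\<Oplus>\<^bsub>free_gmodule R \<beta>\<^esub>b\<in>{b \<in> bs \<beta>. x b \<noteq> \<zero>\<^bsub>R\<^esub>}. x b \<odot>\<^bsub>free_gmodule R \<beta>\<^esub> unit_vec R b)"
  using db x unfolding dual_basis_def by blast
 ultimately show ?thesis by simp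
qed

lemma submodule_preimage:
 assumes M: "module R M" and N: "module R N" and h: "h \<in> module_hom R M N" and L: "submod R L N"
 shows "submod R {x \<in> carrier M. h x \<in> L} M"
proof -
 interpret M: module R M by (rule M)
 interpret N: module R N by (rule N)
 show ?thesis using L h hom_zero[OF M N h] M.module_axioms by (auto simp: submod_def module_hom_def Pi_iff)
qed

lemma submodule_zero: "module R M ==> submod R {\<zero>\<^bsub>M\<^esub>} M"
proof -
 assume M: "module R M"
 interpret M: module R M by (rule M)
 show ?thesis by (auto simp: submod_def M.module_axioms)
qed

lemma submodule_image:
 assumes M: "module R M" and N: "module R N" and h: "h \<in> module_hom R M N"
 shows "submod R (h ` carrier M) N"
proof -
 interpret M: module R M by (rule M)
 interpret N: module R N by (rule N)
 have "h x \<oplus>\<^bsub>N\<^esub> h y = h (x \<oplus>\<^bsub>M\<^esub> y)" if "x \<in> carrier M" "y \<in> carrier M" for x y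
  using h that by (auto simp: module_hom_def)
 moreover have "r \<odot>\<^bsub>N\<^esub> h x = h (r \<odot>\<^bsub>M\<^esub> x)" if "r \<in> carrier R" "x \<in> carrier M" for r x
  using h that by (auto simp: module_hom_def)
 moreover have "\<zero>\<^bsub>N\<^esub> = h \<zero>\<^bsub>M\<^esub>" by (rule hom_zero[OF M N h, symmetric])
 moreover have "h ` carrier M \<subseteq> carrier N" using h by (auto simp: module_hom_def)
 ultimately show ?thesis unfolding submod_def using N by (auto simp: N.module_axioms)
qed

lemma graded_submodule_image:
 assumes R: "gring_ok R" and M: "graded_module R M" and N: "graded_module R N" and h: "h \<in> gr_hom R M N"
 shows "graded_submodule R N (h ` carrier M)"
proof -
 have L: "submod R (h ` carrier M) N"
  by (rule submodule_image[OF graded_moduleD(1)[OF M] graded_moduleD(1)[OF N] gr_homD(1)[OF h]])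
 have "gdec N x i \<in> h ` carrier M" if "x \<in> h ` carrier M" for x i using that gdec_hom[OF M N h] gdec(4)[OF M] by auto
 then have "graded_module R (gsub N (h ` carrier M))" by (rule graded_gsub[OF R N L])
 then show ?thesis using L by (simp add: graded_submodule_def gsub_def)
qed

section \<open>The augmentation filtration on free modules\<close>

definition Fge :: "nat => (int => nat) => nat => (int \<times> nat => cpoly set) set" where
 "Fge n \<beta> s = {x \<in> carrier (fmod n \<beta>). \<forall>p. x p \<in> Hge n s}"

lemma Fge_submodule: "submod (CA n) (Fge n \<beta> s) (fmod n \<beta>)"
proof -
 interpret M: module "CA n" "fmod n \<beta>" by (rule fmod_module[OF H_cring])
 have "x \<otimes>\<^bsub>CA n\<^esub> y \<in> Hge n s" if "x \<in> carrier (CA n)" "y \<in> Hge n s" for x y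
  using Hge_mult[of x n 0 y s] that by (simp add: Hge_0)
 then show ?thesis using M.a_closed M.smult_closed M.zero_closed
  by (auto simp: submod_def Fge_def M.module_axioms fmod_simps Hge_zero Hge_add)
qed

lemma Fge_smult:
 assumes "r \<in> Hge n s" "x \<in> Fge n \<beta> t"
 shows "r \<odot>\<^bsub>fmod n \<beta>\<^esub> x \<in> Fge n \<beta> (s + t)"
proof -
 interpret M: module "CA n" "fmod n \<beta>" by (rule fmod_module[OF H_cring])
 have "r \<in> carrier (CA n)" using assms(1) Hge_sub by blast
 then show ?thesis using assms M.smult_closed[of r x] Hge_mult by (simp add: Fge_def fmod_simps)
qed

lemma Fge_0: "Fge n \<beta> 0 = carrier (fmod n \<beta>)"
proof -
 interpret cring "CA n" by (rule H_cring)
 show ?thesis by (auto simp: Fge_def Hge_0 fmod_simps free_mod_carrier)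
qed

lemma unit_vec_free: "b \<in> bs \<beta> ==> unit_vec (CA n) b \<in> carrier (fmod n \<beta>)"
 using cring.unit_vec_carrier[OF H_cring] by (simp add: fmod_simps)

text \<open>A preimage of a submodule is a submodule, so it is enough to follow coordinates times
  unit vectors; the two filtration degrees add.\<close>

lemma Fge_hom:
 assumes h: "h \<in> module_hom (CA n) (fmod n \<beta>) (fmod n \<gamma>)"
  and x: "x \<in> Fge n \<beta> s" and t: "!!b. b \<in> bs \<beta> ==> h (unit_vec (CA n) b) \<in> Fge n \<gamma> t"
 shows "h x \<in> Fge n \<gamma> (s + t)"
proof -
 let ?H = "CA n"
 let ?F = "free_gmodule ?H \<beta>" and ?G = "free_gmodule ?H \<gamma>"
 interpret F: module ?H ?F by (rule fmod_module[OF H_cring])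
 have L: "submod ?H {y \<in> carrier ?F. h y \<in> Fge n \<gamma> (s + t)} ?F"
  by (rule submodule_preimage[OF fmod_module[OF H_cring] fmod_module[OF H_cring] h Fge_submodule])
 have "x \<in> {y \<in> carrier ?F. h y \<in> Fge n \<gamma> (s + t)}"
 proof (rule fmod_in_submod[OF H_cring L])
  show xc: "x \<in> carrier ?F" using x by (simp add: Fge_def)
  fix b assume b: "b \<in> bs \<beta>"
  have xb: "x b \<in> Hge n s" using x by (simp add: Fge_def)
  then have xh: "x b \<in> carrier ?H" using Hge_sub by blast
  have "h (x b \<odot>\<^bsub>?F\<^esub> unit_vec ?H b) = x b \<odot>\<^bsub>?G\<^esub> h (unit_vec ?H b)"
   using h xh unit_vec_free[OF b] by (auto simp: module_hom_def)
  then show "x b \<odot>\<^bsub>?F\<^esub> unit_vec ?H b \<in> {y \<in> carrier ?F. h y \<in> Fge n \<gamma> (s + t)}"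
   using Fge_smult[OF xb t[OF b]] xh unit_vec_free[OF b] by auto
 qed
 then show ?thesis by simp
qed

text \<open>The augmentation ideal acts by 0 on the trivial module.\<close>

lemma Fge_trivial_hom:
 assumes h: "h \<in> module_hom (CA n) (fmod n \<beta>) (TM n)"
  and x: "x \<in> Fge n \<beta> 1"
 shows "h x = scl n 0"
proof -
 let ?H = "CA n" and ?C = "TM n"
 let ?F = "free_gmodule ?H \<beta>"
 interpret F: module ?H ?F by (rule fmod_module[OF H_cring])
 have L: "submod ?H {y \<in> carrier ?F. h y \<in> {\<zero>\<^bsub>?C\<^esub>}} ?F"
  by (rule submodule_preimage[OF fmod_module[OF H_cring] trivial_module h submodule_zero[OF trivial_module]])
 have "x \<in> {y \<in> carrier ?F. h y \<in> {\<zero>\<^bsub>?C\<^esub>}}"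
 proof (rule fmod_in_submod[OF H_cring L])
  show xc: "x \<in> carrier ?F" using x by (simp add: Fge_def)
  fix b assume b: "b \<in> bs \<beta>"
  have xb: "x b \<in> Hge n 1" using x by (simp add: Fge_def)
  then have xh: "x b \<in> carrier ?H" using Hge_sub by blast
  obtain c where c: "h (unit_vec ?H b) = scl n c"
  proof -
   have "h (unit_vec ?H b) \<in> carrier ?C" using h unit_vec_free[OF b] unfolding module_hom_def by blast
   then show ?thesis using that unfolding trivial_simps by blast
  qed
  have "h (x b \<odot>\<^bsub>?F\<^esub> unit_vec ?H b) = x b \<odot>\<^bsub>?C\<^esub> h (unit_vec ?H b)"
   using h xh unit_vec_free[OF b] by (auto simp: module_hom_def)
  also have "... = scl n 0" using Hge_1[OF xh] xb by (simp add: c trivial_simps)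
  finally show "x b \<odot>\<^bsub>?F\<^esub> unit_vec ?H b \<in> {y \<in> carrier ?F. h y \<in> {\<zero>\<^bsub>?C\<^esub>}}"
   using xh unit_vec_free[OF b] by (simp add: trivial_simps)
 qed
 then show ?thesis by (simp add: trivial_simps)
qed

text \<open>Nakayama's lemma, by descending induction on the nilpotent augmentation filtration.\<close>

lemma free_nakayama:
 assumes L: "submod (CA n) L (fmod n \<beta>)"
  and cover: "!!b. b \<in> bs \<beta> ==> \<exists>k\<in>Fge n \<beta> 1. \<exists>l\<in>L. unit_vec (CA n) b = k \<oplus>\<^bsub>fmod n \<beta>\<^esub> l"
 shows "L = carrier (fmod n \<beta>)"
proof -
 let ?H = "CA n"
 let ?F = "free_gmodule ?H \<beta>"
 interpret F: module ?H ?F by (rule fmod_module[OF H_cring])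
 have Lc: "L \<subseteq> carrier ?F" and La: "!!x y. x \<in> L ==> y \<in> L ==> x \<oplus>\<^bsub>?F\<^esub> y \<in> L"
  and Ls: "!!r x. r \<in> carrier ?H ==> x \<in> L ==> r \<odot>\<^bsub>?F\<^esub> x \<in> L" and L0: "\<zero>\<^bsub>?F\<^esub> \<in> L"
  using L by (auto simp: submod_def)
 obtain d where d: "Hge n d = {\<zero>\<^bsub>?H\<^esub>}" using Hge_top by blast
 have "Fge n \<beta> (d - s) \<subseteq> L" for s
 proof (induction s)
  case 0
  have "Fge n \<beta> d \<subseteq> {\<zero>\<^bsub>?F\<^esub>}" by (auto simp: Fge_def d fmod_simps)
  then show ?case using L0 by auto
 next
  case (Suc s)
  show ?case
  proof (cases "d - s = 0")
   case True
   then have "d - Suc s = d - s" by simp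
   then show ?thesis using Suc by simp
  next
   case False
   then have e: "d - s = (d - Suc s) + 1" by simp
   show ?thesis
   proof
    fix x assume x: "x \<in> Fge n \<beta> (d - Suc s)"
    show "x \<in> L"
    proof (rule fmod_in_submod[OF H_cring L])
     show "x \<in> carrier ?F" using x by (simp add: Fge_def)
     fix b assume b: "b \<in> bs \<beta>"
     have xb: "x b \<in> Hge n (d - Suc s)" using x by (simp add: Fge_def)
     then have xh: "x b \<in> carrier ?H" using Hge_sub by blast
     obtain k l where kl: "k \<in> Fge n \<beta> 1" "l \<in> L" "unit_vec ?H b = k \<oplus>\<^bsub>?F\<^esub> l" using cover[OF b] by blast
     have kc: "k \<in> carrier ?F" using kl(1) by (simp add: Fge_def)
     have "x b \<odot>\<^bsub>?F\<^esub> k \<in> L" using Fge_smult[OF xb kl(1)] Suc unfolding e by blast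
     moreover have "x b \<odot>\<^bsub>?F\<^esub> l \<in> L" by (rule Ls[OF xh kl(2)])
     moreover have "x b \<odot>\<^bsub>?F\<^esub> unit_vec ?H b = x b \<odot>\<^bsub>?F\<^esub> k \<oplus>\<^bsub>?F\<^esub> x b \<odot>\<^bsub>?F\<^esub> l"
      unfolding kl(3) using xh kc kl(2) Lc by (intro F.smult_r_distr) auto
     ultimately show "x b \<odot>\<^bsub>?F\<^esub> unit_vec ?H b \<in> L" using La by simp
    qed
   qed
  qed
 qed
 from this[of d] show ?thesis using Lc Fge_0[of n \<beta>] by auto
qed

text \<open>Translates between a finite set with degrees \<open>w\<close>, here the pairs (I, u),
  and the generator names (l, k) of \<open>free_gmodule\<close>.\<close>

lemma graded_enumeration:
 assumes S: "finite S"
 shows "\<exists>e. bij_betw e S (bs (\<lambda>l. card {x\<in>S. w x = l})) \<and> (\<forall>x\<in>S. fst (e x) = (w x :: int))"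
proof -
 let ?b = "bs (\<lambda>l. card {x\<in>S. w x = l})"
 have "\<exists>h. bij_betw h {x\<in>S. w x = l} {0..<card {x\<in>S. w x = l}}" for l using S by (intro ex_bij_betw_finite_nat) simp
 then obtain h where h: "!!l. bij_betw (h l) {x\<in>S. w x = l} {0..<card {x\<in>S. w x = l}}" by metis
 let ?e = "\<lambda>x. (w x, h (w x) x)"
 have "bij_betw ?e S ?b"
 proof (rule bij_betw_imageI)
  show "inj_on ?e S"
  proof (rule inj_onI)
   fix x y assume xy: "x \<in> S" "y \<in> S" "?e x = ?e y"
   have wx: "w x = w y" using arg_cong[OF xy(3), of fst] by (simp only: fst_conv)
   have "h (w x) x = h (w y) y" using arg_cong[OF xy(3), of snd] by (simp only: snd_conv)
   then have "h (w x) x = h (w x) y" "w y = w x" by (simp_all only: wx)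
   moreover have "x \<in> {z \<in> S. w z = w x}" "y \<in> {z \<in> S. w z = w x}" using xy(1,2) wx by auto
   ultimately show "x = y" using inj_onD[OF bij_betw_imp_inj_on[OF h[of "w x"]]] by blast
  qed
  show "?e ` S = ?b"
  proof (intro equalityI subsetI)
   fix p assume "p \<in> ?e ` S"
   then obtain x where x: "x \<in> S" "p = ?e x" by blast
   have "h (w x) x \<in> {0..<card {y\<in>S. w y = w x}}" using bij_betwE[OF h[of "w x"]] x(1) by simp
   then show "p \<in> ?b" using x by (simp add: bs_def)
  next
   fix p assume "p \<in> ?b"
   then obtain l k where p: "p = (l, k)" "k \<in> {0..<card {y\<in>S. w y = l}}" by (auto simp: bs_def)
   then have "k \<in> h l ` {x\<in>S. w x = l}" using bij_betw_imp_surj_on[OF h[of l]] by simp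
   then obtain x where "x \<in> S" "w x = l" "h l x = k" by blast
   then show "p \<in> ?e ` S" using p by auto
  qed
 qed
 then show ?thesis by (intro exI[of _ ?e]) simp
qed

section \<open>The Koszul-Tate resolution of the trivial module\<close>

text \<open>Homogeneity with respect to the internal degree as an integer: for c negative or odd it
  forces p = 0, so degree shifts need no case distinction.\<close>

definition hz :: "int => cpoly => bool" where "hz c p \<longleftrightarrow> (\<forall>m\<in>kys p. 2 * int (mdeg m) = c)"

lemma hz_0 [simp]: "hz c 0" by (simp add: hz_def)

lemma hz_add: "hz c p ==> hz c q ==> hz c (p + q)" unfolding hz_def using keys_add[of p q] by blast

lemma hz_sum: "(!!i. i \<in> A ==> hz c (g i)) ==> hz c (\<Sum>i\<in>A. g i)"
 by (induction A rule: infinite_finite_induct) (auto simp: hz_add)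

lemma hz_mult:
 assumes "homog e r" "hz c p" "c' = c + 2 * int e"
 shows "hz c' (r * p)"
 unfolding hz_def
proof
 fix m assume "m \<in> kys (r * p)"
 then obtain a b where "m = a + b" "a \<in> kys r" "b \<in> kys p" using keys_mult[of r p] by blast
 then show "2 * int (mdeg m) = c'" using assms by (auto simp: homog_def hz_def mdeg_add)
qed

lemma homog_sg: "homog 0 (sg i I)"
proof -
 have "homog 0 ((-1 :: cpoly) ^ k)" for k
 proof (induction k)
  case (Suc k)
  then show ?case by (auto intro!: homog_uminus)
 qed simp
 then show ?thesis by (simp add: sg_def)
qed

lemma lkp_homog_pos: "homog e p ==> e \<ge> 1 ==> lkp p 0 = 0"
 unfolding homog_def by (metis in_keys_iff mdeg_0 not_one_le_zero)

locale coinv =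
 fixes n :: nat
 assumes n_pos: "n \<ge> 1"

text \<open>The coefficients come from \<open>hsym_expand\<close>: f_j is the sum over i \<le> j of
  x_i h_(n-j)(x_1..x_i). The condition on the indices keeps every \<open>g i j\<close> within the
  first n - 1 variables. Regularity holds since \<open>frel n (Suc j)\<close> is monic in a variable
  absent before.\<close>

sublocale coinv \<subseteq> koszul_tate "n - 1" "frel n" "\<lambda>i j. if i \<le> j \<and> j \<le> n - 1 then hsym i (n - j) else 0"
proof
 show "(if i \<le> j \<and> j \<le> n - 1 then hsym i (n - j) else 0) \<in> polys {1..n-1}" for i j by (auto intro!: hsym_polys)
 show "frel n j = (\<Sum>i\<in>{1..n-1}. vx i * (if i \<le> j \<and> j \<le> n - 1 then hsym i (n - j) else 0))"
  if j: "j \<in> {1..n-1}" for j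
 proof -
  have "n + 1 - j = Suc (n - j)" using j by auto
  then have "frel n j = (\<Sum>i\<in>{1..j}. vx i * hsym i (n - j))" unfolding frel_def by (simp only: hsym_expand)
  also have "... = (\<Sum>i\<in>{1..n-1}. vx i * (if i \<le> j \<and> j \<le> n - 1 then hsym i (n - j) else 0))"
   using j by (intro sum.mono_neutral_cong_left) auto
  finally show ?thesis .
 qed
 show "p \<in> idl {1..n-1} (frel n) j" if "j < n - 1" "frel n (Suc j) * p \<in> idl {1..n-1} (frel n) j" for j p
 proof (rule idl_regular[of j "frel n" "{1..j}" "Suc j" "{1..n-1}" "n - j" "frel n (Suc j)" p])
  show "frel n i \<in> polys {1..j}" if "i \<in> {1..j}" for i using that by (intro frel_polys) auto
  show "monic_in (Suc j) (n - j) ({1..n-1} - {Suc j}) (frel n (Suc j))" using that(1) by (intro frel_monic) auto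
 qed (use that in auto)
 show "lkp p 0 = 0" if "j \<le> n - 1" "p \<in> idl {1..n-1} (frel n) j" for j p
  using that by (intro idl_const_0[of j n p "{1..n-1}"]) auto
qed

context coinv
begin

abbreviation (input) "N \<equiv> n - 1"
abbreviation (input) "H \<equiv> CA n"
abbreviation (input) "C \<equiv> TM n"
abbreviation (input) "J \<equiv> idl {1..n-1} (frel n) (n-1)"

text \<open>Half the internal degree of a generator: T_i has the degree of x_i, and U_k the degree n
  + 1 - k of the relation \<open>frel n k\<close>.\<close>

definition wd :: "nat set \<times> (nat => nat) => nat" where
 "wd x = card (fst x) + (\<Sum>k\<in>{1..N}. (n + 1 - k) * snd x k)"

definition Ix :: "nat => (nat set \<times> (nat => nat)) set" where "Ix m = idx N N m"

lemma Ix_fib: "Ix m = fib 1 (\<lambda>_. 2) N N m" by (simp add: Ix_def idx_def fib_def sum_distrib_left)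

lemma finite_Ix: "finite (Ix m)" unfolding Ix_fib by (rule finite_fib) simp

definition bt :: "nat => int => nat" where
 "bt m = (\<lambda>l. card {x\<in>Ix m. 2 * int (wd x) = l})"

definition enc :: "nat => nat set \<times> (nat => nat) => int \<times> nat" where
 "enc m = (SOME e. bij_betw e (Ix m) (bs (bt m)) \<and> (\<forall>x\<in>Ix m. fst (e x) = 2 * int (wd x)))"

definition dec :: "nat => int \<times> nat => nat set \<times> (nat => nat)" where
 "dec m = inv_into (Ix m) (enc m)"

lemma enc: "bij_betw (enc m) (Ix m) (bs (bt m))" "x \<in> Ix m ==> fst (enc m x) = 2 * int (wd x)"
proof -
 have "\<exists>e. bij_betw e (Ix m) (bs (bt m)) \<and> (\<forall>x\<in>Ix m. fst (e x) = 2 * int (wd x))"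
  unfolding bt_def by (rule graded_enumeration[OF finite_Ix])
 from someI_ex[OF this] have "bij_betw (enc m) (Ix m) (bs (bt m)) \<and> (\<forall>x\<in>Ix m. fst (enc m x) = 2 * int (wd x))"
  unfolding enc_def .
 then show "bij_betw (enc m) (Ix m) (bs (bt m))" "x \<in> Ix m ==> fst (enc m x) = 2 * int (wd x)" by auto
qed

lemma finite_bt: "finite (bs (bt m))" using bij_betw_finite[OF enc(1)[of m]] finite_Ix by simp

lemma dec: "p \<in> bs (bt m) ==> dec m p \<in> Ix m" "p \<in> bs (bt m) ==> enc m (dec m p) = p"
 and dec_enc: "x \<in> Ix m ==> dec m (enc m x) = x" and enc_bs: "x \<in> Ix m ==> enc m x \<in> bs (bt m)"
 using enc(1)[of m] unfolding dec_def bij_betw_def by (auto intro: inv_into_into f_inv_into_f)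

lemma dec_wd: "p \<in> bs (bt m) ==> 2 * int (wd (dec m p)) = fst p"
 using enc(2)[OF dec(1), of p m] dec(2)[of p m] by simp

definition F :: "nat => (cpoly set, int \<times> nat => cpoly set) gmodule" where "F m = free_gmodule H (bt m)"

lemma F_carrier: "x \<in> carrier (F m) \<longleftrightarrow> (\<forall>p. x p \<in> carrier H) \<and> (\<forall>p. p \<notin> bs (bt m) --> x p = \<zero>\<^bsub>H\<^esub>)"
proof -
 interpret H: cring H by (rule H_cring)
 have "finite {p. x p \<noteq> \<zero>\<^bsub>H\<^esub>}" if "\<forall>p. p \<notin> bs (bt m) --> x p = \<zero>\<^bsub>H\<^esub>"
  by (rule finite_subset[OF _ finite_bt[of m]]) (use that in blast)
 then show ?thesis by (auto simp: F_def fmod_simps H.free_mod_carrier)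
qed

lemma F_module: "module H (F m)" unfolding F_def by (rule fmod_module[OF H_cring])

lemma F_graded: "graded_module H (F m)" unfolding F_def by (rule free_gmodule_graded[OF H_gring_ok finite_bt])

lemma F_simps: "\<zero>\<^bsub>F m\<^esub> = (\<lambda>_. \<zero>\<^bsub>H\<^esub>)" "x \<oplus>\<^bsub>F m\<^esub> y = (\<lambda>p. x p \<oplus>\<^bsub>H\<^esub> y p)" "r \<odot>\<^bsub>F m\<^esub> x = (\<lambda>p. r \<otimes>\<^bsub>H\<^esub> x p)"
 "mpart (F m) i = {x \<in> carrier (F m). \<forall>p. x p \<in> rpart H (i - fst p)}"
 by (simp_all add: F_def fmod_simps)

text \<open>Reduces the coefficients of a family modulo the relations and renames the pairs (I, u)
  to generators (l, k).\<close>

definition psh :: "nat => family => int \<times> nat => cpoly set" where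
 "psh m a = (\<lambda>p. if p \<in> bs (bt m) then cl n (a (fst (dec m p)) (snd (dec m p))) else \<zero>\<^bsub>H\<^esub>)"

lemma pnN: "p \<in> polys {1..N} ==> p \<in> pn n" by (rule polys_mono[of "{1..N}"]) auto

lemma cl_J: "p \<in> polys {1..N} ==> q \<in> polys {1..N} ==> cl n p = cl n q \<longleftrightarrow> p - q \<in> J"
 using cl_zero_small[OF n_pos, of "p - q"] cl_eq_iff[of n p q] cl_eq_iff[of n "p - q" 0] by simp

lemma psh_carrier: "a \<in> fam N N m ==> psh m a \<in> carrier (F m)"
proof -
 interpret H: cring H by (rule H_cring)
 assume a: "a \<in> fam N N m"
 have "cl n (a I u) \<in> carrier H" for I u using pnN[OF fam_polys[OF a]] by (simp add: H_carrier)
 then show ?thesis unfolding F_carrier psh_def using H.zero_closed by simp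
qed

lemma psh_enc: "(I, u) \<in> Ix m ==> psh m a (enc m (I, u)) = cl n (a I u)" by (simp add: psh_def enc_bs dec_enc)

text \<open>With \<open>psh_surj\<close> this identifies \<open>F m\<close> with the families of
  degree m modulo \<open>J\<close>, the form in which \<open>tate_exact\<close> is stated.\<close>

lemma psh_eq:
 assumes a: "a \<in> fam N N m" and b: "b \<in> fam N N m"
 shows "psh m a = psh m b \<longleftrightarrow> (\<forall>I u. a I u - b I u \<in> J)"
proof
 assume e: "psh m a = psh m b"
 show "\<forall>I u. a I u - b I u \<in> J"
 proof (intro allI)
  fix I u
  show "a I u - b I u \<in> J"
  proof (cases "(I, u) \<in> Ix m")
   case True
   have "cl n (a I u) = cl n (b I u)" using psh_enc[OF True, of a] psh_enc[OF True, of b] e by simp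
   then show ?thesis using cl_J[OF fam_polys[OF a] fam_polys[OF b]] by simp
  next
   case False
   then show ?thesis using fam_0[OF a] fam_0[OF b] by (simp add: Ix_def idl_zero)
  qed
 qed
next
 assume "\<forall>I u. a I u - b I u \<in> J"
 then have "cl n (a I u) = cl n (b I u)" for I u using cl_J[OF fam_polys[OF a] fam_polys[OF b]] by simp
 then show "psh m a = psh m b" by (simp add: psh_def fun_eq_iff)
qed

lemma psh_add:
 assumes a: "a \<in> fam N N m" and b: "b \<in> fam N N m"
 shows "psh m (\<lambda>I u. a I u + b I u) = psh m a \<oplus>\<^bsub>F m\<^esub> psh m b"
proof -
 interpret H: cring H by (rule H_cring)
 show ?thesis unfolding psh_def F_simps
  using H_add[OF pnN[OF fam_polys[OF a]] pnN[OF fam_polys[OF b]]] by (simp add: fun_eq_iff)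
qed

lemma psh_scale:
 assumes a: "a \<in> fam N N m" and r: "r \<in> polys {1..N}"
 shows "psh m (\<lambda>I u. r * a I u) = cl n r \<odot>\<^bsub>F m\<^esub> psh m a"
proof -
 interpret H: cring H by (rule H_cring)
 have "cl n r \<in> carrier H" using pnN[OF r] by (simp add: H_carrier)
 then show ?thesis unfolding psh_def F_simps
  using H_mult[OF pnN[OF r] pnN[OF fam_polys[OF a]]] by (simp add: fun_eq_iff)
qed

lemma psh_zero: "psh m (\<lambda>I u. 0) = \<zero>\<^bsub>F m\<^esub>" by (simp add: psh_def F_simps H_zero fun_eq_iff)

text \<open>Internal degree i of the whole element: each coefficient makes up for the degree of its
  generator.\<close>

definition hfam :: "int => family => bool" where
 "hfam i a \<longleftrightarrow> (\<forall>I u. hz (i - 2 * int (wd (I, u))) (a I u))"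

text \<open>The predicate \<open>Q\<close> is trivial for plain surjectivity and is homogeneity of
  the coefficients for the graded version.\<close>

lemma psh_lift:
 assumes x: "x \<in> carrier (F m)" and q: "!!p. p \<in> bs (bt m) ==> \<exists>q\<in>polys {1..N}. cl n q = x p \<and> Q p q"
  and Q0: "!!p. Q p 0"
 shows "\<exists>a\<in>fam N N m. psh m a = x \<and> (\<forall>I u. (I, u) \<in> Ix m --> Q (enc m (I, u)) (a I u)) \<and>
   (\<forall>I u. (I, u) \<notin> Ix m --> a I u = 0)"
proof -
 have "\<exists>q. q \<in> polys {1..N} \<and> (p \<in> bs (bt m) --> cl n q = x p) \<and> Q p q" for p using q[of p] Q0[of p] polys_0 by blast
 then obtain s where s: "!!p. s p \<in> polys {1..N}" "!!p. p \<in> bs (bt m) ==> cl n (s p) = x p" "!!p. Q p (s p)" by metis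
 let ?a = "\<lambda>I u. if (I, u) \<in> Ix m then s (enc m (I, u)) else 0"
 have "?a \<in> fam N N m" unfolding fam_def Ix_def using s(1) by simp
 moreover have "psh m ?a = x"
 proof
  fix p show "psh m ?a p = x p" using dec[of p m] s(2)[of p] x by (simp add: psh_def F_carrier)
 qed
 ultimately show ?thesis using s(3) by (intro bexI[of _ ?a]) simp_all
qed

lemma psh_surj:
 assumes x: "x \<in> carrier (F m)"
 shows "\<exists>a\<in>fam N N m. psh m a = x"
proof -
 have "\<exists>q\<in>polys {1..N}. cl n q = x p \<and> True" for p
 proof -
  have "x p \<in> carrier H" using x by (simp add: F_carrier)
  then show ?thesis unfolding H_carrier_small[OF n_pos] by blast
 qed
 from psh_lift[where Q = "\<lambda>_ _. True", OF x this] show ?thesis by blast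
qed

lemma psh_homog_surj:
 assumes x: "x \<in> mpart (F m) i"
 shows "\<exists>a\<in>fam N N m. psh m a = x \<and> hfam i a"
proof -
 have xc: "x \<in> carrier (F m)" using x by (simp add: F_simps)
 have q: "\<exists>q\<in>polys {1..N}. cl n q = x p \<and> hz (i - fst p) q" for p
 proof -
  have xp: "x p \<in> rpart H (i - fst p)" using x by (simp add: F_simps)
  show ?thesis
  proof (cases "\<exists>d. i - fst p = 2 * int d")
   case True
   then obtain d where d: "i - fst p = 2 * int d" by blast
   obtain q where "q \<in> polys {1..N}" "homog d q" "x p = cl n q"
    using xp unfolding d H_rpart_small(1)[OF n_pos] by blast
   then show ?thesis unfolding d by (intro bexI[of _ q]) (auto simp: hz_def homog_def)
  next
   case False
   then have "x p = cl n 0" using xp H_rpart_small(2)[OF n_pos, of "i - fst p"] by blast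
   then show ?thesis by (intro bexI[of _ 0]) simp_all
  qed
 qed
 obtain a where a: "a \<in> fam N N m" "psh m a = x" "!!I u. (I, u) \<in> Ix m ==> hz (i - fst (enc m (I, u))) (a I u)"
  "!!I u. (I, u) \<notin> Ix m ==> a I u = 0"
  using psh_lift[where Q = "\<lambda>p q. hz (i - fst p) q", OF xc q] by auto
 have "hz (i - 2 * int (wd (I, u))) (a I u)" for I u
 proof (cases "(I, u) \<in> Ix m")
  case True
  then show ?thesis using a(3)[OF True] enc(2)[OF True] by simp
 next
  case False
  then show ?thesis using a(4) by simp
 qed
 then show ?thesis using a(1,2) unfolding hfam_def by blast
qed

lemma psh_homog:
 assumes a: "a \<in> fam N N m" and h: "hfam i a"
 shows "psh m a \<in> mpart (F m) i"
proof -
 have "psh m a p \<in> rpart H (i - fst p)" for p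
 proof (cases "p \<in> bs (bt m)")
  case True
  let ?q = "a (fst (dec m p)) (snd (dec m p))"
  have "hz (i - 2 * int (wd (fst (dec m p), snd (dec m p)))) ?q" using h unfolding hfam_def by blast
  then have "hz (i - fst p) ?q" using dec_wd[OF True] by simp
  then have "cl n ?q \<in> rpart H (i - fst p)"
   using pnN[OF fam_polys[OF a]] by (auto simp: H_rpart poly_part_eq hz_def)
  then show ?thesis using True by (simp add: psh_def)
 next
  case False
  have "0 \<in> poly_part n (i - fst p)" by (simp add: poly_part_eq)
  then show ?thesis using False by (simp add: psh_def H_rpart H_zero)
 qed
 then show ?thesis using psh_carrier[OF a] by (simp add: F_simps)
qed

text \<open>Replacing T_k by x_k keeps the degree, and so does replacing U_j, of weight n + 1 - j,
  by T_k times a coefficient of degree n - j.\<close>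

lemma hfam_D:
 assumes a: "a \<in> fam N N m" and h: "hfam i a"
 shows "hfam i (D a)"
 unfolding hfam_def
proof (intro allI)
 fix I u
 let ?c = "i - 2 * int (wd (I, u))"
 show "hz ?c (D a I u)"
 proof (cases "finite I")
  case fin: True
  have 1: "hz ?c (vx k * io k a I u)" for k
  proof (cases "k \<in> I")
   case False
   have w: "wd (insert k I, u) = Suc (wd (I, u))" using fin False by (simp add: wd_def)
   have "hz (i - 2 * int (wd (insert k I, u))) (a (insert k I) u)" using h by (simp add: hfam_def)
   then have "hz (?c - 2) (a (insert k I) u)" unfolding w by (simp add: algebra_simps)
   then have "hz (?c - 2) (sg k I * a (insert k I) u)" by (rule hz_mult[OF homog_sg]) simp
   then have "hz ?c (vx k * (sg k I * a (insert k I) u))" by (rule hz_mult[OF homog_vx]) linarith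
   then show ?thesis using False by (simp add: io_def)
  qed (simp add: io_def)
  have 2: "hz ?c (ep k (G k a) I u)" if k: "k \<in> V" for k
  proof (cases "k \<in> I")
   case True
   have cd: "card I = Suc (card (I - {k}))" by (rule card.remove[OF fin True])
   have "hz ?c ((if k \<le> j \<and> j \<le> n - 1 then hsym k (n - j) else 0) * a (I - {k}) (u(j := Suc (u j))))" if j: "j \<in> V" for j
   proof (cases "k \<le> j \<and> j \<le> n - 1")
    case True
    have "(\<Sum>k\<in>V. (n + 1 - k) * (u(j := Suc (u j))) k) = (n + 1 - j) * Suc (u j) + (\<Sum>k\<in>V - {j}. (n + 1 - k) * (u(j := Suc (u j))) k)"
     using j by (subst sum.remove[of _ j]) auto
    also have "(\<Sum>k\<in>V - {j}. (n + 1 - k) * (u(j := Suc (u j))) k) = (\<Sum>k\<in>V - {j}. (n + 1 - k) * u k)"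
     by (intro sum.cong) auto
    also have "(n + 1 - j) * Suc (u j) + (\<Sum>k\<in>V - {j}. (n + 1 - k) * u k) = (n + 1 - j) + (\<Sum>k\<in>V. (n + 1 - k) * u k)"
     using j by (subst (2) sum.remove[of _ j]) auto
    finally have ww: "(\<Sum>k\<in>V. (n + 1 - k) * (u(j := Suc (u j))) k) = (n + 1 - j) + (\<Sum>k\<in>V. (n + 1 - k) * u k)" .
    have w: "int (wd (I - {k}, u(j := Suc (u j)))) = int (wd (I, u)) + int (n - j)"
    proof -
     have "n + 1 - j = Suc (n - j)" using j by auto
     then show ?thesis using cd ww unfolding wd_def fst_conv snd_conv by linarith
    qed
    have "hz (i - 2 * int (wd (I - {k}, u(j := Suc (u j))))) (a (I - {k}) (u(j := Suc (u j))))"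
     using h unfolding hfam_def by blast
    then have "hz (?c - 2 * int (n - j)) (a (I - {k}) (u(j := Suc (u j))))" unfolding w by (simp add: algebra_simps)
    then have "hz ?c (hsym k (n - j) * a (I - {k}) (u(j := Suc (u j))))" by (rule hz_mult[OF hsym_homog]) simp
    then show ?thesis unfolding if_P[OF True] .
   next
    case False
    show ?thesis unfolding if_not_P[OF False] by simp
   qed
   then have "hz ?c (G k a (I - {k}) u)" unfolding G_def by (rule hz_sum)
   then have "hz ?c (sg k I * G k a (I - {k}) u)" by (rule hz_mult[OF homog_sg]) simp
   then show ?thesis using True by (simp add: ep_def)
  qed (simp add: ep_def)
  show ?thesis unfolding D_def by (intro hz_sum hz_add 1 2)
 next
  case False
  have "D a I u = 0" using False by (intro D_infinite fam_infinite[OF a])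
  then show ?thesis by simp
 qed
qed

definition lft :: "nat => (int \<times> nat => cpoly set) => family" where
 "lft m x = (SOME a. a \<in> fam N N m \<and> psh m a = x)"

lemma lft: "x \<in> carrier (F m) ==> lft m x \<in> fam N N m" "x \<in> carrier (F m) ==> psh m (lft m x) = x"
proof -
 assume "x \<in> carrier (F m)"
 then have "\<exists>a. a \<in> fam N N m \<and> psh m a = x" using psh_surj by blast
 then have "lft m x \<in> fam N N m \<and> psh m (lft m x) = x" unfolding lft_def by (rule someI_ex)
 then show "lft m x \<in> fam N N m" "psh m (lft m x) = x" by auto
qed

definition dF :: "nat => (int \<times> nat => cpoly set) => int \<times> nat => cpoly set" where
 "dF m x = psh m (D (lft (Suc m) x))"

definition eF :: "(int \<times> nat => cpoly set) => cpoly set" where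
 "eF x = scl n (lkp (lft 0 x {} (\<lambda>_. 0)) 0)"

lemma D_fam: "a \<in> fam N N (Suc m) ==> D a \<in> fam N N m" by (rule fam_D) simp_all

text \<open>\<open>dF\<close> is computed from a chosen lift. Two lifts differ by coefficients in
  \<open>J\<close>, and D preserves such families.\<close>

lemma dF_psh:
 assumes a: "a \<in> fam N N (Suc m)"
 shows "dF m (psh (Suc m) a) = psh m (D a)"
proof -
 let ?b = "lft (Suc m) (psh (Suc m) a)"
 have b: "?b \<in> fam N N (Suc m)" "psh (Suc m) ?b = psh (Suc m) a" by (rule lft[OF psh_carrier[OF a]])+
 then have "?b I u - a I u \<in> J" for I u using psh_eq[OF b(1) a] by blast
 then have "D (\<lambda>I u. ?b I u - a I u) I u \<in> J" for I u by (rule ideal_D[OF idl_ideal])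
 then have "D ?b I u - D a I u \<in> J" for I u by (simp only: D_minus)
 then show ?thesis unfolding dF_def using psh_eq[OF D_fam[OF b(1)] D_fam[OF a]] by blast
qed

lemma eF_psh:
 assumes a: "a \<in> fam N N 0"
 shows "eF (psh 0 a) = scl n (lkp (a {} (\<lambda>_. 0)) 0)"
proof -
 let ?b = "lft 0 (psh 0 a)"
 have b: "?b \<in> fam N N 0" "psh 0 ?b = psh 0 a" by (rule lft[OF psh_carrier[OF a]])+
 then have "?b {} (\<lambda>_. 0) - a {} (\<lambda>_. 0) \<in> J" using psh_eq[OF b(1) a] by blast
 then have "lkp (?b {} (\<lambda>_. 0) - a {} (\<lambda>_. 0)) 0 = 0" by (rule const0[OF order_refl])
 then show ?thesis by (simp add: eF_def lookup_minus)
qed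

lemma dF_hom: "dF m \<in> gr_hom H (F (Suc m)) (F m)" unfolding gr_hom_def module_hom_def
proof (intro CollectI conjI Pi_I allI impI subsetI; (elim conjE)?)
 fix x assume "x \<in> carrier (F (Suc m))"
 then obtain a where a: "a \<in> fam N N (Suc m)" "psh (Suc m) a = x" using psh_surj by blast
 show "dF m x \<in> carrier (F m)" unfolding a(2)[symmetric] dF_psh[OF a(1)] by (rule psh_carrier[OF D_fam[OF a(1)]])
 fix y assume "y \<in> carrier (F (Suc m))"
 then obtain b where b: "b \<in> fam N N (Suc m)" "psh (Suc m) b = y" using psh_surj by blast
 have "D (\<lambda>I u. a I u + b I u) = (\<lambda>I u. D a I u + D b I u)" by (intro ext) (rule D_add)
 then show "dF m (x \<oplus>\<^bsub>F (Suc m)\<^esub> y) = dF m x \<oplus>\<^bsub>F m\<^esub> dF m y"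
  unfolding a(2)[symmetric] b(2)[symmetric] psh_add[OF a(1) b(1), symmetric]
   dF_psh[OF fam_add[OF a(1) b(1)]] dF_psh[OF a(1)] dF_psh[OF b(1)]
  using psh_add[OF D_fam[OF a(1)] D_fam[OF b(1)]] by simp
next
 fix r x assume r: "r \<in> carrier H" and x: "x \<in> carrier (F (Suc m))"
 obtain a where a: "a \<in> fam N N (Suc m)" "psh (Suc m) a = x" using psh_surj[OF x] by blast
 obtain q where q: "q \<in> polys {1..N}" "r = cl n q" using r unfolding H_carrier_small[OF n_pos] by blast
 have "D (\<lambda>I u. q * a I u) = (\<lambda>I u. q * D a I u)" by (intro ext) (rule D_scale)
 then show "dF m (r \<odot>\<^bsub>F (Suc m)\<^esub> x) = r \<odot>\<^bsub>F m\<^esub> dF m x"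
  unfolding a(2)[symmetric] q(2) psh_scale[OF a(1) q(1), symmetric] dF_psh[OF fam_scale[OF q(1) a(1)]] dF_psh[OF a(1)]
  using psh_scale[OF D_fam[OF a(1)] q(1)] by simp
next
 fix i y assume "y \<in> dF m ` mpart (F (Suc m)) i"
 then obtain a where a: "a \<in> fam N N (Suc m)" "y = dF m (psh (Suc m) a)" "hfam i a" using psh_homog_surj by blast
 show "y \<in> mpart (F m) i" unfolding a(2) dF_psh[OF a(1)] by (rule psh_homog[OF D_fam[OF a(1)] hfam_D[OF a(1,3)]])
qed

lemma eF_hom: "eF \<in> gr_hom H (F 0) C" unfolding gr_hom_def module_hom_def
proof (intro CollectI conjI Pi_I allI impI subsetI; (elim conjE)?)
 fix x assume "x \<in> carrier (F 0)"
 then obtain a where a: "a \<in> fam N N 0" "psh 0 a = x" using psh_surj by blast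
 show "eF x \<in> carrier C" unfolding a(2)[symmetric] eF_psh[OF a(1)] by (simp add: trivial_simps)
 fix y assume "y \<in> carrier (F 0)"
 then obtain b where b: "b \<in> fam N N 0" "psh 0 b = y" using psh_surj by blast
 show "eF (x \<oplus>\<^bsub>F 0\<^esub> y) = eF x \<oplus>\<^bsub>C\<^esub> eF y" unfolding a(2)[symmetric] b(2)[symmetric] psh_add[OF a(1) b(1), symmetric]
   eF_psh[OF fam_add[OF a(1) b(1)]] eF_psh[OF a(1)] eF_psh[OF b(1)] by (simp add: trivial_simps lookup_add)
next
 fix r x assume r: "r \<in> carrier H" and x: "x \<in> carrier (F 0)"
 obtain a where a: "a \<in> fam N N 0" "psh 0 a = x" using psh_surj[OF x] by blast
 obtain q where q: "q \<in> polys {1..N}" "r = cl n q" using r unfolding H_carrier_small[OF n_pos] by blast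
 show "eF (r \<odot>\<^bsub>F 0\<^esub> x) = r \<odot>\<^bsub>C\<^esub> eF x"
  unfolding a(2)[symmetric] q(2) psh_scale[OF a(1) q(1), symmetric] eF_psh[OF fam_scale[OF q(1) a(1)]] eF_psh[OF a(1)]
  by (simp add: trivial_simps lookup_mult_0 aug_cl)
next
 fix i y assume "y \<in> eF ` mpart (F 0) i"
 then obtain a where a: "a \<in> fam N N 0" "y = eF (psh 0 a)" "hfam i a" using psh_homog_surj by blast
 have "hz (i - 2 * int (wd ({}, \<lambda>_. 0))) (a {} (\<lambda>_. 0))" using a(3) unfolding hfam_def by blast
 then have "hz i (a {} (\<lambda>_. 0))" by (simp add: wd_def)
 then have "i \<noteq> 0 ==> lkp (a {} (\<lambda>_. 0)) 0 = 0" unfolding hz_def by (metis in_keys_iff mdeg_0 mult_zero_right of_nat_0)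
 then show "y \<in> mpart C i" unfolding a(2) eF_psh[OF a(1)] by (simp add: trivial_simps)
qed

text \<open>Along \<open>psh\<close> the statements modulo \<open>J\<close> become exactness:
  \<open>D_D_idl\<close> gives a complex, \<open>tate_exact_0\<close> exactness at the augmentation,
  \<open>tate_exact\<close> exactness elsewhere.\<close>

theorem F_resolution: "graded_projective_resolution H C F dF eF"
 unfolding graded_projective_resolution_def projective_resolution_def
proof (intro conjI allI trivial_module trivial_graded F_graded dF_hom eF_hom gr_homD(1)[OF dF_hom] gr_homD(1)[OF eF_hom])
 show "projective_module H (F m)" for m unfolding F_def by (rule free_gmodule_projective[OF H_cring])
 show "eF ` carrier (F 0) = carrier C"
 proof (intro equalityI image_subsetI subsetI)
  show "eF x \<in> carrier C" if "x \<in> carrier (F 0)" for x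
   using gr_homD(1)[OF eF_hom] that by (auto simp: module_hom_def)
  fix y assume "y \<in> carrier C"
  then obtain c where c: "y = scl n c" by (auto simp: trivial_simps)
  have dl: "dl (sgl 0 c) \<in> fam N N 0" by (rule fam_dl) simp
  have "eF (psh 0 (dl (sgl 0 c))) = y" unfolding eF_psh[OF dl] c by (simp add: dl_def)
  then show "y \<in> eF ` carrier (F 0)" using psh_carrier[OF dl] by blast
 qed
 show "dF 0 ` carrier (F (Suc 0)) = mod_ker (F 0) C eF"
 proof (intro equalityI image_subsetI subsetI)
  fix x assume "x \<in> carrier (F (Suc 0))"
  then obtain a where a: "a \<in> fam N N (Suc 0)" "psh (Suc 0) a = x" using psh_surj by blast
  have "lkp (D a {} (\<lambda>_. 0)) 0 = 0" using a(1) by (intro idl_vx_const0[OF D_deg1[of a N N]]) simp_all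
  then have "eF (psh 0 (D a)) = \<zero>\<^bsub>C\<^esub>" unfolding eF_psh[OF D_fam[OF a(1)]] by (simp add: trivial_simps)
  then show "dF 0 x \<in> mod_ker (F 0) C eF"
   unfolding a(2)[symmetric] dF_psh[OF a(1)] mod_ker_def using psh_carrier[OF D_fam[OF a(1)]] by simp
 next
  fix x assume "x \<in> mod_ker (F 0) C eF"
  then have x: "x \<in> carrier (F 0)" "eF x = \<zero>\<^bsub>C\<^esub>" by (simp_all add: mod_ker_def)
  obtain a where a: "a \<in> fam N N 0" "psh 0 a = x" using psh_surj[OF x(1)] by blast
  have "lkp (a {} (\<lambda>_. 0)) 0 = 0"
   using x(2) unfolding a(2)[symmetric] eF_psh[OF a(1)] by (simp add: trivial_simps coinv_scalar_inj)
  from tate_exact_0[OF a(1) this] obtain b where b: "b \<in> fam N N 1" "!!I u. a I u = D b I u" by blast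
  have "a = D b" using b(2) by (intro ext)
  moreover have "b \<in> fam N N (Suc 0)" using b(1) by simp
  ultimately have "x = dF 0 (psh (Suc 0) b)" using a(2) dF_psh by simp
  then show "x \<in> dF 0 ` carrier (F (Suc 0))" using psh_carrier[OF \<open>b \<in> fam N N (Suc 0)\<close>] by blast
 qed
 fix m
 show "dF (Suc m) ` carrier (F (Suc (Suc m))) = mod_ker (F (Suc m)) (F m) (dF m)"
 proof (intro equalityI image_subsetI subsetI)
  fix x assume "x \<in> carrier (F (Suc (Suc m)))"
  then obtain a where a: "a \<in> fam N N (Suc (Suc m))" "psh (Suc (Suc m)) a = x" using psh_surj by blast
  have "D (D a) I u \<in> J" for I u by (rule D_D_idl[OF a(1) order_refl])
  then have "psh m (D (D a)) = psh m (\<lambda>I u. 0)" using psh_eq[OF D_fam[OF D_fam[OF a(1)]] fam_zero] by simp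
  then have "dF m (psh (Suc m) (D a)) = \<zero>\<^bsub>F m\<^esub>" unfolding dF_psh[OF D_fam[OF a(1)]] psh_zero .
  then show "dF (Suc m) x \<in> mod_ker (F (Suc m)) (F m) (dF m)"
   unfolding a(2)[symmetric] dF_psh[OF a(1)] mod_ker_def using psh_carrier[OF D_fam[OF a(1)]] by simp
 next
  fix x assume "x \<in> mod_ker (F (Suc m)) (F m) (dF m)"
  then have x: "x \<in> carrier (F (Suc m))" "dF m x = \<zero>\<^bsub>F m\<^esub>" by (simp_all add: mod_ker_def)
  obtain a where a: "a \<in> fam N N (Suc m)" "psh (Suc m) a = x" using psh_surj[OF x(1)] by blast
  have "psh m (D a) = psh m (\<lambda>I u. 0)" using x(2) unfolding a(2)[symmetric] dF_psh[OF a(1)] psh_zero .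
  then have "D a I u \<in> J" for I u using psh_eq[OF D_fam[OF a(1)] fam_zero] by simp
  from tate_exact[OF order_refl _ a(1) this] obtain b where b: "b \<in> fam N N (Suc (Suc m))" "\<forall>I u. a I u - D b I u \<in> J" by auto
  have "x = psh (Suc m) (D b)" unfolding a(2)[symmetric] using psh_eq[OF a(1) D_fam[OF b(1)]] b(2) by simp
  then have "x = dF (Suc m) (psh (Suc (Suc m)) b)" using dF_psh[OF b(1)] by simp
  then show "x \<in> dF (Suc m) ` carrier (F (Suc (Suc m)))" using psh_carrier[OF b(1)] by blast
 qed
qed

text \<open>All coefficients of D have positive degree: the variables, and the polynomials h_(n-j)
  with j < n.\<close>

lemma dF_augmentation:
 assumes x: "x \<in> carrier (F (Suc m))"
 shows "dF m x \<in> Fge n (bt m) 1"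
proof -
 obtain a where a: "a \<in> fam N N (Suc m)" "psh (Suc m) a = x" using psh_surj[OF x] by blast
 have "lkp (G k b I u) 0 = 0" for k b I u
  unfolding G_def using lkp_homog_pos[OF hsym_homog] n_pos by (auto simp: lookup_sum lookup_mult_0 intro!: sum.neutral)
 then have 1: "lkp (ep k (G k a) I u) 0 = 0" for k I u by (simp add: ep_def lookup_mult_0)
 have 2: "lkp (vx k) 0 = 0" for k by (rule lkp_homog_pos[OF homog_vx]) simp
 have 0: "lkp (D a I u) 0 = 0" for I u unfolding D_def lookup_sum lookup_add lookup_mult_0 1 2 by simp
 have e: "dF m x = psh m (D a)" unfolding a(2)[symmetric] by (rule dF_psh[OF a(1)])
 have c: "dF m x \<in> carrier (F m)" unfolding a(2)[symmetric] dF_psh[OF a(1)] by (rule psh_carrier[OF D_fam[OF a(1)]])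
 have "dF m x p \<in> Hge n 1" for p
 proof -
  have "dF m x p \<in> carrier H" using c by (simp add: F_carrier)
  moreover have "aug (dF m x p) = 0" unfolding e psh_def using 0[of "fst (dec m p)" "snd (dec m p)"]
   by (auto simp: aug_cl augmentation_zero)
  ultimately show ?thesis using Hge_1 by blast
 qed
 then show ?thesis using c by (simp add: Fge_def F_def)
qed

text \<open>A complement of the image of \<open>dF\<close> contains every generator up to the
  augmentation ideal, so Nakayama applies.\<close>

theorem F_minimal: "minimal_graded_resolution H C F dF eF" unfolding minimal_graded_resolution_def superfluous_def
proof (intro conjI F_resolution allI impI)
 fix m L assume L: "graded_submodule H (F m) L \<and> dF m ` carrier (F (Suc m)) <+>\<^bsub>F m\<^esub> L = carrier (F m)"
 then have sub: "submod H L (free_gmodule H (bt m))" by (simp add: graded_submodule_def F_def)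
 show "L = carrier (F m)" unfolding F_def
 proof (rule free_nakayama[OF sub])
  fix b assume "b \<in> bs (bt m)"
  then have "unit_vec H b \<in> dF m ` carrier (F (Suc m)) <+>\<^bsub>F m\<^esub> L" using unit_vec_free[of b "bt m" n] L by (simp add: F_def)
  then show "\<exists>k\<in>Fge n (bt m) 1. \<exists>l\<in>L. unit_vec H b = k \<oplus>\<^bsub>free_gmodule H (bt m)\<^esub> l"
   using dF_augmentation unfolding set_add_def' F_def[symmetric] by blast
 qed
qed

end

section \<open>Unipotent maps and uniqueness of Betti numbers\<close>

lemma hom_diff:
 assumes M: "module R M" and N: "module R N" and h: "h \<in> module_hom R M N" and x: "x \<in> carrier M" "y \<in> carrier M"
 shows "h (x \<ominus>\<^bsub>M\<^esub> y) = h x \<ominus>\<^bsub>N\<^esub> h y"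
proof -
 interpret M: module R M by (rule M)
 interpret N: module R N by (rule N)
 have hc: "h z \<in> carrier N" if "z \<in> carrier M" for z using h that by (auto simp: module_hom_def)
 have "h x = h ((x \<ominus>\<^bsub>M\<^esub> y) \<oplus>\<^bsub>M\<^esub> y)" using x by (simp add: M.minus_eq M.a_assoc M.l_neg)
 also have "... = h (x \<ominus>\<^bsub>M\<^esub> y) \<oplus>\<^bsub>N\<^esub> h y" using h x by (simp add: module_hom_def)
 finally have e: "h x = h (x \<ominus>\<^bsub>M\<^esub> y) \<oplus>\<^bsub>N\<^esub> h y" .
 have d: "x \<ominus>\<^bsub>M\<^esub> y \<in> carrier M" using x by simp
 show ?thesis unfolding e using hc[OF d] hc[OF x(2)] by (simp add: N.minus_eq N.a_assoc N.r_neg)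
qed

lemma diff_zero_eq:
 assumes M: "module R M" and x: "x \<in> carrier M" "y \<in> carrier M" and e: "x \<ominus>\<^bsub>M\<^esub> y = \<zero>\<^bsub>M\<^esub>"
 shows "x = y"
proof -
 interpret M: module R M by (rule M)
 have "x = (x \<ominus>\<^bsub>M\<^esub> y) \<oplus>\<^bsub>M\<^esub> y" using x by (simp add: M.minus_eq M.a_assoc M.l_neg)
 then show ?thesis using e x by simp
qed

lemma diff_zero:
 assumes M: "module R M" and x: "x \<in> carrier M"
 shows "x \<ominus>\<^bsub>M\<^esub> \<zero>\<^bsub>M\<^esub> = x"
proof -
 interpret M: module R M by (rule M)
 have n: "\<ominus>\<^bsub>M\<^esub> \<zero>\<^bsub>M\<^esub> \<in> carrier M" by (rule M.a_inv_closed[OF M.zero_closed])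
 have "\<ominus>\<^bsub>M\<^esub> \<zero>\<^bsub>M\<^esub> \<oplus>\<^bsub>M\<^esub> \<zero>\<^bsub>M\<^esub> = \<zero>\<^bsub>M\<^esub>" by (rule M.l_neg[OF M.zero_closed])
 then have "\<ominus>\<^bsub>M\<^esub> \<zero>\<^bsub>M\<^esub> = \<zero>\<^bsub>M\<^esub>" unfolding M.r_zero[OF n] .
 then show ?thesis using x by (simp add: M.minus_eq)
qed

lemma self_homotopy:
 assumes R: "b ==> gring_ok R" and nontriv: "\<one>\<^bsub>R\<^esub> \<noteq> \<zero>\<^bsub>R\<^esub>"
  and P: "res b R C P d e"
  and \<psi>: "!!m. \<psi> m \<in> homs b R (P m) (P m)" "!!x. x \<in> carrier (P 0) ==> e (\<psi> 0 x) = e x"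
  "!!m x. x \<in> carrier (P (Suc m)) ==> d m (\<psi> (Suc m) x) = \<psi> m (d m x)"
 shows "\<exists>h. (\<forall>m. h m \<in> homs b R (P m) (P (Suc m))) \<and> (\<forall>x\<in>carrier (P 0). \<psi> 0 x \<ominus>\<^bsub>P 0\<^esub> x = d 0 (h 0 x)) \<and>
  (\<forall>m. \<forall>x\<in>carrier (P (Suc m)). \<psi> (Suc m) x \<ominus>\<^bsub>P (Suc m)\<^esub> x = d (Suc m) (h (Suc m) x) \<oplus>\<^bsub>P (Suc m)\<^esub> h m (d m x))"
proof (rule homotopy[OF R nontriv P P])
 have mP: "module R (P m)" for m using resD(2)[OF P] by (simp add: gmod_def)
 have mC: "module R C" using resD(1)[OF P] by (simp add: gmod_def)
 have \<psi>c: "\<psi> m x \<in> carrier (P m)" if "x \<in> carrier (P m)" for m x by (rule homs_closed[OF \<psi>(1) that])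
 show "(\<lambda>x. \<psi> m x \<ominus>\<^bsub>P m\<^esub> x) \<in> homs b R (P m) (P m)" for m
  by (rule homs_minus[OF resD(2)[OF P] resD(2)[OF P] \<psi>(1) homs_id])
 show "e (\<psi> 0 x \<ominus>\<^bsub>P 0\<^esub> x) = \<zero>\<^bsub>C\<^esub>" if x: "x \<in> carrier (P 0)" for x
 proof -
  interpret C: module R C by (rule mC)
  have "e x \<in> carrier C" by (rule homs_closed[OF resD(5)[OF P] x])
  then show ?thesis
   using hom_diff[OF mP mC homs_hom[OF resD(5)[OF P]] \<psi>c[OF x] x] \<psi>(2)[OF x] by (simp add: C.r_neg C.minus_eq)
 qed
 show "d m (\<psi> (Suc m) x \<ominus>\<^bsub>P (Suc m)\<^esub> x) = \<psi> m (d m x) \<ominus>\<^bsub>P m\<^esub> d m x" if x: "x \<in> carrier (P (Suc m))" for m x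
  using hom_diff[OF mP mP homs_hom[OF resD(4)[OF P]] \<psi>c[OF x] x] \<psi>(3)[OF x] by simp
qed

text \<open>For y homogeneous of degree i, the i-th component of its preimage is mapped to y too;
  injectivity identifies the two.\<close>

lemma gr_hom_inverse:
 assumes M: "graded_module R M" and N: "graded_module R N" and f: "f \<in> gr_hom R M N" and bij: "bij_betw f (carrier M) (carrier N)"
 shows "inv_into (carrier M) f \<in> gr_hom R N M"
proof -
 interpret M: module R M by (rule graded_moduleD(1)[OF M])
 let ?g = "inv_into (carrier M) f"
 have inj: "inj_on f (carrier M)" and im: "f ` carrier M = carrier N" using bij by (auto simp: bij_betw_def)
 have gc: "?g y \<in> carrier M" and fg: "f (?g y) = y" if "y \<in> carrier N" for y
  using that im by (auto intro: inv_into_into f_inv_into_f)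
 have gf: "?g (f x) = x" if "x \<in> carrier M" for x by (rule inv_into_f_f[OF inj that])
 have h: "f (x \<oplus>\<^bsub>M\<^esub> y) = f x \<oplus>\<^bsub>N\<^esub> f y" "r \<in> carrier R ==> f (r \<odot>\<^bsub>M\<^esub> x) = r \<odot>\<^bsub>N\<^esub> f x"
  if "x \<in> carrier M" "y \<in> carrier M" for x y r using gr_homD(1)[OF f] that by (auto simp: module_hom_def)
 have "?g (x \<oplus>\<^bsub>N\<^esub> y) = ?g x \<oplus>\<^bsub>M\<^esub> ?g y" if "x \<in> carrier N" "y \<in> carrier N" for x y
  using gf[of "?g x \<oplus>\<^bsub>M\<^esub> ?g y"] h(1)[OF gc[OF that(1)] gc[OF that(2)]] fg that gc by simp
 moreover have "?g (r \<odot>\<^bsub>N\<^esub> x) = r \<odot>\<^bsub>M\<^esub> ?g x" if "r \<in> carrier R" "x \<in> carrier N" for r x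
  using gf[of "r \<odot>\<^bsub>M\<^esub> ?g x"] h(2)[OF gc[OF that(2)] gc[OF that(2)] that(1)] fg that gc by simp
 moreover have "?g y \<in> mpart M i" if y: "y \<in> mpart N i" for y i
 proof -
  have yc: "y \<in> carrier N" using y graded_moduleD(2)[OF N] by blast
  have "f (gdec M (?g y) i) = gdec N (f (?g y)) i" by (rule gdec_hom[OF M N f gc[OF yc], symmetric])
  also have "... = f (?g y)" using gdec_homog[OF N y, of i] fg[OF yc] by simp
  finally have "gdec M (?g y) i = ?g y" using inj gc[OF yc] gdec(4)[OF M gc[OF yc]] by (auto dest: inj_onD)
  then show ?thesis using gdec(1)[OF M gc[OF yc], of i] by simp
 qed
 ultimately show ?thesis using gc by (auto simp: gr_hom_def module_hom_def)
qed

lemma Fge_diff: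
 assumes "x \<in> carrier (fmod n \<beta>)" "y \<in> carrier (fmod n \<beta>)"
  "x \<ominus>\<^bsub>fmod n \<beta>\<^esub> y \<in> Fge n \<beta> s"
 shows "y \<ominus>\<^bsub>fmod n \<beta>\<^esub> x \<in> Fge n \<beta> s" and "y \<in> Fge n \<beta> s ==> x \<in> Fge n \<beta> s"
proof -
 let ?H = "CA n"
 let ?F = "free_gmodule ?H \<beta>"
 interpret F: module ?H ?F by (rule fmod_module[OF H_cring])
 have sub: "submod ?H (Fge n \<beta> s) ?F" by (rule Fge_submodule)
 have neg: "\<ominus>\<^bsub>?F\<^esub> z \<in> Fge n \<beta> s" if z: "z \<in> Fge n \<beta> s" for z
 proof -
  have zc: "z \<in> carrier ?F" using z by (simp add: Fge_def)
  have "(\<ominus>\<^bsub>?H\<^esub> \<one>\<^bsub>?H\<^esub>) \<odot>\<^bsub>?F\<^esub> z = \<ominus>\<^bsub>?F\<^esub> z" using zc by (simp add: F.smult_l_minus)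
  moreover have "(\<ominus>\<^bsub>?H\<^esub> \<one>\<^bsub>?H\<^esub>) \<odot>\<^bsub>?F\<^esub> z \<in> Fge n \<beta> s"
   using sub z F.R.a_inv_closed[OF F.R.one_closed] unfolding submod_def by blast
  ultimately show ?thesis by simp
 qed
 have "\<ominus>\<^bsub>?F\<^esub> (x \<ominus>\<^bsub>?F\<^esub> y) = y \<ominus>\<^bsub>?F\<^esub> x" using assms(1,2) by (simp add: F.minus_eq F.minus_add F.a_comm)
 then show "y \<ominus>\<^bsub>?F\<^esub> x \<in> Fge n \<beta> s" using neg[OF assms(3)] by simp
 assume y: "y \<in> Fge n \<beta> s"
 have "x = (x \<ominus>\<^bsub>?F\<^esub> y) \<oplus>\<^bsub>?F\<^esub> y" using assms(1,2) by (simp add: F.minus_eq F.a_assoc F.l_neg)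
 moreover have "(x \<ominus>\<^bsub>?F\<^esub> y) \<oplus>\<^bsub>?F\<^esub> y \<in> Fge n \<beta> s" using sub assms(3) y unfolding submod_def by blast
 ultimately show "x \<in> Fge n \<beta> s" by simp
qed

text \<open>The difference from the identity raises the filtration, so an element of the kernel lies
  in every step and is 0. Surjectivity is Nakayama's lemma for the image.\<close>

lemma unipotent_bij:
 assumes \<psi>: "\<psi> \<in> module_hom (CA n) (fmod n \<beta>) (fmod n \<beta>)"
  and u: "!!x. x \<in> carrier (fmod n \<beta>) ==> \<psi> x \<ominus>\<^bsub>fmod n \<beta>\<^esub> x \<in> Fge n \<beta> 1"
 shows "bij_betw \<psi> (carrier (fmod n \<beta>)) (carrier (fmod n \<beta>))"
proof -
 let ?H = "CA n"
 let ?F = "free_gmodule ?H \<beta>"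
 have mF: "module ?H ?F" by (rule fmod_module[OF H_cring])
 interpret F: module ?H ?F by (rule mF)
 have gF: "gmod False ?H ?F" using mF by (simp add: gmod_def)
 have \<psi>c: "\<psi> x \<in> carrier ?F" if "x \<in> carrier ?F" for x using \<psi> that by (auto simp: module_hom_def)
 have "(\<lambda>x. \<psi> x \<ominus>\<^bsub>?F\<^esub> x) \<in> homs False ?H ?F ?F" using \<psi> by (intro homs_minus[OF gF gF] homs_id) (simp add: homs_def)
 then have \<nu>: "(\<lambda>x. \<psi> x \<ominus>\<^bsub>?F\<^esub> x) \<in> module_hom ?H ?F ?F" by (simp add: homs_def)
 have raise: "\<psi> x \<ominus>\<^bsub>?F\<^esub> x \<in> Fge n \<beta> (s + 1)" if "x \<in> Fge n \<beta> s" for x s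
  using Fge_hom[OF \<nu> that] u unit_vec_free by blast
 obtain t where t: "Hge n t = {\<zero>\<^bsub>?H\<^esub>}" using Hge_top by blast
 have ker: "x = \<zero>\<^bsub>?F\<^esub>" if x: "x \<in> carrier ?F" and 0: "\<psi> x = \<zero>\<^bsub>?F\<^esub>" for x
 proof -
  have "x \<in> Fge n \<beta> s" for s
  proof (induction s)
   case 0
   then show ?case using x by (simp add: Fge_0)
  next
   case (Suc s)
   have "x \<ominus>\<^bsub>?F\<^esub> \<psi> x \<in> Fge n \<beta> (Suc s)" using Fge_diff(1)[OF \<psi>c[OF x] x raise[OF Suc]] by simp
   then show ?case unfolding 0 diff_zero[OF mF x] .
  qed
  from this[of t] show ?thesis by (auto simp: Fge_def t fmod_simps)
 qed
 have "inj_on \<psi> (carrier ?F)"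
 proof (rule inj_onI)
  fix x y assume xy: "x \<in> carrier ?F" "y \<in> carrier ?F" "\<psi> x = \<psi> y"
  have "\<psi> (x \<ominus>\<^bsub>?F\<^esub> y) = \<zero>\<^bsub>?F\<^esub>"
   unfolding hom_diff[OF mF mF \<psi> xy(1,2)] xy(3) using \<psi>c[OF xy(2)] by (simp add: F.minus_eq F.r_neg)
  then show "x = y" using diff_zero_eq[OF mF xy(1,2)] ker xy by simp
 qed
 moreover have "\<psi> ` carrier ?F = carrier ?F"
 proof (rule free_nakayama[OF submodule_image[OF mF mF \<psi>]])
  fix b assume "b \<in> bs \<beta>"
  then have b: "unit_vec ?H b \<in> carrier ?F" by (rule unit_vec_free)
  let ?u = "unit_vec ?H b"
  have "?u = (?u \<ominus>\<^bsub>?F\<^esub> \<psi> ?u) \<oplus>\<^bsub>?F\<^esub> \<psi> ?u" using b \<psi>c[OF b] by (simp add: F.minus_eq F.a_assoc F.l_neg)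
  moreover have "?u \<ominus>\<^bsub>?F\<^esub> \<psi> ?u \<in> Fge n \<beta> 1" by (rule Fge_diff(1)[OF \<psi>c[OF b] b u[OF b]])
  ultimately show "\<exists>k\<in>Fge n \<beta> 1. \<exists>l\<in>\<psi> ` carrier ?F. ?u = k \<oplus>\<^bsub>?F\<^esub> l" using b by blast
 qed
 ultimately show ?thesis by (simp add: bij_betw_def)
qed

lemma trivial_finsum:
 assumes "finite A"
 shows "(\<Oplus>\<^bsub>TM n\<^esub>a\<in>A. scl n (c a)) = scl n (\<Sum>a\<in>A. c a)"
proof -
 interpret C: module "CA n" "TM n" by (rule trivial_module)
 show ?thesis using assms
 proof (induction A rule: finite_induct)
  case empty
  then show ?case by (simp add: trivial_simps)
 next
  case (insert a A)
  then have "(\<Oplus>\<^bsub>TM n\<^esub>a\<in>insert a A. scl n (c a)) =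
    scl n (c a) \<oplus>\<^bsub>TM n\<^esub> (\<Oplus>\<^bsub>TM n\<^esub>a\<in>A. scl n (c a))"
   by (intro C.M.finsum_insert) (auto simp: trivial_simps)
  then show ?case using insert by (simp add: trivial_simps)
 qed
qed

lemma augmentation_expand:
 assumes h: "h \<in> module_hom (CA n) (fmod n \<beta>) (TM n)"
  and fin: "finite (bs \<beta>)" and x: "x \<in> carrier (fmod n \<beta>)"
 shows "aug (h x) =
  (\<Sum>b\<in>bs \<beta>. aug (x b) * aug (h (unit_vec (CA n) b)))"
proof -
 let ?H = "CA n" and ?C = "TM n"
 let ?F = "free_gmodule ?H \<beta>"
 interpret H: cring ?H by (rule H_cring)
 interpret F: module ?H ?F by (rule fmod_module[OF H_cring])
 let ?s = "{b \<in> bs \<beta>. x b \<noteq> \<zero>\<^bsub>?H\<^esub>}"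
 have xb: "x b \<in> carrier ?H" for b using x by (simp add: fmod_simps H.free_mod_carrier)
 have hs: "h z = scl n (aug (h z))" if "z \<in> carrier ?F" for z
 proof -
  have "h z \<in> carrier ?C" using h that by (auto simp: module_hom_def)
  then obtain c where "h z = scl n c" unfolding trivial_simps by blast
  then show ?thesis by simp
 qed
 have tm: "h (x b \<odot>\<^bsub>?F\<^esub> unit_vec ?H b) =
   scl n (aug (x b) * aug (h (unit_vec ?H b)))" if b: "b \<in> bs \<beta>" for b
 proof -
  have "h (x b \<odot>\<^bsub>?F\<^esub> unit_vec ?H b) = x b \<odot>\<^bsub>?C\<^esub> h (unit_vec ?H b)"
   using h xb unit_vec_free[OF b] by (auto simp: module_hom_def)
  also have "... = x b \<odot>\<^bsub>?C\<^esub> scl n (aug (h (unit_vec ?H b)))" using hs[OF unit_vec_free[OF b]] by simp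
  finally show ?thesis by (simp add: trivial_simps)
 qed
 have "x = (\<Oplus>\<^bsub>?F\<^esub>b\<in>?s. x b \<odot>\<^bsub>?F\<^esub> unit_vec ?H b)"
  using free_gmodule_dual_basis[OF H_cring, of n \<beta>] x unfolding dual_basis_def by blast
 then have "h x = h (\<Oplus>\<^bsub>?F\<^esub>b\<in>?s. x b \<odot>\<^bsub>?F\<^esub> unit_vec ?H b)" by simp
 also have "... = (\<Oplus>\<^bsub>?C\<^esub>b\<in>?s. h (x b \<odot>\<^bsub>?F\<^esub> unit_vec ?H b))"
  by (rule hom_finsum[OF fmod_module[OF H_cring] trivial_module h])
   (use fin xb unit_vec_free in \<open>auto intro!: F.smult_closed\<close>)
 also have "... = (\<Oplus>\<^bsub>?C\<^esub>b\<in>?s. scl n (aug (x b) * aug (h (unit_vec ?H b))))"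
 proof -
  interpret C: module ?H ?C by (rule trivial_module)
  show ?thesis by (rule C.M.finsum_cong') (auto simp: tm trivial_simps)
 qed
 also have "... = scl n (\<Sum>b\<in>?s. aug (x b) * aug (h (unit_vec ?H b)))" using fin by (intro trivial_finsum) simp
 finally have "aug (h x) = (\<Sum>b\<in>?s. aug (x b) * aug (h (unit_vec ?H b)))" by simp
 also have "... = (\<Sum>b\<in>bs \<beta>. aug (x b) * aug (h (unit_vec ?H b)))"
  by (rule sum.mono_neutral_left[OF fin]) (auto simp: augmentation_zero)
 finally show ?thesis .
qed

lemma coordinate_augmentation_hom:
 "(\<lambda>x. scl n (aug (x b))) \<in> module_hom (CA n) (fmod n \<beta>) (TM n)"
proof -
 interpret H: cring "CA n" by (rule H_cring)
 show ?thesis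
  by (auto simp: module_hom_def fmod_simps trivial_simps H.free_mod_carrier augmentation_add augmentation_mult)
qed

lemma unit_vec_mpart:
 assumes "b \<in> bs \<beta>"
 shows "unit_vec (CA n) b \<in> mpart (fmod n \<beta>) (fst b)"
proof -
 have "\<one>\<^bsub>CA n\<^esub> \<in> rpart (CA n) 0"
 proof -
  have "kys (1 :: cpoly) \<subseteq> {0}" by (metis keys_one subset_refl)
  then have "1 \<in> poly_part n 0" by (auto simp: poly_part_eq)
  then show ?thesis by (simp add: H_rpart H_one)
 qed
 moreover have "\<zero>\<^bsub>CA n\<^esub> \<in> rpart (CA n) i" for i
 proof -
  have "0 \<in> poly_part n i" by (simp add: poly_part_eq)
  then show ?thesis by (auto simp: H_rpart H_zero)
 qed
 ultimately show ?thesis using unit_vec_free[OF assms, of n] by (auto simp: fmod_simps unit_vec_def)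
qed

lemma homogeneous_augmentation:
 assumes "x \<in> mpart (fmod n \<beta>) i" "fst b \<noteq> i"
 shows "aug (x b) = 0"
 using assms by (intro augmentation_rpart[of _ n "i - fst b"]) (simp_all add: fmod_simps)

text \<open>A diagonal entry of the product of the two matrices over the complex numbers. Entries
  between generators of different internal degree have zero augmentation, so the sum stays within
  degree l.\<close>

lemma free_iso_trace:
 assumes fin: "finite (bs \<gamma>)"
  and \<phi>: "\<phi> \<in> gr_hom (CA n) (fmod n \<beta>) (fmod n \<gamma>)"
  and \<psi>: "\<psi> \<in> gr_hom (CA n) (fmod n \<gamma>) (fmod n \<beta>)"
  and inv: "!!x. x \<in> carrier (fmod n \<beta>) ==> \<psi> (\<phi> x) = x"
  and k: "k < \<beta> l"
 shows "(\<Sum>k'<\<gamma> l. aug (\<phi> (unit_vec (CA n) (l, k)) (l, k')) *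
  aug (\<psi> (unit_vec (CA n) (l, k')) (l, k))) = 1"
proof -
 let ?H = "CA n" and ?C = "TM n"
 let ?F = "free_gmodule ?H \<beta>" and ?G = "free_gmodule ?H \<gamma>"
 have b: "(l, k) \<in> bs \<beta>" using k by (simp add: bs_def)
 let ?u = "unit_vec ?H (l, k)"
 let ?y = "\<phi> ?u"
 have u: "?u \<in> carrier ?F" "?u \<in> mpart ?F l" using unit_vec_free[OF b] unit_vec_mpart[OF b] by simp_all
 have y: "?y \<in> carrier ?G" "?y \<in> mpart ?G l" using gr_homD[OF \<phi>] u by (auto simp: module_hom_def)
 let ?h = "\<lambda>x. scl n (aug (\<psi> x (l, k)))"
 have "?h \<in> homs False ?H ?G ?C" by (rule homs_comp[of \<psi> False ?H ?G ?F "\<lambda>x. scl n (aug (x (l, k)))" ?C])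
   (simp_all add: homs_def gr_homD(1)[OF \<psi>] coordinate_augmentation_hom)
 then have h: "?h \<in> module_hom ?H ?G ?C" by (simp add: homs_def)
 have "aug (?h ?y) = 1" using inv[OF u(1)] by (simp add: unit_vec_def augmentation_one)
 then have "1 = (\<Sum>b\<in>bs \<gamma>. aug (?y b) * aug (\<psi> (unit_vec ?H b) (l, k)))"
  using augmentation_expand[OF h fin y(1)] by simp
 also have "... = (\<Sum>b\<in>(\<lambda>k'. (l, k')) ` {..<\<gamma> l}. aug (?y b) * aug (\<psi> (unit_vec ?H b) (l, k)))"
 proof (rule sum.mono_neutral_right[OF fin])
  show "(\<lambda>k'. (l, k')) ` {..<\<gamma> l} \<subseteq> bs \<gamma>" by (auto simp: bs_def)
  show "\<forall>b\<in>bs \<gamma> - (\<lambda>k'. (l, k')) ` {..<\<gamma> l}. aug (?y b) * aug (\<psi> (unit_vec ?H b) (l, k)) = 0"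
  proof
   fix b assume "b \<in> bs \<gamma> - (\<lambda>k'. (l, k')) ` {..<\<gamma> l}"
   then have "fst b \<noteq> l" by (cases b) (auto simp: bs_def)
   then show "aug (?y b) * aug (\<psi> (unit_vec ?H b) (l, k)) = 0" using homogeneous_augmentation[OF y(2)] by simp
  qed
 qed
 also have "... = (\<Sum>k'<\<gamma> l. aug (?y (l, k')) * aug (\<psi> (unit_vec ?H (l, k')) (l, k)))"
  by (subst sum.reindex) (auto simp: inj_on_def)
 finally show ?thesis by simp
qed

text \<open>Graded Betti numbers are unique: modulo the augmentation ideal an isomorphism becomes a pair of
 mutually inverse complex matrices, and the traces of the two products agree.\<close>

lemma free_iso_unique:
 assumes P: "graded_module (CA n) P" and fin: "finite (bs \<beta>)" "finite (bs \<gamma>)"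
  and iso: "gr_isomorphic (CA n) P (fmod n \<beta>)"
   "gr_isomorphic (CA n) P (fmod n \<gamma>)"
 shows "\<beta> = \<gamma>"
proof
 fix l
 let ?H = "CA n"
 let ?F = "free_gmodule ?H \<beta>" and ?G = "free_gmodule ?H \<gamma>"
 have gF: "graded_module ?H ?F" and gG: "graded_module ?H ?G" by (intro free_gmodule_graded[OF H_gring_ok] fin)+
 obtain a where a: "a \<in> gr_hom ?H P ?F" "bij_betw a (carrier P) (carrier ?F)" using iso(1) by (auto simp: gr_isomorphic_def)
 obtain c where c: "c \<in> gr_hom ?H P ?G" "bij_betw c (carrier P) (carrier ?G)" using iso(2) by (auto simp: gr_isomorphic_def)
 let ?a' = "inv_into (carrier P) a" and ?c' = "inv_into (carrier P) c"
 have a': "?a' \<in> gr_hom ?H ?F P" by (rule gr_hom_inverse[OF P gF a])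
 have c': "?c' \<in> gr_hom ?H ?G P" by (rule gr_hom_inverse[OF P gG c])
 let ?\<phi> = "\<lambda>x. c (?a' x)" and ?\<psi> = "\<lambda>x. a (?c' x)"
 have \<phi>: "?\<phi> \<in> gr_hom ?H ?F ?G" using homs_comp[of ?a' True ?H ?F P c ?G] a' c(1) by (simp add: homs_def)
 have \<psi>: "?\<psi> \<in> gr_hom ?H ?G ?F" using homs_comp[of ?c' True ?H ?G P a ?F] c' a(1) by (simp add: homs_def)
 have 1: "?\<psi> (?\<phi> x) = x" if "x \<in> carrier ?F" for x
  using that a(2) c(2) by (simp add: bij_betw_inv_into_left bij_betw_inv_into_right bij_betw_apply[OF bij_betw_inv_into])
 have 2: "?\<phi> (?\<psi> x) = x" if "x \<in> carrier ?G" for x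
  using that a(2) c(2) by (simp add: bij_betw_inv_into_left bij_betw_inv_into_right bij_betw_apply[OF bij_betw_inv_into])
 let ?A = "\<lambda>k k'. aug (?\<phi> (unit_vec ?H (l, k)) (l, k'))"
 let ?B = "\<lambda>k k'. aug (?\<psi> (unit_vec ?H (l, k)) (l, k'))"
 have "of_nat (\<beta> l) = (\<Sum>k<\<beta> l. \<Sum>k'<\<gamma> l. ?A k k' * ?B k' k)" using free_iso_trace[OF fin(2) \<phi> \<psi> 1] by simp
 also have "... = (\<Sum>k'<\<gamma> l. \<Sum>k<\<beta> l. ?B k' k * ?A k k')" by (subst sum.swap) (simp only: mult.commute)
 also have "... = of_nat (\<gamma> l)" using free_iso_trace[OF fin(1) \<psi> \<phi> 2] by simp
 finally show "\<beta> l = \<gamma> l" by (simp only: of_nat_eq_iff)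
qed

text \<open>Projectivity sees carrier, zero, addition and scalars only; this carries it from a plain
  module record to one with a grading field.\<close>

lemma projective_cong:
 assumes P: "projective_module R (P :: ('r, 'p, 'x) module_scheme)"
  and eq: "carrier P' = carrier P" "\<zero>\<^bsub>P'\<^esub> = \<zero>\<^bsub>P\<^esub>" "!!x y. x \<oplus>\<^bsub>P'\<^esub> y = x \<oplus>\<^bsub>P\<^esub> y" "!!r x. r \<odot>\<^bsub>P'\<^esub> x = r \<odot>\<^bsub>P\<^esub> x"
 shows "projective_module R (P' :: ('r, 'p, 'y) module_scheme)"
proof -
 have mP: "module R P" using P by (simp add: projective_module_def)
 interpret module R P by (rule mP)
 have "module R P'" by (rule module_transport[OF mP, of "\<lambda>x. x"]) (auto simp: eq)
 moreover have "module_hom R P' M = module_hom R P M" for M :: "('r, 'p => 'r) module"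
  by (simp add: module_hom_def eq)
 ultimately show ?thesis using P unfolding projective_module_def eq(1) by metis
qed

section \<open>Comparison with arbitrary resolutions\<close>

context coinv
begin

lemma F_res: "res b H C F dF eF" using F_resolution by (simp add: res_def graded_projective_resolution_def)

text \<open>The homotopy on F consists of terms through \<open>dF\<close>, whose values lie in the
  augmentation submodule; hence g f is the identity modulo that submodule. On P no such
  simplification is available, so the homotopy k itself is kept.\<close>

lemma equivalence:
 assumes P: "res b H C P d e"
 obtains f g k where "!!m. f m \<in> homs b H (F m) (P m)" "!!m. g m \<in> homs b H (P m) (F m)"
  "!!x. x \<in> carrier (F 0) ==> e (f 0 x) = eF x"
  "!!m x. x \<in> carrier (F (Suc m)) ==> d m (f (Suc m) x) = f m (dF m x)"
  "!!m x. x \<in> carrier (P (Suc m)) ==> dF m (g (Suc m) x) = g m (d m x)"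
  "!!m x. x \<in> carrier (F m) ==> g m (f m x) \<ominus>\<^bsub>F m\<^esub> x \<in> Fge n (bt m) 1"
  "!!m. k m \<in> homs b H (P m) (P (Suc m))"
  "!!x. x \<in> carrier (P 0) ==> f 0 (g 0 x) \<ominus>\<^bsub>P 0\<^esub> x = d 0 (k 0 x)"
  "!!m x. x \<in> carrier (P (Suc m)) ==> f (Suc m) (g (Suc m) x) \<ominus>\<^bsub>P (Suc m)\<^esub> x = d (Suc m) (k (Suc m) x) \<oplus>\<^bsub>P (Suc m)\<^esub> k m (d m x)"
proof -
 obtain f where f: "!!m. f m \<in> homs b H (F m) (P m)" "!!x. x \<in> carrier (F 0) ==> e (f 0 x) = eF x"
  "!!m x. x \<in> carrier (F (Suc m)) ==> d m (f (Suc m) x) = f m (dF m x)"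
  using comparison[OF H_gring_ok H_nontrivial F_res P] by blast
 obtain g where g: "!!m. g m \<in> homs b H (P m) (F m)" "!!x. x \<in> carrier (P 0) ==> eF (g 0 x) = e x"
  "!!m x. x \<in> carrier (P (Suc m)) ==> dF m (g (Suc m) x) = g m (d m x)"
  using comparison[OF H_gring_ok H_nontrivial P F_res] by blast
 have fc: "f m x \<in> carrier (P m)" if "x \<in> carrier (F m)" for m x by (rule homs_closed[OF f(1) that])
 have gc: "g m x \<in> carrier (F m)" if "x \<in> carrier (P m)" for m x by (rule homs_closed[OF g(1) that])
 have dFc: "dF m x \<in> carrier (F m)" if "x \<in> carrier (F (Suc m))" for m x by (rule homs_closed[OF resD(4)[OF F_res] that])
 have dc: "d m x \<in> carrier (P m)" if "x \<in> carrier (P (Suc m))" for m x by (rule homs_closed[OF resD(4)[OF P] that])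
 have "\<exists>k. (\<forall>m. k m \<in> homs b H (P m) (P (Suc m))) \<and> (\<forall>x\<in>carrier (P 0). f 0 (g 0 x) \<ominus>\<^bsub>P 0\<^esub> x = d 0 (k 0 x)) \<and>
  (\<forall>m. \<forall>x\<in>carrier (P (Suc m)). f (Suc m) (g (Suc m) x) \<ominus>\<^bsub>P (Suc m)\<^esub> x = d (Suc m) (k (Suc m) x) \<oplus>\<^bsub>P (Suc m)\<^esub> k m (d m x))"
  by (rule self_homotopy[OF H_gring_ok H_nontrivial P, of "\<lambda>m x. f m (g m x)"])
   (auto simp: f g gc intro: homs_comp[OF g(1) f(1)])
 then obtain k where k: "!!m. k m \<in> homs b H (P m) (P (Suc m))"
  "!!x. x \<in> carrier (P 0) ==> f 0 (g 0 x) \<ominus>\<^bsub>P 0\<^esub> x = d 0 (k 0 x)"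
  "!!m x. x \<in> carrier (P (Suc m)) ==> f (Suc m) (g (Suc m) x) \<ominus>\<^bsub>P (Suc m)\<^esub> x = d (Suc m) (k (Suc m) x) \<oplus>\<^bsub>P (Suc m)\<^esub> k m (d m x)"
  by blast
 have "\<exists>h. (\<forall>m. h m \<in> homs b H (F m) (F (Suc m))) \<and> (\<forall>x\<in>carrier (F 0). g 0 (f 0 x) \<ominus>\<^bsub>F 0\<^esub> x = dF 0 (h 0 x)) \<and>
  (\<forall>m. \<forall>x\<in>carrier (F (Suc m)). g (Suc m) (f (Suc m) x) \<ominus>\<^bsub>F (Suc m)\<^esub> x = dF (Suc m) (h (Suc m) x) \<oplus>\<^bsub>F (Suc m)\<^esub> h m (dF m x))"
  by (rule self_homotopy[OF H_gring_ok H_nontrivial F_res, where \<psi> = "\<lambda>m x. g m (f m x)"])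
   (auto simp: f g fc intro: homs_comp[OF f(1) g(1)])
 then obtain h where h: "!!m. h m \<in> homs b H (F m) (F (Suc m))"
  "!!x. x \<in> carrier (F 0) ==> g 0 (f 0 x) \<ominus>\<^bsub>F 0\<^esub> x = dF 0 (h 0 x)"
  "!!m x. x \<in> carrier (F (Suc m)) ==> g (Suc m) (f (Suc m) x) \<ominus>\<^bsub>F (Suc m)\<^esub> x = dF (Suc m) (h (Suc m) x) \<oplus>\<^bsub>F (Suc m)\<^esub> h m (dF m x)"
  by blast
 have hc: "h m x \<in> carrier (F (Suc m))" if "x \<in> carrier (F m)" for m x by (rule homs_closed[OF h(1) that])
 have hF: "h m x \<in> Fge n (bt (Suc m)) 1" if x: "x \<in> Fge n (bt m) 1" for m x
 proof -
  have "h m x \<in> Fge n (bt (Suc m)) (1 + 0)"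
  proof (rule Fge_hom[OF _ x])
   show "h m \<in> module_hom H (free_gmodule H (bt m)) (free_gmodule H (bt (Suc m)))"
    using homs_hom[OF h(1)] by (simp add: F_def)
   show "h m (unit_vec H b) \<in> Fge n (bt (Suc m)) 0" if "b \<in> bs (bt m)" for b
    using hc unit_vec_free[OF that] by (simp add: Fge_0 F_def)
  qed
  then show ?thesis by simp
 qed
 have "g m (f m x) \<ominus>\<^bsub>F m\<^esub> x \<in> Fge n (bt m) 1" if x: "x \<in> carrier (F m)" for m x
 proof (cases m)
  case 0
  show ?thesis using dF_augmentation[OF hc] x h(2) unfolding 0 by simp
 next
  case (Suc m')
  have "dF (Suc m') (h (Suc m') x) \<oplus>\<^bsub>F (Suc m')\<^esub> h m' (dF m' x) \<in> Fge n (bt (Suc m')) 1"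
   using Fge_submodule[of n "bt (Suc m')" 1] dF_augmentation[OF hc] hF[OF dF_augmentation] x
   unfolding submod_def F_def[symmetric] Suc by blast
  then show ?thesis using h(3) x unfolding Suc by simp
 qed
 then show thesis by (intro that[OF f(1) g(1) f(2) f(3) g(3) _ k]) assumption+
qed

text \<open>A single vanishing P m is contradictory: g f would be 0 on \<open>F m\<close> while
  being the identity modulo the augmentation submodule, which contains no generator.\<close>

lemma resolution_infinite:
 fixes P :: "nat => (cpoly set, 'p) module"
 assumes n2: "n \<ge> 2" and P: "projective_resolution H C P d e"
 shows "infinite {m. carrier (P m) \<noteq> {\<zero>\<^bsub>P m\<^esub>}}"
proof
 assume "finite {m. carrier (P m) \<noteq> {\<zero>\<^bsub>P m\<^esub>}}"
 then obtain m where m: "carrier (P m) = {\<zero>\<^bsub>P m\<^esub>}"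
  using infinite_UNIV_nat by (metis (mono_tags) Collect_cong finite_subset mem_Collect_eq subsetI top_greatest)
 \<comment> \<open>Empty graded parts only adapt the record type; the comparison is run with the
   flag False, which does not look at them.\<close>
 define P' :: "nat => (cpoly set, 'p) gmodule" where "P' m = module.extend (P m) (gmodule.fields (\<lambda>_. {}))" for m
 have eq: "carrier (P' m) = carrier (P m)" "\<zero>\<^bsub>P' m\<^esub> = \<zero>\<^bsub>P m\<^esub>" "x \<oplus>\<^bsub>P' m\<^esub> y = x \<oplus>\<^bsub>P m\<^esub> y"
  "r \<odot>\<^bsub>P' m\<^esub> x = r \<odot>\<^bsub>P m\<^esub> x" for m x y r
  by (simp_all add: P'_def module.defs)
 have hom: "module_hom H (P' i) (P' j) = module_hom H (P i) (P j)" "module_hom H (P' i) C = module_hom H (P i) C" for i j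
  by (simp_all add: module_hom_def eq)
 have pr: "projective_module H (P m)" for m using P by (simp add: projective_resolution_def)
 have pr': "projective_module H (P' m)" for m by (rule projective_cong[OF pr[of m] eq])
 have "res False H C P' d e" using P pr' by (simp add: res_def projective_resolution_def hom mod_ker_def eq)
 from equivalence[OF this] obtain f g where fg: "!!m. f m \<in> homs False H (F m) (P' m)" "!!m. g m \<in> homs False H (P' m) (F m)"
  "!!m x. x \<in> carrier (F m) ==> g m (f m x) \<ominus>\<^bsub>F m\<^esub> x \<in> Fge n (bt m) 1" by metis
 \<comment> \<open>A generator in every homological degree m: the (m div 2)-th divided power of U_1,
   times T_1 if m is odd. Index 1 exists since n is at least 2.\<close>
 let ?x = "(if odd m then {1} else {}, \<lambda>k. if k = 1 then m div 2 else 0) :: nat set \<times> (nat => nat)"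
 have "(\<Sum>k\<in>{1..N}. if k = 1 then m div 2 else 0) = m div 2" using n2 by simp
 moreover have "(if odd m then 1 else 0) + 2 * (m div 2) = m" by auto
 ultimately have "?x \<in> Ix m" using n2 unfolding Ix_def idx_def by (auto split: if_splits)
 then have b: "enc m ?x \<in> bs (bt m)" by (rule enc_bs)
 let ?b = "enc m ?x"
 let ?u = "unit_vec H ?b"
 interpret F: module H "F m" by (rule F_module)
 have u: "?u \<in> carrier (F m)" using unit_vec_free[OF b] by (simp add: F_def)
 have "f m ?u = \<zero>\<^bsub>P' m\<^esub>" using homs_closed[OF fg(1) u] m by (simp add: eq)
 moreover have "g m \<zero>\<^bsub>P' m\<^esub> = \<zero>\<^bsub>F m\<^esub>"
  using homs_zero[OF _ _ fg(2), of m] resD(2)[OF \<open>res False H C P' d e\<close>] resD(2)[OF F_res] by blast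
 ultimately have "\<zero>\<^bsub>F m\<^esub> \<ominus>\<^bsub>F m\<^esub> ?u \<in> Fge n (bt m) 1" using fg(3)[OF u] by simp
 then have "?u \<ominus>\<^bsub>F m\<^esub> \<zero>\<^bsub>F m\<^esub> \<in> Fge n (bt m) 1"
  using Fge_diff(1)[of "\<zero>\<^bsub>F m\<^esub>" n "bt m" ?u 1] u F.zero_closed by (simp add: F_def)
 then have "?u \<in> Fge n (bt m) 1" unfolding diff_zero[OF F_module u] .
 then have "\<one>\<^bsub>H\<^esub> \<in> Hge n 1" unfolding Fge_def unit_vec_def by (auto dest: spec[of _ ?b])
 moreover have "\<one>\<^bsub>H\<^esub> \<in> carrier H" using F.R.one_closed .
 ultimately show False using Hge_1[of "\<one>\<^bsub>H\<^esub>" n] augmentation_one[of n] by simp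
qed

text \<open>As g f is bijective, f is injective. Surjectivity goes by induction: for x in P (m+1)
  write d x = f y; by injectivity y is a cycle, y = dF z, and x - f z is a boundary. So images of f
  and d together fill P (m+1), and minimality discards d. Then g is bijective.\<close>

theorem minimal_iso:
 assumes min: "minimal_graded_resolution H C P d e"
 shows "gr_isomorphic H (P m) (free_gmodule H (bt m))"
proof -
 have gr: "graded_projective_resolution H C P d e" and sup: "!!m. superfluous H (P m) (d m ` carrier (P (Suc m)))"
  using min by (simp_all add: minimal_graded_resolution_def)
 have P: "res True H C P d e" using gr by (simp add: res_def graded_projective_resolution_def)
 have gP: "graded_module H (P m)" for m using gr by (simp add: graded_projective_resolution_def)
 have mP: "module H (P m)" for m by (rule graded_moduleD(1)[OF gP])
 obtain f g k where f: "!!m. f m \<in> homs True H (F m) (P m)" and g: "!!m. g m \<in> homs True H (P m) (F m)"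
  and ef: "!!x. x \<in> carrier (F 0) ==> e (f 0 x) = eF x"
  and df: "!!m x. x \<in> carrier (F (Suc m)) ==> d m (f (Suc m) x) = f m (dF m x)"
  and gf: "!!m x. x \<in> carrier (F m) ==> g m (f m x) \<ominus>\<^bsub>F m\<^esub> x \<in> Fge n (bt m) 1"
  using equivalence[OF P] by metis
 have fh: "f m \<in> gr_hom H (F m) (P m)" for m using f by (simp add: homs_def)
 have fc: "f m x \<in> carrier (P m)" if "x \<in> carrier (F m)" for m x by (rule homs_closed[OF f that])
 have gc: "g m x \<in> carrier (F m)" if "x \<in> carrier (P m)" for m x by (rule homs_closed[OF g that])
 have dc: "d m x \<in> carrier (P m)" if "x \<in> carrier (P (Suc m))" for m x by (rule homs_closed[OF resD(4)[OF P] that])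
 have dFc: "dF m x \<in> carrier (F m)" if "x \<in> carrier (F (Suc m))" for m x by (rule homs_closed[OF resD(4)[OF F_res] that])
 have "(\<lambda>x. g m (f m x)) \<in> module_hom H (F m) (F m)" for m by (rule homs_hom[OF homs_comp[OF f g]])
 then have bij: "bij_betw (\<lambda>x. g m (f m x)) (carrier (F m)) (carrier (F m))" for m
  using gf unfolding F_def by (intro unipotent_bij) simp_all
 have inj: "x = y" if "x \<in> carrier (F m)" "y \<in> carrier (F m)" "f m x = f m y" for m x y
  using inj_onD[OF bij_betw_imp_inj_on[OF bij[of m]], of x y] that by simp
 have f0: "f m \<zero>\<^bsub>F m\<^esub> = \<zero>\<^bsub>P m\<^esub>" for m by (rule homs_zero[OF resD(2)[OF F_res] resD(2)[OF P] f])
 have F0: "\<zero>\<^bsub>F m\<^esub> \<in> carrier (F m)" for m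
 proof -
  interpret F: module H "F m" by (rule F_module)
  show ?thesis by (rule F.zero_closed)
 qed
 have cover: "f m ` carrier (F m) = carrier (P m)"
  if c: "!!x. x \<in> carrier (P m) ==> \<exists>z\<in>carrier (F m). x \<ominus>\<^bsub>P m\<^esub> f m z \<in> d m ` carrier (P (Suc m))" for m
 proof -
  interpret P: module H "P m" by (rule mP)
  have "d m ` carrier (P (Suc m)) <+>\<^bsub>P m\<^esub> f m ` carrier (F m) = carrier (P m)"
  proof (intro equalityI subsetI)
   fix x assume "x \<in> d m ` carrier (P (Suc m)) <+>\<^bsub>P m\<^esub> f m ` carrier (F m)"
   then obtain y z where yz: "y \<in> carrier (P (Suc m))" "z \<in> carrier (F m)" "x = d m y \<oplus>\<^bsub>P m\<^esub> f m z"
    unfolding set_add_def' by blast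
   show "x \<in> carrier (P m)" unfolding yz(3) by (intro P.a_closed dc fc yz)
  next
   fix x assume x: "x \<in> carrier (P m)"
   then obtain z where z: "z \<in> carrier (F m)" "x \<ominus>\<^bsub>P m\<^esub> f m z \<in> d m ` carrier (P (Suc m))" using c by blast
   have "x = (x \<ominus>\<^bsub>P m\<^esub> f m z) \<oplus>\<^bsub>P m\<^esub> f m z" using x fc[OF z(1)] by (simp add: P.minus_eq P.a_assoc P.l_neg)
   then show "x \<in> d m ` carrier (P (Suc m)) <+>\<^bsub>P m\<^esub> f m ` carrier (F m)" unfolding set_add_def' using z by blast
  qed
  moreover have "graded_submodule H (P m) (f m ` carrier (F m))"
   by (rule graded_submodule_image[OF H_gring_ok F_graded gP fh])
  ultimately show ?thesis using sup[of m] unfolding superfluous_def by blast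
 qed
 have step: "f (Suc m) ` carrier (F (Suc m)) = carrier (P (Suc m))"
  if z: "!!x. x \<in> carrier (P (Suc m)) ==> \<exists>z\<in>carrier (F (Suc m)). d m x = f m (dF m z)" for m
 proof (rule cover)
  fix x assume x: "x \<in> carrier (P (Suc m))"
  then obtain z where z: "z \<in> carrier (F (Suc m))" "d m x = f m (dF m z)" using z by blast
  interpret P: module H "P m" by (rule mP)
  interpret P1: module H "P (Suc m)" by (rule mP)
  have "d m (x \<ominus>\<^bsub>P (Suc m)\<^esub> f (Suc m) z) = d m x \<ominus>\<^bsub>P m\<^esub> d m (f (Suc m) z)"
   by (rule hom_diff[OF mP mP homs_hom[OF resD(4)[OF P]] x fc[OF z(1)]])
  also have "... = \<zero>\<^bsub>P m\<^esub>" using df[OF z(1)] z(2) dc[OF x] by (simp add: P.minus_eq P.r_neg)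
  finally have "x \<ominus>\<^bsub>P (Suc m)\<^esub> f (Suc m) z \<in> d (Suc m) ` carrier (P (Suc (Suc m)))"
   unfolding resD(8)[OF P] using x fc[OF z(1)] by simp
  then show "\<exists>z\<in>carrier (F (Suc m)). x \<ominus>\<^bsub>P (Suc m)\<^esub> f (Suc m) z \<in> d (Suc m) ` carrier (P (Suc (Suc m)))"
   using z(1) by blast
 qed
 have S0: "f 0 ` carrier (F 0) = carrier (P 0)"
 proof (rule cover)
  fix x assume x: "x \<in> carrier (P 0)"
  have "e x \<in> carrier C" by (rule homs_closed[OF resD(5)[OF P] x])
  then obtain z where z: "z \<in> carrier (F 0)" "eF z = e x" using resD(6)[OF F_res[of True]] by (metis imageE)
  interpret C: module H C by (rule trivial_module)
  interpret P0: module H "P 0" by (rule mP)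
  have "e (x \<ominus>\<^bsub>P 0\<^esub> f 0 z) = e x \<ominus>\<^bsub>C\<^esub> e (f 0 z)"
   by (rule hom_diff[OF mP trivial_module homs_hom[OF resD(5)[OF P]] x fc[OF z(1)]])
  also have "... = \<zero>\<^bsub>C\<^esub>" using ef[OF z(1)] z(2) \<open>e x \<in> carrier C\<close> by (simp add: C.minus_eq C.r_neg)
  finally have "x \<ominus>\<^bsub>P 0\<^esub> f 0 z \<in> d 0 ` carrier (P (Suc 0))" unfolding resD(7)[OF P] using x fc[OF z(1)] by simp
  then show "\<exists>z\<in>carrier (F 0). x \<ominus>\<^bsub>P 0\<^esub> f 0 z \<in> d 0 ` carrier (P (Suc 0))" using z(1) by blast
 qed
 have surj: "f m ` carrier (F m) = carrier (P m)" for m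
 proof (induction m)
  case 0
  show ?case by (rule S0)
 next
  case (Suc m)
  show ?case
  proof (rule step)
   fix x assume x: "x \<in> carrier (P (Suc m))"
   obtain y where y: "y \<in> carrier (F m)" "d m x = f m y" using Suc dc[OF x] by (metis imageE)
   have "y \<in> dF m ` carrier (F (Suc m))"
   proof (cases m)
    case 0
    have "eF y = \<zero>\<^bsub>C\<^esub>" using ef y x resD(9)[OF P] unfolding 0 by metis
    then show ?thesis using resD(7)[OF F_res[of True]] y(1) unfolding 0 by blast
   next
    case (Suc m')
    have "f m' (dF m' y) = \<zero>\<^bsub>P m'\<^esub>" using df y x resD(10)[OF P] unfolding Suc by metis
    then have "dF m' y = \<zero>\<^bsub>F m'\<^esub>" using inj[of "dF m' y" m' "\<zero>\<^bsub>F m'\<^esub>"] dFc y(1) f0 F0 unfolding Suc by metis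
    then show ?thesis using resD(8)[OF F_res[of True]] y(1) unfolding Suc by blast
   qed
   then show "\<exists>z\<in>carrier (F (Suc m)). d m x = f m (dF m z)" using y(2) by blast
  qed
 qed
 have "bij_betw (g m) (carrier (P m)) (carrier (F m))"
 proof (rule bij_betw_imageI)
  show "inj_on (g m) (carrier (P m))"
  proof (rule inj_onI)
   fix x y assume xy: "x \<in> carrier (P m)" "y \<in> carrier (P m)" "g m x = g m y"
   obtain x' y' where "x' \<in> carrier (F m)" "y' \<in> carrier (F m)" "x = f m x'" "y = f m y'" using xy(1,2) surj[of m] by blast
   then show "x = y" using inj_onD[OF bij_betw_imp_inj_on[OF bij[of m]], of x' y'] xy(3) by simp
  qed
  show "g m ` carrier (P m) = carrier (F m)"
   using bij_betw_imp_surj_on[OF bij[of m]] unfolding surj[of m, symmetric] image_image .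
 qed
 then show ?thesis unfolding gr_isomorphic_def F_def[symmetric] using g by (auto simp: homs_def)
qed

section \<open>The Poincare series\<close>

lemma finite_bt_support: "finite {l. bt m l \<noteq> 0}"
proof (rule finite_subset)
 show "{l. bt m l \<noteq> 0} \<subseteq> fst ` bs (bt m)"
 proof
  fix l assume "l \<in> {l. bt m l \<noteq> 0}"
  then have "(l, 0) \<in> bs (bt m)" by (simp add: bs_def)
  then show "l \<in> fst ` bs (bt m)" by (metis fst_conv image_eqI)
 qed
qed (simp add: finite_bt)

lemma minimal_betti:
 assumes min: "minimal_graded_resolution H C P d e"
 shows "graded_betti_numbers H P bt" and "graded_betti_numbers H P \<beta> ==> \<beta> = bt"
proof -
 show "graded_betti_numbers H P bt"
  using minimal_iso[OF min] finite_bt_support by (simp add: graded_betti_numbers_def)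
 assume \<beta>: "graded_betti_numbers H P \<beta>"
 have gP: "graded_module H (P m)" for m
  using min by (simp add: minimal_graded_resolution_def graded_projective_resolution_def)
 have "\<beta> m = bt m" for m
  using \<beta> by (intro free_iso_unique[OF gP finite_bs finite_bt _ minimal_iso[OF min]]) (auto simp: graded_betti_numbers_def)
 then show "\<beta> = bt" by (rule ext)
qed

lemma sum_bt:
 fixes \<phi> :: "int => 'a::comm_ring_1"
 shows "(\<Sum>l | bt m l \<noteq> 0. of_nat (bt m l) * \<phi> l) = (\<Sum>x\<in>Ix m. \<phi> (2 * int (wd x)))"
proof -
 let ?w = "\<lambda>x. 2 * int (wd x)"
 have im: "?w ` Ix m = {l. bt m l \<noteq> 0}" using finite_Ix[of m] by (auto simp: bt_def card_eq_0_iff)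
 have "(\<Sum>x\<in>Ix m. \<phi> (?w x)) = (\<Sum>l\<in>?w ` Ix m. \<Sum>x\<in>{x\<in>Ix m. ?w x = l}. \<phi> (?w x))" by (rule sum.image_gen[OF finite_Ix])
 also have "... = (\<Sum>l | bt m l \<noteq> 0. of_nat (bt m l) * \<phi> l)" unfolding im by (intro sum.cong refl) (simp add: bt_def)
 finally show ?thesis by simp
qed

text \<open>The remaining relations have degrees n, ..., 2; the linear one was used up by the
  elimination, so the product starts at 2.\<close>

lemma prod_reindex_down: "(\<Prod>k\<in>{1..N}. \<phi> (n + 1 - k)) = (\<Prod>j=2..n. (\<phi> j :: 'a::comm_monoid_mult))"
 by (rule prod.reindex_bij_witness[of _ "\<lambda>j. n + 1 - j" "\<lambda>k. n + 1 - k"]) (use n_pos in auto)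

text \<open>In the generating function an exterior generator contributes q^2 t and the k-th divided
  power generator q^(2(n+1-k)) t^2.\<close>

lemma poincare_bt:
 "poincare_series bt = (1 + fps_const (fls_X ^ 2) * fps_X) ^ (n - 1) /
   (\<Prod>j=2..n. 1 - fps_const (fls_X ^ (2 * j)) * fps_X ^ 2)"
proof -
 let ?C = "\<lambda>k. fls_X ^ (2 * (n + 1 - k)) :: rat fls"
 let ?Q = "\<Prod>j=2..n. 1 - fps_const (fls_X ^ (2 * j)) * fps_X ^ 2 :: rat fls fps"
 have w: "fls_X_intpow (2 * int (wd x)) = wt (fls_X ^ 2) ?C N x" for x
 proof -
  have "fls_X_intpow (2 * int (wd x)) = fls_X ^ (2 * wd x)" by (simp add: fls_X_power_conv_shift_1)
  also have "... = wt (fls_X ^ 2) ?C N x"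
   by (simp add: wt_def wd_def power_mult[symmetric] power_add[symmetric] power_sum[symmetric] distrib_left sum_distrib_left mult.assoc)
  finally show ?thesis .
 qed
 have "poincare_series bt = gen_series 1 (\<lambda>_. 2) (fls_X ^ 2) ?C N N"
  unfolding poincare_series_def gen_series_def sum_bt w Ix_fib ..
 then have "poincare_series bt * (\<Prod>k\<in>{1..N}. 1 - fps_const (?C k) * fps_X ^ 2) = (1 + fps_const (fls_X ^ 2) * fps_X ^ 1) ^ N"
  using gen_series_eq[of N "\<lambda>_. 2" 1 "fls_X ^ 2" ?C N] by simp
 also have "(\<Prod>k\<in>{1..N}. 1 - fps_const (?C k) * fps_X ^ 2) = ?Q"
  by (rule prod_reindex_down[of "\<lambda>j. 1 - fps_const (fls_X ^ (2 * j)) * fps_X ^ 2"])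
 finally have e: "poincare_series bt * ?Q = (1 + fps_const (fls_X ^ 2) * fps_X) ^ (n - 1)" by simp
 have "1 - fps_const c * fps_X ^ 2 \<noteq> (0 :: rat fls fps)" for c
 proof
  assume "1 - fps_const c * fps_X ^ 2 = (0 :: rat fls fps)"
  from arg_cong[OF this, of "\<lambda>p. fps_nth p 0"] show False by (simp add: power2_eq_square)
 qed
 then have "?Q \<noteq> 0" by (subst prod_zero_iff) auto
 then show ?thesis unfolding e[symmetric] by (rule nonzero_mult_div_cancel_right[symmetric])
qed

end

section \<open>Ext spaces\<close>

lemma complex_cring: "cring complex_field"
 by (intro cringI abelian_groupI comm_monoidI) (auto simp: algebra_simps intro: exI[of _ "- x" for x])

lemma complex_field: "field complex_field"
proof (rule cring.cring_fieldI[OF complex_cring])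
 have "\<exists>y. y * x = 1 \<and> x * y = 1" if "x \<noteq> 0" for x :: complex using that by (intro exI[of _ "inverse x"]) simp
 then show "Units complex_field = carrier complex_field - {\<zero>\<^bsub>complex_field\<^esub>}" by (auto simp: Units_def)
qed

lemma complex_finsum: "finite A ==> finsum complex_field f A = sum f A"
proof (induction A rule: finite_induct)
 interpret cring complex_field by (rule complex_cring)
 case empty
 then show ?case by simp
next
 interpret cring complex_field by (rule complex_cring)
 case (insert x A)
 then show ?case by (subst finsum_insert) auto
qed

lemma free_mod_complex_dim:
 assumes B: "finite B"
 shows "vectorspace complex_field (free_mod complex_field B)"
  and "vectorspace.fin_dim complex_field (free_mod complex_field B)"
  and "vectorspace.dim complex_field (free_mod complex_field B) = card B"
proof -
 let ?K = complex_field
 let ?M = "free_mod ?K B"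
 interpret K: cring ?K by (rule complex_cring)
 have M: "module ?K ?M" by (rule K.free_mod_module)
 show vs: "vectorspace ?K ?M" by (intro vectorspace.intro M complex_field)
 interpret V: vectorspace ?K ?M by (rule vs)
 let ?u = "unit_vec ?K"
 let ?U = "?u ` B"
 have inj: "inj_on ?u B" by (rule inj_onI) (auto simp: unit_vec_def fun_eq_iff split: if_splits)
 have U: "?U \<subseteq> carrier ?M" by (intro image_subsetI K.unit_vec_carrier)
 have fU: "finite ?U" using B by simp
 have carM: "x \<in> carrier ?M \<longleftrightarrow> (\<forall>i. i \<notin> B --> x i = 0)" for x
 proof -
  have "finite {i. x i \<noteq> 0}" if "\<forall>i. i \<notin> B --> x i = 0" by (rule finite_subset[OF _ B]) (use that in auto)
  then show ?thesis by (auto simp: K.free_mod_carrier)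
 qed
 have lc: "V.lincomb a ?U = (\<lambda>i. if i \<in> B then a (?u i) else 0)" for a
 proof
  fix i
  have "V.lincomb a ?U i = (\<Oplus>\<^bsub>?M\<^esub>v\<in>?U. a v \<odot>\<^bsub>?M\<^esub> v) i" by (simp add: V.lincomb_def)
  also have "... = (\<Oplus>\<^bsub>?K\<^esub>v\<in>?U. (a v \<odot>\<^bsub>?M\<^esub> v) i)" using U by (intro K.free_mod_finsum fU V.smult_closed) auto
  also have "... = (\<Sum>v\<in>?U. a v * v i)" by (simp add: complex_finsum[OF fU] K.free_mod_simps)
  also have "... = (\<Sum>j\<in>B. a (?u j) * ?u j i)" by (rule sum.reindex[OF inj, unfolded o_def])
  also have "... = (\<Sum>j\<in>B. if j = i then a (?u j) else 0)" by (intro sum.cong) (auto simp: unit_vec_def)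
  also have "... = (if i \<in> B then a (?u i) else 0)" using B by simp
  finally show "V.lincomb a ?U i = (if i \<in> B then a (?u i) else 0)" .
 qed
 have gen: "V.gen_set ?U"
 proof (intro equalityI subsetI)
  fix x assume "x \<in> V.span ?U"
  then show "x \<in> carrier ?M" using V.span_is_subset2[OF U] by blast
 next
  fix x assume x: "x \<in> carrier ?M"
  have "V.lincomb (\<lambda>v. x (inv_into B ?u v)) ?U = x"
   unfolding lc using x inv_into_f_f[OF inj] by (auto simp: carM fun_eq_iff)
  then show "x \<in> V.span ?U" unfolding V.finite_span[OF fU U] by (auto intro!: exI[of _ "\<lambda>v. x (inv_into B ?u v)"])
 qed
 have li: "V.lin_indpt ?U"
 proof (rule V.finite_lin_indpt2[OF fU U])
  fix a assume "V.lincomb a ?U = \<zero>\<^bsub>?M\<^esub>"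
  then have "(if i \<in> B then a (?u i) else 0) = 0" for i unfolding lc K.free_mod_simps by (simp add: fun_eq_iff)
  then show "\<forall>v\<in>?U. a v = \<zero>\<^bsub>?K\<^esub>" by (metis (mono_tags, lifting) imageE ring.simps(1))
 qed
 show "V.fin_dim" unfolding V.fin_dim_def using fU U gen by blast
 have "V.basis ?U" using li gen U by (simp add: V.basis_def)
 then show "V.dim = card B" using V.dim_basis[OF fU] card_image[OF inj] by simp
qed

text \<open>The first b values of T define a surjection of V onto a b-dimensional space with kernel
  W. The cosets of W are its level sets \<open>L c\<close>, so c \<mapsto> \<open>L c\<close> is an
  isomorphism onto the quotient.\<close>

lemma quotient_dim:
 fixes V :: "(complex, 'v) module" and T :: "'v => nat => complex"
 assumes V: "module complex_field V"
  and Ta: "!!x y k. x \<in> carrier V ==> y \<in> carrier V ==> k < b ==> T (x \<oplus>\<^bsub>V\<^esub> y) k = T x k + T y k"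
  and Ts: "!!c x k. x \<in> carrier V ==> k < b ==> T (c \<odot>\<^bsub>V\<^esub> x) k = c * T x k"
  and W: "W = {x \<in> carrier V. \<forall>k<b. T x k = 0}"
  and surj: "!!c. \<exists>x\<in>carrier V. \<forall>k<b. T x k = c k"
 shows "vectorspace complex_field (quotient_module V W)"
  and "vectorspace.fin_dim complex_field (quotient_module V W)"
  and "vectorspace.dim complex_field (quotient_module V W) = b"
proof -
 let ?K = complex_field
 let ?M = "free_mod ?K {..<b}"
 define Q where "Q = quotient_module V W"
 interpret K: cring ?K by (rule complex_cring)
 interpret V: module ?K V by (rule V)
 interpret M: module ?K ?M by (rule K.free_mod_module)
 define L where "L c = {y \<in> carrier V. \<forall>k<b. T y k = c k}" for c
 have ne: "\<exists>y. y \<in> L c" for c using surj[of c] by (auto simp: L_def)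
 have Tneg: "y \<oplus>\<^bsub>V\<^esub> ((-1) \<odot>\<^bsub>V\<^esub> x) \<in> carrier V" "(y \<oplus>\<^bsub>V\<^esub> ((-1) \<odot>\<^bsub>V\<^esub> x)) \<oplus>\<^bsub>V\<^esub> x = y"
  "k < b ==> T (y \<oplus>\<^bsub>V\<^esub> ((-1) \<odot>\<^bsub>V\<^esub> x)) k = T y k - T x k" if "x \<in> carrier V" "y \<in> carrier V" for x y k
 proof -
  have s: "(-1) \<odot>\<^bsub>V\<^esub> x \<in> carrier V" using that V.smult_closed[of "-1" x] by simp
  show "y \<oplus>\<^bsub>V\<^esub> ((-1) \<odot>\<^bsub>V\<^esub> x) \<in> carrier V" using s that by simp
  show "k < b ==> T (y \<oplus>\<^bsub>V\<^esub> ((-1) \<odot>\<^bsub>V\<^esub> x)) k = T y k - T x k" using s that by (simp add: Ta Ts)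
  have "((-1) \<odot>\<^bsub>V\<^esub> x) \<oplus>\<^bsub>V\<^esub> x = \<zero>\<^bsub>V\<^esub>"
   using V.smult_l_distr[of "-1" 1 x] V.smult_one[OF that(1)] V.smult_l_null[OF that(1)] that by simp
  then show "(y \<oplus>\<^bsub>V\<^esub> ((-1) \<odot>\<^bsub>V\<^esub> x)) \<oplus>\<^bsub>V\<^esub> x = y" using s that by (simp add: V.a_assoc)
 qed
 have coset: "W +>\<^bsub>V\<^esub> x = L (T x)" if x: "x \<in> carrier V" for x
 proof (intro equalityI subsetI)
  fix y assume "y \<in> W +>\<^bsub>V\<^esub> x"
  then obtain w where "w \<in> W" "y = w \<oplus>\<^bsub>V\<^esub> x" unfolding a_r_coset_def' by blast
  then show "y \<in> L (T x)" using x by (simp add: L_def W Ta)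
 next
  fix y assume y: "y \<in> L (T x)"
  then have yc: "y \<in> carrier V" by (simp add: L_def)
  have "y \<oplus>\<^bsub>V\<^esub> ((-1) \<odot>\<^bsub>V\<^esub> x) \<in> W" using Tneg(1,3)[OF x yc] y by (simp add: W L_def)
  then show "y \<in> W +>\<^bsub>V\<^esub> x" unfolding a_r_coset_def' using Tneg(2)[OF x yc] by force
 qed
 have Lcong: "L c = L c'" if "!!k. k < b ==> c k = c' k" for c c' using that by (auto simp: L_def)
 have Qc: "carrier Q = range L"
 proof (intro equalityI subsetI)
  fix A assume "A \<in> carrier Q"
  then show "A \<in> range L" unfolding Q_def quotient_module_def A_RCOSETS_def' using coset by auto
 next
  fix A assume "A \<in> range L"
  then obtain c where c: "A = L c" by blast
  obtain x where x: "x \<in> carrier V" "\<forall>k<b. T x k = c k" using surj by blast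
  have "A = W +>\<^bsub>V\<^esub> x" unfolding c coset[OF x(1)] using x(2) by (intro Lcong) simp
  then show "A \<in> carrier Q" unfolding Q_def quotient_module_def A_RCOSETS_def' using x(1) by auto
 qed
 have Q0: "\<zero>\<^bsub>Q\<^esub> = L (\<lambda>_. 0)" by (simp add: Q_def quotient_module_def W L_def)
 have Qa: "L c \<oplus>\<^bsub>Q\<^esub> L c' = L (\<lambda>k. c k + c' k)" for c c'
 proof -
  have "L c <+>\<^bsub>V\<^esub> L c' = L (\<lambda>k. c k + c' k)"
  proof (intro equalityI subsetI)
   fix z assume "z \<in> L c <+>\<^bsub>V\<^esub> L c'"
   then obtain x y where "x \<in> L c" "y \<in> L c'" "z = x \<oplus>\<^bsub>V\<^esub> y" unfolding set_add_def' by blast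
   then show "z \<in> L (\<lambda>k. c k + c' k)" by (simp add: L_def Ta)
  next
   fix z assume z: "z \<in> L (\<lambda>k. c k + c' k)"
   obtain y where y: "y \<in> L c'" using ne by blast
   have yz: "y \<in> carrier V" "z \<in> carrier V" using y z by (simp_all add: L_def)
   have "z \<oplus>\<^bsub>V\<^esub> ((-1) \<odot>\<^bsub>V\<^esub> y) \<in> L c" using Tneg(1,3)[OF yz] y z by (simp add: L_def)
   then show "z \<in> L c <+>\<^bsub>V\<^esub> L c'" unfolding set_add_def' using y Tneg(2)[OF yz] by force
  qed
  then show ?thesis by (simp add: Q_def quotient_module_def)
 qed
 have Qs: "r \<odot>\<^bsub>Q\<^esub> L c = L (\<lambda>k. r * c k)" for r c
 proof -
  have "W +>\<^bsub>V\<^esub> (r \<odot>\<^bsub>V\<^esub> x) = L (\<lambda>k. r * c k)" if x: "x \<in> L c" for x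
  proof -
   have xc: "x \<in> carrier V" "r \<odot>\<^bsub>V\<^esub> x \<in> carrier V" using x V.smult_closed[of r x] by (simp_all add: L_def)
   show ?thesis unfolding coset[OF xc(2)] using x xc by (intro Lcong) (simp add: L_def Ts)
  qed
  moreover obtain y where "y \<in> L c" using ne by blast
  ultimately have "(\<Union>x\<in>L c. W +>\<^bsub>V\<^esub> (r \<odot>\<^bsub>V\<^esub> x)) = L (\<lambda>k. r * c k)" by auto
  then show ?thesis by (simp add: Q_def quotient_module_def)
 qed
 define \<Theta> where "\<Theta> A = (\<lambda>k. if k < b then T (SOME y. y \<in> A) k else 0)" for A
 have \<Theta>: "\<Theta> (L c) = (\<lambda>k. if k < b then c k else 0)" for c
 proof -
  have "(SOME y. y \<in> L c) \<in> L c" by (rule someI_ex[OF ne])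
  then show ?thesis by (auto simp: \<Theta>_def L_def fun_eq_iff)
 qed
 have carM: "x \<in> carrier ?M \<longleftrightarrow> (\<forall>i. \<not> i < b --> x i = 0)" for x
 proof -
  have "finite {i. x i \<noteq> 0}" if "\<forall>i. \<not> i < b --> x i = 0" by (rule finite_subset[of _ "{..<b}"]) (use that in auto)
  then show ?thesis by (auto simp: K.free_mod_carrier)
 qed
 have mQ: "module ?K Q"
 proof (rule module_transport[OF K.free_mod_module, of \<Theta> Q "{..<b}"])
  show "inj_on \<Theta> (carrier Q)"
  proof (rule inj_onI)
   fix A A' assume "A \<in> carrier Q" "A' \<in> carrier Q" and e: "\<Theta> A = \<Theta> A'"
   then obtain c c' where c: "A = L c" "A' = L c'" unfolding Qc by blast
   have "c k = c' k" if "k < b" for k using fun_cong[OF e, of k] that unfolding c \<Theta> by simp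
   then show "A = A'" unfolding c by (rule Lcong)
  qed
 qed (auto simp: Qc \<Theta> carM Q0 Qa Qs K.free_mod_simps fun_eq_iff)
 have vQ: "vectorspace ?K Q" by (intro vectorspace.intro mQ complex_field)
 have fB: "finite {..<b}" by simp
 have "L \<in> module_hom ?K ?M Q" by (auto simp: module_hom_def Qc K.free_mod_simps Qa Qs)
 then have lin: "linear_map ?K ?M Q L"
  by (intro linear_map.intro mod_hom.intro mod_hom_axioms.intro vQ free_mod_complex_dim(1)[OF fB] mQ K.free_mod_module)
 have inj: "inj_on L (carrier ?M)"
 proof (rule inj_onI)
  fix x y assume xy: "x \<in> carrier ?M" "y \<in> carrier ?M" "L x = L y"
  have "x k = y k" for k
   using arg_cong[OF xy(3), of "\<lambda>A. \<Theta> A k"] xy(1,2) unfolding \<Theta> by (cases "k < b") (simp_all add: carM)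
  then show "x = y" by (rule ext)
 qed
 have sur: "L ` carrier ?M = carrier Q"
 proof (intro equalityI subsetI)
  fix A assume "A \<in> carrier Q"
  then obtain c where c: "A = L c" unfolding Qc by blast
  have e: "A = L (\<lambda>k. if k < b then c k else 0)" unfolding c by (rule Lcong) simp
  show "A \<in> L ` carrier ?M" unfolding e by (rule imageI) (simp add: carM)
 qed (auto simp: Qc)
 show "vectorspace ?K (quotient_module V W)" using vQ by (simp add: Q_def)
 show "vectorspace.fin_dim ?K (quotient_module V W)"
  using linear_map.surj_fin_dim[OF lin free_mod_complex_dim(2)[OF fB] sur] by (simp add: Q_def)
 show "vectorspace.dim ?K (quotient_module V W) = b"
  using linear_map.dim_eq[OF lin free_mod_complex_dim(2)[OF fB] inj sur] free_mod_complex_dim(3)[OF fB] by (simp add: Q_def)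
qed

section \<open>Homomorphisms into shifted trivial modules, and Ext\<close>

text \<open>The ambient space from which the cocycle spaces inherit their module axioms, by
  \<open>module_transport\<close>.\<close>

definition fun_mod :: "(complex, 'p => complex) module" where
 "fun_mod = \<lparr>carrier = UNIV, monoid.mult = undefined, monoid.one = undefined, ring.zero = (\<lambda>_. 0),
   ring.add = (\<lambda>f g x. f x + g x), module.smult = (\<lambda>c f x. c * f x)\<rparr>"

lemma fun_mod_module: "module complex_field fun_mod"
proof (rule module_criteria; (intro allI ballI impI)?; (elim conjE)?)
 show "cring complex_field" by (rule complex_cring)
 fix v :: "'p => complex"
 show "\<exists>w\<in>carrier fun_mod. v \<oplus>\<^bsub>fun_mod\<^esub> w = \<zero>\<^bsub>fun_mod\<^esub>" by (intro bexI[of _ "\<lambda>x. - v x"]) (simp_all add: fun_mod_def)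
qed (auto simp: fun_mod_def algebra_simps fun_eq_iff)

text \<open>Through the augmentation a graded map into the shifted trivial module becomes a
  complex-valued function, supported in degree l; \<open>scalar_gr_hom\<close> is the way
  back.\<close>

lemma shift_hom:
 assumes "\<phi> \<in> gr_hom (CA n) M (gshift l (TM n))"
 shows "\<phi> \<in> module_hom (CA n) M (TM n)"
  and "x \<in> carrier M ==> \<phi> x = scl n (aug (\<phi> x))"
  and "x \<in> carrier M ==> y \<in> carrier M ==>
   aug (\<phi> (x \<oplus>\<^bsub>M\<^esub> y)) = aug (\<phi> x) + aug (\<phi> y)"
  and "r \<in> carrier (CA n) ==> x \<in> carrier M ==>
   aug (\<phi> (r \<odot>\<^bsub>M\<^esub> x)) = aug r * aug (\<phi> x)"
  and "x \<in> mpart M i ==> i \<noteq> l ==> aug (\<phi> x) = 0"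
proof -
 let ?C = "TM n"
 show h: "\<phi> \<in> module_hom (CA n) M ?C" using gr_homD(1)[OF assms] by (simp add: module_hom_def gshift_simps)
 have s: "\<phi> x = scl n (aug (\<phi> x))" if "x \<in> carrier M" for x
 proof -
  have "\<phi> x \<in> carrier ?C" using h that by (auto simp: module_hom_def)
  then obtain c where "\<phi> x = scl n c" unfolding trivial_simps by blast
  then show ?thesis by simp
 qed
 show "x \<in> carrier M ==> \<phi> x = scl n (aug (\<phi> x))" by (rule s)
 show "aug (\<phi> (x \<oplus>\<^bsub>M\<^esub> y)) = aug (\<phi> x) + aug (\<phi> y)"
  if "x \<in> carrier M" "y \<in> carrier M"
 proof -
  have "\<phi> (x \<oplus>\<^bsub>M\<^esub> y) = \<phi> x \<oplus>\<^bsub>?C\<^esub> \<phi> y" using h that by (simp add: module_hom_def)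
  also have "... = scl n (aug (\<phi> x) + aug (\<phi> y))" by (subst (1 2) s) (simp_all add: that trivial_simps)
  finally show ?thesis by simp
 qed
 show "aug (\<phi> (r \<odot>\<^bsub>M\<^esub> x)) = aug r * aug (\<phi> x)"
  if "r \<in> carrier (CA n)" "x \<in> carrier M"
 proof -
  have "\<phi> (r \<odot>\<^bsub>M\<^esub> x) = r \<odot>\<^bsub>?C\<^esub> \<phi> x" using h that by (simp add: module_hom_def)
  also have "... = scl n (aug r * aug (\<phi> x))" by (subst s) (simp_all add: that trivial_simps)
  finally show ?thesis by simp
 qed
 show "x \<in> mpart M i ==> i \<noteq> l ==> aug (\<phi> x) = 0"
  using gr_homD(2)[OF assms, of x i] by (auto simp: gshift_simps trivial_simps)
qed

lemma scalar_gr_hom: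
 assumes M: "graded_module (CA n) M"
  and add: "!!x y. x \<in> carrier M ==> y \<in> carrier M ==> \<alpha> (x \<oplus>\<^bsub>M\<^esub> y) = \<alpha> x + \<alpha> y"
  and smult: "!!r x. r \<in> carrier (CA n) ==> x \<in> carrier M ==> \<alpha> (r \<odot>\<^bsub>M\<^esub> x) = aug r * \<alpha> x"
  and part: "!!i x. x \<in> mpart M i ==> i \<noteq> l ==> \<alpha> x = 0"
 shows "(\<lambda>x\<in>carrier M. scl n (\<alpha> x)) \<in>
  gr_hom (CA n) M (gshift l (TM n)) \<inter> extensional (carrier M)"
proof -
 interpret M: module "CA n" M by (rule graded_moduleD(1)[OF M])
 let ?f = "\<lambda>x\<in>carrier M. scl n (\<alpha> x)"
 have "?f \<in> module_hom (CA n) M (gshift l (TM n))"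
  by (auto simp: module_hom_def gshift_simps trivial_simps add smult)
 moreover have "?f x \<in> mpart (gshift l (TM n)) i" if x: "x \<in> mpart M i" for x i
 proof -
  have "?f x = scl n (\<alpha> x)" using x graded_moduleD(2)[OF M, of i] by auto
  moreover have "i \<noteq> l ==> \<alpha> x = 0" by (rule part[OF x])
  ultimately show ?thesis by (simp add: gshift_simps trivial_simps)
 qed
 ultimately show ?thesis by (auto simp: gr_hom_def simp del: restrict_apply)
qed

lemma homs_mpart: "h \<in> homs True R M N ==> x \<in> mpart M i ==> h x \<in> mpart N i" by (auto simp: homs_def gr_hom_def)

lemma Fge_diff_augmentation:
 assumes x: "x \<in> carrier (fmod n \<beta>)" "y \<in> carrier (fmod n \<beta>)"
  and d: "x \<ominus>\<^bsub>fmod n \<beta>\<^esub> y \<in> Fge n \<beta> 1"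
 shows "aug (x p) = aug (y p)"
proof -
 let ?F = "fmod n \<beta>"
 interpret H: cring "CA n" by (rule H_cring)
 interpret F: module "CA n" ?F by (rule fmod_module[OF H_cring])
 let ?z = "x \<ominus>\<^bsub>?F\<^esub> y"
 have "x = ?z \<oplus>\<^bsub>?F\<^esub> y" using x by (simp add: F.minus_eq F.a_assoc F.l_neg)
 then have "x p = ?z p \<oplus>\<^bsub>CA n\<^esub> y p" by (metis fmod_simps(3))
 moreover have zc: "?z p \<in> carrier (CA n)" using d Hge_sub by (auto simp: Fge_def)
 moreover have "y p \<in> carrier (CA n)" using x(2) by (simp add: fmod_simps H.free_mod_carrier)
 moreover have "aug (?z p) = 0" using d Hge_1[OF zc] by (simp add: Fge_def)
 ultimately show ?thesis by (simp add: augmentation_add)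
qed

context coinv
begin

text \<open>Cocycles are measured by their values T along f on the generators of \<open>F m\<close>
  of degree l. Coboundaries have T = 0 because \<open>dF\<close> ends in the augmentation submodule.
  If T vanishes on a cocycle \<phi>, then \<phi> f = 0, so \<phi> = -\<phi>(f g - 1) is a coboundary
  by the homotopy. All values are attained by coordinates composed with g.\<close>

theorem Ext_dim:
 assumes gr: "graded_projective_resolution H C P d e"
 shows "vectorspace complex_field (Ext_space (scl n) H P d (gshift l C) m)"
  and "vectorspace.fin_dim complex_field (Ext_space (scl n) H P d (gshift l C) m)"
  and "vectorspace.dim complex_field (Ext_space (scl n) H P d (gshift l C) m) = bt m l"
proof -
 have P: "res True H C P d e" using gr by (simp add: res_def graded_projective_resolution_def)
 have gP: "graded_module H (P m)" for m using gr by (simp add: graded_projective_resolution_def)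
 have mP: "module H (P m)" for m by (rule graded_moduleD(1)[OF gP])
 obtain f g k where f: "!!m. f m \<in> homs True H (F m) (P m)" and g: "!!m. g m \<in> homs True H (P m) (F m)"
  and ef: "!!x. x \<in> carrier (F 0) ==> e (f 0 x) = eF x"
  and df: "!!m x. x \<in> carrier (F (Suc m)) ==> d m (f (Suc m) x) = f m (dF m x)"
  and dg: "!!m x. x \<in> carrier (P (Suc m)) ==> dF m (g (Suc m) x) = g m (d m x)"
  and gf: "!!m x. x \<in> carrier (F m) ==> g m (f m x) \<ominus>\<^bsub>F m\<^esub> x \<in> Fge n (bt m) 1"
  and k: "!!m. k m \<in> homs True H (P m) (P (Suc m))"
  and k0: "!!x. x \<in> carrier (P 0) ==> f 0 (g 0 x) \<ominus>\<^bsub>P 0\<^esub> x = d 0 (k 0 x)"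
  and kS: "!!m x. x \<in> carrier (P (Suc m)) ==> f (Suc m) (g (Suc m) x) \<ominus>\<^bsub>P (Suc m)\<^esub> x = d (Suc m) (k (Suc m) x) \<oplus>\<^bsub>P (Suc m)\<^esub> k m (d m x)"
  by (rule equivalence[OF P]) (rule that; assumption)
 have fc: "f m x \<in> carrier (P m)" if "x \<in> carrier (F m)" for m x by (rule homs_closed[OF f that])
 have gc: "g m x \<in> carrier (F m)" if "x \<in> carrier (P m)" for m x by (rule homs_closed[OF g that])
 have kc: "k m x \<in> carrier (P (Suc m))" if "x \<in> carrier (P m)" for m x by (rule homs_closed[OF k that])
 have dc: "d m x \<in> carrier (P m)" if "x \<in> carrier (P (Suc m))" for m x by (rule homs_closed[OF resD(4)[OF P] that])
 have dFc: "dF m x \<in> carrier (F m)" if "x \<in> carrier (F (Suc m))" for m x by (rule homs_closed[OF resD(4)[OF F_res] that])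
 let ?Cl = "gshift l C"
 let ?S = "\<lambda>m. gr_hom_space (scl n) H (P m) ?Cl"
 let ?G = "\<lambda>m. gr_hom H (P m) ?Cl \<inter> extensional (carrier (P m))"
 let ?a = "\<lambda>\<phi> x. aug (\<phi> x)"
 have S: "carrier (?S m) = ?G m" for m by (simp add: gr_hom_space_def)
 define Zc where "Zc = cocycles (scl n) H P d ?Cl m"
 have Zc: "\<phi> \<in> Zc \<longleftrightarrow> \<phi> \<in> ?G m \<and> (\<forall>x\<in>carrier (P (Suc m)). \<phi> (d m x) = scl n 0)" for \<phi>
  by (auto simp: Zc_def cocycles_def S gshift_simps trivial_simps)
 let ?V = "(?S m)\<lparr>carrier := Zc\<rparr>"
 define b where "b = bt m l"
 let ?u = "\<lambda>k. unit_vec H (l, k)"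
 define T where "T \<phi> k = ?a \<phi> (f m (?u k))" for \<phi> k
 have ub: "(l, k) \<in> bs (bt m)" if "k < b" for k using that by (simp add: b_def bs_def)
 have uc: "?u k \<in> carrier (F m)" if "k < b" for k using unit_vec_free[OF ub[OF that]] by (simp add: F_def)
 have sc: "(\<lambda>x\<in>carrier (P m). scl n (\<alpha> x)) \<in> Zc"
  if "!!x y. x \<in> carrier (P m) ==> y \<in> carrier (P m) ==> \<alpha> (x \<oplus>\<^bsub>P m\<^esub> y) = \<alpha> x + \<alpha> y"
   "!!r x. r \<in> carrier H ==> x \<in> carrier (P m) ==> \<alpha> (r \<odot>\<^bsub>P m\<^esub> x) = aug r * \<alpha> x"
   "!!i x. x \<in> mpart (P m) i ==> i \<noteq> l ==> \<alpha> x = 0"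
   "!!x. x \<in> carrier (P (Suc m)) ==> \<alpha> (d m x) = 0" for \<alpha>
  unfolding Zc using scalar_gr_hom[where \<alpha> = \<alpha>, OF gP that(1-3)] that(4) dc by simp
 have gh: "\<phi> \<in> gr_hom H (P m) ?Cl" if "\<phi> \<in> Zc" for \<phi> using that by (simp add: Zc)
 have Zd: "?a \<phi> (d m x) = 0" if "\<phi> \<in> Zc" "x \<in> carrier (P (Suc m))" for \<phi> x using that by (simp add: Zc)
 have Zadd: "\<phi> \<oplus>\<^bsub>?V\<^esub> \<psi> = (\<lambda>x\<in>carrier (P m). scl n (?a \<phi> x + ?a \<psi> x))" if "\<phi> \<in> Zc" "\<psi> \<in> Zc" for \<phi> \<psi>
 proof -
  have "\<phi> x \<oplus>\<^bsub>C\<^esub> \<psi> x = scl n (?a \<phi> x + ?a \<psi> x)" if x: "x \<in> carrier (P m)" for x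
   using shift_hom(2)[OF gh[OF \<open>\<phi> \<in> Zc\<close>] x] shift_hom(2)[OF gh[OF \<open>\<psi> \<in> Zc\<close>] x]
   by (metis trivial_simps(3))
  then have "(\<lambda>x\<in>carrier (P m). \<phi> x \<oplus>\<^bsub>C\<^esub> \<psi> x) = (\<lambda>x\<in>carrier (P m). scl n (?a \<phi> x + ?a \<psi> x))" by (rule restrict_ext)
  then show ?thesis by (simp add: gr_hom_space_def gshift_simps)
 qed
 have Zsm: "c \<odot>\<^bsub>?V\<^esub> \<phi> = (\<lambda>x\<in>carrier (P m). scl n (c * ?a \<phi> x))" if "\<phi> \<in> Zc" for \<phi> c
 proof -
  have "scl n c \<odot>\<^bsub>C\<^esub> \<phi> x = scl n (c * ?a \<phi> x)" if x: "x \<in> carrier (P m)" for x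
   using shift_hom(2)[OF gh[OF \<open>\<phi> \<in> Zc\<close>] x] by (metis trivial_simps(4) aug_scalar)
  then have "(\<lambda>x\<in>carrier (P m). scl n c \<odot>\<^bsub>C\<^esub> \<phi> x) = (\<lambda>x\<in>carrier (P m). scl n (c * ?a \<phi> x))" by (rule restrict_ext)
  then show ?thesis by (simp add: gr_hom_space_def gshift_simps)
 qed
 have Z0: "\<zero>\<^bsub>?V\<^esub> = (\<lambda>x\<in>carrier (P m). scl n 0)" by (simp add: gr_hom_space_def gshift_simps trivial_simps)
 have cAdd: "(\<lambda>x\<in>carrier (P m). scl n (?a \<phi> x + ?a \<psi> x)) \<in> Zc" if "\<phi> \<in> Zc" "\<psi> \<in> Zc" for \<phi> \<psi>
  by (rule sc) (simp_all add: shift_hom(3-5)[OF gh[OF that(1)]] shift_hom(3-5)[OF gh[OF that(2)]] Zd that distrib_left)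
 have cSm: "(\<lambda>x\<in>carrier (P m). scl n (c * ?a \<phi> x)) \<in> Zc" if "\<phi> \<in> Zc" for \<phi> c
  by (rule sc) (simp_all add: shift_hom(3-5)[OF gh[OF that]] Zd that distrib_left)
 have c0: "(\<lambda>x\<in>carrier (P m). scl n 0) \<in> Zc" by (rule sc) simp_all
 have Vmod: "module complex_field ?V"
 proof (rule module_transport[OF fun_mod_module, of "\<lambda>\<phi> x. if x \<in> carrier (P m) then ?a \<phi> x else 0"])
  show "inj_on (\<lambda>\<phi> x. if x \<in> carrier (P m) then ?a \<phi> x else 0) (carrier ?V)"
  proof (rule inj_onI)
   fix \<phi> \<psi> assume z: "\<phi> \<in> carrier ?V" "\<psi> \<in> carrier ?V"
    and e: "(\<lambda>x. if x \<in> carrier (P m) then ?a \<phi> x else 0) = (\<lambda>x. if x \<in> carrier (P m) then ?a \<psi> x else 0)"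
   have zz: "\<phi> \<in> Zc" "\<psi> \<in> Zc" using z by simp_all
   have "\<phi> x = \<psi> x" if x: "x \<in> carrier (P m)" for x
   proof -
    have "?a \<phi> x = ?a \<psi> x" using fun_cong[OF e, of x] x by simp
    then show ?thesis using shift_hom(2)[OF gh[OF zz(1)] x] shift_hom(2)[OF gh[OF zz(2)] x] by simp
   qed
   moreover have "\<phi> \<in> extensional (carrier (P m))" "\<psi> \<in> extensional (carrier (P m))" using zz by (simp_all add: Zc)
   ultimately show "\<phi> = \<psi>" by (intro extensionalityI[of _ "carrier (P m)"])
  qed
  show "\<zero>\<^bsub>?V\<^esub> \<in> carrier ?V" unfolding Z0 using c0 by simp
  show "(\<lambda>x. if x \<in> carrier (P m) then ?a \<zero>\<^bsub>?V\<^esub> x else 0) = \<zero>\<^bsub>fun_mod\<^esub>" unfolding Z0 by (auto simp: fun_mod_def)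
  fix \<phi> assume "\<phi> \<in> carrier ?V"
  then have \<phi>: "\<phi> \<in> Zc" by simp
  show "r \<odot>\<^bsub>?V\<^esub> \<phi> \<in> carrier ?V \<and> (\<lambda>x. if x \<in> carrier (P m) then ?a (r \<odot>\<^bsub>?V\<^esub> \<phi>) x else 0) =
    r \<odot>\<^bsub>fun_mod\<^esub> (\<lambda>x. if x \<in> carrier (P m) then ?a \<phi> x else 0)" for r
   unfolding Zsm[OF \<phi>] using cSm[OF \<phi>] by (auto simp: fun_mod_def fun_eq_iff)
  fix \<psi> assume "\<psi> \<in> carrier ?V"
  then have \<psi>: "\<psi> \<in> Zc" by simp
  show "\<phi> \<oplus>\<^bsub>?V\<^esub> \<psi> \<in> carrier ?V \<and> (\<lambda>x. if x \<in> carrier (P m) then ?a (\<phi> \<oplus>\<^bsub>?V\<^esub> \<psi>) x else 0) =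
    (\<lambda>x. if x \<in> carrier (P m) then ?a \<phi> x else 0) \<oplus>\<^bsub>fun_mod\<^esub> (\<lambda>x. if x \<in> carrier (P m) then ?a \<psi> x else 0)"
   unfolding Zadd[OF \<phi> \<psi>] using cAdd[OF \<phi> \<psi>] by (auto simp: fun_mod_def fun_eq_iff)
 qed (auto simp: fun_mod_def)
 have compF: "(\<lambda>x. \<psi> (f m' x)) \<in> module_hom H (F m') C" if "\<psi> \<in> gr_hom H (P m') ?Cl" for \<psi> m'
  using homs_comp[of "f m'" False H "F m'" "P m'" \<psi> C] homs_hom[OF f] shift_hom(1)[OF that]
  by (simp add: homs_def)
 \<comment> \<open>Generators in degrees other than l are sent to 0 for reasons of degree, so T
   determines \<phi> f.\<close>
 have vanish: "?a \<phi> (f m y) = 0" if \<phi>: "\<phi> \<in> Zc" "\<forall>k<b. T \<phi> k = 0" and y: "y \<in> carrier (F m)" for \<phi> y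
 proof -
  have "?a \<phi> (f m (unit_vec H p)) = 0" if p: "p \<in> bs (bt m)" for p
  proof (cases "fst p = l")
   case True
   then have "snd p < b" "p = (l, snd p)" using p by (auto simp: bs_def b_def)
   then show ?thesis using \<phi>(2) unfolding T_def by metis
  next
   case False
   have "f m (unit_vec H p) \<in> mpart (P m) (fst p)"
    using unit_vec_mpart[OF p, of n] by (intro homs_mpart[OF f]) (simp add: F_def)
   then show ?thesis using shift_hom(5)[OF gh[OF \<phi>(1)] _ False] by blast
  qed
  then show ?thesis
   using augmentation_expand[OF compF[OF gh[OF \<phi>(1)], unfolded F_def] finite_bt y[unfolded F_def]] by simp
 qed
 have gfsplit: "?a \<phi> x = - ?a \<phi> (f m (g m x) \<ominus>\<^bsub>P m\<^esub> x)"
  if \<phi>: "\<phi> \<in> Zc" "\<forall>k<b. T \<phi> k = 0" and x: "x \<in> carrier (P m)" for \<phi> x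
 proof -
  interpret Pm: module H "P m" by (rule mP)
  let ?y = "f m (g m x)"
  have y: "?y \<in> carrier (P m)" by (intro fc gc x)
  have "?y = (?y \<ominus>\<^bsub>P m\<^esub> x) \<oplus>\<^bsub>P m\<^esub> x" using x y by (simp add: Pm.minus_eq Pm.a_assoc Pm.l_neg)
  then have "?a \<phi> ?y = ?a \<phi> (?y \<ominus>\<^bsub>P m\<^esub> x) + ?a \<phi> x"
   using shift_hom(3)[OF gh[OF \<phi>(1)], of "?y \<ominus>\<^bsub>P m\<^esub> x" x] x y by (metis Pm.minus_closed)
  then show ?thesis using vanish[OF \<phi> gc[OF x]] by (simp add: eq_neg_iff_add_eq_0 add.commute)
 qed
 have ext: "\<phi> = (\<lambda>x\<in>carrier (P m). scl n (\<alpha> x))"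
  if "\<phi> \<in> Zc" "!!x. x \<in> carrier (P m) ==> ?a \<phi> x = \<alpha> x" for \<phi> \<alpha>
 proof (rule extensionalityI[of _ "carrier (P m)"])
  show "\<phi> \<in> extensional (carrier (P m))" using that(1) by (simp add: Zc)
  show "\<phi> x = (\<lambda>x\<in>carrier (P m). scl n (\<alpha> x)) x" if x: "x \<in> carrier (P m)" for x
   using shift_hom(2)[OF gh[OF \<open>\<phi> \<in> Zc\<close>] x] \<open>!!x. x \<in> carrier (P m) ==> ?a \<phi> x = \<alpha> x\<close>[OF x] x by simp
 qed simp
 have W: "coboundaries (scl n) H P d ?Cl m = {\<phi> \<in> carrier ?V. \<forall>k<b. T \<phi> k = 0}"
 proof (cases m)
  case 0
  have "\<phi> = (\<lambda>x\<in>carrier (P m). scl n 0)" if \<phi>: "\<phi> \<in> Zc" "\<forall>k<b. T \<phi> k = 0" for \<phi>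
  proof (rule ext[OF \<phi>(1)])
   fix x assume x: "x \<in> carrier (P m)"
   show "?a \<phi> x = 0" using gfsplit[OF \<phi> x] k0 x Zd[OF \<phi>(1) kc[of x m, folded 0]] kc[of x 0] unfolding 0 by simp
  qed
  moreover have "T (\<lambda>x\<in>carrier (P m). scl n 0) k = 0" if "k < b" for k using fc[OF uc[OF that]] by (simp add: T_def)
  ultimately have "{\<phi> \<in> Zc. \<forall>k<b. T \<phi> k = 0} = {\<lambda>x\<in>carrier (P m). scl n 0}" using c0 by blast
  moreover have "\<zero>\<^bsub>?S 0\<^esub> = (\<lambda>x\<in>carrier (P m). scl n 0)"
   unfolding 0 by (simp add: gr_hom_space_def gshift_simps trivial_simps)
  ultimately show ?thesis unfolding coboundaries_def 0 by simp
 next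
  case (Suc m')
  have "coboundaries (scl n) H P d ?Cl m = (\<lambda>\<psi>. \<lambda>x\<in>carrier (P m). \<psi> (d m' x)) ` ?G m'"
   unfolding coboundaries_def Suc by (simp add: S)
  also have "... = {\<phi> \<in> Zc. \<forall>k<b. T \<phi> k = 0}"
  proof (intro equalityI subsetI)
   fix \<phi> assume "\<phi> \<in> (\<lambda>\<psi>. \<lambda>x\<in>carrier (P m). \<psi> (d m' x)) ` ?G m'"
   then obtain \<psi> where \<psi>: "\<psi> \<in> gr_hom H (P m') ?Cl" "\<phi> = (\<lambda>x\<in>carrier (P m). \<psi> (d m' x))" by blast
   note dcm = dc[of _ m', folded Suc]
   have dh: "d m' (x \<oplus>\<^bsub>P m\<^esub> y) = d m' x \<oplus>\<^bsub>P m'\<^esub> d m' y" "r \<in> carrier H ==> d m' (r \<odot>\<^bsub>P m\<^esub> x) = r \<odot>\<^bsub>P m'\<^esub> d m' x"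
    if "x \<in> carrier (P m)" "y \<in> carrier (P m)" for x y r
    using homs_hom[OF resD(4)[OF P, of m']] that unfolding Suc by (auto simp: module_hom_def)
   have \<psi>0: "?a \<psi> \<zero>\<^bsub>P m'\<^esub> = 0"
    using hom_zero[OF mP trivial_module shift_hom(1)[OF \<psi>(1)]] by (simp add: trivial_simps)
   have "\<phi> = (\<lambda>x\<in>carrier (P m). scl n (?a \<psi> (d m' x)))"
    unfolding \<psi>(2) by (intro restrict_ext shift_hom(2)[OF \<psi>(1)] dcm)
   also have "... \<in> Zc"
   proof (rule sc)
    show "?a \<psi> (d m' (x \<oplus>\<^bsub>P m\<^esub> y)) = ?a \<psi> (d m' x) + ?a \<psi> (d m' y)" if "x \<in> carrier (P m)" "y \<in> carrier (P m)" for x y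
     using that by (simp add: dh shift_hom(3)[OF \<psi>(1)] dcm)
    show "?a \<psi> (d m' (r \<odot>\<^bsub>P m\<^esub> x)) = aug r * ?a \<psi> (d m' x)" if "r \<in> carrier H" "x \<in> carrier (P m)" for r x
     using that by (simp add: dh shift_hom(4)[OF \<psi>(1)] dcm)
    show "?a \<psi> (d m' x) = 0" if "x \<in> mpart (P m) i" "i \<noteq> l" for x i
     using shift_hom(5)[OF \<psi>(1) homs_mpart[OF resD(4)[OF P, of m'], of x i] that(2)] that(1) unfolding Suc by simp
    show "?a \<psi> (d m' (d m x)) = 0" if "x \<in> carrier (P (Suc m))" for x
     using resD(10)[OF P, of x m'] that \<psi>0 unfolding Suc by simp
   qed
   finally have "\<phi> \<in> Zc" .
   moreover have "T \<phi> k = 0" if kb: "k < b" for k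
   proof -
    have u: "?u k \<in> carrier (F (Suc m'))" using uc[OF kb] unfolding Suc .
    have "T \<phi> k = ?a \<psi> (d m' (f m (?u k)))" unfolding T_def \<psi>(2) using fc[OF uc[OF kb]] by simp
    also have "... = ?a \<psi> (f m' (dF m' (?u k)))" using df[OF u] unfolding Suc by simp
    also have "... = 0" using Fge_trivial_hom[OF compF[OF \<psi>(1), unfolded F_def] dF_augmentation[OF u]] by simp
    finally show ?thesis .
   qed
   ultimately show "\<phi> \<in> {\<phi> \<in> Zc. \<forall>k<b. T \<phi> k = 0}" by simp
  next
   fix \<phi> assume "\<phi> \<in> {\<phi> \<in> Zc. \<forall>k<b. T \<phi> k = 0}"
   then have \<phi>: "\<phi> \<in> Zc" "\<forall>k<b. T \<phi> k = 0" by simp_all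
   note kcm = kc[of _ m', folded Suc]
   have kh: "k m' (x \<oplus>\<^bsub>P m'\<^esub> y) = k m' x \<oplus>\<^bsub>P m\<^esub> k m' y" "r \<in> carrier H ==> k m' (r \<odot>\<^bsub>P m'\<^esub> x) = r \<odot>\<^bsub>P m\<^esub> k m' x"
    if "x \<in> carrier (P m')" "y \<in> carrier (P m')" for x y r
    using homs_hom[OF k[of m']] that unfolding Suc by (auto simp: module_hom_def)
   \<comment> \<open>The cochain -\<phi> k has coboundary \<phi>: in f g - 1 = d k + k d the cocycle
     \<phi> kills the part d k.\<close>
   have \<psi>: "(\<lambda>y\<in>carrier (P m'). scl n (- ?a \<phi> (k m' y))) \<in> ?G m'"
   proof (rule scalar_gr_hom[OF gP])
    show "- ?a \<phi> (k m' (x \<oplus>\<^bsub>P m'\<^esub> y)) = - ?a \<phi> (k m' x) + - ?a \<phi> (k m' y)" if "x \<in> carrier (P m')" "y \<in> carrier (P m')" for x y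
     using that by (simp add: kh shift_hom(3)[OF gh[OF \<phi>(1)]] kcm)
    show "- ?a \<phi> (k m' (r \<odot>\<^bsub>P m'\<^esub> x)) = aug r * - ?a \<phi> (k m' x)" if "r \<in> carrier H" "x \<in> carrier (P m')" for r x
     using that by (simp add: kh shift_hom(4)[OF gh[OF \<phi>(1)]] kcm)
    show "- ?a \<phi> (k m' x) = 0" if "x \<in> mpart (P m') i" "i \<noteq> l" for x i
     using shift_hom(5)[OF gh[OF \<phi>(1)] _ that(2), of "k m' x"] homs_mpart[OF k[of m'], of x i] that(1) unfolding Suc by simp
   qed
   have "\<phi> = (\<lambda>x\<in>carrier (P m). scl n (- ?a \<phi> (k m' (d m' x))))"
   proof (rule ext[OF \<phi>(1)])
    fix x assume x: "x \<in> carrier (P m)"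
    have x': "x \<in> carrier (P (Suc m'))" using x unfolding Suc .
    have "?a \<phi> x = - ?a \<phi> (d m (k m x) \<oplus>\<^bsub>P m\<^esub> k m' (d m' x))" using gfsplit[OF \<phi> x] kS[OF x'] unfolding Suc by simp
    also have "... = - ?a \<phi> (k m' (d m' x))"
     using shift_hom(3)[OF gh[OF \<phi>(1)] dc[OF kc[OF x]] kcm[OF dc[OF x']]] Zd[OF \<phi>(1) kc[OF x]] by simp
    finally show "?a \<phi> x = - ?a \<phi> (k m' (d m' x))" .
   qed
   also have "... = (\<lambda>x\<in>carrier (P m). (\<lambda>y\<in>carrier (P m'). scl n (- ?a \<phi> (k m' y))) (d m' x))"
    using dc[of _ m'] unfolding Suc by (intro restrict_ext) simp
   finally show "\<phi> \<in> (\<lambda>\<psi>. \<lambda>x\<in>carrier (P m). \<psi> (d m' x)) ` ?G m'" using \<psi> by blast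
  qed
  finally show ?thesis by simp
 qed
 have Ta: "T (\<phi> \<oplus>\<^bsub>?V\<^esub> \<psi>) k = T \<phi> k + T \<psi> k" if "\<phi> \<in> carrier ?V" "\<psi> \<in> carrier ?V" "k < b" for \<phi> \<psi> k
 proof -
  have "\<phi> \<in> Zc" "\<psi> \<in> Zc" using that by simp_all
  from Zadd[OF this] show ?thesis unfolding T_def using fc[OF uc[OF that(3)]] by simp
 qed
 have Ts: "T (c \<odot>\<^bsub>?V\<^esub> \<phi>) k = c * T \<phi> k" if "\<phi> \<in> carrier ?V" "k < b" for c \<phi> k
 proof -
  have "\<phi> \<in> Zc" using that by simp
  from Zsm[OF this] show ?thesis unfolding T_def using fc[OF uc[OF that(2)]] by simp
 qed
 have surj: "\<exists>\<phi>\<in>carrier ?V. \<forall>k<b. T \<phi> k = c k" for c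
 proof -
  \<comment> \<open>A linear form in the degree-l coordinates of \<open>g m x\<close>. It is a
    cocycle as g d = dF g lies in the augmentation submodule, and along f it takes the prescribed
    values since g f is the identity modulo that submodule.\<close>
  let ?\<alpha> = "\<lambda>x. \<Sum>k<b. c k * aug (g m x (l, k))"
  have Fc: "y p \<in> carrier H" if "y \<in> carrier (F m)" for y p using that by (simp add: F_carrier)
  have gh': "g m (x \<oplus>\<^bsub>P m\<^esub> y) = g m x \<oplus>\<^bsub>F m\<^esub> g m y" "r \<in> carrier H ==> g m (r \<odot>\<^bsub>P m\<^esub> x) = r \<odot>\<^bsub>F m\<^esub> g m x"
   if "x \<in> carrier (P m)" "y \<in> carrier (P m)" for x y r
   using homs_hom[OF g[of m]] that by (auto simp: module_hom_def)
  have "(\<lambda>x\<in>carrier (P m). scl n (?\<alpha> x)) \<in> Zc"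
  proof (rule sc)
   show "?\<alpha> (x \<oplus>\<^bsub>P m\<^esub> y) = ?\<alpha> x + ?\<alpha> y" if "x \<in> carrier (P m)" "y \<in> carrier (P m)" for x y
    using that by (simp add: gh' F_simps augmentation_add Fc gc distrib_left sum.distrib)
   show "?\<alpha> (r \<odot>\<^bsub>P m\<^esub> x) = aug r * ?\<alpha> x" if "r \<in> carrier H" "x \<in> carrier (P m)" for r x
    using that by (simp add: gh' F_simps augmentation_mult Fc gc sum_distrib_left ac_simps)
   show "?\<alpha> x = 0" if x: "x \<in> mpart (P m) i" "i \<noteq> l" for x i
   proof -
    have "g m x \<in> mpart (free_gmodule H (bt m)) i" using homs_mpart[OF g x(1)] by (simp add: F_def)
    then have "aug (g m x (l, k)) = 0" for k using x(2) by (intro homogeneous_augmentation) auto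
    then show ?thesis by simp
   qed
   show "?\<alpha> (d m x) = 0" if x: "x \<in> carrier (P (Suc m))" for x
   proof -
    have "g m (d m x) \<in> Fge n (bt m) 1" using dF_augmentation[OF gc[OF x]] dg[OF x] by simp
    then have "aug (g m (d m x) p) = 0" for p using Hge_1[OF Fc[OF gc[OF dc[OF x]]]] by (simp add: Fge_def)
    then show ?thesis by simp
   qed
  qed
  moreover have "T (\<lambda>x\<in>carrier (P m). scl n (?\<alpha> x)) k = c k" if kb: "k < b" for k
  proof -
   have "aug (g m (f m (?u k)) p) = aug (?u k p)" for p
    using Fge_diff_augmentation[of "g m (f m (?u k))" n "bt m" "?u k" p] gc[OF fc[OF uc[OF kb]]] uc[OF kb] gf[OF uc[OF kb]]
    by (simp add: F_def)
   then have "T (\<lambda>x\<in>carrier (P m). scl n (?\<alpha> x)) k = (\<Sum>k'<b. c k' * aug (?u k (l, k')))"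
    unfolding T_def using fc[OF uc[OF kb]] by simp
   also have "... = (\<Sum>k'<b. if k' = k then c k' else 0)"
    by (intro sum.cong) (auto simp: unit_vec_def augmentation_one augmentation_zero)
   finally show ?thesis using kb by simp
  qed
  ultimately show ?thesis by (intro bexI[of _ "\<lambda>x\<in>carrier (P m). scl n (?\<alpha> x)"]) auto
 qed
 have E: "Ext_space (scl n) H P d ?Cl m = quotient_module ?V (coboundaries (scl n) H P d ?Cl m)"
  by (simp add: Ext_space_def Zc_def)
 note q = quotient_dim[OF Vmod Ta Ts W surj]
 show "vectorspace complex_field (Ext_space (scl n) H P d ?Cl m)" unfolding E by (rule q(1))
 show "vectorspace.fin_dim complex_field (Ext_space (scl n) H P d ?Cl m)" unfolding E by (rule q(2))
 show "vectorspace.dim complex_field (Ext_space (scl n) H P d ?Cl m) = bt m l" unfolding E b_def[symmetric] by (rule q(3))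
qed

section \<open>The Euler characteristic\<close>

text \<open>U_k has homological degree 2 and weight n + 1 - k \<ge> 2. Hence a fixed internal degree
  meets only finitely many homological degrees.\<close>

lemma Ix_degree_le: "x \<in> Ix m ==> m \<le> wd x"
proof -
 assume "x \<in> Ix m"
 then have m: "m = card (fst x) + 2 * (\<Sum>k\<in>{1..N}. snd x k)" by (auto simp: Ix_def idx_def)
 have "2 * (\<Sum>k\<in>{1..N}. snd x k) = (\<Sum>k\<in>{1..N}. 2 * snd x k)" by (rule sum_distrib_left)
 also have "... \<le> (\<Sum>k\<in>{1..N}. (n + 1 - k) * snd x k)" by (intro sum_mono mult_right_mono) auto
 finally show ?thesis unfolding m wd_def by simp
qed

lemma bt_nonzero: "bt m l \<noteq> 0 \<longleftrightarrow> (\<exists>x\<in>Ix m. 2 * int (wd x) = l)"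
 using finite_Ix[of m] by (auto simp: bt_def card_eq_0_iff)

lemma bt_negative: "l < 0 ==> bt m l = 0" using bt_nonzero[of m l] by auto

lemma finite_bt_degrees: "finite {m. bt m l \<noteq> 0}"
proof (rule finite_subset)
 show "{m. bt m l \<noteq> 0} \<subseteq> {..nat l}"
 proof
  fix m assume "m \<in> {m. bt m l \<noteq> 0}"
  then obtain x where x: "x \<in> Ix m" "2 * int (wd x) = l" unfolding bt_nonzero by blast
  then show "m \<in> {..nat l}" using Ix_degree_le[OF x(1)] by auto
 qed
qed simp

text \<open>The generators are now counted by internal degree and weighted by the sign of the
  homological degree. The factor 1 - q^2 is cancelled n times from the quantum integers, once
  against the missing j = 1.\<close>

lemma euler_bt: "euler_series bt = 1 / qfact fps_X n"
proof -
 let ?\<gamma> = "\<lambda>k. 2 * (n + 1 - k)"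
 let ?X = "fib 2 ?\<gamma> N N"
 define dg :: "nat set \<times> (nat => nat) => nat" where "dg x = card (fst x) + 2 * (\<Sum>k\<in>{1..N}. snd x k)" for x
 have g1: "1 \<le> ?\<gamma> k" if "k \<in> {1..N}" for k using that by auto
 have fin: "finite (?X l)" for l by (rule finite_fib) (use n_pos in auto)
 have eq: "{x \<in> ?X l. dg x = m} = {x \<in> Ix m. 2 * int (wd x) = int l}" for m l
 proof (rule Collect_cong)
  fix x :: "nat set \<times> (nat => nat)"
  obtain I u where x: "x = (I, u)" by (cases x)
  define S1 where "S1 = (\<Sum>k\<in>{1..N}. (n + 1 - k) * u k)"
  define S2 where "S2 = (\<Sum>k\<in>{1..N}. u k)"
  have S1: "(\<Sum>k\<in>{1..N}. 2 * (n + 1 - k) * u k) = 2 * S1" by (simp add: S1_def sum_distrib_left mult.assoc)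
  show "x \<in> ?X l \<and> dg x = m \<longleftrightarrow> x \<in> Ix m \<and> 2 * int (wd x) = int l"
   unfolding x Ix_def idx_def fib_def dg_def wd_def mem_Collect_eq prod.case fst_conv snd_conv S1
    S1_def[symmetric] S2_def[symmetric] by auto
 qed
 have nz: "dg ` ?X l = {m. bt m (int l) \<noteq> 0}" for l
 proof -
  have "m \<in> dg ` ?X l \<longleftrightarrow> (\<exists>x\<in>Ix m. 2 * int (wd x) = int l)" for m
  proof -
   have "m \<in> dg ` ?X l \<longleftrightarrow> (\<exists>x. x \<in> {x \<in> ?X l. dg x = m})" by auto
   then show ?thesis unfolding eq by auto
  qed
  note im = this
  show ?thesis by (rule Set.set_eqI) (simp only: mem_Collect_eq bt_nonzero im)
 qed
 have coeff: "(\<Sum>m | bt m (int l) \<noteq> 0. (- 1) ^ m * of_nat (bt m (int l))) = (\<Sum>x\<in>?X l. wt (- 1 :: rat) (\<lambda>_. 1) N x)" for l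
 proof -
  \<comment> \<open>Divided powers have even homological degree, so the sign depends on the exterior
    part alone.\<close>
  have "(\<Sum>x\<in>?X l. wt (- 1 :: rat) (\<lambda>_. 1) N x) = (\<Sum>x\<in>?X l. (- 1) ^ dg x)"
   by (intro sum.cong refl) (simp add: wt_def dg_def power_add power_mult)
  also have "... = (\<Sum>m\<in>dg ` ?X l. \<Sum>x\<in>{x \<in> ?X l. dg x = m}. (- 1) ^ dg x)" by (rule sum.image_gen[OF fin])
  also have "... = (\<Sum>m | bt m (int l) \<noteq> 0. (- 1) ^ m * of_nat (bt m (int l)))" unfolding nz
  proof (intro sum.cong refl)
   fix m
   have "(\<Sum>x\<in>{x \<in> ?X l. dg x = m}. (- 1 :: rat) ^ dg x) = (\<Sum>x\<in>{x \<in> ?X l. dg x = m}. (- 1) ^ m)"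
    by (intro sum.cong) auto
   then show "(\<Sum>x\<in>{x \<in> ?X l. dg x = m}. (- 1 :: rat) ^ dg x) = (- 1) ^ m * of_nat (bt m (int l))"
    unfolding eq by (simp add: bt_def)
  qed
  finally show ?thesis by simp
 qed
 let ?E = "euler_series bt"
 have "?E = gen_series 2 ?\<gamma> (- 1) (\<lambda>_. 1) N N" unfolding euler_series_def gen_series_def coeff ..
 then have "?E * (\<Prod>k\<in>{1..N}. 1 - fps_X ^ ?\<gamma> k) = (1 - fps_X ^ 2) ^ N"
  using gen_series_eq[of N ?\<gamma> 2 "- 1 :: rat" "\<lambda>_. 1" N, OF g1] by simp
 also have "(\<Prod>k\<in>{1..N}. 1 - fps_X ^ ?\<gamma> k) = (\<Prod>j=2..n. 1 - fps_X ^ (2 * j) :: rat fps)"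
  by (rule prod_reindex_down[of "\<lambda>j. 1 - fps_X ^ (2 * j) :: rat fps"])
 finally have E: "?E * (\<Prod>j=2..n. 1 - fps_X ^ (2 * j)) = (1 - fps_X ^ 2) ^ N" .
 let ?y = "1 - fps_X ^ 2 :: rat fps"
 \<comment> \<open>The finite geometric sum: multiplication by 1 - q^2 turns a quantum integer into
   1 - q^(2k).\<close>
 have geo: "?y * qint fps_X k = 1 - fps_X ^ (2 * k)" for k
 proof (induction k)
  case (Suc k)
  have "?y * qint fps_X (Suc k) = ?y * qint fps_X k + ?y * fps_X ^ (2 * k)" by (simp add: qint_def distrib_left)
  also have "... = 1 - fps_X ^ 2 * fps_X ^ (2 * k)" unfolding Suc by (simp add: left_diff_distrib)
  finally show ?case by (simp add: power_add[symmetric])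
 qed (simp add: qint_def)
 have "(\<Prod>k=1..n. ?y * qint fps_X k) = ?y ^ n * qfact fps_X n" by (simp add: prod.distrib qfact_def)
 then have "?y ^ n * qfact fps_X n = (\<Prod>k=1..n. 1 - fps_X ^ (2 * k))" by (simp add: geo)
 also have "... = ?y * (\<Prod>k=2..n. 1 - fps_X ^ (2 * k))"
  using n_pos by (subst prod.atLeast_Suc_atMost) (auto simp: numeral_2_eq_2)
 finally have "?y * (?y ^ N * qfact fps_X n) = ?y * (\<Prod>k=2..n. 1 - fps_X ^ (2 * k))"
  using n_pos by (metis (no_types) Suc_diff_1 mult.assoc power_Suc less_eq_Suc_le One_nat_def)
 moreover have y0: "?y \<noteq> 0"
 proof
  assume "?y = 0"
  from arg_cong[OF this, of "\<lambda>p. fps_nth p 0"] show False by (simp add: power2_eq_square)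
 qed
 ultimately have q: "?y ^ N * qfact fps_X n = (\<Prod>k=2..n. 1 - fps_X ^ (2 * k))" using mult_left_cancel[OF y0] by blast
 have "?y ^ N * (?E * qfact fps_X n) = ?E * (?y ^ N * qfact fps_X n)" by (simp only: ac_simps)
 also have "... = ?y ^ N * 1" unfolding q using E by simp
 finally have "?y ^ N * (?E * qfact fps_X n) = ?y ^ N * 1" .
 then have EQ: "?E * qfact fps_X n = 1" using y0 by (metis mult_left_cancel power_not_zero)
 then have "qfact fps_X n \<noteq> (0 :: rat fps)" by auto
 then show ?thesis unfolding EQ[symmetric] by (rule nonzero_mult_div_cancel_right[symmetric])
qed

end

section \<open>The class of the coinvariant algebra\<close>

lemma artin_keys: "kys r \<subseteq> artin n n ==> r \<in> pn n" by (auto simp: artin_def polys_def)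

lemma artin_rep: "p \<in> pn n ==> \<exists>r. kys r \<subseteq> artin n n \<and> cl n r = cl n p"
 using artin_exists[of n n p] unfolding cl_eq_iff coinv_ideal_eq
 by (metis idl_uminus minus_diff_eq order_refl)

lemma artin_rep_unique:
 assumes "kys r \<subseteq> artin n n" "kys r' \<subseteq> artin n n" "cl n r = cl n r'"
 shows "r = r'"
proof -
 have "kys (r - r') \<subseteq> artin n n" using assms(1,2) keys_diff[of r r'] by blast
 moreover have "r - r' \<in> idl {1..n} (frel n) n" using assms(3) unfolding cl_eq_iff coinv_ideal_eq .
 ultimately have "r - r' = 0" by (rule artin_unique[OF order_refl])
 then show ?thesis by simp
qed

lemma artin_rep_homog:
 assumes p: "p \<in> pn n" "homog s p"
 shows "\<exists>r. kys r \<subseteq> {b \<in> artin n n. mdeg b = s} \<and> cl n r = cl n p"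
proof -
 obtain r where r: "kys r \<subseteq> artin n n" "cl n r = cl n p" using artin_rep[OF p(1)] by blast
 have "cl n (gcomp s r) = cl n (gcomp s p)" by (rule cl_gcomp[OF artin_keys[OF r(1)] p(1) r(2)])
 then have "cl n (gcomp s r) = cl n p" using gcomp_homog[OF p(2)] by simp
 then show ?thesis using r(1) by (intro exI[of _ "gcomp s r"]) (auto simp: keys_gcomp)
qed

lemma artin_rep_rpart:
 assumes "x \<in> rpart (CA n) i"
 shows "\<exists>r. kys r \<subseteq> {b \<in> artin n n. 2 * int (mdeg b) = i} \<and> cl n r = x"
proof -
 obtain p where p: "p \<in> pn n" "\<forall>m\<in>kys p. 2 * int (mdeg m) = i" "x = cl n p"
  using assms by (auto simp: H_rpart poly_part_eq)
 show ?thesis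
 proof (cases "p = 0")
  case True
  then show ?thesis using p by (intro exI[of _ 0]) simp
 next
  case False
  then obtain m where "m \<in> kys p" by (metis all_not_in_conv keys_eq_empty)
  then have i: "i = 2 * int (mdeg m)" using p(2) by simp
  then have "homog (mdeg m) p" using p(2) by (auto simp: homog_def)
  from artin_rep_homog[OF p(1) this] show ?thesis using i p(3) by auto
 qed
qed

lemma polys_keys: "p \<in> pn n \<longleftrightarrow> kys p \<subseteq> {m. kys m \<subseteq> {1..n}}" by (auto simp: polys_def)

text \<open>Multiplying a basis monomial by \<open>q\<close> multiplies it by the constant term of \<open>q\<close>, up to basis
 monomials of larger degree.\<close>

lemma artin_mult:
 assumes a: "a \<in> artin n n" and q: "q \<in> pn n"
 shows "\<exists>r. kys r \<subseteq> {b \<in> artin n n. mdeg a < mdeg b} \<and> cl n (q * sgl a c) = cl n (sgl a (lkp q 0 * c) + r)"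
 using q[unfolded polys_keys]
proof (induction q rule: keys_induct)
 case zero
 then show ?case by (intro exI[of _ 0]) simp
next
 case (single m c')
 show ?case
 proof (cases "m = 0")
  case True
  then show ?thesis by (intro exI[of _ 0]) (simp add: mult_single)
 next
  case False
  have pn: "sgl (m + a) (c' * c) \<in> pn n"
   using single a by (auto simp: polys_def keys_add_nat artin_def split: if_splits)
  have "homog (mdeg m + mdeg a) (sgl (m + a) (c' * c))" by (auto simp: homog_def mdeg_add split: if_splits)
  from artin_rep_homog[OF pn this] obtain r where "kys r \<subseteq> {b \<in> artin n n. mdeg b = mdeg m + mdeg a}"
   "cl n r = cl n (sgl (m + a) (c' * c))" by blast
  note r = this
  have "0 < mdeg m" using False by (metis mdeg_eq_0_iff neq0_conv)
  then have "kys r \<subseteq> {b \<in> artin n n. mdeg a < mdeg b}" using r(1) by fastforce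
  then show ?thesis using False r(2) by (intro exI[of _ r]) (simp add: mult_single lookup_single when_def)
 qed
next
 case (add p q)
 obtain r where r: "kys r \<subseteq> {b \<in> artin n n. mdeg a < mdeg b}" "cl n (p * sgl a c) = cl n (sgl a (lkp p 0 * c) + r)" using add(1) by blast
 obtain s where s: "kys s \<subseteq> {b \<in> artin n n. mdeg a < mdeg b}" "cl n (q * sgl a c) = cl n (sgl a (lkp q 0 * c) + s)" using add(2) by blast
 have "cl n ((p + q) * sgl a c) = cl n (sgl a (lkp (p + q) 0 * c) + (r + s))"
 proof -
  have "p * sgl a c - (sgl a (lkp p 0 * c) + r) \<in> coinv_ideal n" "q * sgl a c - (sgl a (lkp q 0 * c) + s) \<in> coinv_ideal n"
   using r(2) s(2) by (simp_all add: cl_eq_iff)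
  then have "(p * sgl a c - (sgl a (lkp p 0 * c) + r)) + (q * sgl a c - (sgl a (lkp q 0 * c) + s)) \<in> coinv_ideal n"
   by (rule ideal_of_add[OF ideal_of_coinv])
  moreover have "(p * sgl a c - (sgl a (lkp p 0 * c) + r)) + (q * sgl a c - (sgl a (lkp q 0 * c) + s))
    = (p + q) * sgl a c - (sgl a (lkp (p + q) 0 * c) + (r + s))"
   by (simp add: algebra_simps lookup_add single_add)
  ultimately show ?thesis by (simp add: cl_eq_iff)
 qed
 moreover have "kys (r + s) \<subseteq> {b \<in> artin n n. mdeg a < mdeg b}" using r(1) s(1) keys_add[of r s] by blast
 ultimately show ?case by blast
qed

definition Lsp :: "nat => (nat \<Rightarrow>\<^sub>0 nat) set => cpoly set set" where
 "Lsp n W = cl n ` {r. kys r \<subseteq> W}"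

text \<open>Sets of basis monomials closed under passage to larger degree. By
  \<open>artin_mult\<close> their spans are ideals; they are the steps of the filtration.\<close>

definition upset :: "nat => (nat \<Rightarrow>\<^sub>0 nat) set => bool" where
 "upset n W \<longleftrightarrow> W \<subseteq> artin n n \<and> (\<forall>a\<in>W. \<forall>b\<in>artin n n. mdeg a < mdeg b --> b \<in> W)"

lemma Lsp_add:
 assumes W: "W \<subseteq> artin n n" and "x \<in> Lsp n W" "y \<in> Lsp n W"
 shows "x \<oplus>\<^bsub>CA n\<^esub> y \<in> Lsp n W"
proof -
 obtain r s where rs: "kys r \<subseteq> W" "x = cl n r" "kys s \<subseteq> W" "y = cl n s" using assms(2,3) by (auto simp: Lsp_def)
 have "r \<in> pn n" "s \<in> pn n" using artin_keys subset_trans[OF rs(1) W] subset_trans[OF rs(3) W] by blast+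
 then have "x \<oplus>\<^bsub>CA n\<^esub> y = cl n (r + s)" by (simp add: rs H_add)
 moreover have "kys (r + s) \<subseteq> W" using rs keys_add[of r s] by blast
 ultimately show ?thesis by (auto simp: Lsp_def)
qed

text \<open>Products create only monomials of larger degree, so on a coefficient in the least degree
  the algebra acts through its augmentation.\<close>

lemma Lsp_mult_coeff:
 assumes W: "upset n W" and q: "q \<in> pn n" and r: "kys r \<subseteq> W" and a: "!!b. b \<in> W ==> mdeg a \<le> mdeg b"
 shows "\<exists>r'. kys r' \<subseteq> W \<and> cl n (q * r) = cl n r' \<and> lkp r' a = lkp q 0 * lkp r a"
 using r
proof (induction r rule: keys_induct)
 case zero
 then show ?case by (intro exI[of _ 0]) simp
next
 case (single b c)
 then have b: "b \<in> artin n n" using W by (auto simp: upset_def)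
 obtain s where s: "kys s \<subseteq> {d \<in> artin n n. mdeg b < mdeg d}" "cl n (q * sgl b c) = cl n (sgl b (lkp q 0 * c) + s)"
  using artin_mult[OF b q] by blast
 have "kys s \<subseteq> W" using s(1) W single unfolding upset_def by blast
 then have "kys (sgl b (lkp q 0 * c) + s) \<subseteq> W"
  using single keys_add[of "sgl b (lkp q 0 * c)" s] by (auto split: if_splits)
 moreover have "a \<notin> kys s" using s(1) a[OF single] by auto
 then have "lkp (sgl b (lkp q 0 * c) + s) a = lkp q 0 * lkp (sgl b c) a"
  by (simp add: lookup_add lookup_single when_def in_keys_iff)
 ultimately show ?case using s(2) by blast
next
 case (add p r)
 obtain p' where p': "kys p' \<subseteq> W" "cl n (q * p) = cl n p'" "lkp p' a = lkp q 0 * lkp p a" using add(1) by blast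
 obtain r' where r': "kys r' \<subseteq> W" "cl n (q * r) = cl n r'" "lkp r' a = lkp q 0 * lkp r a" using add(2) by blast
 have "(q * p - p') + (q * r - r') \<in> coinv_ideal n"
  using p'(2) r'(2) unfolding cl_eq_iff by (rule ideal_of_add[OF ideal_of_coinv])
 moreover have "(q * p - p') + (q * r - r') = q * (p + r) - (p' + r')" by (simp add: algebra_simps)
 ultimately have "cl n (q * (p + r)) = cl n (p' + r')" by (simp add: cl_eq_iff)
 moreover have "kys (p' + r') \<subseteq> W" using p'(1) r'(1) keys_add[of p' r'] by blast
 ultimately show ?case using p'(3) r'(3) by (intro exI[of _ "p' + r'"]) (simp add: lookup_add distrib_left)
qed

lemma Lsp_submodule:
 assumes W: "upset n W"
 shows "submod (CA n) (Lsp n W) (rmod n)"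
proof -
 have WB: "W \<subseteq> artin n n" using W by (simp add: upset_def)
 have "Lsp n W \<subseteq> carrier (CA n)" using WB artin_keys by (fastforce simp: Lsp_def H_carrier)
 moreover have "\<zero>\<^bsub>CA n\<^esub> \<in> Lsp n W" by (auto simp: Lsp_def H_zero intro!: image_eqI[of _ _ 0])
 moreover have "h \<otimes>\<^bsub>CA n\<^esub> x \<in> Lsp n W" if h: "h \<in> carrier (CA n)" and x: "x \<in> Lsp n W" for h x
 proof -
  obtain q where q: "q \<in> pn n" "h = cl n q" using h by (auto simp: H_carrier)
  obtain r where r: "kys r \<subseteq> W" "x = cl n r" using x by (auto simp: Lsp_def)
  have "r \<in> pn n" by (rule artin_keys[OF subset_trans[OF r(1) WB]])
  then have "h \<otimes>\<^bsub>CA n\<^esub> x = cl n (q * r)" unfolding q(2) r(2) by (rule H_mult[OF q(1)])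
  moreover obtain r' where "kys r' \<subseteq> W" "cl n (q * r) = cl n r'" using Lsp_mult_coeff[OF W q(1) r(1), of 0] by auto
  ultimately show ?thesis by (auto simp: Lsp_def)
 qed
 ultimately show ?thesis using Lsp_add[OF WB] by (simp add: submod_def rmod_simps regular_module[OF H_cring])
qed

lemma Lsp_graded:
 assumes W: "upset n W"
 shows "graded_module (CA n) (gsub (rmod n) (Lsp n W))"
proof (rule graded_gsub[OF H_gring_ok _ Lsp_submodule[OF W]])
 let ?M = "rmod n"
 show gM: "graded_module (CA n) ?M" using H_gring_ok[of n] by (simp add: gring_ok_def)
 have WB: "W \<subseteq> artin n n" using W by (simp add: upset_def)
 fix x i assume "x \<in> Lsp n W"
 then obtain r where r: "kys r \<subseteq> W" "x = cl n r" by (auto simp: Lsp_def)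
 have z: "\<zero>\<^bsub>?M\<^esub> \<in> Lsp n W" by (auto simp: Lsp_def H_zero rmod_simps intro!: image_eqI[of _ _ 0])
 have "kys r \<subseteq> artin n n \<and> gdec ?M (cl n r) i \<in> Lsp n W" using r(1)
 proof (induction r rule: keys_induct)
  case zero
  have "cl n 0 \<in> mpart ?M i" using graded_moduleD(3)[OF gM, of i] by (simp add: rmod_simps H_zero)
  then show ?case using gdec_homog[OF gM, of "cl n 0" i i] z by (simp add: rmod_simps H_zero)
 next
  case (single b c)
  have b: "b \<in> artin n n" using single WB by blast
  have "sgl b c \<in> pn n" using b by (auto simp: polys_def artin_def split: if_splits)
  then have "cl n (sgl b c) \<in> mpart ?M (2 * int (mdeg b))"
   by (auto simp: rmod_simps H_rpart poly_part_eq intro!: imageI split: if_splits)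
  from gdec_homog[OF gM this, of i] have "gdec ?M (cl n (sgl b c)) i \<in> {cl n (sgl b c), \<zero>\<^bsub>?M\<^esub>}" by auto
  moreover have "cl n (sgl b c) \<in> Lsp n W" unfolding Lsp_def using single by (intro imageI) (auto split: if_splits)
  ultimately show ?case using z b by (auto split: if_splits)
 next
  case (add p q)
  have pq: "p \<in> pn n" "q \<in> pn n" using artin_keys add by blast+
  have "gdec ?M (cl n p \<oplus>\<^bsub>?M\<^esub> cl n q) i = gdec ?M (cl n p) i \<oplus>\<^bsub>?M\<^esub> gdec ?M (cl n q) i"
   using pq by (intro gdec_add[OF gM]) (auto simp: rmod_simps H_carrier)
  moreover have "cl n p \<oplus>\<^bsub>?M\<^esub> cl n q = cl n (p + q)" using pq by (simp add: rmod_simps H_add)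
  ultimately have "gdec ?M (cl n (p + q)) i \<in> Lsp n W" using Lsp_add[OF WB] add by (simp add: rmod_simps)
  then show ?case using add keys_add[of p q] by blast
 qed
 then show "gdec ?M x i \<in> Lsp n W" using r(2) by simp
qed

section \<open>Finite generation and relations in the Grothendieck group\<close>

text \<open>The span is the least submodule containing \<open>S\<close>; the lemma replaces it by
  this property, which transfers easily to shifts and spans.\<close>

lemma fg_gmodulesI:
 assumes M: "graded_module R M" and S: "finite S" "S \<subseteq> carrier M"
  and gen: "!!L. submod R L M ==> S \<subseteq> L ==> carrier M \<subseteq> L"
 shows "M \<in> fg_gmodules R"
proof -
 interpret module R M by (rule graded_moduleD(1)[OF M])
 have "span S \<subseteq> carrier M" using span_is_submodule[OF S(2)] by (simp add: submod_def)
 moreover have "carrier M \<subseteq> span S" by (rule gen[OF span_is_submodule[OF S(2)] in_own_span[OF S(2)]])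
 ultimately show ?thesis using M S unfolding fg_gmodules_def by blast
qed

lemma fg_gmodulesD:
 assumes "M \<in> fg_gmodules R"
 shows "graded_module R M"
  and "\<exists>S. finite S \<and> S \<subseteq> carrier M \<and> (\<forall>L. submod R L M --> S \<subseteq> L --> carrier M \<subseteq> L)"
proof -
 show M: "graded_module R M" using assms by (simp add: fg_gmodules_def)
 interpret module R M by (rule graded_moduleD(1)[OF M])
 obtain S where S: "finite S" "S \<subseteq> carrier M" "span S = carrier M" using assms by (auto simp: fg_gmodules_def)
 have "carrier M \<subseteq> L" if "submod R L M" "S \<subseteq> L" for L using span_is_subset[OF that(2,1)] S(3) by simp
 then show "\<exists>S. finite S \<and> S \<subseteq> carrier M \<and> (\<forall>L. submod R L M --> S \<subseteq> L --> carrier M \<subseteq> L)" using S(1,2) by blast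
qed

lemma Lsp_fg:
 assumes W: "upset n W"
 shows "gsub (rmod n) (Lsp n W) \<in> fg_gmodules (CA n)"
proof (rule fg_gmodulesI[OF Lsp_graded[OF W]])
 let ?M = "rmod n"
 have WB: "W \<subseteq> artin n n" using W by (simp add: upset_def)
 let ?S = "(\<lambda>a. cl n (sgl a 1)) ` W"
 show "finite ?S" using finite_subset[OF WB finite_artin] by simp
 show "?S \<subseteq> carrier (gsub ?M (Lsp n W))" by (auto simp: gsub_simps Lsp_def)
 fix L assume L: "submod (CA n) L (gsub ?M (Lsp n W))" "?S \<subseteq> L"
 have La: "x \<oplus>\<^bsub>CA n\<^esub> y \<in> L" if "x \<in> L" "y \<in> L" for x y
  using L(1) that by (auto simp: submod_def gsub_simps rmod_simps)
 have Ls: "r \<otimes>\<^bsub>CA n\<^esub> y \<in> L" if "r \<in> carrier (CA n)" "y \<in> L" for r y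
  using L(1) that by (auto simp: submod_def gsub_simps rmod_simps)
 have L0: "cl n 0 \<in> L" using L(1) by (auto simp: submod_def gsub_simps rmod_simps H_zero)
 have "r \<in> pn n \<and> cl n r \<in> L" if "kys r \<subseteq> W" for r using that
 proof (induction r rule: keys_induct)
  case zero
  then show ?case using L0 by simp
 next
  case (single a c)
  have a: "sgl a d \<in> pn n" for d using single WB by (auto simp: polys_def artin_def split: if_splits)
  have "cl n (sgl 0 c) \<otimes>\<^bsub>CA n\<^esub> cl n (sgl a 1) \<in> L" using single L(2) by (intro Ls) (auto simp: H_carrier)
  then show ?case using a[of 1] a[of c] by (simp add: H_mult mult_single)
 next
  case (add p q)
  then show ?case using La[of "cl n p" "cl n q"] by (simp add: H_add)
 qed
 then show "carrier (gsub ?M (Lsp n W)) \<subseteq> L" by (auto simp: gsub_simps Lsp_def)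
qed

lemma gshift_submodule: "submod R L (gshift k M) \<longleftrightarrow> module R (gshift k M) \<and> (module R M --> submod R L M)"
 if "module R M"
 using that gshift_module[OF that] by (auto simp: submod_def gshift_simps)

lemma gshift_fg: "M \<in> fg_gmodules R ==> gshift k M \<in> fg_gmodules R"
proof -
 assume M: "M \<in> fg_gmodules R"
 have gM: "graded_module R M" by (rule fg_gmodulesD(1)[OF M])
 obtain S where S: "finite S" "S \<subseteq> carrier M"
  "!!L. submod R L M ==> S \<subseteq> L ==> carrier M \<subseteq> L" using fg_gmodulesD(2)[OF M] by blast
 show ?thesis
 proof (rule fg_gmodulesI[OF graded_gshift[OF gM] S(1)])
  show "S \<subseteq> carrier (gshift k M)" using S(2) by (simp add: gshift_simps)
  show "carrier (gshift k M) \<subseteq> L" if "submod R L (gshift k M)" "S \<subseteq> L" for L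
   using S(3)[OF _ that(2)] that(1) gshift_submodule[OF graded_moduleD(1)[OF gM]] graded_moduleD(1)[OF gM]
   by (auto simp: gshift_simps)
 qed
qed

lemma trivial_fg: "TM n \<in> fg_gmodules (CA n)"
proof (rule fg_gmodulesI[OF trivial_graded, of "{scl n 1}"])
 let ?C = "TM n"
 show "{scl n 1} \<subseteq> carrier ?C" by (auto simp: trivial_simps)
 fix L assume L: "submod (CA n) L ?C" "{scl n 1} \<subseteq> L"
 show "carrier ?C \<subseteq> L"
 proof
  fix x assume "x \<in> carrier ?C"
  then obtain c where c: "x = scl n c" by (auto simp: trivial_simps)
  have "scl n c \<in> carrier (CA n)" by (auto simp: coinv_scalar_cl H_carrier)
  then have "scl n c \<odot>\<^bsub>?C\<^esub> scl n 1 \<in> L" using L(2) by (intro LinearCombinations.submodule.smult_closed[OF L(1)]) simp_all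
  then show "x \<in> L" by (simp add: c trivial_simps)
 qed
qed simp

lemma K0_subgroup: "subgroup (K0_relations R) (free_Abelian_group (fg_gmodules R))" unfolding K0_relations_def
proof (rule group.generate_is_subgroup[OF group_free_Abelian_group], clarsimp)
 fix A B C x assume S: "A \<in> fg_gmodules R" "B \<in> fg_gmodules R" "C \<in> fg_gmodules R"
  and x: "x \<in> Poly_Mapping.keys (frag_of B - frag_of A - frag_of C)"
 have "Poly_Mapping.keys (frag_of B - frag_of A - frag_of C) \<subseteq> {A, B, C}"
  using keys_diff[of "frag_of B - frag_of A" "frag_of C"] keys_diff[of "frag_of B" "frag_of A"] by auto
 then show "x \<in> fg_gmodules R" using x S by blast
qed

lemma K0_zero: "0 \<in> K0_relations R"
 and K0_add: "x \<in> K0_relations R ==> y \<in> K0_relations R ==> x + y \<in> K0_relations R"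
 using subgroup.one_closed[OF K0_subgroup[of R]] subgroup.m_closed[OF K0_subgroup[of R], of x y] by simp_all

lemma K0_uminus: "x \<in> K0_relations R ==> - x \<in> K0_relations R"
proof -
 assume x: "x \<in> K0_relations R"
 have "x \<in> carrier (free_Abelian_group (fg_gmodules R))" using subgroup.mem_carrier[OF K0_subgroup x] .
 then show ?thesis using subgroup.m_inv_closed[OF K0_subgroup x] by simp
qed

lemma K0_minus: "x \<in> K0_relations R ==> y \<in> K0_relations R ==> x - y \<in> K0_relations R"
 using K0_add[OF _ K0_uminus, of x R y] by simp

lemma K0_exact:
 assumes "A \<in> fg_gmodules R" "B \<in> fg_gmodules R" "C \<in> fg_gmodules R" "short_exact R A B C"
 shows "frag_of B - frag_of A - frag_of C \<in> K0_relations R"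
 unfolding K0_relations_def using assms by (intro generate.incl) blast

lemma gr_hom_gshift: "f \<in> gr_hom R M N ==> f \<in> gr_hom R (gshift k M) (gshift k N)"
 by (auto simp: gr_hom_def module_hom_def gshift_simps)

lemma short_exact_gshift:
 assumes "short_exact R A B C"
 shows "short_exact R (gshift k A) (gshift k B) (gshift k C)"
proof -
 obtain f g where fg: "f \<in> gr_hom R A B" "g \<in> gr_hom R B C" "inj_on f (carrier A)"
  "f ` carrier A = mod_ker B C g" "g ` carrier B = carrier C" using assms unfolding short_exact_def by blast
 show ?thesis unfolding short_exact_def
  using fg(3-5) by (intro bexI[OF _ gr_hom_gshift[OF fg(1)]] bexI[OF _ gr_hom_gshift[OF fg(2)]]) (simp add: gshift_simps mod_ker_def)
qed

text \<open>A shift preserves short exactness and finite generation, so it maps generating relations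
  to generating relations.\<close>

lemma K0_shift:
 assumes "x \<in> K0_relations R"
 shows "frag_extend (\<lambda>M. frag_of (gshift k M)) x \<in> K0_relations R"
 using assms[unfolded K0_relations_def]
proof (induction rule: generate.induct)
 case one
 then show ?case by (simp add: K0_zero)
next
 case (incl h)
 then obtain A B C where h: "h = frag_of B - frag_of A - frag_of C" "A \<in> fg_gmodules R" "B \<in> fg_gmodules R" "C \<in> fg_gmodules R"
  "short_exact R A B C" by blast
 show ?case unfolding h(1) frag_extend_diff frag_extend_of by (intro K0_exact gshift_fg short_exact_gshift h)
next
 case (inv h)
 then obtain A B C where h: "h = frag_of B - frag_of A - frag_of C" "A \<in> fg_gmodules R" "B \<in> fg_gmodules R" "C \<in> fg_gmodules R"
  "short_exact R A B C" by blast
 have "h \<in> K0_relations R" unfolding h(1) by (intro K0_exact h)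
 then have "h \<in> carrier (free_Abelian_group (fg_gmodules R))" using subgroup.mem_carrier[OF K0_subgroup] by blast
 then have "inv\<^bsub>free_Abelian_group (fg_gmodules R)\<^esub> h = - h" by simp
 moreover have "frag_extend (\<lambda>M. frag_of (gshift k M)) h \<in> K0_relations R" unfolding h(1) frag_extend_diff frag_extend_of
  by (intro K0_exact gshift_fg short_exact_gshift h)
 ultimately show ?case by (simp add: frag_extend_minus K0_uminus)
next
 case (eng h1 h2)
 then show ?case by (simp add: frag_extend_add K0_add)
qed

lemma laurent_act_relations:
 assumes x: "x \<in> K0_relations R"
 shows "laurent_act p x \<in> K0_relations R"
 unfolding laurent_act_def
proof (induction p rule: frag_induction[OF subset_UNIV, case_names zero one diff])
 case (diff a b)
 then show ?case by (simp add: frag_extend_diff K0_minus)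
qed (simp_all add: K0_zero K0_shift[OF x] frag_extend_of)

lemma laurent_act_add: "laurent_act p (x + y) = laurent_act p x + laurent_act p y" unfolding laurent_act_def
proof (induction p rule: frag_induction[OF subset_UNIV, case_names zero one diff])
 case (diff a b)
 then show ?case by (simp add: frag_extend_diff)
qed (simp_all add: frag_extend_of frag_extend_add)

lemma K0_coset_eq:
 assumes "x - y \<in> K0_relations R"
 shows "K0_relations R #>\<^bsub>free_Abelian_group (fg_gmodules R)\<^esub> x = K0_relations R #>\<^bsub>free_Abelian_group (fg_gmodules R)\<^esub> y"
proof -
 have "h + x \<in> (\<lambda>h. h + y) ` K0_relations R" if "h \<in> K0_relations R" for h
  using K0_add[OF that assms] by (intro image_eqI[of _ _ "h + (x - y)"]) (simp_all add: algebra_simps)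
 moreover have "h + y \<in> (\<lambda>h. h + x) ` K0_relations R" if "h \<in> K0_relations R" for h
  using K0_minus[OF that assms] by (intro image_eqI[of _ _ "h - (x - y)"]) (simp_all add: algebra_simps)
 ultimately show ?thesis unfolding r_coset_def by auto
qed

text \<open>The action preserves the relations, so the union in the definition of \<open>K0\<close>
  consists of equal cosets.\<close>

lemma K0_smult_class:
 assumes "C \<in> fg_gmodules R"
 shows "p \<odot>\<^bsub>K0 R\<^esub> K0_class R C = K0_relations R #>\<^bsub>free_Abelian_group (fg_gmodules R)\<^esub> laurent_act p (frag_of C)"
proof -
 let ?F = "free_Abelian_group (fg_gmodules R)" and ?N = "K0_relations R"
 have "?N #>\<^bsub>?F\<^esub> laurent_act p x = ?N #>\<^bsub>?F\<^esub> laurent_act p (frag_of C)" if x: "x \<in> ?N #>\<^bsub>?F\<^esub> frag_of C" for x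
 proof -
  obtain y where y: "y \<in> ?N" "x = y + frag_of C" using x by (auto simp: r_coset_def)
  show ?thesis by (rule K0_coset_eq) (simp add: y laurent_act_add laurent_act_relations)
 qed
 moreover have "frag_of C \<in> ?N #>\<^bsub>?F\<^esub> frag_of C" using K0_zero[of R] by (auto simp: r_coset_def intro!: bexI[of _ 0])
 ultimately have "(\<Union>x\<in>?N #>\<^bsub>?F\<^esub> frag_of C. ?N #>\<^bsub>?F\<^esub> laurent_act p x) = ?N #>\<^bsub>?F\<^esub> laurent_act p (frag_of C)"
  by (intro SUP_eq_const) blast+
 then show ?thesis by (simp add: K0_def K0_class_def Let_def)
qed

text \<open>The quotient map takes the coefficient at \<open>a\<close> of the Artin normal form.
  Since \<open>a\<close> has least degree, this is linear over the algebra acting through its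
  augmentation, and its kernel is spanned by \<open>W\<close>.\<close>

lemma short_exact_artin:
 assumes W: "upset n W" and W': "upset n (insert a W)" and aW: "a \<notin> W" and min: "!!b. b \<in> W ==> mdeg a \<le> mdeg b"
 shows "short_exact (CA n) (gsub (rmod n) (Lsp n W))
  (gsub (rmod n) (Lsp n (insert a W))) (gshift (2 * int (mdeg a)) (TM n))"
proof -
 let ?H = "CA n" and ?C = "TM n"
 let ?A = "gsub (regular_gmodule ?H) (Lsp n W)" and ?B = "gsub (regular_gmodule ?H) (Lsp n (insert a W))"
 let ?S = "gshift (2 * int (mdeg a)) ?C"
 have WB: "insert a W \<subseteq> artin n n" using W' by (simp add: upset_def)
 have mon: "Lsp n W \<subseteq> Lsp n (insert a W)" by (auto simp: Lsp_def)
 \<comment> \<open>The Artin normal form, which is unique, so the choice agrees with every reduced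
   representative.\<close>
 define \<rho> where "\<rho> x = (SOME r. kys r \<subseteq> artin n n \<and> cl n r = x)" for x
 have \<rho>: "\<rho> (cl n r) = r" if r: "kys r \<subseteq> insert a W" for r
 proof -
  have rB: "kys r \<subseteq> artin n n" using r WB by blast
  then have "\<exists>s. kys s \<subseteq> artin n n \<and> cl n s = cl n r" by blast
  from someI_ex[OF this] have "kys (\<rho> (cl n r)) \<subseteq> artin n n \<and> cl n (\<rho> (cl n r)) = cl n r" unfolding \<rho>_def .
  then show ?thesis using artin_rep_unique rB by blast
 qed
 define \<pi> where "\<pi> x = scl n (lkp (\<rho> x) a)" for x
 have \<pi>: "\<pi> (cl n r) = scl n (lkp r a)" if "kys r \<subseteq> insert a W" for r using \<rho>[OF that] by (simp add: \<pi>_def)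
 have pn: "r \<in> pn n" if "kys r \<subseteq> insert a W" for r using artin_keys subset_trans[OF that WB] by blast
 have \<pi>h: "\<pi> \<in> gr_hom ?H ?B ?S" unfolding gr_hom_def module_hom_def
 proof (intro CollectI conjI Pi_I allI impI subsetI; (elim conjE)?)
  show "\<pi> x \<in> carrier ?S" for x by (simp add: \<pi>_def gshift_simps trivial_simps)
  show "\<pi> (x \<oplus>\<^bsub>?B\<^esub> y) = \<pi> x \<oplus>\<^bsub>?S\<^esub> \<pi> y" if xy: "x \<in> carrier ?B" "y \<in> carrier ?B" for x y
  proof -
   obtain r s where rs: "kys r \<subseteq> insert a W" "x = cl n r" "kys s \<subseteq> insert a W" "y = cl n s"
    using xy by (auto simp: gsub_simps Lsp_def)
   have "kys (r + s) \<subseteq> insert a W" using rs keys_add[of r s] by blast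
   then show ?thesis
    using rs pn[OF rs(1)] pn[OF rs(3)] by (simp add: gsub_simps rmod_simps gshift_simps trivial_simps H_add \<pi> lookup_add)
  qed
  show "\<pi> (h \<odot>\<^bsub>?B\<^esub> x) = h \<odot>\<^bsub>?S\<^esub> \<pi> x" if h: "h \<in> carrier ?H" and x: "x \<in> carrier ?B" for h x
  proof -
   obtain r where r: "kys r \<subseteq> insert a W" "x = cl n r" using x by (auto simp: gsub_simps Lsp_def)
   obtain q where q: "q \<in> pn n" "h = cl n q" using h by (auto simp: H_carrier)
   obtain r' where r': "kys r' \<subseteq> insert a W" "cl n (q * r) = cl n r'" "lkp r' a = lkp q 0 * lkp r a"
    using Lsp_mult_coeff[OF W' q(1) r(1), of a] min by auto
   show ?thesis using r' r q pn[OF r(1)]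
    by (simp add: gsub_simps rmod_simps gshift_simps trivial_simps H_mult \<pi> aug_cl)
  qed
  fix i y assume "y \<in> \<pi> ` mpart ?B i"
  then obtain x where x: "x \<in> rpart ?H i" "x \<in> Lsp n (insert a W)" "y = \<pi> x" by (auto simp: gsub_simps rmod_simps)
  obtain r where r: "kys r \<subseteq> insert a W" "x = cl n r" using x(2) by (auto simp: Lsp_def)
  obtain s where s: "kys s \<subseteq> {b \<in> artin n n. 2 * int (mdeg b) = i}" "cl n s = x" using artin_rep_rpart[OF x(1)] by blast
  have "s = r" using r s WB by (intro artin_rep_unique) auto
  then have "i \<noteq> 2 * int (mdeg a) ==> lkp r a = 0" using s(1) by (auto simp: in_keys_iff)
  then show "y \<in> mpart ?S i" unfolding x(3) r(2) \<pi>[OF r(1)] by (auto simp: gshift_simps trivial_simps)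
 qed
 have ker: "carrier ?A = mod_ker ?B ?S \<pi>"
 proof (intro equalityI subsetI)
  fix x assume "x \<in> carrier ?A"
  then obtain r where r: "kys r \<subseteq> W" "x = cl n r" by (auto simp: gsub_simps Lsp_def)
  then have "lkp r a = 0" using aW by (auto simp: in_keys_iff)
  then show "x \<in> mod_ker ?B ?S \<pi>" using r \<pi>[of r] by (auto simp: mod_ker_def gsub_simps Lsp_def gshift_simps trivial_simps)
 next
  fix x assume "x \<in> mod_ker ?B ?S \<pi>"
  then have x: "x \<in> Lsp n (insert a W)" "\<pi> x = scl n 0" by (auto simp: mod_ker_def gsub_simps gshift_simps trivial_simps)
  then obtain r where r: "kys r \<subseteq> insert a W" "x = cl n r" by (auto simp: Lsp_def)
  then have "lkp r a = 0" using x(2) \<pi>[OF r(1)] by (simp add: coinv_scalar_inj)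
  then have "kys r \<subseteq> W" using r(1) by (auto simp: in_keys_iff)
  then show "x \<in> carrier ?A" using r(2) by (auto simp: gsub_simps Lsp_def)
 qed
 have im: "\<pi> ` carrier ?B = carrier ?S"
 proof (intro equalityI subsetI)
  fix y assume "y \<in> carrier ?S"
  then obtain c where c: "y = scl n c" by (auto simp: gshift_simps trivial_simps)
  have k: "kys (sgl a c) \<subseteq> insert a W" by auto
  then have "y = \<pi> (cl n (sgl a c))" using \<pi>[OF k] c by simp
  moreover have "cl n (sgl a c) \<in> carrier ?B" using k by (auto simp: gsub_simps Lsp_def)
  ultimately show "y \<in> \<pi> ` carrier ?B" by blast
 qed (auto simp: \<pi>_def gshift_simps trivial_simps)
 have id: "(\<lambda>x. x) \<in> gr_hom ?H ?A ?B" using mon by (auto simp: gr_hom_def module_hom_def gsub_simps)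
 show ?thesis unfolding short_exact_def using ker im by (intro bexI[OF _ id] bexI[OF _ \<pi>h]) (simp add: inj_on_def)
qed

text \<open>For a zero module the sequence formed by three copies of it is exact, and its relation
  is the negative of the class.\<close>

lemma K0_zero_module:
 assumes M: "M \<in> fg_gmodules R" and z: "carrier M = {\<zero>\<^bsub>M\<^esub>}"
 shows "frag_of M \<in> K0_relations R"
proof -
 have id: "(\<lambda>x. x) \<in> gr_hom R M M" by (auto simp: gr_hom_def module_hom_def)
 have "short_exact R M M M" unfolding short_exact_def by (intro bexI[OF _ id]) (auto simp: mod_ker_def z)
 from K0_uminus[OF K0_exact[OF M M M this]] show ?thesis by simp
qed

text \<open>A monomial of least degree is removed; what remains is again closed upwards.\<close>

lemma K0_artin:
 "finite W ==> upset n W ==> frag_of (gsub (rmod n) (Lsp n W)) -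
  (\<Sum>a\<in>W. frag_of (gshift (2 * int (mdeg a)) (TM n))) \<in> K0_relations (CA n)"
proof (induction "card W" arbitrary: W)
 case 0
 then have W: "W = {}" by simp
 have "Lsp n {} = {cl n 0}" by (auto simp: Lsp_def)
 then have "carrier (gsub (rmod n) (Lsp n W)) = {\<zero>\<^bsub>gsub (rmod n) (Lsp n W)\<^esub>}"
  unfolding W by (simp add: gsub_simps rmod_simps H_zero)
 from K0_zero_module[OF Lsp_fg[OF 0(3)] this] show ?case unfolding W by simp
next
 case (Suc c)
 let ?H = "CA n"
 let ?G = "\<lambda>W. gsub (regular_gmodule ?H) (Lsp n W)"
 let ?S = "\<lambda>a. gshift (2 * int (mdeg a)) (TM n)"
 have "W \<noteq> {}" using Suc(2) by auto
 then obtain a where a: "a \<in> W" "!!b. b \<in> W ==> mdeg a \<le> mdeg b"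
  using ex_min_if_finite[of "mdeg ` W"] Suc(3) by (metis (no_types, lifting) finite_imageI image_iff image_is_empty not_le)
 define W' where "W' = W - {a}"
 have W: "W = insert a W'" "a \<notin> W'" "finite W'" using a(1) Suc(3) by (auto simp: W'_def)
 have "upset n W'" unfolding upset_def
 proof (intro conjI ballI impI)
  show "W' \<subseteq> artin n n" using Suc(4) by (auto simp: upset_def W'_def)
  fix b c assume b: "b \<in> W'" and c: "c \<in> artin n n" "mdeg b < mdeg c"
  then have "c \<in> W" using Suc(4) W(1) unfolding upset_def by blast
  moreover have "c \<noteq> a" using a(2)[of b] b c W(1) by auto
  ultimately show "c \<in> W'" by (simp add: W'_def)
 qed
 note up = this
 have "card W' = c" using Suc(2) W by simp
 then have IH: "frag_of (?G W') - (\<Sum>a\<in>W'. frag_of (?S a)) \<in> K0_relations ?H" using Suc(1)[OF _ W(3) up] by simp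
 have ex: "frag_of (?G W) - frag_of (?G W') - frag_of (?S a) \<in> K0_relations ?H" unfolding W(1)
  by (rule K0_exact[OF Lsp_fg[OF up] Lsp_fg gshift_fg[OF trivial_fg] short_exact_artin[OF up]])
   (use Suc(4) W a in auto)
 have eq: "(frag_of (?G W') - (\<Sum>a\<in>W'. frag_of (?S a))) + (frag_of (?G W) - frag_of (?G W') - frag_of (?S a))
   = frag_of (?G W) - (\<Sum>a\<in>W. frag_of (?S a))"
  using W(2,3) unfolding W(1) by simp
 show ?case using K0_add[OF IH ex] unfolding eq .
qed

section \<open>The generating function of the Artin monomials\<close>

lemma artin_Suc:
 assumes k: "Suc k \<le> n"
 shows "bij_betw (\<lambda>(a, e). a + sgl (Suc k) e) (artin n k \<times> {..<n + 1 - Suc k}) (artin n (Suc k))"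
proof (rule bij_betwI[where g = "\<lambda>m. (m - sgl (Suc k) (lkp m (Suc k)), lkp m (Suc k))"])
 have nk: "lkp a (Suc k) = 0" if "a \<in> artin n k" for a using that by (auto simp: artin_def in_keys_iff)
 show "(\<lambda>(a, e). a + sgl (Suc k) e) \<in> artin n k \<times> {..<n + 1 - Suc k} \<rightarrow> artin n (Suc k)"
 proof (rule Pi_I)
  fix x assume "x \<in> artin n k \<times> {..<n + 1 - Suc k}"
  then obtain a e where x: "x = (a, e)" and a: "a \<in> artin n k" and e: "e \<in> {..<n + 1 - Suc k}" by auto
  have "kys (a + sgl (Suc k) e) \<subseteq> {1..Suc k}" using a by (auto simp: artin_def keys_add_nat split: if_splits)
  moreover have "lkp (a + sgl (Suc k) e) i < n + 1 - i" if i: "i \<in> {1..Suc k}" for i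
  proof (cases "i = Suc k")
   case True
   then show ?thesis using e nk[OF a] by (simp add: lookup_add lookup_single)
  next
   case False
   then show ?thesis using a i by (auto simp: lookup_add lookup_single artin_def)
  qed
  ultimately show "(\<lambda>(a, e). a + sgl (Suc k) e) x \<in> artin n (Suc k)" by (simp add: x artin_def)
 qed
 show "(\<lambda>m. (m - sgl (Suc k) (lkp m (Suc k)), lkp m (Suc k))) \<in> artin n (Suc k) \<rightarrow> artin n k \<times> {..<n + 1 - Suc k}"
 proof (rule Pi_I)
  fix m assume m: "m \<in> artin n (Suc k)"
  have "kys (m - sgl (Suc k) (lkp m (Suc k))) \<subseteq> {1..k}"
  proof
   fix i assume "i \<in> kys (m - sgl (Suc k) (lkp m (Suc k)))"
   then have "i \<in> kys m" "i \<noteq> Suc k" by (auto simp: in_keys_iff lookup_minus lookup_single when_def split: if_splits)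
   then show "i \<in> {1..k}" using m by (auto simp: artin_def le_Suc_eq)
  qed
  moreover have "lkp (m - sgl (Suc k) (lkp m (Suc k))) i < n + 1 - i" if "i \<in> {1..k}" for i
   using m that by (auto simp: artin_def lookup_minus lookup_single when_def)
  moreover have "Suc k \<in> {1..Suc k}" by simp
  then have "lkp m (Suc k) < n + 1 - Suc k" using m unfolding artin_def by blast
  ultimately show "(m - sgl (Suc k) (lkp m (Suc k)), lkp m (Suc k)) \<in> artin n k \<times> {..<n + 1 - Suc k}"
   by (simp add: artin_def)
 qed
 fix x assume "x \<in> artin n k \<times> {..<n + 1 - Suc k}"
 then obtain a e where x: "x = (a, e)" "a \<in> artin n k" by auto
 have l: "lkp (a + sgl (Suc k) e) (Suc k) = e" using nk[OF x(2)] by (simp add: lookup_add)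
 show "(\<lambda>m. (m - sgl (Suc k) (lkp m (Suc k)), lkp m (Suc k))) ((\<lambda>(a, e). a + sgl (Suc k) e) x) = x"
  unfolding x(1) prod.case l by simp
next
 fix m assume "m \<in> artin n (Suc k)"
 show "(\<lambda>(a, e). a + sgl (Suc k) e) (m - sgl (Suc k) (lkp m (Suc k)), lkp m (Suc k)) = m"
  unfolding prod.case by (rule poly_mapping_eqI) (auto simp: lookup_add lookup_minus lookup_single when_def)
qed

lemma artin_generating_function:
 "k \<le> n ==> (\<Prod>i\<in>{1..k}. \<Sum>e<n + 1 - i. sgl (2 * int e) 1) = (\<Sum>a\<in>artin n k. sgl (2 * int (mdeg a)) (1 :: int))"
proof (induction k)
 case 0
 have "artin n 0 = {0}" by (auto simp: artin_def)
 then show ?case by simp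
next
 case (Suc k)
 have "(\<Prod>i\<in>{1..Suc k}. \<Sum>e<n + 1 - i. sgl (2 * int e) (1 :: int)) =
   (\<Sum>a\<in>artin n k. sgl (2 * int (mdeg a)) 1) * (\<Sum>e<n + 1 - Suc k. sgl (2 * int e) 1)"
  using Suc by simp
 also have "... = (\<Sum>(a, e)\<in>artin n k \<times> {..<n + 1 - Suc k}. sgl (2 * int (mdeg a)) 1 * sgl (2 * int e) 1)"
  by (simp only: sum_product sum.cartesian_product)
 also have "... = (\<Sum>x\<in>artin n k \<times> {..<n + 1 - Suc k}. sgl (2 * int (mdeg ((\<lambda>(a, e). a + sgl (Suc k) e) x))) 1)"
  by (intro sum.cong refl) (auto simp: mult_single mdeg_add)
 also have "... = (\<Sum>m\<in>artin n (Suc k). sgl (2 * int (mdeg m)) 1)"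
  by (rule sum.reindex_bij_betw[OF artin_Suc[OF Suc.prems], of "\<lambda>m. sgl (2 * int (mdeg m)) (1 :: int)"])
 finally show ?case .
qed

text \<open>The exponent of x_i has n + 1 - i possible values and contributes the quantum integer of
  n + 1 - i.\<close>

lemma qfact_artin: "qfact (sgl 1 1) n = (\<Sum>a\<in>artin n n. sgl (2 * int (mdeg a)) (1 :: int))"
proof -
 have pw: "(sgl 1 1 :: int \<Rightarrow>\<^sub>0 int) ^ m = sgl (int m) 1" for m by (induction m) (simp_all add: mult_single)
 have "qint (sgl 1 1 :: int \<Rightarrow>\<^sub>0 int) m = (\<Sum>e<m. sgl (2 * int e) 1)" for m unfolding qint_def pw by simp
 then have "qfact (sgl 1 1 :: int \<Rightarrow>\<^sub>0 int) n = (\<Prod>k=1..n. \<Sum>e<k. sgl (2 * int e) 1)" by (simp add: qfact_def)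
 also have "... = (\<Prod>i\<in>{1..n}. \<Sum>e<n + 1 - i. sgl (2 * int e) 1)"
  by (rule prod.reindex_bij_witness[of _ "\<lambda>i. n + 1 - i" "\<lambda>k. n + 1 - k"]) auto
 finally show ?thesis using artin_generating_function[of n n] by simp
qed

theorem regular_K0_class:
 "K0_class (CA n) (rmod n) =
   qfact (sgl 1 1) n \<odot>\<^bsub>K0 (CA n)\<^esub> K0_class (CA n) (TM n)"
proof -
 let ?H = "CA n" and ?C = "TM n"
 have fin: "finite (artin n n)" by (rule finite_artin)
 have "Lsp n (artin n n) = carrier ?H" using artin_rep artin_keys by (fastforce simp: Lsp_def H_carrier image_iff)
 moreover have "rpart ?H i \<inter> carrier ?H = rpart ?H i" for i using rpart_carrier[OF H_gring_ok] by blast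
 ultimately have reg: "gsub (regular_gmodule ?H) (Lsp n (artin n n)) = regular_gmodule ?H"
  by (simp add: gsub_def regular_gmodule_def)
 have "laurent_act (qfact (sgl 1 1) n) (frag_of ?C) = (\<Sum>a\<in>artin n n. frag_of (gshift (2 * int (mdeg a)) ?C))"
  unfolding laurent_act_def qfact_artin frag_extend_sum[OF fin] by simp
 moreover have "frag_of (regular_gmodule ?H) - (\<Sum>a\<in>artin n n. frag_of (gshift (2 * int (mdeg a)) ?C)) \<in> K0_relations ?H"
  using K0_artin[OF fin, of n] unfolding reg by (simp add: upset_def)
 ultimately show ?thesis unfolding K0_smult_class[OF trivial_fg] unfolding K0_class_def by (intro K0_coset_eq) simp
qed

text \<open>For n = 1 the algebra is the field itself and the trivial module is projective, hence
  the restriction in the clause on infinite resolutions. The existence clause ensures that the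
  statement about minimal resolutions is not vacuous. In the Ext clause the vanishing in negative
  degrees and the finiteness in each degree ensure that \<open>euler_series\<close> represents the
  full alternating sum.\<close>

theorem theorem21:
  fixes n :: nat
  assumes "n \<ge> 1"
  shows
    "let H = coinv_algebra n; C = trivial_gmodule n in
     (K0_class H (regular_gmodule H) =
        qfact (Poly_Mapping.single 1 1) n \<odot>\<^bsub>K0 H\<^esub> K0_class H C) \<and>
     (n \<ge> 2 \<longrightarrow>
       (\<forall>(P :: nat \<Rightarrow> (cpoly set, 'p) module) d e.
          projective_resolution H C P d e \<longrightarrow> infinite {m. carrier (P m) \<noteq> {\<zero>\<^bsub>P m\<^esub>}})) \<and>
     (\<exists>(P :: nat \<Rightarrow> (cpoly set, int \<times> nat \<Rightarrow> cpoly set) gmodule) d e.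
        minimal_graded_resolution H C P d e) \<and>
     (\<forall>(P :: nat \<Rightarrow> (cpoly set, 'p) gmodule) d e.
        minimal_graded_resolution H C P d e \<longrightarrow>
          (\<exists>\<beta>. graded_betti_numbers H P \<beta>) \<and>
          (\<forall>\<beta>. graded_betti_numbers H P \<beta> \<longrightarrow>
             poincare_series \<beta> =
               (1 + fps_const (fls_X ^ 2) * fps_X) ^ (n - 1) /
               (\<Prod>j=2..n. 1 - fps_const (fls_X ^ (2 * j)) * fps_X ^ 2))) \<and>
     (\<forall>(P :: nat \<Rightarrow> (cpoly set, 'p) gmodule) d e.
        graded_projective_resolution H C P d e \<longrightarrow>
          (let E = (\<lambda>m l. Ext_space (coinv_scalar n) H P d (gshift l C) m);
               D = (\<lambda>m l. vectorspace.dim complex_field (E m l))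
           in (\<forall>m l. vectorspace complex_field (E m l) \<and>
                     vectorspace.fin_dim complex_field (E m l)) \<and>
              (\<forall>m l. l < 0 \<longrightarrow> D m l = 0) \<and>
              (\<forall>l. finite {m. D m l \<noteq> 0}) \<and>
              euler_series D = 1 / qfact fps_X n))"
proof -
 interpret coinv n by unfold_locales (rule assms)
 show ?thesis unfolding Let_def
 proof (intro conjI allI impI)
  show "K0_class H (regular_gmodule H) = qfact (Poly_Mapping.single 1 1) n \<odot>\<^bsub>K0 H\<^esub> K0_class H C"
   by (rule regular_K0_class)
  show "infinite {m. carrier (P m) \<noteq> {\<zero>\<^bsub>P m\<^esub>}}"
   if "n \<ge> 2" "projective_resolution H C P d e" for P :: "nat => (cpoly set, 'p) module" and d e
   by (rule resolution_infinite[OF that])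
  show "\<exists>(P :: nat => (cpoly set, int \<times> nat => cpoly set) gmodule) d e. minimal_graded_resolution H C P d e"
   using F_minimal by blast
  fix P :: "nat => (cpoly set, 'p) gmodule" and d e
  {
   assume "minimal_graded_resolution H C P d e"
   note betti = minimal_betti[OF this]
   show "\<exists>\<beta>. graded_betti_numbers H P \<beta>" using betti(1) by blast
   show "poincare_series \<beta> = (1 + fps_const (fls_X ^ 2) * fps_X) ^ (n - 1) /
     (\<Prod>j=2..n. 1 - fps_const (fls_X ^ (2 * j)) * fps_X ^ 2)" if "graded_betti_numbers H P \<beta>" for \<beta>
    unfolding betti(2)[OF that] by (rule poincare_bt)
  }
  assume gr: "graded_projective_resolution H C P d e"
  note dims = Ext_dim[OF gr]
  show "vectorspace complex_field (Ext_space (scl n) H P d (gshift l C) m)" for m l by (rule dims(1))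
  show "vectorspace.fin_dim complex_field (Ext_space (scl n) H P d (gshift l C) m)" for m l by (rule dims(2))
  show "vectorspace.dim complex_field (Ext_space (scl n) H P d (gshift l C) m) = 0" if "l < 0" for m l
   unfolding dims(3) by (rule bt_negative[OF that])
  show "finite {m. vectorspace.dim complex_field (Ext_space (scl n) H P d (gshift l C) m) \<noteq> 0}" for l
   unfolding dims(3) by (rule finite_bt_degrees)
  show "euler_series (\<lambda>m l. vectorspace.dim complex_field (Ext_space (scl n) H P d (gshift l C) m)) = 1 / qfact fps_X n"
   unfolding dims(3) using euler_bt .
 qed
qed

end
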